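(* Let $G$ be a group. The 2-category $3\mathsf{Cat}_G^{\mathrm{st}}$ of strict $G$-pointed 3-categories is equivalent to the 2-category $G\mathsf{CrsBrd}^{\mathrm{st}}$ of strict $G$-crossed braided categories.
   Context: $\mathsf{Gray}$-monoids. A $\mathsf{Gray}$-monoid is a monoid in the category of strict 2-categories with the Gray tensor product: a strict 2-category $\mathcal C$ (0-, 1-, 2-cells; composition $\circ$ of 1-cells, vertical composition $*$ of 2-cells) with a unit 0-cell $1_{\mathcal C}$, strictly associative and unital tensoring with 0-cells by strict 2-functors $a\otimes-$, $-\otimes a$, and interchanger 2-isomorphisms $\phi_{x,y}:(x\otimes\mathrm{id}_d)\circ(\mathrm{id}_a\otimes y)\Rightarrow(\mathrm{id}_b\otimes y)\circ(x\otimes\mathrm{id}_c)$ for $x:a\to b$, $y:c\to d$, natural and compatible with identities, composition and tensor. One sets $x\otimes y:=(x\otimes\mathrm{id}_d)\circ(\mathrm{id}_a\otimes y)$, and similarly for 2-cells. The strict 2-category $3\mathsf{Cat}_G^{\mathrm{st}}$. Objects: $\mathsf{Gray}$-monoids $\mathcal C$ whose set of 0-cells is $\{g_{\mathcal C}\}_{g\in G}$ (identified with $G$) with tensor product of 0-cells the group multiplication. 1-morphisms $A:\mathcal C\to\mathcal D$: 3-functors (trihomomorphisms) $\mathrm{B}\mathcal C\to\mathrm{B}\mathcal D$ between the one-object deloopings with $A(g_{\mathcal C})=g_{\mathcal D}$, $\mu^A_{g,h}=\mathrm{id}$, $\iota^A_*=\mathrm{id}_{e_{\mathcal D}}$, $\iota^A_1=A^1_e$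 and identity associators and unitors. Explicitly: a 2-functor $(A,A^1,A^2):\mathcal C\to\mathcal D$ with $A(g_{\mathcal C})=g_{\mathcal D}$ (invertible $A^1_g:\mathrm{id}_{g_{\mathcal D}}\Rightarrow A(\mathrm{id}_{g_{\mathcal C}})$, $A^2_{y,x}:A(y)\circ A(x)\Rightarrow A(y\circ x)$) and natural invertible 2-cells $\mu^A_{x,y}:A(x)\otimes A(y)\Rightarrow A(x\otimes y)$ such that: for composable $x_1,x_2$ and $y_1,y_2$, $A^2_{x_2\otimes y_2,x_1\otimes y_1}*(\mu_{x_2,y_2}\circ\mu_{x_1,y_1})=A(\phi)*\mu_{x_2\circ x_1,y_2\circ y_1}*(A^2_{x_2,x_1}\otimes A^2_{y_2,y_1})*\phi^{-1}$ (whiskered interchangers); $\mu_{\mathrm{id}_g,\mathrm{id}_h}*(A^1_g\otimes A^1_h)=A^1_{gh}$; $\mu_{x\otimes y,z}*(\mu_{x,y}\otimes\mathrm{id})=\mu_{x,y\otimes z}*(\mathrm{id}\otimes\mu_{y,z})$; $\mu_{\mathrm{id}_e,x}*(A^1_e\otimes\mathrm{id})=\mathrm{id}_{A(x)}=\mu_{x,\mathrm{id}_e}*(\mathrm{id}\otimes A^1_e)$. 2-morphisms $\eta:A\Rightarrow B$: transformations (tritransformations) with $\eta_*=e_{\mathcal D}$, $\eta_g=\mathrm{id}$, $\eta^1,\eta^2$ identities; explicitly, families of invertible 2-cells $\eta_x:A(x)\Rightarrow B(x)$, natural in $x$, with $\eta_{y\circ x}*A^2_{y,x}=B^2_{y,x}*(\eta_y\circ\eta_x)$,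 $\eta_{\mathrm{id}_g}*A^1_g=B^1_g$, $\eta_{x\otimes y}*\mu^A_{x,y}=\mu^B_{x,y}*(\eta_x\otimes\eta_y)$. Composition is the usual one. The 2-category $G\mathsf{CrsBrd}$. A $G$-crossed braided category $\mathfrak C$ consists of categories $(\mathfrak C_g)_{g\in G}$, bifunctors $\otimes=\otimes_{g,h}:\mathfrak C_g\times\mathfrak C_h\to\mathfrak C_{gh}$, natural associator isomorphisms, a unit object $1\in\mathfrak C_e$ and natural unitor isomorphisms satisfying the pentagon and triangle axioms; functors $F_g:\mathfrak C_h\to\mathfrak C_{ghg^{-1}}$ ($g,h\in G$) with an isomorphism $i_g:1\to F_g(1)$ and natural isomorphisms $\psi^g_{a,b}:F_g(a)\otimes F_g(b)\to F_g(a\otimes b)$, $\mu^{g,h}:F_gF_h\Rightarrow F_{gh}$, $\iota:\mathrm{id}\Rightarrow F_e$, such that each $(F_g,\psi^g,i_g)$ satisfies the associativity and unitality axioms of a monoidal functor, $\mu^{g,h}_{a\otimes b}\circ F_g(\psi^h)\circ\psi^g=\psi^{gh}\circ(\mu^{g,h}_a\otimes\mu^{g,h}_b)$, $\mu^{gh,k}\circ\mu^{g,h}_{F_k(-)}=\mu^{g,hk}\circ F_g(\mu^{h,k})$, $\psi^e\circ(\iota_a\otimes\iota_b)=\iota_{a\otimes b}$, $\mu^{e,g}\circ\iota_{F_g(-)}=\mathrm{id}=\mu^{g,e}\circ F_g(\iota)$; and natural isomorphisms $\beta_{a,b}:a\otimes b\to F_g(b)\otimes a$ for $a\in\mathfrak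 C_g,b\in\mathfrak C_h$ such that for $a\in\mathfrak C_g,b\in\mathfrak C_h,c\in\mathfrak C_k$ (suppressing associators): $(\mu^{ghg^{-1},g}_c\otimes\mathrm{id})\circ\beta_{F_g(b),F_g(c)}\circ(\psi^g_{b,c})^{-1}=(\mu^{g,h}_c\otimes\mathrm{id})\circ(\psi^g_{F_h(c),b})^{-1}\circ F_g(\beta_{b,c})$; $((\psi^g_{b,c})^{-1}\otimes\mathrm{id}_a)\circ\beta_{a,b\otimes c}=(\mathrm{id}\otimes\beta_{a,c})\circ(\beta_{a,b}\otimes\mathrm{id}_c)$; $((\mu^{g,h}_c)^{-1}\otimes\mathrm{id})\circ\beta_{a\otimes b,c}=(\beta_{a,F_h(c)}\otimes\mathrm{id}_b)\circ(\mathrm{id}_a\otimes\beta_{b,c})$. It is strict if the associators, unitors, and all $i_g,\psi^g,\mu^{g,h},\iota$ are identities. A 1-morphism $(\mathbf A,\mathbf a):\mathfrak C\to\mathfrak D$ ($G$-crossed braided functor) consists of functors $\mathbf A_g:\mathfrak C_g\to\mathfrak D_g$, a unit isomorphism $\mathbf A^1:1_{\mathfrak D}\to\mathbf A(1_{\mathfrak C})$ and natural isomorphisms $\mathbf A^2_{a,b}:\mathbf A(a)\otimes\mathbf A(b)\to\mathbf A(a\otimes b)$ satisfying the monoidal functor axioms, and monoidal natural isomorphisms $\mathbf a_g:F^{\mathfrak D}_g\circ\mathbf A\Rightarrow\mathbf A\circ F^{\mathfrak C}_g$ with $\mathbf a_{gh}\circ\mu^{\mathfrak D}_{g,h}=\mathbf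 A(\mu^{\mathfrak C}_{g,h})\circ(\mathbf a_g)_{F^{\mathfrak C}_h(-)}\circ F^{\mathfrak D}_g(\mathbf a_h)$ and $\mathbf A(\beta^{\mathfrak C}_{a,b})\circ\mathbf A^2_{a,b}=\mathbf A^2_{F_g(b),a}\circ(\mathbf a_g\otimes\mathrm{id})\circ\beta^{\mathfrak D}_{\mathbf A(a),\mathbf A(b)}$ for $a\in\mathfrak C_g$. A 2-morphism $h:(\mathbf A,\mathbf a)\Rightarrow(\mathbf B,\mathbf b)$ ($G$-crossed braided natural transformation) is a monoidal natural transformation $h:\mathbf A\Rightarrow\mathbf B$ with $\mathbf b_g\circ F^{\mathfrak D}_g(h_x)=h_{F^{\mathfrak C}_g(x)}\circ\mathbf a_g$ for all $g$. Compositions are the usual ones. $G\mathsf{CrsBrd}^{\mathrm{st}}$ is the full 2-subcategory on strict $G$-crossed braided categories.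
   Formalization: Since 2-morphisms of 3Cat_G^st are invertible but those of GCrsBrd^st need not be, the claim is proved in two forms: with only invertible 2-morphisms kept in GCrsBrd^st, and with invertibility of the components η_x dropped in 3Cat_G^st. *)

theory Defs
  imports "HOL-Algebra.Group"
begin

section \<open>Arrows and categories\<close>

text \<open>
  An arrow carries its endpoints together with a name. The hom-sets of a category are therefore
  always disjoint as sets of arrows, while the same name may be used in several of them, so that an
  arbitrary family of hom-sets with elements in a type can be encoded without enlarging the type.
\<close>

datatype ('v, 'e) arr = Arr (src: 'v) (trg: 'v) (lab: 'e)

record ('v, 'e) cat =
  Obj :: "'v set"
  Arrs :: "('v, 'e) arr set"
  idt :: "'v \<Rightarrow> ('v, 'e) arr"
  vcmp :: "('v, 'e) arr \<Rightarrow> ('v, 'e) arr \<Rightarrow> ('v, 'e) arr"  (infixl "\<cdot>\<index>" 65)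

definition Hom :: "('v, 'e, 'z) cat_scheme \<Rightarrow> 'v \<Rightarrow> 'v \<Rightarrow> ('v, 'e) arr set" where
  "Hom C a b = {f \<in> Arrs C. src f = a \<and> trg f = b}"

definition inverse_arrs ::
    "('v, 'e, 'z) cat_scheme \<Rightarrow> ('v, 'e) arr \<Rightarrow> ('v, 'e) arr \<Rightarrow> bool" where
  "inverse_arrs C f g \<longleftrightarrow> f \<in> Arrs C \<and> g \<in> Hom C (trg f) (src f) \<and>
     g \<cdot>\<^bsub>C\<^esub> f = idt C (src f) \<and> f \<cdot>\<^bsub>C\<^esub> g = idt C (trg f)"

definition iso_arr :: "('v, 'e, 'z) cat_scheme \<Rightarrow> ('v, 'e) arr \<Rightarrow> bool" where
  "iso_arr C f \<longleftrightarrow> (\<exists>g. inverse_arrs C f g)"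

definition inv_arr :: "('v, 'e, 'z) cat_scheme \<Rightarrow> ('v, 'e) arr \<Rightarrow> ('v, 'e) arr" where
  "inv_arr C f = (THE g. inverse_arrs C f g)"

definition Iso :: "('v, 'e, 'z) cat_scheme \<Rightarrow> 'v \<Rightarrow> 'v \<Rightarrow> ('v, 'e) arr set" where
  "Iso C a b = {f \<in> Hom C a b. iso_arr C f}"

locale category =
  fixes C :: "('v, 'e, 'z) cat_scheme" (structure)
  assumes src_closed: "f \<in> Arrs C \<Longrightarrow> src f \<in> Obj C"
    and trg_closed: "f \<in> Arrs C \<Longrightarrow> trg f \<in> Obj C"
    and idt_closed: "a \<in> Obj C \<Longrightarrow> idt C a \<in> Hom C a a"
    and vcmp_closed: "\<lbrakk>f \<in> Hom C a b; g \<in> Hom C b c\<rbrakk> \<Longrightarrow> g \<cdot> f \<in> Hom C a c"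
    and vcmp_idt_left: "f \<in> Hom C a b \<Longrightarrow> idt C b \<cdot> f = f"
    and vcmp_idt_right: "f \<in> Hom C a b \<Longrightarrow> f \<cdot> idt C a = f"
    and vcmp_assoc: "\<lbrakk>f \<in> Hom C a b; g \<in> Hom C b c; h \<in> Hom C c d\<rbrakk>
          \<Longrightarrow> (h \<cdot> g) \<cdot> f = h \<cdot> (g \<cdot> f)"

definition is_functor ::
    "('v, 'e, 'z) cat_scheme \<Rightarrow> ('w, 'f, 'y) cat_scheme \<Rightarrow>
     ('v \<Rightarrow> 'w) \<Rightarrow> (('v, 'e) arr \<Rightarrow> ('w, 'f) arr) \<Rightarrow> bool" where
  "is_functor C D F0 F1 \<longleftrightarrow>
     (\<forall>a \<in> Obj C. F0 a \<in> Obj D \<and> F1 (idt C a) = idt D (F0 a)) \<and>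
     (\<forall>f \<in> Arrs C. F1 f \<in> Hom D (F0 (src f)) (F0 (trg f))) \<and>
     (\<forall>f \<in> Arrs C. \<forall>g \<in> Arrs C. src g = trg f \<longrightarrow> F1 (g \<cdot>\<^bsub>C\<^esub> f) = F1 g \<cdot>\<^bsub>D\<^esub> F1 f)"


section \<open>Strict 2-categories, pseudofunctors and equivalences\<close>

text \<open>
  The category underlying the record is the disjoint union of all hom-categories: its objects are
  the 1-cells, its arrows the 2-cells, and \<open>\<beta> \<cdot> \<alpha>\<close> is vertical composition (first \<open>\<alpha>\<close>, then \<open>\<beta>\<close>),
  written with an asterisk in the literature on Gray-monoids. \<open>y \<bullet> x\<close> is the composite of 1-cells
  (first \<open>x\<close>, then \<open>y\<close>) and \<open>\<beta> \<star> \<alpha>\<close> the corresponding horizontal composite of 2-cells.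
\<close>

record ('a, 'b, 'c) two_cat = "(('a, 'b) arr, 'c) cat" +
  Obj0 :: "'a set"
  id1 :: "'a \<Rightarrow> ('a, 'b) arr"
  cmp1 :: "('a, 'b) arr \<Rightarrow> ('a, 'b) arr \<Rightarrow> ('a, 'b) arr"  (infixl "\<bullet>\<index>" 70)
  hcmp :: "(('a, 'b) arr, 'c) arr \<Rightarrow> (('a, 'b) arr, 'c) arr \<Rightarrow> (('a, 'b) arr, 'c) arr"
            (infixl "\<star>\<index>" 70)

definition Hom1 :: "('a, 'b, 'c, 'z) two_cat_scheme \<Rightarrow> 'a \<Rightarrow> 'a \<Rightarrow> ('a, 'b) arr set" where
  "Hom1 C a b = {x \<in> Obj C. src x = a \<and> trg x = b}"

definition composable1 ::
    "('a, 'b, 'c, 'z) two_cat_scheme \<Rightarrow> ('a, 'b) arr \<Rightarrow> ('a, 'b) arr \<Rightarrow> bool" where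
  "composable1 C y x \<longleftrightarrow> x \<in> Obj C \<and> y \<in> Obj C \<and> src y = trg x"

definition composable2 ::
    "('a, 'b, 'c, 'z) two_cat_scheme \<Rightarrow> (('a, 'b) arr, 'c) arr \<Rightarrow> (('a, 'b) arr, 'c) arr \<Rightarrow> bool"
  where
  "composable2 C \<beta> \<alpha> \<longleftrightarrow> \<alpha> \<in> Arrs C \<and> \<beta> \<in> Arrs C \<and> src (src \<beta>) = trg (src \<alpha>)"

locale two_category = category C for C :: "('a, 'b, 'c, 'z) two_cat_scheme" (structure) +
  assumes src1_closed: "x \<in> Obj C \<Longrightarrow> src x \<in> Obj0 C"
    and trg1_closed: "x \<in> Obj C \<Longrightarrow> trg x \<in> Obj0 C"
    and parallel: "\<alpha> \<in> Arrs C \<Longrightarrow> src (src \<alpha>) = src (trg \<alpha>) \<and> trg (src \<alpha>) = trg (trg \<alpha>)"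
    and id1_closed: "a \<in> Obj0 C \<Longrightarrow> id1 C a \<in> Hom1 C a a"
    and cmp1_closed: "\<lbrakk>x \<in> Hom1 C a b; y \<in> Hom1 C b c\<rbrakk> \<Longrightarrow> y \<bullet> x \<in> Hom1 C a c"
    and cmp1_id_left: "x \<in> Hom1 C a b \<Longrightarrow> id1 C b \<bullet> x = x"
    and cmp1_id_right: "x \<in> Hom1 C a b \<Longrightarrow> x \<bullet> id1 C a = x"
    and cmp1_assoc: "\<lbrakk>x \<in> Hom1 C a b; y \<in> Hom1 C b c; z \<in> Hom1 C c d\<rbrakk>
          \<Longrightarrow> (z \<bullet> y) \<bullet> x = z \<bullet> (y \<bullet> x)"
    and hcmp_closed: "composable2 C \<beta> \<alpha>
          \<Longrightarrow> \<beta> \<star> \<alpha> \<in> Hom C (src \<beta> \<bullet> src \<alpha>) (trg \<beta> \<bullet> trg \<alpha>)"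
    and hcmp_idt: "composable1 C y x \<Longrightarrow> idt C y \<star> idt C x = idt C (y \<bullet> x)"
    and interchange: "\<lbrakk>\<alpha> \<in> Hom C x x'; \<alpha>' \<in> Hom C x' x''; \<beta> \<in> Hom C y y'; \<beta>' \<in> Hom C y' y'';
            src y = trg x\<rbrakk>
          \<Longrightarrow> (\<beta>' \<cdot> \<beta>) \<star> (\<alpha>' \<cdot> \<alpha>) = (\<beta>' \<star> \<alpha>') \<cdot> (\<beta> \<star> \<alpha>)"
    and hcmp_id_left: "\<alpha> \<in> Arrs C \<Longrightarrow> idt C (id1 C (trg (src \<alpha>))) \<star> \<alpha> = \<alpha>"
    and hcmp_id_right: "\<alpha> \<in> Arrs C \<Longrightarrow> \<alpha> \<star> idt C (id1 C (src (src \<alpha>))) = \<alpha>"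
    and hcmp_assoc: "\<lbrakk>composable2 C \<beta> \<alpha>; composable2 C \<gamma> \<beta>\<rbrakk>
          \<Longrightarrow> (\<gamma> \<star> \<beta>) \<star> \<alpha> = \<gamma> \<star> (\<beta> \<star> \<alpha>)"

definition strict_two_functor ::
    "('a, 'b, 'c, 'z) two_cat_scheme \<Rightarrow> ('d, 'e, 'f, 'y) two_cat_scheme \<Rightarrow> ('a \<Rightarrow> 'd) \<Rightarrow>
     (('a, 'b) arr \<Rightarrow> ('d, 'e) arr) \<Rightarrow>
     ((('a, 'b) arr, 'c) arr \<Rightarrow> (('d, 'e) arr, 'f) arr) \<Rightarrow> bool" where
  "strict_two_functor C D F0 F1 F2 \<longleftrightarrow>
     is_functor C D F1 F2 \<and>
     (\<forall>a \<in> Obj0 C. F0 a \<in> Obj0 D \<and> F1 (id1 C a) = id1 D (F0 a)) \<and>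
     (\<forall>x \<in> Obj C. F1 x \<in> Hom1 D (F0 (src x)) (F0 (trg x))) \<and>
     (\<forall>x y. composable1 C y x \<longrightarrow> F1 (y \<bullet>\<^bsub>C\<^esub> x) = F1 y \<bullet>\<^bsub>D\<^esub> F1 x) \<and>
     (\<forall>\<alpha> \<beta>. composable2 C \<beta> \<alpha> \<longrightarrow> F2 (\<beta> \<star>\<^bsub>C\<^esub> \<alpha>) = F2 \<beta> \<star>\<^bsub>D\<^esub> F2 \<alpha>)"

text \<open>
  In the following record, \<open>munit F a\<close> is the coherence cell \<open>F\<^sup>1\<close> from the identity of \<open>F a\<close> to the
  image of the identity of \<open>a\<close>, and \<open>mcomp F y x\<close> is the coherence cell \<open>F\<^sup>2\<close> from the composite of
  the images of \<open>y\<close> and \<open>x\<close> to the image of their composite.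
\<close>

record ('a, 'b, 'c, 'd, 'e, 'f) pfun =
  map0 :: "'a \<Rightarrow> 'd"
  map1 :: "('a, 'b) arr \<Rightarrow> ('d, 'e) arr"
  map2 :: "(('a, 'b) arr, 'c) arr \<Rightarrow> (('d, 'e) arr, 'f) arr"
  munit :: "'a \<Rightarrow> (('d, 'e) arr, 'f) arr"
  mcomp :: "('a, 'b) arr \<Rightarrow> ('a, 'b) arr \<Rightarrow> (('d, 'e) arr, 'f) arr"

locale pseudofunctor = C: two_category C + D: two_category D
  for C :: "('a, 'b, 'c, 'z) two_cat_scheme"
    and D :: "('d, 'e, 'f, 'y) two_cat_scheme" +
  fixes F :: "('a, 'b, 'c, 'd, 'e, 'f, 'x) pfun_scheme"
  assumes map0_closed: "a \<in> Obj0 C \<Longrightarrow> map0 F a \<in> Obj0 D"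
    and map1_closed: "x \<in> Obj C \<Longrightarrow> map1 F x \<in> Hom1 D (map0 F (src x)) (map0 F (trg x))"
    and locally_functor: "is_functor C D (map1 F) (map2 F)"
    and munit_iso: "a \<in> Obj0 C \<Longrightarrow> munit F a \<in> Iso D (id1 D (map0 F a)) (map1 F (id1 C a))"
    and mcomp_iso: "composable1 C y x
          \<Longrightarrow> mcomp F y x \<in> Iso D (map1 F y \<bullet>\<^bsub>D\<^esub> map1 F x) (map1 F (y \<bullet>\<^bsub>C\<^esub> x))"
    and mcomp_natural: "composable2 C \<beta> \<alpha>
          \<Longrightarrow> mcomp F (trg \<beta>) (trg \<alpha>) \<cdot>\<^bsub>D\<^esub> (map2 F \<beta> \<star>\<^bsub>D\<^esub> map2 F \<alpha>)
              = map2 F (\<beta> \<star>\<^bsub>C\<^esub> \<alpha>) \<cdot>\<^bsub>D\<^esub> mcomp F (src \<beta>) (src \<alpha>)"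
    and mcomp_assoc: "\<lbrakk>composable1 C y x; composable1 C z y\<rbrakk>
          \<Longrightarrow> mcomp F z (y \<bullet>\<^bsub>C\<^esub> x) \<cdot>\<^bsub>D\<^esub> (idt D (map1 F z) \<star>\<^bsub>D\<^esub> mcomp F y x)
              = mcomp F (z \<bullet>\<^bsub>C\<^esub> y) x \<cdot>\<^bsub>D\<^esub> (mcomp F z y \<star>\<^bsub>D\<^esub> idt D (map1 F x))"
    and munit_left: "x \<in> Hom1 C a b
          \<Longrightarrow> mcomp F (id1 C b) x \<cdot>\<^bsub>D\<^esub> (munit F b \<star>\<^bsub>D\<^esub> idt D (map1 F x)) = idt D (map1 F x)"
    and munit_right: "x \<in> Hom1 C a b
          \<Longrightarrow> mcomp F x (id1 C a) \<cdot>\<^bsub>D\<^esub> (idt D (map1 F x) \<star>\<^bsub>D\<^esub> munit F a) = idt D (map1 F x)"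

definition isomorphic1 ::
    "('a, 'b, 'c, 'z) two_cat_scheme \<Rightarrow> ('a, 'b) arr \<Rightarrow> ('a, 'b) arr \<Rightarrow> bool" where
  "isomorphic1 C x y \<longleftrightarrow> (\<exists>\<alpha>. \<alpha> \<in> Iso C x y)"

definition equivalent0 :: "('a, 'b, 'c, 'z) two_cat_scheme \<Rightarrow> 'a \<Rightarrow> 'a \<Rightarrow> bool" where
  "equivalent0 C a b \<longleftrightarrow> (\<exists>x \<in> Hom1 C a b. \<exists>y \<in> Hom1 C b a.
     isomorphic1 C (y \<bullet>\<^bsub>C\<^esub> x) (id1 C a) \<and> isomorphic1 C (x \<bullet>\<^bsub>C\<^esub> y) (id1 C b))"

text \<open>
  A pseudofunctor is an equivalence of 2-categories if it is essentially surjective on objects (up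
  to internal equivalence) and an equivalence of categories on each hom-category.
\<close>

locale equivalence_pseudofunctor = pseudofunctor +
  assumes ess_surj0: "d \<in> Obj0 D \<Longrightarrow> \<exists>c \<in> Obj0 C. equivalent0 D (map0 F c) d"
    and ess_surj1: "\<lbrakk>a \<in> Obj0 C; b \<in> Obj0 C; y \<in> Hom1 D (map0 F a) (map0 F b)\<rbrakk>
          \<Longrightarrow> \<exists>x \<in> Hom1 C a b. isomorphic1 D (map1 F x) y"
    and fully_faithful2: "\<lbrakk>x \<in> Hom1 C a b; x' \<in> Hom1 C a b; \<gamma> \<in> Hom D (map1 F x) (map1 F x')\<rbrakk>
          \<Longrightarrow> \<exists>!\<alpha>. \<alpha> \<in> Hom C x x' \<and> map2 F \<alpha> = \<gamma>"

definition equivalent_two_categories ::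
    "('a, 'b, 'c) two_cat \<Rightarrow> ('d, 'e, 'f) two_cat \<Rightarrow> bool" where
  "equivalent_two_categories C D \<longleftrightarrow>
     (\<exists>F :: ('a, 'b, 'c, 'd, 'e, 'f) pfun. equivalence_pseudofunctor C D F)"

definition full_sub_two_category :: "('a, 'b, 'c) two_cat \<Rightarrow> 'a set \<Rightarrow> ('a, 'b, 'c) two_cat" where
  "full_sub_two_category X S = X
     \<lparr> Obj0 := {a \<in> Obj0 X. a \<in> S},
       Obj := {x \<in> Obj X. src x \<in> S \<and> trg x \<in> S},
       Arrs := {\<alpha> \<in> Arrs X. src (src \<alpha>) \<in> S \<and> trg (src \<alpha>) \<in> S} \<rparr>"

text \<open>Only the invertible 2-cells are kept; all 0-cells and 1-cells remain.\<close>

definition two_one_core :: "('a, 'b, 'c) two_cat \<Rightarrow> ('a, 'b, 'c) two_cat" where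
  "two_one_core X = X \<lparr> Arrs := {\<alpha> \<in> Arrs X. iso_arr X \<alpha>} \<rparr>"


section \<open>Gray-monoids\<close>

text \<open>
  \<open>a \<triangleright> x\<close> and \<open>a \<unrhd> \<alpha>\<close> are the actions of the 2-functor tensoring with the 0-cell \<open>a\<close> on the left
  on 1-cells and 2-cells, \<open>x \<triangleleft> a\<close> and \<open>\<alpha> \<unlhd> a\<close> those of tensoring with \<open>a\<close> on the right.
  \<open>ichg C x y\<close> is the interchanger \<open>\<phi>\<close>.
\<close>

record ('a, 'b, 'c) gray = "('a, 'b, 'c) two_cat" +
  unit0 :: 'a
  ten0 :: "'a \<Rightarrow> 'a \<Rightarrow> 'a"  (infixl "\<otimes>\<^sub>0\<index>" 75)
  lten1 :: "'a \<Rightarrow> ('a, 'b) arr \<Rightarrow> ('a, 'b) arr"  (infixl "\<triangleright>\<index>" 80)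
  rten1 :: "('a, 'b) arr \<Rightarrow> 'a \<Rightarrow> ('a, 'b) arr"  (infixl "\<triangleleft>\<index>" 80)
  lten2 :: "'a \<Rightarrow> (('a, 'b) arr, 'c) arr \<Rightarrow> (('a, 'b) arr, 'c) arr"  (infixl "\<unrhd>\<index>" 80)
  rten2 :: "(('a, 'b) arr, 'c) arr \<Rightarrow> 'a \<Rightarrow> (('a, 'b) arr, 'c) arr"  (infixl "\<unlhd>\<index>" 80)
  ichg :: "('a, 'b) arr \<Rightarrow> ('a, 'b) arr \<Rightarrow> (('a, 'b) arr, 'c) arr"

definition ten1 ::
    "('a, 'b, 'c, 'z) gray_scheme \<Rightarrow> ('a, 'b) arr \<Rightarrow> ('a, 'b) arr \<Rightarrow> ('a, 'b) arr"
    (infixl "\<otimes>\<^sub>1\<index>" 75) where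
  "x \<otimes>\<^sub>1\<^bsub>C\<^esub> y = (x \<triangleleft>\<^bsub>C\<^esub> trg y) \<bullet>\<^bsub>C\<^esub> (src x \<triangleright>\<^bsub>C\<^esub> y)"

definition ten2 ::
    "('a, 'b, 'c, 'z) gray_scheme \<Rightarrow> (('a, 'b) arr, 'c) arr \<Rightarrow> (('a, 'b) arr, 'c) arr
     \<Rightarrow> (('a, 'b) arr, 'c) arr"
    (infixl "\<otimes>\<^sub>2\<index>" 75) where
  "\<alpha> \<otimes>\<^sub>2\<^bsub>C\<^esub> \<beta> = (\<alpha> \<unlhd>\<^bsub>C\<^esub> trg (src \<beta>)) \<star>\<^bsub>C\<^esub> (src (src \<alpha>) \<unrhd>\<^bsub>C\<^esub> \<beta>)"

locale gray_monoid = two_category C for C :: "('a, 'b, 'c, 'z) gray_scheme" (structure) +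
  assumes unit0_closed: "unit0 C \<in> Obj0 C"
    and ten0_closed: "\<lbrakk>a \<in> Obj0 C; b \<in> Obj0 C\<rbrakk> \<Longrightarrow> a \<otimes>\<^sub>0 b \<in> Obj0 C"
    and ten0_assoc: "\<lbrakk>a \<in> Obj0 C; b \<in> Obj0 C; c \<in> Obj0 C\<rbrakk>
          \<Longrightarrow> (a \<otimes>\<^sub>0 b) \<otimes>\<^sub>0 c = a \<otimes>\<^sub>0 (b \<otimes>\<^sub>0 c)"
    and ten0_unit: "a \<in> Obj0 C \<Longrightarrow> unit0 C \<otimes>\<^sub>0 a = a \<and> a \<otimes>\<^sub>0 unit0 C = a"
    and lten_functor: "a \<in> Obj0 C \<Longrightarrow>
          strict_two_functor C C (\<lambda>b. a \<otimes>\<^sub>0 b) (\<lambda>x. a \<triangleright> x) (\<lambda>\<alpha>. a \<unrhd> \<alpha>)"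
    and rten_functor: "a \<in> Obj0 C \<Longrightarrow>
          strict_two_functor C C (\<lambda>b. b \<otimes>\<^sub>0 a) (\<lambda>x. x \<triangleleft> a) (\<lambda>\<alpha>. \<alpha> \<unlhd> a)"
    and ten1_unit: "x \<in> Obj C \<Longrightarrow> unit0 C \<triangleright> x = x \<and> x \<triangleleft> unit0 C = x"
    and ten2_unit: "\<alpha> \<in> Arrs C \<Longrightarrow> unit0 C \<unrhd> \<alpha> = \<alpha> \<and> \<alpha> \<unlhd> unit0 C = \<alpha>"
    and ten1_assoc: "\<lbrakk>a \<in> Obj0 C; b \<in> Obj0 C; x \<in> Obj C\<rbrakk>
          \<Longrightarrow> (a \<otimes>\<^sub>0 b) \<triangleright> x = a \<triangleright> (b \<triangleright> x) \<and> (a \<triangleright> x) \<triangleleft> b = a \<triangleright> (x \<triangleleft> b)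
              \<and> (x \<triangleleft> a) \<triangleleft> b = x \<triangleleft> (a \<otimes>\<^sub>0 b)"
    and ten2_assoc: "\<lbrakk>a \<in> Obj0 C; b \<in> Obj0 C; \<alpha> \<in> Arrs C\<rbrakk>
          \<Longrightarrow> (a \<otimes>\<^sub>0 b) \<unrhd> \<alpha> = a \<unrhd> (b \<unrhd> \<alpha>) \<and> (a \<unrhd> \<alpha>) \<unlhd> b = a \<unrhd> (\<alpha> \<unlhd> b)
              \<and> (\<alpha> \<unlhd> a) \<unlhd> b = \<alpha> \<unlhd> (a \<otimes>\<^sub>0 b)"
    and ichg_iso: "\<lbrakk>x \<in> Hom1 C a b; y \<in> Hom1 C c d\<rbrakk>
          \<Longrightarrow> ichg C x y \<in> Iso C ((x \<triangleleft> d) \<bullet> (a \<triangleright> y)) ((b \<triangleright> y) \<bullet> (x \<triangleleft> c))"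
    and ichg_natural: "\<lbrakk>x \<in> Hom1 C a b; y \<in> Hom1 C c d; \<alpha> \<in> Hom C x x'; \<beta> \<in> Hom C y y'\<rbrakk>
          \<Longrightarrow> ichg C x' y' \<cdot> ((\<alpha> \<unlhd> d) \<star> (a \<unrhd> \<beta>)) = ((b \<unrhd> \<beta>) \<star> (\<alpha> \<unlhd> c)) \<cdot> ichg C x y"
    and ichg_id_left: "\<lbrakk>a \<in> Obj0 C; y \<in> Obj C\<rbrakk> \<Longrightarrow> ichg C (id1 C a) y = idt C (a \<triangleright> y)"
    and ichg_id_right: "\<lbrakk>a \<in> Obj0 C; x \<in> Obj C\<rbrakk> \<Longrightarrow> ichg C x (id1 C a) = idt C (x \<triangleleft> a)"
    and ichg_comp_left: "\<lbrakk>x \<in> Hom1 C a b; x' \<in> Hom1 C b b'; y \<in> Hom1 C c d\<rbrakk>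
          \<Longrightarrow> ichg C (x' \<bullet> x) y
              = (ichg C x' y \<star> idt C (x \<triangleleft> c)) \<cdot> (idt C (x' \<triangleleft> d) \<star> ichg C x y)"
    and ichg_comp_right: "\<lbrakk>x \<in> Hom1 C a b; y \<in> Hom1 C c d; y' \<in> Hom1 C d d'\<rbrakk>
          \<Longrightarrow> ichg C x (y' \<bullet> y)
              = (idt C (b \<triangleright> y') \<star> ichg C x y) \<cdot> (ichg C x y' \<star> idt C (a \<triangleright> y))"
    and ichg_tensor: "\<lbrakk>a \<in> Obj0 C; x \<in> Obj C; y \<in> Obj C\<rbrakk>
          \<Longrightarrow> ichg C (a \<triangleright> x) y = a \<unrhd> ichg C x y
              \<and> ichg C (x \<triangleleft> a) y = ichg C x (a \<triangleright> y)
              \<and> ichg C x (y \<triangleleft> a) = ichg C x y \<unlhd> a"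


section \<open>Strict G-pointed 3-categories\<close>

definition strict_pointed :: "('g, 'h) monoid_scheme \<Rightarrow> ('g, 'o, 'm) gray \<Rightarrow> bool" where
  "strict_pointed G C \<longleftrightarrow> gray_monoid C \<and> Obj0 C = carrier G \<and> unit0 C = \<one>\<^bsub>G\<^esub> \<and>
     (\<forall>g \<in> carrier G. \<forall>h \<in> carrier G. g \<otimes>\<^sub>0\<^bsub>C\<^esub> h = g \<otimes>\<^bsub>G\<^esub> h)"

record ('g, 'o, 'm) fun3 = "('g, 'o, 'm, 'g, 'o, 'm) pfun" +
  mten :: "('g, 'o) arr \<Rightarrow> ('g, 'o) arr \<Rightarrow> (('g, 'o) arr, 'm) arr"

text \<open>
  The extensionality assumptions say that the maps are \<open>undefined\<close> outside their intended domains.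
  They make equality of 1-morphisms of 3-categories agree with equality of the underlying data, as
  is needed for a strict 2-category of such morphisms.
\<close>

locale functor3 = pseudofunctor C D A
  for C :: "('g, 'o, 'm) gray" and D :: "('g, 'o, 'm) gray" and A :: "('g, 'o, 'm) fun3" +
  assumes map0_id: "a \<in> Obj0 C \<Longrightarrow> map0 A a = a"
    and mten_iso: "\<lbrakk>x \<in> Obj C; y \<in> Obj C\<rbrakk>
          \<Longrightarrow> mten A x y \<in> Iso D (map1 A x \<otimes>\<^sub>1\<^bsub>D\<^esub> map1 A y) (map1 A (x \<otimes>\<^sub>1\<^bsub>C\<^esub> y))"
    and mten_natural: "\<lbrakk>\<alpha> \<in> Hom C x x'; \<beta> \<in> Hom C y y'\<rbrakk>
          \<Longrightarrow> mten A x' y' \<cdot>\<^bsub>D\<^esub> (map2 A \<alpha> \<otimes>\<^sub>2\<^bsub>D\<^esub> map2 A \<beta>)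
              = map2 A (\<alpha> \<otimes>\<^sub>2\<^bsub>C\<^esub> \<beta>) \<cdot>\<^bsub>D\<^esub> mten A x y"
    and mten_comp: "\<lbrakk>composable1 C x2 x1; composable1 C y2 y1\<rbrakk>
          \<Longrightarrow> mcomp A (x2 \<otimes>\<^sub>1\<^bsub>C\<^esub> y2) (x1 \<otimes>\<^sub>1\<^bsub>C\<^esub> y1) \<cdot>\<^bsub>D\<^esub> (mten A x2 y2 \<star>\<^bsub>D\<^esub> mten A x1 y1)
              = map2 A (idt C (x2 \<triangleleft>\<^bsub>C\<^esub> trg y2) \<star>\<^bsub>C\<^esub> ichg C x1 y2 \<star>\<^bsub>C\<^esub> idt C (src x1 \<triangleright>\<^bsub>C\<^esub> y1))
                \<cdot>\<^bsub>D\<^esub> mten A (x2 \<bullet>\<^bsub>C\<^esub> x1) (y2 \<bullet>\<^bsub>C\<^esub> y1)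
                \<cdot>\<^bsub>D\<^esub> (mcomp A x2 x1 \<otimes>\<^sub>2\<^bsub>D\<^esub> mcomp A y2 y1)
                \<cdot>\<^bsub>D\<^esub> (idt D (map1 A x2 \<triangleleft>\<^bsub>D\<^esub> trg (map1 A y2))
                    \<star>\<^bsub>D\<^esub> inv_arr D (ichg D (map1 A x1) (map1 A y2))
                    \<star>\<^bsub>D\<^esub> idt D (src (map1 A x1) \<triangleright>\<^bsub>D\<^esub> map1 A y1))"
    and mten_id: "\<lbrakk>g \<in> Obj0 C; h \<in> Obj0 C\<rbrakk>
          \<Longrightarrow> mten A (id1 C g) (id1 C h) \<cdot>\<^bsub>D\<^esub> (munit A g \<otimes>\<^sub>2\<^bsub>D\<^esub> munit A h) = munit A (g \<otimes>\<^sub>0\<^bsub>C\<^esub> h)"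
    and mten_assoc: "\<lbrakk>x \<in> Obj C; y \<in> Obj C; z \<in> Obj C\<rbrakk>
          \<Longrightarrow> mten A (x \<otimes>\<^sub>1\<^bsub>C\<^esub> y) z \<cdot>\<^bsub>D\<^esub> (mten A x y \<otimes>\<^sub>2\<^bsub>D\<^esub> idt D (map1 A z))
              = mten A x (y \<otimes>\<^sub>1\<^bsub>C\<^esub> z) \<cdot>\<^bsub>D\<^esub> (idt D (map1 A x) \<otimes>\<^sub>2\<^bsub>D\<^esub> mten A y z)"
    and mten_unit_left: "x \<in> Obj C
          \<Longrightarrow> mten A (id1 C (unit0 C)) x \<cdot>\<^bsub>D\<^esub> (munit A (unit0 C) \<otimes>\<^sub>2\<^bsub>D\<^esub> idt D (map1 A x))
              = idt D (map1 A x)"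
    and mten_unit_right: "x \<in> Obj C
          \<Longrightarrow> mten A x (id1 C (unit0 C)) \<cdot>\<^bsub>D\<^esub> (idt D (map1 A x) \<otimes>\<^sub>2\<^bsub>D\<^esub> munit A (unit0 C))
              = idt D (map1 A x)"
    and map0_ext: "map0 A \<in> extensional (Obj0 C)"
    and map1_ext: "map1 A \<in> extensional (Obj C)"
    and map2_ext: "map2 A \<in> extensional (Arrs C)"
    and munit_ext: "munit A \<in> extensional (Obj0 C)"
    and mcomp_ext: "\<not> composable1 C y x \<Longrightarrow> mcomp A y x = undefined"
    and mten_ext: "\<not> (x \<in> Obj C \<and> y \<in> Obj C) \<Longrightarrow> mten A x y = undefined"

definition id_fun3 :: "('g, 'o, 'm) gray \<Rightarrow> ('g, 'o, 'm) fun3" where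
  "id_fun3 C = \<lparr> map0 = (\<lambda>a \<in> Obj0 C. a), map1 = (\<lambda>x \<in> Obj C. x), map2 = (\<lambda>\<alpha> \<in> Arrs C. \<alpha>),
     munit = (\<lambda>a \<in> Obj0 C. idt C (id1 C a)),
     mcomp = (\<lambda>y x. if composable1 C y x then idt C (y \<bullet>\<^bsub>C\<^esub> x) else undefined),
     mten = (\<lambda>x y. if x \<in> Obj C \<and> y \<in> Obj C then idt C (x \<otimes>\<^sub>1\<^bsub>C\<^esub> y) else undefined) \<rparr>"

text \<open>\<open>comp_fun3 C E B A\<close> is the composite of \<open>A : C \<rightarrow> D\<close> followed by \<open>B : D \<rightarrow> E\<close>.\<close>

definition comp_fun3 ::
    "('g, 'o, 'm) gray \<Rightarrow> ('g, 'o, 'm) gray \<Rightarrow> ('g, 'o, 'm) fun3 \<Rightarrow> ('g, 'o, 'm) fun3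
     \<Rightarrow> ('g, 'o, 'm) fun3" where
  "comp_fun3 C E B A =
     \<lparr> map0 = (\<lambda>a \<in> Obj0 C. map0 B (map0 A a)),
       map1 = (\<lambda>x \<in> Obj C. map1 B (map1 A x)),
       map2 = (\<lambda>\<alpha> \<in> Arrs C. map2 B (map2 A \<alpha>)),
       munit = (\<lambda>a \<in> Obj0 C. map2 B (munit A a) \<cdot>\<^bsub>E\<^esub> munit B (map0 A a)),
       mcomp = (\<lambda>y x. if composable1 C y x
                  then map2 B (mcomp A y x) \<cdot>\<^bsub>E\<^esub> mcomp B (map1 A y) (map1 A x) else undefined),
       mten = (\<lambda>x y. if x \<in> Obj C \<and> y \<in> Obj C
                  then map2 B (mten A x y) \<cdot>\<^bsub>E\<^esub> mten B (map1 A x) (map1 A y) else undefined) \<rparr>"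

locale transformation3 = A: functor3 C D A + B: functor3 C D B
  for C :: "('g, 'o, 'm) gray" and D :: "('g, 'o, 'm) gray"
    and A :: "('g, 'o, 'm) fun3" and B :: "('g, 'o, 'm) fun3" +
  fixes \<eta> :: "('g, 'o) arr \<Rightarrow> (('g, 'o) arr, 'm) arr"
  assumes component: "x \<in> Obj C \<Longrightarrow> \<eta> x \<in> Hom D (map1 A x) (map1 B x)"
    and natural: "\<alpha> \<in> Hom C x x' \<Longrightarrow> \<eta> x' \<cdot>\<^bsub>D\<^esub> map2 A \<alpha> = map2 B \<alpha> \<cdot>\<^bsub>D\<^esub> \<eta> x"
    and respects_comp: "composable1 C y x
          \<Longrightarrow> \<eta> (y \<bullet>\<^bsub>C\<^esub> x) \<cdot>\<^bsub>D\<^esub> mcomp A y x = mcomp B y x \<cdot>\<^bsub>D\<^esub> (\<eta> y \<star>\<^bsub>D\<^esub> \<eta> x)"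
    and respects_id: "a \<in> Obj0 C \<Longrightarrow> \<eta> (id1 C a) \<cdot>\<^bsub>D\<^esub> munit A a = munit B a"
    and respects_ten: "\<lbrakk>x \<in> Obj C; y \<in> Obj C\<rbrakk>
          \<Longrightarrow> \<eta> (x \<otimes>\<^sub>1\<^bsub>C\<^esub> y) \<cdot>\<^bsub>D\<^esub> mten A x y = mten B x y \<cdot>\<^bsub>D\<^esub> (\<eta> x \<otimes>\<^sub>2\<^bsub>D\<^esub> \<eta> y)"
    and ext: "\<eta> \<in> extensional (Obj C)"

locale invertible_transformation3 = transformation3 +
  assumes invertible: "x \<in> Obj C \<Longrightarrow> iso_arr D (\<eta> x)"

type_synonym ('g, 'o, 'm) three_cat =
  "(('g, 'o, 'm) gray, ('g, 'o, 'm) fun3, ('g, 'o) arr \<Rightarrow> (('g, 'o) arr, 'm) arr) two_cat"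

text \<open>
  In \<open>ThreeCat_st\<close> the components of a transformation are invertible, as for any tritransformation,
  so all its 2-morphisms are invertible. Crossed braided natural transformations need not be
  invertible; with those, it is the variant \<open>ThreeCat_st_lax\<close> that can be compared, which differs
  from \<open>ThreeCat_st\<close> only in that the components of transformations may be arbitrary 2-cells.
  The type variables \<open>'o\<close> and \<open>'m\<close> play the role of universes for names of 1-cells and 2-cells.
\<close>

definition ThreeCat_st_lax :: "('g, 'h) monoid_scheme \<Rightarrow> ('g, 'o, 'm) three_cat" where
  "ThreeCat_st_lax G =
     \<lparr> Obj = {Arr C D A | C D A. strict_pointed G C \<and> strict_pointed G D \<and> functor3 C D A},
       Arrs = {Arr (Arr C D A) (Arr C D B) \<eta> | C D A B \<eta>.
                 strict_pointed G C \<and> strict_pointed G D \<and> transformation3 C D A B \<eta>},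
       idt = (\<lambda>X. Arr X X (\<lambda>x \<in> Obj (src X). idt (trg X) (map1 (lab X) x))),
       vcmp = (\<lambda>\<zeta> \<eta>. Arr (src \<eta>) (trg \<zeta>)
                (\<lambda>x \<in> Obj (src (src \<eta>)). lab \<zeta> x \<cdot>\<^bsub>trg (src \<eta>)\<^esub> lab \<eta> x)),
       Obj0 = {C. strict_pointed G C},
       id1 = (\<lambda>C. Arr C C (id_fun3 C)),
       cmp1 = (\<lambda>Y X. Arr (src X) (trg Y) (comp_fun3 (src X) (trg Y) (lab Y) (lab X))),
       hcmp = (\<lambda>\<zeta> \<eta>. let C = src (src \<eta>); E = trg (src \<zeta>) in
                Arr (Arr C E (comp_fun3 C E (lab (src \<zeta>)) (lab (src \<eta>))))
                    (Arr C E (comp_fun3 C E (lab (trg \<zeta>)) (lab (trg \<eta>))))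
                    (\<lambda>x \<in> Obj C. lab \<zeta> (map1 (lab (trg \<eta>)) x)
                                   \<cdot>\<^bsub>E\<^esub> map2 (lab (src \<zeta>)) (lab \<eta> x))) \<rparr>"

definition ThreeCat_st :: "('g, 'h) monoid_scheme \<Rightarrow> ('g, 'o, 'm) three_cat" where
  "ThreeCat_st G = ThreeCat_st_lax G
     \<lparr> Arrs := {Arr (Arr C D A) (Arr C D B) \<eta> | C D A B \<eta>.
                  strict_pointed G C \<and> strict_pointed G D
                  \<and> invertible_transformation3 C D A B \<eta>} \<rparr>"


section \<open>G-crossed braided categories\<close>

text \<open>
  The family of categories indexed by the group is stored as its disjoint union, a single category
  whose objects are pairs of a grade and a name: the member of the family at \<open>g\<close> consists of the
  objects \<open>(g, a)\<close>, and there are no morphisms between objects of different grades.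

  \<open>Fo C g a\<close> and \<open>Fm C g f\<close> are the values of the functor \<open>F\<^sub>g\<close> on objects and morphisms; \<open>Fi\<close>,
  \<open>Fpsi\<close>, \<open>Fmu\<close> and \<open>Fiota\<close> are the structure isomorphisms \<open>i\<close>, \<open>\<psi>\<close>, \<open>\<mu>\<close> and \<open>\<iota>\<close>. The
  associators usually suppressed in the hexagon axioms for the braiding are written out.
\<close>

record ('g, 'o, 'm) crsbrd = "('g \<times> 'o, 'm) cat" +
  tenO :: "'g \<times> 'o \<Rightarrow> 'g \<times> 'o \<Rightarrow> 'g \<times> 'o"  (infixl "\<otimes>\<^sub>o\<index>" 75)
  tenM :: "('g \<times> 'o, 'm) arr \<Rightarrow> ('g \<times> 'o, 'm) arr \<Rightarrow> ('g \<times> 'o, 'm) arr"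
            (infixl "\<otimes>\<^sub>m\<index>" 75)
  assr :: "'g \<times> 'o \<Rightarrow> 'g \<times> 'o \<Rightarrow> 'g \<times> 'o \<Rightarrow> ('g \<times> 'o, 'm) arr"
  unitO :: "'g \<times> 'o"
  lunit :: "'g \<times> 'o \<Rightarrow> ('g \<times> 'o, 'm) arr"
  runit :: "'g \<times> 'o \<Rightarrow> ('g \<times> 'o, 'm) arr"
  Fo :: "'g \<Rightarrow> 'g \<times> 'o \<Rightarrow> 'g \<times> 'o"
  Fm :: "'g \<Rightarrow> ('g \<times> 'o, 'm) arr \<Rightarrow> ('g \<times> 'o, 'm) arr"
  Fi :: "'g \<Rightarrow> ('g \<times> 'o, 'm) arr"
  Fpsi :: "'g \<Rightarrow> 'g \<times> 'o \<Rightarrow> 'g \<times> 'o \<Rightarrow> ('g \<times> 'o, 'm) arr"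
  Fmu :: "'g \<Rightarrow> 'g \<Rightarrow> 'g \<times> 'o \<Rightarrow> ('g \<times> 'o, 'm) arr"
  Fiota :: "'g \<times> 'o \<Rightarrow> ('g \<times> 'o, 'm) arr"
  brd :: "'g \<times> 'o \<Rightarrow> 'g \<times> 'o \<Rightarrow> ('g \<times> 'o, 'm) arr"

locale crossed_braided = category C + group G
  for G :: "('g, 'h) monoid_scheme" and C :: "('g, 'o, 'm) crsbrd" (structure) +
  assumes grade_closed: "a \<in> Obj C \<Longrightarrow> fst a \<in> carrier G"
    and grade_arr: "f \<in> Arrs C \<Longrightarrow> fst (src f) = fst (trg f)"
    and tenO_closed: "\<lbrakk>a \<in> Obj C; b \<in> Obj C\<rbrakk>
          \<Longrightarrow> a \<otimes>\<^sub>o b \<in> Obj C \<and> fst (a \<otimes>\<^sub>o b) = fst a \<otimes>\<^bsub>G\<^esub> fst b"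
    and tenM_closed: "\<lbrakk>f \<in> Hom C a a'; u \<in> Hom C b b'\<rbrakk> \<Longrightarrow> f \<otimes>\<^sub>m u \<in> Hom C (a \<otimes>\<^sub>o b) (a' \<otimes>\<^sub>o b')"
    and tenM_idt: "\<lbrakk>a \<in> Obj C; b \<in> Obj C\<rbrakk> \<Longrightarrow> idt C a \<otimes>\<^sub>m idt C b = idt C (a \<otimes>\<^sub>o b)"
    and tenM_vcmp: "\<lbrakk>f \<in> Hom C a a'; f' \<in> Hom C a' a''; u \<in> Hom C b b'; u' \<in> Hom C b' b''\<rbrakk>
          \<Longrightarrow> (f' \<cdot> f) \<otimes>\<^sub>m (u' \<cdot> u) = (f' \<otimes>\<^sub>m u') \<cdot> (f \<otimes>\<^sub>m u)"
    and assr_iso: "\<lbrakk>a \<in> Obj C; b \<in> Obj C; c \<in> Obj C\<rbrakk>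
          \<Longrightarrow> assr C a b c \<in> Iso C ((a \<otimes>\<^sub>o b) \<otimes>\<^sub>o c) (a \<otimes>\<^sub>o (b \<otimes>\<^sub>o c))"
    and assr_natural: "\<lbrakk>f \<in> Hom C a a'; u \<in> Hom C b b'; v \<in> Hom C c c'\<rbrakk>
          \<Longrightarrow> assr C a' b' c' \<cdot> ((f \<otimes>\<^sub>m u) \<otimes>\<^sub>m v) = (f \<otimes>\<^sub>m (u \<otimes>\<^sub>m v)) \<cdot> assr C a b c"
    and unitO_closed: "unitO C \<in> Obj C \<and> fst (unitO C) = \<one>\<^bsub>G\<^esub>"
    and lunit_iso: "a \<in> Obj C \<Longrightarrow> lunit C a \<in> Iso C (unitO C \<otimes>\<^sub>o a) a"
    and runit_iso: "a \<in> Obj C \<Longrightarrow> runit C a \<in> Iso C (a \<otimes>\<^sub>o unitO C) a"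
    and lunit_natural: "f \<in> Hom C a a' \<Longrightarrow> lunit C a' \<cdot> (idt C (unitO C) \<otimes>\<^sub>m f) = f \<cdot> lunit C a"
    and runit_natural: "f \<in> Hom C a a' \<Longrightarrow> runit C a' \<cdot> (f \<otimes>\<^sub>m idt C (unitO C)) = f \<cdot> runit C a"
    and pentagon: "\<lbrakk>a \<in> Obj C; b \<in> Obj C; c \<in> Obj C; d \<in> Obj C\<rbrakk>
          \<Longrightarrow> (idt C a \<otimes>\<^sub>m assr C b c d) \<cdot> assr C a (b \<otimes>\<^sub>o c) d \<cdot> (assr C a b c \<otimes>\<^sub>m idt C d)
              = assr C a b (c \<otimes>\<^sub>o d) \<cdot> assr C (a \<otimes>\<^sub>o b) c d"
    and triangle: "\<lbrakk>a \<in> Obj C; b \<in> Obj C\<rbrakk>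
          \<Longrightarrow> (idt C a \<otimes>\<^sub>m lunit C b) \<cdot> assr C a (unitO C) b = runit C a \<otimes>\<^sub>m idt C b"
    and F_functor: "g \<in> carrier G \<Longrightarrow> is_functor C C (Fo C g) (Fm C g)"
    and F_grade: "\<lbrakk>g \<in> carrier G; a \<in> Obj C\<rbrakk>
          \<Longrightarrow> fst (Fo C g a) = g \<otimes>\<^bsub>G\<^esub> fst a \<otimes>\<^bsub>G\<^esub> inv\<^bsub>G\<^esub> g"
    and Fi_iso: "g \<in> carrier G \<Longrightarrow> Fi C g \<in> Iso C (unitO C) (Fo C g (unitO C))"
    and Fpsi_iso: "\<lbrakk>g \<in> carrier G; a \<in> Obj C; b \<in> Obj C\<rbrakk>
          \<Longrightarrow> Fpsi C g a b \<in> Iso C (Fo C g a \<otimes>\<^sub>o Fo C g b) (Fo C g (a \<otimes>\<^sub>o b))"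
    and Fpsi_natural: "\<lbrakk>g \<in> carrier G; f \<in> Hom C a a'; u \<in> Hom C b b'\<rbrakk>
          \<Longrightarrow> Fpsi C g a' b' \<cdot> (Fm C g f \<otimes>\<^sub>m Fm C g u) = Fm C g (f \<otimes>\<^sub>m u) \<cdot> Fpsi C g a b"
    and F_assr: "\<lbrakk>g \<in> carrier G; a \<in> Obj C; b \<in> Obj C; c \<in> Obj C\<rbrakk>
          \<Longrightarrow> Fm C g (assr C a b c) \<cdot> Fpsi C g (a \<otimes>\<^sub>o b) c \<cdot> (Fpsi C g a b \<otimes>\<^sub>m idt C (Fo C g c))
              = Fpsi C g a (b \<otimes>\<^sub>o c) \<cdot> (idt C (Fo C g a) \<otimes>\<^sub>m Fpsi C g b c)
                \<cdot> assr C (Fo C g a) (Fo C g b) (Fo C g c)"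
    and F_lunit: "\<lbrakk>g \<in> carrier G; a \<in> Obj C\<rbrakk>
          \<Longrightarrow> Fm C g (lunit C a) \<cdot> Fpsi C g (unitO C) a \<cdot> (Fi C g \<otimes>\<^sub>m idt C (Fo C g a))
              = lunit C (Fo C g a)"
    and F_runit: "\<lbrakk>g \<in> carrier G; a \<in> Obj C\<rbrakk>
          \<Longrightarrow> Fm C g (runit C a) \<cdot> Fpsi C g a (unitO C) \<cdot> (idt C (Fo C g a) \<otimes>\<^sub>m Fi C g)
              = runit C (Fo C g a)"
    and Fmu_iso: "\<lbrakk>g \<in> carrier G; h \<in> carrier G; a \<in> Obj C\<rbrakk>
          \<Longrightarrow> Fmu C g h a \<in> Iso C (Fo C g (Fo C h a)) (Fo C (g \<otimes>\<^bsub>G\<^esub> h) a)"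
    and Fmu_natural: "\<lbrakk>g \<in> carrier G; h \<in> carrier G; f \<in> Hom C a a'\<rbrakk>
          \<Longrightarrow> Fmu C g h a' \<cdot> Fm C g (Fm C h f) = Fm C (g \<otimes>\<^bsub>G\<^esub> h) f \<cdot> Fmu C g h a"
    and Fiota_iso: "a \<in> Obj C \<Longrightarrow> Fiota C a \<in> Iso C a (Fo C \<one>\<^bsub>G\<^esub> a)"
    and Fiota_natural: "f \<in> Hom C a a' \<Longrightarrow> Fiota C a' \<cdot> f = Fm C \<one>\<^bsub>G\<^esub> f \<cdot> Fiota C a"
    and Fmu_Fpsi: "\<lbrakk>g \<in> carrier G; h \<in> carrier G; a \<in> Obj C; b \<in> Obj C\<rbrakk>
          \<Longrightarrow> Fmu C g h (a \<otimes>\<^sub>o b) \<cdot> Fm C g (Fpsi C h a b) \<cdot> Fpsi C g (Fo C h a) (Fo C h b)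
              = Fpsi C (g \<otimes>\<^bsub>G\<^esub> h) a b \<cdot> (Fmu C g h a \<otimes>\<^sub>m Fmu C g h b)"
    and Fmu_assoc: "\<lbrakk>g \<in> carrier G; h \<in> carrier G; k \<in> carrier G; a \<in> Obj C\<rbrakk>
          \<Longrightarrow> Fmu C (g \<otimes>\<^bsub>G\<^esub> h) k a \<cdot> Fmu C g h (Fo C k a)
              = Fmu C g (h \<otimes>\<^bsub>G\<^esub> k) a \<cdot> Fm C g (Fmu C h k a)"
    and Fpsi_Fiota: "\<lbrakk>a \<in> Obj C; b \<in> Obj C\<rbrakk>
          \<Longrightarrow> Fpsi C \<one>\<^bsub>G\<^esub> a b \<cdot> (Fiota C a \<otimes>\<^sub>m Fiota C b) = Fiota C (a \<otimes>\<^sub>o b)"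
    and Fmu_Fiota_left: "\<lbrakk>g \<in> carrier G; a \<in> Obj C\<rbrakk>
          \<Longrightarrow> Fmu C \<one>\<^bsub>G\<^esub> g a \<cdot> Fiota C (Fo C g a) = idt C (Fo C g a)"
    and Fmu_Fiota_right: "\<lbrakk>g \<in> carrier G; a \<in> Obj C\<rbrakk>
          \<Longrightarrow> Fmu C g \<one>\<^bsub>G\<^esub> a \<cdot> Fm C g (Fiota C a) = idt C (Fo C g a)"
    and brd_iso: "\<lbrakk>a \<in> Obj C; b \<in> Obj C\<rbrakk>
          \<Longrightarrow> brd C a b \<in> Iso C (a \<otimes>\<^sub>o b) (Fo C (fst a) b \<otimes>\<^sub>o a)"
    and brd_natural: "\<lbrakk>f \<in> Hom C a a'; u \<in> Hom C b b'\<rbrakk>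
          \<Longrightarrow> brd C a' b' \<cdot> (f \<otimes>\<^sub>m u) = (Fm C (fst a) u \<otimes>\<^sub>m f) \<cdot> brd C a b"
    and brd_F: "\<lbrakk>g \<in> carrier G; b \<in> Obj C; c \<in> Obj C; h = fst b\<rbrakk>
          \<Longrightarrow> (Fmu C (g \<otimes>\<^bsub>G\<^esub> h \<otimes>\<^bsub>G\<^esub> inv\<^bsub>G\<^esub> g) g c \<otimes>\<^sub>m idt C (Fo C g b))
                \<cdot> brd C (Fo C g b) (Fo C g c) \<cdot> inv_arr C (Fpsi C g b c)
              = (Fmu C g h c \<otimes>\<^sub>m idt C (Fo C g b))
                \<cdot> inv_arr C (Fpsi C g (Fo C h c) b) \<cdot> Fm C g (brd C b c)"
    and hexagon_right: "\<lbrakk>a \<in> Obj C; b \<in> Obj C; c \<in> Obj C; g = fst a\<rbrakk>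
          \<Longrightarrow> assr C (Fo C g b) (Fo C g c) a
                \<cdot> (inv_arr C (Fpsi C g b c) \<otimes>\<^sub>m idt C a) \<cdot> brd C a (b \<otimes>\<^sub>o c) \<cdot> assr C a b c
              = (idt C (Fo C g b) \<otimes>\<^sub>m brd C a c) \<cdot> assr C (Fo C g b) a c
                \<cdot> (brd C a b \<otimes>\<^sub>m idt C c)"
    and hexagon_left: "\<lbrakk>a \<in> Obj C; b \<in> Obj C; c \<in> Obj C; g = fst a; h = fst b\<rbrakk>
          \<Longrightarrow> (inv_arr C (Fmu C g h c) \<otimes>\<^sub>m idt C (a \<otimes>\<^sub>o b)) \<cdot> brd C (a \<otimes>\<^sub>o b) c
              = assr C (Fo C g (Fo C h c)) a b \<cdot> (brd C a (Fo C h c) \<otimes>\<^sub>m idt C b)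
                \<cdot> inv_arr C (assr C a (Fo C h c) b) \<cdot> (idt C a \<otimes>\<^sub>m brd C b c) \<cdot> assr C a b c"

definition strict_crossed_braided ::
    "('g, 'h) monoid_scheme \<Rightarrow> ('g, 'o, 'm) crsbrd \<Rightarrow> bool" where
  "strict_crossed_braided G C \<longleftrightarrow> crossed_braided G C \<and>
     (\<forall>a \<in> Obj C. \<forall>b \<in> Obj C. \<forall>c \<in> Obj C. assr C a b c = idt C ((a \<otimes>\<^sub>o\<^bsub>C\<^esub> b) \<otimes>\<^sub>o\<^bsub>C\<^esub> c)) \<and>
     (\<forall>a \<in> Obj C. lunit C a = idt C a \<and> runit C a = idt C a \<and> Fiota C a = idt C a) \<and>
     (\<forall>g \<in> carrier G. Fi C g = idt C (unitO C)) \<and>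
     (\<forall>g \<in> carrier G. \<forall>a \<in> Obj C. \<forall>b \<in> Obj C. Fpsi C g a b = idt C (Fo C g (a \<otimes>\<^sub>o\<^bsub>C\<^esub> b))) \<and>
     (\<forall>g \<in> carrier G. \<forall>h \<in> carrier G. \<forall>a \<in> Obj C. Fmu C g h a = idt C (Fo C (g \<otimes>\<^bsub>G\<^esub> h) a))"

text \<open>
  A G-crossed braided functor: \<open>cobj\<close> and \<open>carr\<close> are the actions on objects and morphisms, \<open>cunit\<close>
  and \<open>cten\<close> the monoidal structure, and \<open>cact\<close> the natural isomorphisms relating the actions.
\<close>

record ('g, 'o, 'm) crsfun =
  cobj :: "'g \<times> 'o \<Rightarrow> 'g \<times> 'o"
  carr :: "('g \<times> 'o, 'm) arr \<Rightarrow> ('g \<times> 'o, 'm) arr"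
  cunit :: "('g \<times> 'o, 'm) arr"
  cten :: "'g \<times> 'o \<Rightarrow> 'g \<times> 'o \<Rightarrow> ('g \<times> 'o, 'm) arr"
  cact :: "'g \<Rightarrow> 'g \<times> 'o \<Rightarrow> ('g \<times> 'o, 'm) arr"

locale crossed_functor = C: crossed_braided G C + D: crossed_braided G D
  for G :: "('g, 'h) monoid_scheme"
    and C :: "('g, 'o, 'm) crsbrd" and D :: "('g, 'o, 'm) crsbrd" +
  fixes A :: "('g, 'o, 'm) crsfun"
  assumes functorial: "is_functor C D (cobj A) (carr A)"
    and grade_preserving: "a \<in> Obj C \<Longrightarrow> fst (cobj A a) = fst a"
    and cunit_iso: "cunit A \<in> Iso D (unitO D) (cobj A (unitO C))"
    and cten_iso: "\<lbrakk>a \<in> Obj C; b \<in> Obj C\<rbrakk>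
          \<Longrightarrow> cten A a b \<in> Iso D (cobj A a \<otimes>\<^sub>o\<^bsub>D\<^esub> cobj A b) (cobj A (a \<otimes>\<^sub>o\<^bsub>C\<^esub> b))"
    and cten_natural: "\<lbrakk>f \<in> Hom C a a'; u \<in> Hom C b b'\<rbrakk>
          \<Longrightarrow> cten A a' b' \<cdot>\<^bsub>D\<^esub> (carr A f \<otimes>\<^sub>m\<^bsub>D\<^esub> carr A u) = carr A (f \<otimes>\<^sub>m\<^bsub>C\<^esub> u) \<cdot>\<^bsub>D\<^esub> cten A a b"
    and cten_assr: "\<lbrakk>a \<in> Obj C; b \<in> Obj C; c \<in> Obj C\<rbrakk>
          \<Longrightarrow> carr A (assr C a b c) \<cdot>\<^bsub>D\<^esub> cten A (a \<otimes>\<^sub>o\<^bsub>C\<^esub> b) c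
                \<cdot>\<^bsub>D\<^esub> (cten A a b \<otimes>\<^sub>m\<^bsub>D\<^esub> idt D (cobj A c))
              = cten A a (b \<otimes>\<^sub>o\<^bsub>C\<^esub> c) \<cdot>\<^bsub>D\<^esub> (idt D (cobj A a) \<otimes>\<^sub>m\<^bsub>D\<^esub> cten A b c)
                \<cdot>\<^bsub>D\<^esub> assr D (cobj A a) (cobj A b) (cobj A c)"
    and cten_lunit: "a \<in> Obj C
          \<Longrightarrow> carr A (lunit C a) \<cdot>\<^bsub>D\<^esub> cten A (unitO C) a \<cdot>\<^bsub>D\<^esub> (cunit A \<otimes>\<^sub>m\<^bsub>D\<^esub> idt D (cobj A a))
              = lunit D (cobj A a)"
    and cten_runit: "a \<in> Obj C
          \<Longrightarrow> carr A (runit C a) \<cdot>\<^bsub>D\<^esub> cten A a (unitO C) \<cdot>\<^bsub>D\<^esub> (idt D (cobj A a) \<otimes>\<^sub>m\<^bsub>D\<^esub> cunit A)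
              = runit D (cobj A a)"
    and cact_iso: "\<lbrakk>g \<in> carrier G; x \<in> Obj C\<rbrakk>
          \<Longrightarrow> cact A g x \<in> Iso D (Fo D g (cobj A x)) (cobj A (Fo C g x))"
    and cact_natural: "\<lbrakk>g \<in> carrier G; f \<in> Hom C x x'\<rbrakk>
          \<Longrightarrow> cact A g x' \<cdot>\<^bsub>D\<^esub> Fm D g (carr A f) = carr A (Fm C g f) \<cdot>\<^bsub>D\<^esub> cact A g x"
    and cact_ten: "\<lbrakk>g \<in> carrier G; x \<in> Obj C; y \<in> Obj C\<rbrakk>
          \<Longrightarrow> cact A g (x \<otimes>\<^sub>o\<^bsub>C\<^esub> y) \<cdot>\<^bsub>D\<^esub> Fm D g (cten A x y) \<cdot>\<^bsub>D\<^esub> Fpsi D g (cobj A x) (cobj A y)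
              = carr A (Fpsi C g x y) \<cdot>\<^bsub>D\<^esub> cten A (Fo C g x) (Fo C g y)
                \<cdot>\<^bsub>D\<^esub> (cact A g x \<otimes>\<^sub>m\<^bsub>D\<^esub> cact A g y)"
    and cact_unit: "g \<in> carrier G
          \<Longrightarrow> cact A g (unitO C) \<cdot>\<^bsub>D\<^esub> Fm D g (cunit A) \<cdot>\<^bsub>D\<^esub> Fi D g = carr A (Fi C g) \<cdot>\<^bsub>D\<^esub> cunit A"
    and cact_mult: "\<lbrakk>g \<in> carrier G; h \<in> carrier G; x \<in> Obj C\<rbrakk>
          \<Longrightarrow> cact A (g \<otimes>\<^bsub>G\<^esub> h) x \<cdot>\<^bsub>D\<^esub> Fmu D g h (cobj A x)
              = carr A (Fmu C g h x) \<cdot>\<^bsub>D\<^esub> cact A g (Fo C h x) \<cdot>\<^bsub>D\<^esub> Fm D g (cact A h x)"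
    and cact_brd: "\<lbrakk>a \<in> Obj C; b \<in> Obj C; g = fst a\<rbrakk>
          \<Longrightarrow> carr A (brd C a b) \<cdot>\<^bsub>D\<^esub> cten A a b
              = cten A (Fo C g b) a \<cdot>\<^bsub>D\<^esub> (cact A g b \<otimes>\<^sub>m\<^bsub>D\<^esub> idt D (cobj A a))
                \<cdot>\<^bsub>D\<^esub> brd D (cobj A a) (cobj A b)"
    and cobj_ext: "cobj A \<in> extensional (Obj C)"
    and carr_ext: "carr A \<in> extensional (Arrs C)"
    and cten_ext: "\<not> (a \<in> Obj C \<and> b \<in> Obj C) \<Longrightarrow> cten A a b = undefined"
    and cact_ext: "\<not> (g \<in> carrier G \<and> x \<in> Obj C) \<Longrightarrow> cact A g x = undefined"

definition id_crsfun ::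
    "('g, 'h) monoid_scheme \<Rightarrow> ('g, 'o, 'm) crsbrd \<Rightarrow> ('g, 'o, 'm) crsfun" where
  "id_crsfun G C =
     \<lparr> cobj = (\<lambda>a \<in> Obj C. a), carr = (\<lambda>f \<in> Arrs C. f), cunit = idt C (unitO C),
       cten = (\<lambda>a b. if a \<in> Obj C \<and> b \<in> Obj C then idt C (a \<otimes>\<^sub>o\<^bsub>C\<^esub> b) else undefined),
       cact = (\<lambda>g x. if g \<in> carrier G \<and> x \<in> Obj C then idt C (Fo C g x) else undefined) \<rparr>"

text \<open>\<open>comp_crsfun G C E B A\<close> is \<open>A : C \<rightarrow> D\<close> followed by \<open>B : D \<rightarrow> E\<close>.\<close>

definition comp_crsfun ::
    "('g, 'h) monoid_scheme \<Rightarrow> ('g, 'o, 'm) crsbrd \<Rightarrow> ('g, 'o, 'm) crsbrd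
     \<Rightarrow> ('g, 'o, 'm) crsfun \<Rightarrow> ('g, 'o, 'm) crsfun \<Rightarrow> ('g, 'o, 'm) crsfun" where
  "comp_crsfun G C E B A =
     \<lparr> cobj = (\<lambda>a \<in> Obj C. cobj B (cobj A a)),
       carr = (\<lambda>f \<in> Arrs C. carr B (carr A f)),
       cunit = carr B (cunit A) \<cdot>\<^bsub>E\<^esub> cunit B,
       cten = (\<lambda>a b. if a \<in> Obj C \<and> b \<in> Obj C
                 then carr B (cten A a b) \<cdot>\<^bsub>E\<^esub> cten B (cobj A a) (cobj A b) else undefined),
       cact = (\<lambda>g x. if g \<in> carrier G \<and> x \<in> Obj C
                 then carr B (cact A g x) \<cdot>\<^bsub>E\<^esub> cact B g (cobj A x) else undefined) \<rparr>"

locale crossed_transformation = A: crossed_functor G C D A + B: crossed_functor G C D B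
  for G :: "('g, 'h) monoid_scheme"
    and C :: "('g, 'o, 'm) crsbrd" and D :: "('g, 'o, 'm) crsbrd"
    and A :: "('g, 'o, 'm) crsfun" and B :: "('g, 'o, 'm) crsfun" +
  fixes \<eta> :: "'g \<times> 'o \<Rightarrow> ('g \<times> 'o, 'm) arr"
  assumes component: "x \<in> Obj C \<Longrightarrow> \<eta> x \<in> Hom D (cobj A x) (cobj B x)"
    and natural: "f \<in> Hom C x x' \<Longrightarrow> \<eta> x' \<cdot>\<^bsub>D\<^esub> carr A f = carr B f \<cdot>\<^bsub>D\<^esub> \<eta> x"
    and respects_unit: "\<eta> (unitO C) \<cdot>\<^bsub>D\<^esub> cunit A = cunit B"
    and respects_ten: "\<lbrakk>x \<in> Obj C; y \<in> Obj C\<rbrakk>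
          \<Longrightarrow> \<eta> (x \<otimes>\<^sub>o\<^bsub>C\<^esub> y) \<cdot>\<^bsub>D\<^esub> cten A x y = cten B x y \<cdot>\<^bsub>D\<^esub> (\<eta> x \<otimes>\<^sub>m\<^bsub>D\<^esub> \<eta> y)"
    and respects_act: "\<lbrakk>g \<in> carrier G; x \<in> Obj C\<rbrakk>
          \<Longrightarrow> cact B g x \<cdot>\<^bsub>D\<^esub> Fm D g (\<eta> x) = \<eta> (Fo C g x) \<cdot>\<^bsub>D\<^esub> cact A g x"
    and ext: "\<eta> \<in> extensional (Obj C)"

type_synonym ('g, 'o, 'm) crsbrd_two_cat =
  "(('g, 'o, 'm) crsbrd, ('g, 'o, 'm) crsfun, 'g \<times> 'o \<Rightarrow> ('g \<times> 'o, 'm) arr) two_cat"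

definition GCrsBrd :: "('g, 'h) monoid_scheme \<Rightarrow> ('g, 'o, 'm) crsbrd_two_cat" where
  "GCrsBrd G =
     \<lparr> Obj = {Arr C D A | C D A. crossed_functor G C D A},
       Arrs = {Arr (Arr C D A) (Arr C D B) \<eta> | C D A B \<eta>. crossed_transformation G C D A B \<eta>},
       idt = (\<lambda>X. Arr X X (\<lambda>x \<in> Obj (src X). idt (trg X) (cobj (lab X) x))),
       vcmp = (\<lambda>\<zeta> \<eta>. Arr (src \<eta>) (trg \<zeta>)
                (\<lambda>x \<in> Obj (src (src \<eta>)). lab \<zeta> x \<cdot>\<^bsub>trg (src \<eta>)\<^esub> lab \<eta> x)),
       Obj0 = {C. crossed_braided G C},
       id1 = (\<lambda>C. Arr C C (id_crsfun G C)),
       cmp1 = (\<lambda>Y X. Arr (src X) (trg Y) (comp_crsfun G (src X) (trg Y) (lab Y) (lab X))),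
       hcmp = (\<lambda>\<zeta> \<eta>. let C = src (src \<eta>); E = trg (src \<zeta>) in
                Arr (Arr C E (comp_crsfun G C E (lab (src \<zeta>)) (lab (src \<eta>))))
                    (Arr C E (comp_crsfun G C E (lab (trg \<zeta>)) (lab (trg \<eta>))))
                    (\<lambda>x \<in> Obj C. lab \<zeta> (cobj (lab (trg \<eta>)) x)
                                   \<cdot>\<^bsub>E\<^esub> carr (lab (src \<zeta>)) (lab \<eta> x))) \<rparr>"

definition GCrsBrd_st :: "('g, 'h) monoid_scheme \<Rightarrow> ('g, 'o, 'm) crsbrd_two_cat" where
  "GCrsBrd_st G = full_sub_two_category (GCrsBrd G) {C. strict_crossed_braided G C}"

end

theory Submission
  imports Defs
begin

text \<open>
  The 0-cells of a Gray-monoid \<open>C\<close> whose 0-cells form the group \<open>G\<close> are invertible, so tensoring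
  with the 0-cell \<open>inv g\<close> on the right identifies the category of 1-cells from \<open>g\<close> to \<open>h\<close> with
  that of 1-cells from \<open>\<one>\<close> to \<open>h \<otimes> inv g\<close>. Nothing is lost by keeping only the 1-cells out of the
  unit. They are the objects of a strict crossed braided category \<open>crossed_of G C\<close>: the grade of
  a 1-cell is its target, the tensor product is that of \<open>C\<close>, and \<open>g\<close> acts by the conjugation
  \<open>g \<triangleright> (x \<triangleleft> inv g)\<close>. For \<open>x\<close> from \<open>\<one>\<close> to \<open>g\<close> and \<open>y\<close> from \<open>\<one>\<close> to \<open>h\<close> the interchanger leads from
  \<open>x \<otimes>\<^sub>1 y\<close> to \<open>(g \<triangleright> y) \<bullet> x\<close>, which equals \<open>(g \<triangleright> (y \<triangleleft> inv g)) \<otimes>\<^sub>1 x\<close>, so it is a crossed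
  braiding.

  A functor \<open>A\<close> of Gray-monoids restricts to these 1-cells. It commutes with conjugation only up
  to isomorphism, because it preserves the identity 1-cell of \<open>g\<close> only up to \<open>munit A g\<close>; the
  cells \<open>acell\<close>, composed of its coherence cells for tensoring with identity 1-cells on either
  side, are the action isomorphisms of the crossed braided functor \<open>crsfun_of\<close>. Transformations
  are restricted to the same 1-cells. The result is a strict 2-functor from \<open>ThreeCat_st_lax G\<close>
  to \<open>GCrsBrd_st G\<close>.

  On 2-cells it is bijective. Every 1-cell has the form \<open>y \<triangleleft> g\<close> with \<open>y\<close> a 1-cell out of the
  unit, and the cells \<open>rcell\<close> identify the value of a functor there with \<open>A y \<triangleleft> g\<close>. This
  determines the component of a transformation at \<open>y \<triangleleft> g\<close> by that at \<open>y\<close> (\<open>trans_of_inj\<close>), and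
  used as a definition it extends every crossed braided transformation (\<open>eta_transformation\<close>,
  \<open>trans_of_eta\<close>).

  On 1-cells it is surjective. Given a crossed braided functor, \<open>fun3_of\<close> shifts a 1-cell so that
  it starts at the unit, applies the functor and shifts back. Shifting is injective on parallel
  2-cells and turns the operations of \<open>C\<close> into those of \<open>crossed_of G C\<close> (\<open>down1_ops\<close>,
  \<open>down2_ops\<close>, \<open>down2_ichg\<close>), so every law that \<open>fun3_of\<close> has to satisfy becomes an identity for
  crossed braided functors. The only laborious one is the exchange law \<open>mt_exchange\<close>.

  On 0-cells it is essentially surjective. In the Gray-monoid \<open>gray_of G K\<close> the 1-cells from \<open>g\<close>
  to \<open>h\<close> are the objects of \<open>K\<close> of grade \<open>h \<otimes> inv g\<close>, and \<open>crossed_of G (gray_of G K)\<close> agrees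
  with \<open>K\<close> on the intended domains of all operations (\<open>crossed_of_gray_agree\<close>).

  A strict 2-functor with these properties is an equivalence, which is the second half of the
  theorem. For the first half, an equivalence restricts to the invertible 2-cells on both sides
  (\<open>core_equivalence\<close>), and \<open>ThreeCat_st G\<close> consists of the invertible 2-cells of
  \<open>ThreeCat_st_lax G\<close>, since the inverses of the components of a transformation form a
  transformation (\<open>ThreeCat_st_core\<close>).
\<close>


section \<open>Categories and functors\<close>

context category
begin

lemma src_Obj [simp]: "f \<in> Arrs C \<Longrightarrow> src f \<in> Obj C"
  and trg_Obj [simp]: "f \<in> Arrs C \<Longrightarrow> trg f \<in> Obj C"
  by (simp_all add: src_closed trg_closed)

lemma idt_simps [simp]:
  assumes "a \<in> Obj C"
  shows "idt C a \<in> Arrs C" "src (idt C a) = a" "trg (idt C a) = a"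
  using idt_closed[OF assms] by (auto simp: Hom_def)

lemma vcmp_simps [simp]:
  assumes "f \<in> Arrs C" "g \<in> Arrs C" "src g = trg f"
  shows "g \<cdot> f \<in> Arrs C" "src (g \<cdot> f) = src f" "trg (g \<cdot> f) = trg g"
  using vcmp_closed[of f "src f" "trg f" g "trg g"] assms by (auto simp: Hom_def)

lemma idt_vcmp [simp]: "\<lbrakk>f \<in> Arrs C; trg f = b\<rbrakk> \<Longrightarrow> idt C b \<cdot> f = f"
  using vcmp_idt_left[of f "src f" "trg f"] by (auto simp: Hom_def)

lemma vcmp_idt [simp]: "\<lbrakk>f \<in> Arrs C; src f = a\<rbrakk> \<Longrightarrow> f \<cdot> idt C a = f"
  using vcmp_idt_right[of f "src f" "trg f"] by (auto simp: Hom_def)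

lemma vcmp_assoc' [simp]:
  "\<lbrakk>f \<in> Arrs C; g \<in> Arrs C; h \<in> Arrs C; src g = trg f; src h = trg g\<rbrakk>
   \<Longrightarrow> (h \<cdot> g) \<cdot> f = h \<cdot> (g \<cdot> f)"
  using vcmp_assoc[of f "src f" "trg f" g "trg g" h "trg h"] by (auto simp: Hom_def)

text \<open>
  Composites are kept bracketed to the right, where an equation for \<open>g \<cdot> f\<close> cannot rewrite
  \<open>g \<cdot> (f \<cdot> r)\<close>. Combined with this rule by \<open>THEN\<close> it can.
\<close>

lemma reassoc:
  "\<lbrakk>g \<cdot> f = k; f \<in> Arrs C; g \<in> Arrs C; src g = trg f; r \<in> Arrs C; trg r = src f\<rbrakk>
   \<Longrightarrow> g \<cdot> (f \<cdot> r) = k \<cdot> r"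
  using vcmp_assoc'[of r f g] by simp

lemma inverse_arrs_iff:
  "inverse_arrs C f g \<longleftrightarrow> f \<in> Arrs C \<and> g \<in> Arrs C \<and> src g = trg f \<and> trg g = src f \<and>
     g \<cdot> f = idt C (src f) \<and> f \<cdot> g = idt C (trg f)"
  by (auto simp: inverse_arrs_def Hom_def)

lemma inverse_arrs_unique:
  assumes "inverse_arrs C f g" "inverse_arrs C f h"
  shows "g = h"
proof -
  note 1 = assms[unfolded inverse_arrs_iff]
  have "g = g \<cdot> (f \<cdot> h)" using 1 by simp
  also have "\<dots> = (g \<cdot> f) \<cdot> h" using 1 by (intro vcmp_assoc'[symmetric]) auto
  also have "\<dots> = h" using 1 by simp
  finally show ?thesis .
qed

lemma inv_arr_eqI: "inverse_arrs C f g \<Longrightarrow> inv_arr C f = g"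
  unfolding inv_arr_def using inverse_arrs_unique by blast

lemma inverse_arrs_inv_arr: "iso_arr C f \<Longrightarrow> inverse_arrs C f (inv_arr C f)"
  using inv_arr_eqI by (auto simp: iso_arr_def)

lemma iso_simps [simp]:
  assumes "iso_arr C f"
  shows "f \<in> Arrs C" "inv_arr C f \<in> Arrs C" "src (inv_arr C f) = trg f" "trg (inv_arr C f) = src f"
    "inv_arr C f \<cdot> f = idt C (src f)" "f \<cdot> inv_arr C f = idt C (trg f)"
  using inverse_arrs_inv_arr[OF assms] by (auto simp: inverse_arrs_iff)

lemma iso_inv_vcmp [simp]:
  "\<lbrakk>iso_arr C f; r \<in> Arrs C; trg r = src f\<rbrakk> \<Longrightarrow> inv_arr C f \<cdot> (f \<cdot> r) = r"
  using reassoc[of "inv_arr C f" f "idt C (src f)" r] by simp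

lemma iso_vcmp_inv [simp]:
  "\<lbrakk>iso_arr C f; r \<in> Arrs C; trg r = trg f\<rbrakk> \<Longrightarrow> f \<cdot> (inv_arr C f \<cdot> r) = r"
  using reassoc[of f "inv_arr C f" "idt C (trg f)" r] by simp

lemma inverse_arrs_idt: "a \<in> Obj C \<Longrightarrow> inverse_arrs C (idt C a) (idt C a)"
  by (simp add: inverse_arrs_iff)

lemma iso_idt [simp]: "a \<in> Obj C \<Longrightarrow> iso_arr C (idt C a)"
  using inverse_arrs_idt by (auto simp: iso_arr_def)

lemma inv_idt [simp]: "a \<in> Obj C \<Longrightarrow> inv_arr C (idt C a) = idt C a"
  using inverse_arrs_idt inv_arr_eqI by blast

lemma inverse_arrs_vcmp:
  assumes "iso_arr C f" "iso_arr C g" "src g = trg f"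
  shows "inverse_arrs C (g \<cdot> f) (inv_arr C f \<cdot> inv_arr C g)"
  using assms by (simp add: inverse_arrs_iff)

lemma iso_vcmp [simp]: "\<lbrakk>iso_arr C f; iso_arr C g; src g = trg f\<rbrakk> \<Longrightarrow> iso_arr C (g \<cdot> f)"
  using inverse_arrs_vcmp by (auto simp: iso_arr_def)

lemma iso_inv [simp]: "iso_arr C f \<Longrightarrow> iso_arr C (inv_arr C f)"
  unfolding iso_arr_def[of C "inv_arr C f"] by (auto simp: inverse_arrs_iff intro!: exI[of _ f])

lemma iso_cancel_left:
  assumes "f \<cdot> x = f \<cdot> y" "iso_arr C f" "x \<in> Arrs C" "y \<in> Arrs C" "trg x = src f" "trg y = src f"
  shows "x = y"
  using arg_cong[OF assms(1), of "\<lambda>z. inv_arr C f \<cdot> z"] assms(2-) by simp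

lemma iso_cancel_right:
  assumes "x \<cdot> f = y \<cdot> f" "iso_arr C f" "x \<in> Arrs C" "y \<in> Arrs C" "src x = trg f" "src y = trg f"
  shows "x = y"
  using arg_cong[OF assms(1), of "\<lambda>z. z \<cdot> inv_arr C f"] assms(2-) by simp

text \<open>
  At a unit the multiplicativity law of a structure isomorphism often says that it is idempotent;
  it is then an identity.
\<close>

lemma idempotent_iso: "\<lbrakk>f \<cdot> f = f; iso_arr C f; src f = trg f\<rbrakk> \<Longrightarrow> f = idt C (src f)"
  by (rule iso_cancel_left[of f]) auto

lemma move_iso_left:
  "\<lbrakk>b = a \<cdot> q; q \<cdot> p = idt C (src p); a \<in> Arrs C; q \<in> Arrs C; p \<in> Arrs C; src a = trg q; src q = trg p\<rbrakk>
   \<Longrightarrow> b \<cdot> p = a"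
  using vcmp_simps(3)[of p q] by simp

lemma Iso_iff: "f \<in> Iso C a b \<longleftrightarrow> iso_arr C f \<and> src f = a \<and> trg f = b"
  by (auto simp: Iso_def Hom_def)

end

locale functor_pair = C: category C + D: category D
  for C :: "('v, 'e, 'z) cat_scheme" and D :: "('w, 'f, 'y) cat_scheme" +
  fixes fo :: "'v \<Rightarrow> 'w" and fa :: "('v, 'e) arr \<Rightarrow> ('w, 'f) arr"
  assumes functorial: "is_functor C D fo fa"
begin

lemma fo_Obj [simp]: "a \<in> Obj C \<Longrightarrow> fo a \<in> Obj D"
  and fa_idt [simp]: "a \<in> Obj C \<Longrightarrow> fa (idt C a) = idt D (fo a)"
  and fa_Arrs [simp]: "f \<in> Arrs C \<Longrightarrow> fa f \<in> Arrs D"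
  and fa_src [simp]: "f \<in> Arrs C \<Longrightarrow> src (fa f) = fo (src f)"
  and fa_trg [simp]: "f \<in> Arrs C \<Longrightarrow> trg (fa f) = fo (trg f)"
  and fa_vcmp [simp]:
    "\<lbrakk>f \<in> Arrs C; g \<in> Arrs C; src g = trg f\<rbrakk> \<Longrightarrow> fa (g \<cdot>\<^bsub>C\<^esub> f) = fa g \<cdot>\<^bsub>D\<^esub> fa f"
  using functorial by (auto simp: is_functor_def Hom_def)

lemma inverse_arrs_fa: "inverse_arrs C f g \<Longrightarrow> inverse_arrs D (fa f) (fa g)"
  unfolding C.inverse_arrs_iff D.inverse_arrs_iff
  by (auto simp flip: fa_vcmp)

lemma iso_fa [simp]: "iso_arr C f \<Longrightarrow> iso_arr D (fa f)"
  using inverse_arrs_fa by (auto simp: iso_arr_def)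

end


section \<open>Composition structures, their weak functors and transformations\<close>

text \<open>
  The composition of 1-cells in a 2-category and the tensor products of Gray-monoids and of
  strict crossed braided categories have the same form: a strictly associative and unital
  operation \<open>\<odot>\<close> on the objects of a category, with a matching functorial operation \<open>\<diamondop>\<close> on its
  arrows. The labels \<open>s x\<close> and \<open>t x\<close> say which objects can be combined; for a tensor product they
  carry no information and lie in the unit type. Both families of coherence cells of a functor of
  Gray-monoids, and that of a monoidal functor, then make it a weak functor in one sense, and
  identities, composites and transformations need to be studied only once.
\<close>

locale strict_composition = category C for C :: "('v, 'e, 'z) cat_scheme" (structure) +
  fixes I :: "'i set" and s t :: "'v \<Rightarrow> 'i" and e :: "'i \<Rightarrow> 'v"
    and tO :: "'v \<Rightarrow> 'v \<Rightarrow> 'v" (infixl "\<odot>" 70)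
    and tA :: "('v, 'e) arr \<Rightarrow> ('v, 'e) arr \<Rightarrow> ('v, 'e) arr" (infixl "\<diamondop>" 70)
  assumes s_closed: "x \<in> Obj C \<Longrightarrow> s x \<in> I"
    and t_closed: "x \<in> Obj C \<Longrightarrow> t x \<in> I"
    and s_trg: "f \<in> Arrs C \<Longrightarrow> s (trg f) = s (src f)"
    and t_trg: "f \<in> Arrs C \<Longrightarrow> t (trg f) = t (src f)"
    and e_Obj [simp]: "i \<in> I \<Longrightarrow> e i \<in> Obj C"
    and e_ends: "i \<in> I \<Longrightarrow> s (e i) = i" "i \<in> I \<Longrightarrow> t (e i) = i"
    and tO_Obj [simp]: "\<lbrakk>x \<in> Obj C; y \<in> Obj C; s y = t x\<rbrakk> \<Longrightarrow> y \<odot> x \<in> Obj C"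
    and tO_ends:
      "\<lbrakk>x \<in> Obj C; y \<in> Obj C; s y = t x\<rbrakk> \<Longrightarrow> s (y \<odot> x) = s x"
      "\<lbrakk>x \<in> Obj C; y \<in> Obj C; s y = t x\<rbrakk> \<Longrightarrow> t (y \<odot> x) = t y"
    and tO_assoc [simp]:
      "\<lbrakk>x \<in> Obj C; y \<in> Obj C; z \<in> Obj C; s y = t x; s z = t y\<rbrakk> \<Longrightarrow> (z \<odot> y) \<odot> x = z \<odot> (y \<odot> x)"
    and tO_unit_left [simp]: "\<lbrakk>x \<in> Obj C; t x = i\<rbrakk> \<Longrightarrow> e i \<odot> x = x"
    and tO_unit_right [simp]: "\<lbrakk>x \<in> Obj C; s x = i\<rbrakk> \<Longrightarrow> x \<odot> e i = x"
    and tA_simps [simp]: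
      "\<lbrakk>f \<in> Arrs C; g \<in> Arrs C; s (src g) = t (src f)\<rbrakk> \<Longrightarrow> g \<diamondop> f \<in> Arrs C"
      "\<lbrakk>f \<in> Arrs C; g \<in> Arrs C; s (src g) = t (src f)\<rbrakk> \<Longrightarrow> src (g \<diamondop> f) = src g \<odot> src f"
      "\<lbrakk>f \<in> Arrs C; g \<in> Arrs C; s (src g) = t (src f)\<rbrakk> \<Longrightarrow> trg (g \<diamondop> f) = trg g \<odot> trg f"
    and tA_idt [simp]: "\<lbrakk>x \<in> Obj C; y \<in> Obj C; s y = t x\<rbrakk> \<Longrightarrow> idt C y \<diamondop> idt C x = idt C (y \<odot> x)"
    and tA_vcmp: "\<lbrakk>f \<in> Arrs C; g \<in> Arrs C; f' \<in> Arrs C; g' \<in> Arrs C; src f' = trg f; src g' = trg g;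
          s (src g) = t (src f)\<rbrakk> \<Longrightarrow> (g' \<cdot> g) \<diamondop> (f' \<cdot> f) = (g' \<diamondop> f') \<cdot> (g \<diamondop> f)"
    and tA_assoc [simp]:
      "\<lbrakk>f \<in> Arrs C; g \<in> Arrs C; h \<in> Arrs C; s (src g) = t (src f); s (src h) = t (src g)\<rbrakk>
       \<Longrightarrow> (h \<diamondop> g) \<diamondop> f = h \<diamondop> (g \<diamondop> f)"
    and tA_unit_left [simp]: "\<lbrakk>f \<in> Arrs C; t (src f) = i\<rbrakk> \<Longrightarrow> idt C (e i) \<diamondop> f = f"
    and tA_unit_right [simp]: "\<lbrakk>f \<in> Arrs C; s (src f) = i\<rbrakk> \<Longrightarrow> f \<diamondop> idt C (e i) = f"
begin

(* With constant s and t these rules rewrite a constant to itself, so they are made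
   simplification rules only where that does not happen. *)
lemmas ends = s_closed t_closed s_trg t_trg e_ends tO_ends

context
  notes ends [simp]
begin

lemma merge:
  "\<lbrakk>f \<in> Arrs C; g \<in> Arrs C; f' \<in> Arrs C; g' \<in> Arrs C; src f' = trg f; src g' = trg g;
    s (src g) = t (src f)\<rbrakk> \<Longrightarrow> (g' \<diamondop> f') \<cdot> (g \<diamondop> f) = (g' \<cdot> g) \<diamondop> (f' \<cdot> f)"
  by (simp add: tA_vcmp)

lemma merge_r:
  "\<lbrakk>f \<in> Arrs C; g \<in> Arrs C; f' \<in> Arrs C; g' \<in> Arrs C; src f' = trg f; src g' = trg g;
    s (src g) = t (src f); r \<in> Arrs C; trg r = src g \<odot> src f\<rbrakk>
   \<Longrightarrow> (g' \<diamondop> f') \<cdot> ((g \<diamondop> f) \<cdot> r) = ((g' \<cdot> g) \<diamondop> (f' \<cdot> f)) \<cdot> r"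
  by (rule reassoc) (simp_all add: merge)

lemma whisker_left:
  "\<lbrakk>f \<in> Arrs C; f' \<in> Arrs C; src f' = trg f; x \<in> Obj C; s x = t (src f)\<rbrakk>
   \<Longrightarrow> idt C x \<diamondop> (f' \<cdot> f) = (idt C x \<diamondop> f') \<cdot> (idt C x \<diamondop> f)"
  by (simp add: merge)

lemma whisker_right:
  "\<lbrakk>g \<in> Arrs C; g' \<in> Arrs C; src g' = trg g; x \<in> Obj C; s (src g) = t x\<rbrakk>
   \<Longrightarrow> (g' \<cdot> g) \<diamondop> idt C x = (g' \<diamondop> idt C x) \<cdot> (g \<diamondop> idt C x)"
  by (simp add: merge)

lemma inverse_arrs_tA:
  assumes "iso_arr C f" "iso_arr C g" "s (src g) = t (src f)"
  shows "inverse_arrs C (g \<diamondop> f) (inv_arr C g \<diamondop> inv_arr C f)"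
  using assms by (simp add: inverse_arrs_iff merge)

lemma iso_tA [simp]: "\<lbrakk>iso_arr C f; iso_arr C g; s (src g) = t (src f)\<rbrakk> \<Longrightarrow> iso_arr C (g \<diamondop> f)"
  using inverse_arrs_tA by (auto simp: iso_arr_def)

lemma inv_tA: "\<lbrakk>iso_arr C f; iso_arr C g; s (src g) = t (src f)\<rbrakk>
  \<Longrightarrow> inv_arr C (g \<diamondop> f) = inv_arr C g \<diamondop> inv_arr C f"
  by (rule inv_arr_eqI[OF inverse_arrs_tA])

end

end

text \<open>
  The map \<open>k\<close> is the effect on labels: on 0-cells if the operation is the composition of 1-cells.
\<close>

locale weak_functor = C: strict_composition C I s t e tO tA + D: strict_composition D J s' t' e' tO' tA'
    + functor_pair C D fo fa
  for C :: "('v, 'e, 'z) cat_scheme" and I :: "'i set" and s t e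
    and tO :: "'v \<Rightarrow> 'v \<Rightarrow> 'v" (infixl "\<odot>" 70)
    and tA :: "('v, 'e) arr \<Rightarrow> ('v, 'e) arr \<Rightarrow> ('v, 'e) arr" (infixl "\<diamondop>" 70)
    and D :: "('w, 'f, 'y) cat_scheme" and J :: "'j set" and s' t' e'
    and tO' :: "'w \<Rightarrow> 'w \<Rightarrow> 'w" (infixl "\<odot>''" 70)
    and tA' :: "('w, 'f) arr \<Rightarrow> ('w, 'f) arr \<Rightarrow> ('w, 'f) arr" (infixl "\<diamondop>''" 70)
    and fo fa +
  fixes k :: "'i \<Rightarrow> 'j" and eps :: "'i \<Rightarrow> ('w, 'f) arr" and mu :: "'v \<Rightarrow> 'v \<Rightarrow> ('w, 'f) arr"
  assumes k_closed: "i \<in> I \<Longrightarrow> k i \<in> J"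
    and s_fo: "x \<in> Obj C \<Longrightarrow> s' (fo x) = k (s x)"
    and t_fo: "x \<in> Obj C \<Longrightarrow> t' (fo x) = k (t x)"
    and eps_iso [simp]: "i \<in> I \<Longrightarrow> iso_arr D (eps i)"
    and eps_src [simp]: "i \<in> I \<Longrightarrow> src (eps i) = e' (k i)"
    and eps_trg [simp]: "i \<in> I \<Longrightarrow> trg (eps i) = fo (e i)"
    and mu_iso [simp]: "\<lbrakk>x \<in> Obj C; y \<in> Obj C; s y = t x\<rbrakk> \<Longrightarrow> iso_arr D (mu y x)"
    and mu_src [simp]: "\<lbrakk>x \<in> Obj C; y \<in> Obj C; s y = t x\<rbrakk> \<Longrightarrow> src (mu y x) = fo y \<odot>' fo x"
    and mu_trg [simp]: "\<lbrakk>x \<in> Obj C; y \<in> Obj C; s y = t x\<rbrakk> \<Longrightarrow> trg (mu y x) = fo (y \<odot> x)"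
    and mu_natural: "\<lbrakk>f \<in> Arrs C; g \<in> Arrs C; s (src g) = t (src f)\<rbrakk>
       \<Longrightarrow> mu (trg g) (trg f) \<cdot>\<^bsub>D\<^esub> (fa g \<diamondop>' fa f) = fa (g \<diamondop> f) \<cdot>\<^bsub>D\<^esub> mu (src g) (src f)"
    and mu_assoc: "\<lbrakk>x \<in> Obj C; y \<in> Obj C; z \<in> Obj C; s y = t x; s z = t y\<rbrakk>
       \<Longrightarrow> mu z (y \<odot> x) \<cdot>\<^bsub>D\<^esub> (idt D (fo z) \<diamondop>' mu y x) = mu (z \<odot> y) x \<cdot>\<^bsub>D\<^esub> (mu z y \<diamondop>' idt D (fo x))"
    and mu_unit_left: "\<lbrakk>x \<in> Obj C; t x = i\<rbrakk>
       \<Longrightarrow> mu (e i) x \<cdot>\<^bsub>D\<^esub> (eps i \<diamondop>' idt D (fo x)) = idt D (fo x)"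
    and mu_unit_right: "\<lbrakk>x \<in> Obj C; s x = i\<rbrakk>
       \<Longrightarrow> mu x (e i) \<cdot>\<^bsub>D\<^esub> (idt D (fo x) \<diamondop>' eps i) = idt D (fo x)"
begin

lemmas fun_ends = k_closed s_fo t_fo

lemma eps_Arrs [simp]: "i \<in> I \<Longrightarrow> eps i \<in> Arrs D"
  by (rule D.iso_simps(1)) simp

end

text \<open>
  The data are described by equations on their domains instead of being fixed, so that the lemma
  applies to functors that are undefined elsewhere; the same holds for the lemmas on composites.
\<close>

lemma (in strict_composition) weak_functor_identity:
  assumes "\<And>x. x \<in> Obj C \<Longrightarrow> fo x = x" "\<And>f. f \<in> Arrs C \<Longrightarrow> fa f = f" "\<And>i. i \<in> I \<Longrightarrow> k i = i"
    "\<And>i. i \<in> I \<Longrightarrow> eps i = idt C (e i)"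
    "\<And>x y. \<lbrakk>x \<in> Obj C; y \<in> Obj C; s y = t x\<rbrakk> \<Longrightarrow> mu y x = idt C (y \<odot> x)"
  shows "weak_functor C I s t e tO tA C I s t e tO tA fo fa k eps mu"
proof -
  interpret functor_pair C C fo fa
    by unfold_locales (simp add: is_functor_def assms Hom_def)
  note ends [simp]
  show ?thesis
    by unfold_locales (auto simp: assms)
qed

text \<open>
  Each coherence law of the composite follows from that of the first functor, mapped by the
  second, and that of the second. What joins them is naturality of \<open>mu'\<close> at the coherence cells
  of the first.
\<close>

lemma weak_functor_composite:
  fixes C :: "('v, 'e, 'z) cat_scheme" and D :: "('v2, 'e2, 'z2) cat_scheme"
    and E :: "('v3, 'e3, 'z3) cat_scheme"
  assumes F: "weak_functor C I s t e tO tA D I' s' t' e' tO' tA' fo fa k eps mu"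
    and G: "weak_functor D I' s' t' e' tO' tA' E I'' s'' t'' e'' tO'' tA'' fo' fa' k' eps' mu'"
    and ho: "\<And>x. x \<in> Obj C \<Longrightarrow> ho x = fo' (fo x)"
    and ha: "\<And>f. f \<in> Arrs C \<Longrightarrow> ha f = fa' (fa f)"
    and l: "\<And>i. i \<in> I \<Longrightarrow> l i = k' (k i)"
    and eta: "\<And>i. i \<in> I \<Longrightarrow> eta i = fa' (eps i) \<cdot>\<^bsub>E\<^esub> eps' (k i)"
    and nu: "\<And>x y. \<lbrakk>x \<in> Obj C; y \<in> Obj C; s y = t x\<rbrakk> \<Longrightarrow> nu y x = fa' (mu y x) \<cdot>\<^bsub>E\<^esub> mu' (fo y) (fo x)"
  shows "weak_functor C I s t e tO tA E I'' s'' t'' e'' tO'' tA'' ho ha l eta nu"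
proof -
  interpret F: weak_functor C I s t e tO tA D I' s' t' e' tO' tA' fo fa k eps mu by (rule F)
  interpret G: weak_functor D I' s' t' e' tO' tA' E I'' s'' t'' e'' tO'' tA'' fo' fa' k' eps' mu'
    by (rule G)
  interpret H: functor_pair C E ho ha
    by unfold_locales (simp add: is_functor_def ho ha Hom_def)
  note [simp] = F.C.ends F.D.ends G.D.ends F.fun_ends G.fun_ends
  show ?thesis
  proof unfold_locales
    fix f g assume fg: "f \<in> Arrs C" "g \<in> Arrs C" "s (src g) = t (src f)"
    have "nu (trg g) (trg f) \<cdot>\<^bsub>E\<^esub> tA'' (ha g) (ha f)
        = fa' (mu (trg g) (trg f)) \<cdot>\<^bsub>E\<^esub> (mu' (fo (trg g)) (fo (trg f)) \<cdot>\<^bsub>E\<^esub> tA'' (fa' (fa g)) (fa' (fa f)))"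
      using fg by (simp add: ha nu)
    also have "\<dots> = fa' (mu (trg g) (trg f)) \<cdot>\<^bsub>E\<^esub> fa' (tA' (fa g) (fa f)) \<cdot>\<^bsub>E\<^esub> mu' (fo (src g)) (fo (src f))"
      using fg G.mu_natural[of "fa f" "fa g"] by simp
    also have "\<dots> = fa' (mu (trg g) (trg f) \<cdot>\<^bsub>D\<^esub> tA' (fa g) (fa f)) \<cdot>\<^bsub>E\<^esub> mu' (fo (src g)) (fo (src f))"
      using fg by simp
    also have "\<dots> = ha (tA g f) \<cdot>\<^bsub>E\<^esub> nu (src g) (src f)"
      using fg by (simp add: F.mu_natural nu ha)
    finally show "nu (trg g) (trg f) \<cdot>\<^bsub>E\<^esub> tA'' (ha g) (ha f) = ha (tA g f) \<cdot>\<^bsub>E\<^esub> nu (src g) (src f)" .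
  next
    fix x y z assume xyz: "x \<in> Obj C" "y \<in> Obj C" "z \<in> Obj C" "s y = t x" "s z = t y"
    have "nu z (tO y x) \<cdot>\<^bsub>E\<^esub> tA'' (idt E (ho z)) (nu y x)
       = fa' (mu z (tO y x)) \<cdot>\<^bsub>E\<^esub> (mu' (fo z) (fo (tO y x)) \<cdot>\<^bsub>E\<^esub> tA'' (fa' (idt D (fo z))) (fa' (mu y x)))
           \<cdot>\<^bsub>E\<^esub> tA'' (idt E (fo' (fo z))) (mu' (fo y) (fo x))"
      using xyz by (simp add: ho nu G.D.merge)
    also have "\<dots> = fa' (mu z (tO y x)) \<cdot>\<^bsub>E\<^esub> (fa' (tA' (idt D (fo z)) (mu y x)) \<cdot>\<^bsub>E\<^esub> mu' (fo z) (tO' (fo y) (fo x)))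
           \<cdot>\<^bsub>E\<^esub> tA'' (idt E (fo' (fo z))) (mu' (fo y) (fo x))"
      using xyz G.mu_natural[of "mu y x" "idt D (fo z)"] by (simp del: G.fa_idt)
    also have "\<dots> = fa' (mu z (tO y x) \<cdot>\<^bsub>D\<^esub> tA' (idt D (fo z)) (mu y x)) \<cdot>\<^bsub>E\<^esub>
         (mu' (fo z) (tO' (fo y) (fo x)) \<cdot>\<^bsub>E\<^esub> tA'' (idt E (fo' (fo z))) (mu' (fo y) (fo x)))"
      using xyz by simp
    also have "\<dots> = fa' (mu (tO z y) x \<cdot>\<^bsub>D\<^esub> tA' (mu z y) (idt D (fo x))) \<cdot>\<^bsub>E\<^esub>
         (mu' (tO' (fo z) (fo y)) (fo x) \<cdot>\<^bsub>E\<^esub> tA'' (mu' (fo z) (fo y)) (idt E (fo' (fo x))))"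
      using xyz by (simp add: F.mu_assoc G.mu_assoc del: G.fa_vcmp)
    also have "\<dots> = fa' (mu (tO z y) x) \<cdot>\<^bsub>E\<^esub> (fa' (tA' (mu z y) (idt D (fo x))) \<cdot>\<^bsub>E\<^esub> mu' (tO' (fo z) (fo y)) (fo x))
          \<cdot>\<^bsub>E\<^esub> tA'' (mu' (fo z) (fo y)) (idt E (fo' (fo x)))"
      using xyz by simp
    also have "\<dots> = fa' (mu (tO z y) x) \<cdot>\<^bsub>E\<^esub> (mu' (fo (tO z y)) (fo x) \<cdot>\<^bsub>E\<^esub> tA'' (fa' (mu z y)) (fa' (idt D (fo x))))
          \<cdot>\<^bsub>E\<^esub> tA'' (mu' (fo z) (fo y)) (idt E (fo' (fo x)))"
      using xyz G.mu_natural[of "idt D (fo x)" "mu z y"] by (simp del: G.fa_idt)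
    also have "\<dots> = nu (tO z y) x \<cdot>\<^bsub>E\<^esub> tA'' (nu z y) (idt E (ho x))"
      using xyz by (simp add: ho nu G.D.merge)
    finally show "nu z (tO y x) \<cdot>\<^bsub>E\<^esub> tA'' (idt E (ho z)) (nu y x) = nu (tO z y) x \<cdot>\<^bsub>E\<^esub> tA'' (nu z y) (idt E (ho x))" .
  next
    fix x i assume xi: "x \<in> Obj C" "t x = i"
    have i: "i \<in> I" using xi by auto
    have "nu (e i) x \<cdot>\<^bsub>E\<^esub> tA'' (eta i) (idt E (ho x))
      = fa' (mu (e i) x) \<cdot>\<^bsub>E\<^esub> (mu' (fo (e i)) (fo x) \<cdot>\<^bsub>E\<^esub> tA'' (fa' (eps i)) (fa' (idt D (fo x)))) \<cdot>\<^bsub>E\<^esub> tA'' (eps' (k i)) (idt E (fo' (fo x)))"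
      using xi i by (simp add: nu eta ho G.D.merge)
    also have "\<dots> = fa' (mu (e i) x) \<cdot>\<^bsub>E\<^esub> (fa' (tA' (eps i) (idt D (fo x))) \<cdot>\<^bsub>E\<^esub> mu' (e' (k i)) (fo x)) \<cdot>\<^bsub>E\<^esub> tA'' (eps' (k i)) (idt E (fo' (fo x)))"
      using xi i G.mu_natural[of "idt D (fo x)" "eps i"] by (simp del: G.fa_idt)
    also have "\<dots> = fa' (mu (e i) x \<cdot>\<^bsub>D\<^esub> tA' (eps i) (idt D (fo x))) \<cdot>\<^bsub>E\<^esub> (mu' (e' (k i)) (fo x) \<cdot>\<^bsub>E\<^esub> tA'' (eps' (k i)) (idt E (fo' (fo x))))"
      using xi i by simp
    also have "\<dots> = idt E (ho x)" using xi i by (simp add: F.mu_unit_left G.mu_unit_left ho del: G.fa_vcmp)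
    finally show "nu (e i) x \<cdot>\<^bsub>E\<^esub> tA'' (eta i) (idt E (ho x)) = idt E (ho x)" .
  next
    fix x i assume xi: "x \<in> Obj C" "s x = i"
    have i: "i \<in> I" using xi by auto
    have "nu x (e i) \<cdot>\<^bsub>E\<^esub> tA'' (idt E (ho x)) (eta i)
      = fa' (mu x (e i)) \<cdot>\<^bsub>E\<^esub> (mu' (fo x) (fo (e i)) \<cdot>\<^bsub>E\<^esub> tA'' (fa' (idt D (fo x))) (fa' (eps i))) \<cdot>\<^bsub>E\<^esub> tA'' (idt E (fo' (fo x))) (eps' (k i))"
      using xi i by (simp add: nu eta ho G.D.merge)
    also have "\<dots> = fa' (mu x (e i)) \<cdot>\<^bsub>E\<^esub> (fa' (tA' (idt D (fo x)) (eps i)) \<cdot>\<^bsub>E\<^esub> mu' (fo x) (e' (k i))) \<cdot>\<^bsub>E\<^esub> tA'' (idt E (fo' (fo x))) (eps' (k i))"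
      using xi i G.mu_natural[of "eps i" "idt D (fo x)"] by (simp del: G.fa_idt)
    also have "\<dots> = fa' (mu x (e i) \<cdot>\<^bsub>D\<^esub> tA' (idt D (fo x)) (eps i)) \<cdot>\<^bsub>E\<^esub> (mu' (fo x) (e' (k i)) \<cdot>\<^bsub>E\<^esub> tA'' (idt E (fo' (fo x))) (eps' (k i)))"
      using xi i by simp
    also have "\<dots> = idt E (ho x)" using xi i by (simp add: F.mu_unit_right G.mu_unit_right ho del: G.fa_vcmp)
    finally show "nu x (e i) \<cdot>\<^bsub>E\<^esub> tA'' (idt E (ho x)) (eta i) = idt E (ho x)" .
  qed (simp_all add: ho ha l eta nu)
qed

locale weak_transformation =
  F: weak_functor C I s t e tO tA D J s' t' e' tO' tA' fo fa k eps mu +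
  G: weak_functor C I s t e tO tA D J s' t' e' tO' tA' go ga k delta nu
  for C :: "('v, 'e, 'z) cat_scheme" and I :: "'i set" and s t e
    and tO :: "'v \<Rightarrow> 'v \<Rightarrow> 'v" (infixl "\<odot>" 70)
    and tA :: "('v, 'e) arr \<Rightarrow> ('v, 'e) arr \<Rightarrow> ('v, 'e) arr" (infixl "\<diamondop>" 70)
    and D :: "('w, 'f, 'y) cat_scheme" and J :: "'j set" and s' t' e'
    and tO' :: "'w \<Rightarrow> 'w \<Rightarrow> 'w" (infixl "\<odot>''" 70)
    and tA' :: "('w, 'f) arr \<Rightarrow> ('w, 'f) arr \<Rightarrow> ('w, 'f) arr" (infixl "\<diamondop>''" 70)
    and fo fa k eps mu go ga delta nu +
  fixes \<eta> :: "'v \<Rightarrow> ('w, 'f) arr"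
  assumes comp_Arrs [simp]: "x \<in> Obj C \<Longrightarrow> \<eta> x \<in> Arrs D"
    and comp_src [simp]: "x \<in> Obj C \<Longrightarrow> src (\<eta> x) = fo x"
    and comp_trg [simp]: "x \<in> Obj C \<Longrightarrow> trg (\<eta> x) = go x"
    and nat: "f \<in> Arrs C \<Longrightarrow> \<eta> (trg f) \<cdot>\<^bsub>D\<^esub> fa f = ga f \<cdot>\<^bsub>D\<^esub> \<eta> (src f)"
    and resp_eps: "i \<in> I \<Longrightarrow> \<eta> (e i) \<cdot>\<^bsub>D\<^esub> eps i = delta i"
    and resp_mu: "\<lbrakk>x \<in> Obj C; y \<in> Obj C; s y = t x\<rbrakk>
       \<Longrightarrow> \<eta> (y \<odot> x) \<cdot>\<^bsub>D\<^esub> mu y x = nu y x \<cdot>\<^bsub>D\<^esub> (\<eta> y \<diamondop>' \<eta> x)"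

lemma (in weak_functor) identity_transformation:
  assumes "\<And>x. x \<in> Obj C \<Longrightarrow> \<eta> x = idt D (fo x)"
  shows "weak_transformation C I s t e tO tA D J s' t' e' tO' tA' fo fa k eps mu fo fa eps mu \<eta>"
  using fun_ends C.ends D.ends by unfold_locales (simp_all add: assms)

lemma weak_transformation_vcmp:
  assumes T: "weak_transformation C I s t e tO tA D J s' t' e' tO' tA' fo fa k eps mu go ga delta nu \<eta>"
    and S: "weak_transformation C I s t e tO tA D J s' t' e' tO' tA' go ga k delta nu ho ha gam xi \<zeta>"
    and \<theta>: "\<And>x. x \<in> Obj C \<Longrightarrow> \<theta> x = \<zeta> x \<cdot>\<^bsub>D\<^esub> \<eta> x"
  shows "weak_transformation C I s t e tO tA D J s' t' e' tO' tA' fo fa k eps mu ho ha gam xi \<theta>"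
proof -
  interpret T: weak_transformation C I s t e tO tA D J s' t' e' tO' tA' fo fa k eps mu go ga delta nu \<eta>
    by (rule T)
  interpret S: weak_transformation C I s t e tO tA D J s' t' e' tO' tA' go ga k delta nu ho ha gam xi \<zeta>
    by (rule S)
  note [simp] = T.F.C.ends T.F.D.ends T.F.fun_ends T.G.fun_ends S.G.fun_ends
  show ?thesis
  proof unfold_locales
    fix f assume f: "f \<in> Arrs C"
    show "\<theta> (trg f) \<cdot>\<^bsub>D\<^esub> fa f = ha f \<cdot>\<^bsub>D\<^esub> \<theta> (src f)"
      using f by (simp add: \<theta> T.nat S.nat[THEN T.F.D.reassoc])
  next
    fix x y assume "x \<in> Obj C" "y \<in> Obj C" "s y = t x"
    then show "\<theta> (tO y x) \<cdot>\<^bsub>D\<^esub> mu y x = xi y x \<cdot>\<^bsub>D\<^esub> tA' (\<theta> y) (\<theta> x)"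
      by (simp add: \<theta> T.resp_mu S.resp_mu[THEN T.F.D.reassoc] T.F.D.merge)
  qed (simp_all add: \<theta> T.resp_eps S.resp_eps)
qed

text \<open>
  Naturality of \<open>\<zeta>\<close> at the coherence cells of the target of \<open>\<eta>\<close> lets these cells pass \<open>\<zeta>\<close>.
\<close>

lemma weak_transformation_hcmp:
  fixes C :: "('v, 'e, 'z) cat_scheme" and D :: "('v2, 'e2, 'z2) cat_scheme"
    and E :: "('v3, 'e3, 'z3) cat_scheme"
  assumes T: "weak_transformation C I s t e tO tA D I' s' t' e' tO' tA' fo fa k eps mu go ga delta nu \<eta>"
    and S: "weak_transformation D I' s' t' e' tO' tA' E I'' s'' t'' e'' tO'' tA'' fo' fa' k' eps' mu' go' ga' delta' nu' \<zeta>"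
    and F: "weak_functor C I s t e tO tA E I'' s'' t'' e'' tO'' tA'' ho ha l alp xi"
    and G: "weak_functor C I s t e tO tA E I'' s'' t'' e'' tO'' tA'' jo ja l bet om"
    and ho: "\<And>x. x \<in> Obj C \<Longrightarrow> ho x = fo' (fo x)" "\<And>x. x \<in> Obj C \<Longrightarrow> jo x = go' (go x)"
    and ha: "\<And>f. f \<in> Arrs C \<Longrightarrow> ha f = fa' (fa f)" "\<And>f. f \<in> Arrs C \<Longrightarrow> ja f = ga' (ga f)"
    and alp: "\<And>i. i \<in> I \<Longrightarrow> alp i = fa' (eps i) \<cdot>\<^bsub>E\<^esub> eps' (k i)" "\<And>i. i \<in> I \<Longrightarrow> bet i = ga' (delta i) \<cdot>\<^bsub>E\<^esub> delta' (k i)"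
    and xi: "\<And>x y. \<lbrakk>x \<in> Obj C; y \<in> Obj C; s y = t x\<rbrakk> \<Longrightarrow> xi y x = fa' (mu y x) \<cdot>\<^bsub>E\<^esub> mu' (fo y) (fo x)"
      "\<And>x y. \<lbrakk>x \<in> Obj C; y \<in> Obj C; s y = t x\<rbrakk> \<Longrightarrow> om y x = ga' (nu y x) \<cdot>\<^bsub>E\<^esub> nu' (go y) (go x)"
    and \<theta>: "\<And>x. x \<in> Obj C \<Longrightarrow> \<theta> x = \<zeta> (go x) \<cdot>\<^bsub>E\<^esub> fa' (\<eta> x)"
  shows "weak_transformation C I s t e tO tA E I'' s'' t'' e'' tO'' tA'' ho ha l alp xi jo ja bet om \<theta>"
proof -
  interpret T: weak_transformation C I s t e tO tA D I' s' t' e' tO' tA' fo fa k eps mu go ga delta nu \<eta>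
    by (rule T)
  interpret S: weak_transformation D I' s' t' e' tO' tA' E I'' s'' t'' e'' tO'' tA'' fo' fa' k' eps' mu' go' ga' delta' nu' \<zeta>
    by (rule S)
  interpret F: weak_functor C I s t e tO tA E I'' s'' t'' e'' tO'' tA'' ho ha l alp xi by (rule F)
  interpret G: weak_functor C I s t e tO tA E I'' s'' t'' e'' tO'' tA'' jo ja l bet om by (rule G)
  note r = S.F.D.reassoc
  note [simp] = T.F.C.ends T.F.D.ends S.F.D.ends T.F.fun_ends S.F.fun_ends T.G.fun_ends S.G.fun_ends
  show ?thesis
  proof unfold_locales
    fix f assume f: "f \<in> Arrs C"
    have "\<theta> (trg f) \<cdot>\<^bsub>E\<^esub> ha f = \<zeta> (go (trg f)) \<cdot>\<^bsub>E\<^esub> fa' (\<eta> (trg f) \<cdot>\<^bsub>D\<^esub> fa f)"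
      using f by (simp add: \<theta> ha)
    also have "\<dots> = \<zeta> (go (trg f)) \<cdot>\<^bsub>E\<^esub> fa' (ga f) \<cdot>\<^bsub>E\<^esub> fa' (\<eta> (src f))"
      using f by (simp add: T.nat)
    also have "\<dots> = ja f \<cdot>\<^bsub>E\<^esub> \<theta> (src f)"
      using f S.nat[of "ga f"] S.nat[of "ga f", THEN r] by (simp add: \<theta> ha)
    finally show "\<theta> (trg f) \<cdot>\<^bsub>E\<^esub> ha f = ja f \<cdot>\<^bsub>E\<^esub> \<theta> (src f)" .
  next
    fix i assume i: "i \<in> I"
    have "\<theta> (e i) \<cdot>\<^bsub>E\<^esub> alp i = \<zeta> (go (e i)) \<cdot>\<^bsub>E\<^esub> fa' (\<eta> (e i) \<cdot>\<^bsub>D\<^esub> eps i) \<cdot>\<^bsub>E\<^esub> eps' (k i)"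
      using i by (simp add: \<theta> alp)
    also have "\<dots> = \<zeta> (go (e i)) \<cdot>\<^bsub>E\<^esub> fa' (delta i) \<cdot>\<^bsub>E\<^esub> eps' (k i)"
      using i by (simp only: T.resp_eps)
    also have "\<dots> = bet i"
      using i S.nat[of "delta i", THEN r] by (simp add: S.resp_eps alp)
    finally show "\<theta> (e i) \<cdot>\<^bsub>E\<^esub> alp i = bet i" .
  next
    fix x y assume xy: "x \<in> Obj C" "y \<in> Obj C" "s y = t x"
    have "\<theta> (tO y x) \<cdot>\<^bsub>E\<^esub> xi y x
        = \<zeta> (go (tO y x)) \<cdot>\<^bsub>E\<^esub> fa' (\<eta> (tO y x) \<cdot>\<^bsub>D\<^esub> mu y x) \<cdot>\<^bsub>E\<^esub> mu' (fo y) (fo x)"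
      using xy by (simp add: \<theta> xi)
    also have "\<dots> = \<zeta> (go (tO y x)) \<cdot>\<^bsub>E\<^esub> (fa' (nu y x) \<cdot>\<^bsub>E\<^esub> (fa' (tA' (\<eta> y) (\<eta> x)) \<cdot>\<^bsub>E\<^esub> mu' (fo y) (fo x)))"
      using xy by (simp add: T.resp_mu)
    also have "\<dots> = ga' (nu y x) \<cdot>\<^bsub>E\<^esub> (\<zeta> (tO' (go y) (go x)) \<cdot>\<^bsub>E\<^esub> (fa' (tA' (\<eta> y) (\<eta> x)) \<cdot>\<^bsub>E\<^esub> mu' (fo y) (fo x)))"
      using xy S.nat[of "nu y x", THEN r] by simp
    also have "\<dots> = ga' (nu y x) \<cdot>\<^bsub>E\<^esub> (\<zeta> (tO' (go y) (go x)) \<cdot>\<^bsub>E\<^esub> (mu' (go y) (go x) \<cdot>\<^bsub>E\<^esub> tA'' (fa' (\<eta> y)) (fa' (\<eta> x))))"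
      using xy S.F.mu_natural[of "\<eta> x" "\<eta> y"] by simp
    also have "\<dots> = om y x \<cdot>\<^bsub>E\<^esub> tA'' (\<theta> y) (\<theta> x)"
      using xy by (simp add: S.resp_mu[THEN r] \<theta> xi S.F.D.merge)
    finally show "\<theta> (tO y x) \<cdot>\<^bsub>E\<^esub> xi y x = om y x \<cdot>\<^bsub>E\<^esub> tA'' (\<theta> y) (\<theta> x)" .
  qed (simp_all add: \<theta> ho)
qed


section \<open>2-categories of structured categories\<close>

text \<open>
  The common shape of \<open>ThreeCat_st_lax\<close> and \<open>GCrsBrd_st\<close>: the 0-cells are categories with further
  structure, a 1-cell is a functor together with coherence data, packed in \<open>'b\<close>, and a 2-cell is
  a natural family of arrows. That they are 2-categories can be proved once for both.
\<close>

definition structured_two_cat ::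
    "('v, 'e, 'z) cat_scheme set \<Rightarrow>
     (('v, 'e, 'z) cat_scheme \<Rightarrow> ('v, 'e, 'z) cat_scheme \<Rightarrow> 'b \<Rightarrow> bool) \<Rightarrow>
     (('v, 'e, 'z) cat_scheme \<Rightarrow> ('v, 'e, 'z) cat_scheme \<Rightarrow> 'b \<Rightarrow> 'b \<Rightarrow> ('v \<Rightarrow> ('v, 'e) arr) \<Rightarrow> bool) \<Rightarrow>
     ('b \<Rightarrow> 'v \<Rightarrow> 'v) \<Rightarrow> ('b \<Rightarrow> ('v, 'e) arr \<Rightarrow> ('v, 'e) arr) \<Rightarrow>
     (('v, 'e, 'z) cat_scheme \<Rightarrow> 'b) \<Rightarrow>
     (('v, 'e, 'z) cat_scheme \<Rightarrow> ('v, 'e, 'z) cat_scheme \<Rightarrow> 'b \<Rightarrow> 'b \<Rightarrow> 'b) \<Rightarrow>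
     (('v, 'e, 'z) cat_scheme, 'b, 'v \<Rightarrow> ('v, 'e) arr) two_cat" where
  "structured_two_cat Ob Fun Trf fo fa idf compf =
     \<lparr> Obj = {Arr C D A | C D A. C \<in> Ob \<and> D \<in> Ob \<and> Fun C D A},
       Arrs = {Arr (Arr C D A) (Arr C D B) \<eta> | C D A B \<eta>. C \<in> Ob \<and> D \<in> Ob \<and> Trf C D A B \<eta>},
       idt = (\<lambda>X. Arr X X (\<lambda>x \<in> Obj (src X). idt (trg X) (fo (lab X) x))),
       vcmp = (\<lambda>\<zeta> \<eta>. Arr (src \<eta>) (trg \<zeta>)
                (\<lambda>x \<in> Obj (src (src \<eta>)). lab \<zeta> x \<cdot>\<^bsub>trg (src \<eta>)\<^esub> lab \<eta> x)),
       Obj0 = Ob,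
       id1 = (\<lambda>C. Arr C C (idf C)),
       cmp1 = (\<lambda>Y X. Arr (src X) (trg Y) (compf (src X) (trg Y) (lab Y) (lab X))),
       hcmp = (\<lambda>\<zeta> \<eta>. let C = src (src \<eta>); E = trg (src \<zeta>) in
                Arr (Arr C E (compf C E (lab (src \<zeta>)) (lab (src \<eta>))))
                    (Arr C E (compf C E (lab (trg \<zeta>)) (lab (trg \<eta>))))
                    (\<lambda>x \<in> Obj C. lab \<zeta> (fo (lab (trg \<eta>)) x)
                                   \<cdot>\<^bsub>E\<^esub> fa (lab (src \<zeta>)) (lab \<eta> x))) \<rparr>"

text \<open>
  \<open>fo\<close> and \<open>fa\<close> extract the underlying functor from a 1-cell. About the additional structure one
  only has to know that the operations preserve it and that composition of 1-cells is strict; all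
  laws for 2-cells hold componentwise in the target categories.
\<close>

locale structured_categories =
  fixes Ob :: "('v, 'e, 'z) cat_scheme set"
    and Fun :: "('v, 'e, 'z) cat_scheme \<Rightarrow> ('v, 'e, 'z) cat_scheme \<Rightarrow> 'b \<Rightarrow> bool"
    and Trf :: "('v, 'e, 'z) cat_scheme \<Rightarrow> ('v, 'e, 'z) cat_scheme \<Rightarrow> 'b \<Rightarrow> 'b \<Rightarrow> ('v \<Rightarrow> ('v, 'e) arr) \<Rightarrow> bool"
    and fo :: "'b \<Rightarrow> 'v \<Rightarrow> 'v" and fa :: "'b \<Rightarrow> ('v, 'e) arr \<Rightarrow> ('v, 'e) arr"
    and idf :: "('v, 'e, 'z) cat_scheme \<Rightarrow> 'b"
    and compf :: "('v, 'e, 'z) cat_scheme \<Rightarrow> ('v, 'e, 'z) cat_scheme \<Rightarrow> 'b \<Rightarrow> 'b \<Rightarrow> 'b"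
  assumes category: "C \<in> Ob \<Longrightarrow> category C"
    and Fun_functor: "\<lbrakk>C \<in> Ob; D \<in> Ob; Fun C D A\<rbrakk> \<Longrightarrow> is_functor C D (fo A) (fa A)"
    and Fun_id: "C \<in> Ob \<Longrightarrow> Fun C C (idf C)"
    and fo_id: "\<lbrakk>C \<in> Ob; x \<in> Obj C\<rbrakk> \<Longrightarrow> fo (idf C) x = x"
    and fa_id: "\<lbrakk>C \<in> Ob; f \<in> Arrs C\<rbrakk> \<Longrightarrow> fa (idf C) f = f"
    and Fun_comp: "\<lbrakk>C \<in> Ob; D \<in> Ob; E \<in> Ob; Fun C D A; Fun D E B\<rbrakk> \<Longrightarrow> Fun C E (compf C E B A)"
    and fo_comp: "\<lbrakk>C \<in> Ob; E \<in> Ob; x \<in> Obj C\<rbrakk> \<Longrightarrow> fo (compf C E B A) x = fo B (fo A x)"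
    and fa_comp: "\<lbrakk>C \<in> Ob; E \<in> Ob; f \<in> Arrs C\<rbrakk> \<Longrightarrow> fa (compf C E B A) f = fa B (fa A f)"
    and comp_id_left: "\<lbrakk>C \<in> Ob; D \<in> Ob; Fun C D A\<rbrakk> \<Longrightarrow> compf C D (idf D) A = A"
    and comp_id_right: "\<lbrakk>C \<in> Ob; D \<in> Ob; Fun C D A\<rbrakk> \<Longrightarrow> compf C D A (idf C) = A"
    and comp_assoc: "\<lbrakk>C \<in> Ob; D \<in> Ob; E \<in> Ob; E' \<in> Ob; Fun C D A; Fun D E B; Fun E E' K\<rbrakk>
          \<Longrightarrow> compf C E' (compf D E' K B) A = compf C E' K (compf C E B A)"
    and Trf_Fun: "\<lbrakk>C \<in> Ob; D \<in> Ob; Trf C D A B \<eta>\<rbrakk> \<Longrightarrow> Fun C D A \<and> Fun C D B"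
    and Trf_ext: "\<lbrakk>C \<in> Ob; D \<in> Ob; Trf C D A B \<eta>\<rbrakk> \<Longrightarrow> \<eta> \<in> extensional (Obj C)"
    and Trf_component: "\<lbrakk>C \<in> Ob; D \<in> Ob; Trf C D A B \<eta>; x \<in> Obj C\<rbrakk> \<Longrightarrow> \<eta> x \<in> Hom D (fo A x) (fo B x)"
    and Trf_natural: "\<lbrakk>C \<in> Ob; D \<in> Ob; Trf C D A B \<eta>; f \<in> Arrs C\<rbrakk>
          \<Longrightarrow> \<eta> (trg f) \<cdot>\<^bsub>D\<^esub> fa A f = fa B f \<cdot>\<^bsub>D\<^esub> \<eta> (src f)"
    and Trf_id: "\<lbrakk>C \<in> Ob; D \<in> Ob; Fun C D A\<rbrakk> \<Longrightarrow> Trf C D A A (\<lambda>x \<in> Obj C. idt D (fo A x))"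
    and Trf_vcmp: "\<lbrakk>C \<in> Ob; D \<in> Ob; Trf C D A B \<eta>; Trf C D B K \<zeta>\<rbrakk>
          \<Longrightarrow> Trf C D A K (\<lambda>x \<in> Obj C. \<zeta> x \<cdot>\<^bsub>D\<^esub> \<eta> x)"
    and Trf_hcmp: "\<lbrakk>C \<in> Ob; D \<in> Ob; E \<in> Ob; Trf C D A B \<eta>; Trf D E A' B' \<zeta>\<rbrakk>
          \<Longrightarrow> Trf C E (compf C E A' A) (compf C E B' B)
                (\<lambda>x \<in> Obj C. \<zeta> (fo B x) \<cdot>\<^bsub>E\<^esub> fa A' (\<eta> x))"
begin

abbreviation "TC \<equiv> structured_two_cat Ob Fun Trf fo fa idf compf"

lemma ext_eqI: "\<lbrakk>\<eta> \<in> extensional S; \<And>x. x \<in> S \<Longrightarrow> \<eta> x = \<zeta> x\<rbrakk> \<Longrightarrow> (\<lambda>x \<in> S. \<zeta> x) = \<eta>"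
  by (auto simp: fun_eq_iff extensional_def)

lemma two_category_TC: "two_category TC"
proof -
  note def = structured_two_cat_def Hom_def Hom1_def composable1_def composable2_def Let_def
  have pair: "functor_pair C D (fo A) (fa A)" if "C \<in> Ob" "D \<in> Ob" "Fun C D A" for C D A
    using that Fun_functor category
    by (simp add: functor_pair_def functor_pair_axioms_def)
  have comp: "\<eta> x \<in> Arrs D" "src (\<eta> x) = fo A x" "trg (\<eta> x) = fo B x"
    if "C \<in> Ob" "D \<in> Ob" "Trf C D A B \<eta>" "x \<in> Obj C" for C D A B \<eta> x
    using Trf_component[OF that] by (auto simp: Hom_def)
  show ?thesis
  proof unfold_locales
    fix f a b assume *: "f \<in> Hom TC a b"
    then obtain C D A B \<eta> where f: "f = Arr (Arr C D A) (Arr C D B) \<eta>" "C \<in> Ob" "D \<in> Ob" "Trf C D A B \<eta>"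
      by (auto simp: def)
    interpret D: category D using f category by auto
    have ab: "a = Arr C D A" "b = Arr C D B" using * f by (auto simp: Hom_def)
    show "idt TC b \<cdot>\<^bsub>TC\<^esub> f = f" "f \<cdot>\<^bsub>TC\<^esub> idt TC a = f"
      using f comp[OF f(2-4)] Trf_ext[OF f(2-4)] by (auto simp: def ab intro!: ext_eqI)
  next
    fix f g h a b c d assume "f \<in> Hom TC a b" "g \<in> Hom TC b c" "h \<in> Hom TC c d"
    then obtain C D A B \<eta> B' \<zeta> B'' \<theta> where f: "f = Arr (Arr C D A) (Arr C D B) \<eta>" "C \<in> Ob" "D \<in> Ob" "Trf C D A B \<eta>"
      and g: "g = Arr (Arr C D B) (Arr C D B') \<zeta>" "Trf C D B B' \<zeta>"
      and h: "h = Arr (Arr C D B') (Arr C D B'') \<theta>" "Trf C D B' B'' \<theta>"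
      by (auto simp: def)
    interpret D: category D using f category by auto
    show "h \<cdot>\<^bsub>TC\<^esub> g \<cdot>\<^bsub>TC\<^esub> f = h \<cdot>\<^bsub>TC\<^esub> (g \<cdot>\<^bsub>TC\<^esub> f)"
      using comp[OF f(2-4)] comp[OF f(2,3) g(2)] comp[OF f(2,3) h(2)]
      by (auto simp: def f(1) g(1) h(1) fun_eq_iff)
  next
    fix \<beta> \<alpha> assume "composable2 TC \<beta> \<alpha>"
    then show "hcmp TC \<beta> \<alpha> \<in> Hom TC (cmp1 TC (src \<beta>) (src \<alpha>)) (cmp1 TC (trg \<beta>) (trg \<alpha>))"
      by (auto simp: def intro: Trf_hcmp)
  next
    fix y x assume "composable1 TC y x"
    then obtain C D A E B where x: "x = Arr C D A" "y = Arr D E B" "C \<in> Ob" "D \<in> Ob" "E \<in> Ob" "Fun C D A" "Fun D E B"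
      by (auto simp: def)
    interpret A: functor_pair C D "fo A" "fa A" using pair x by auto
    interpret B: functor_pair D E "fo B" "fa B" using pair x by auto
    show "hcmp TC (idt TC y) (idt TC x) = idt TC (cmp1 TC y x)"
      using x by (auto simp: def fun_eq_iff fo_comp)
  next
    fix \<alpha> x x' \<alpha>' x'' \<beta> y y' \<beta>' y''
    assume "\<alpha> \<in> Hom TC x x'" "\<alpha>' \<in> Hom TC x' x''" "\<beta> \<in> Hom TC y y'" "\<beta>' \<in> Hom TC y' y''" "src y = trg x"
    then obtain C D A B B' \<eta> \<eta>' E A1 B1 B1' \<zeta> \<zeta>' where
      a: "\<alpha> = Arr (Arr C D A) (Arr C D B) \<eta>" "\<alpha>' = Arr (Arr C D B) (Arr C D B') \<eta>'"
       "\<beta> = Arr (Arr D E A1) (Arr D E B1) \<zeta>" "\<beta>' = Arr (Arr D E B1) (Arr D E B1') \<zeta>'"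
      and ob: "C \<in> Ob" "D \<in> Ob" "E \<in> Ob"
      and n: "Trf C D A B \<eta>" "Trf C D B B' \<eta>'" "Trf D E A1 B1 \<zeta>" "Trf D E B1 B1' \<zeta>'"
      by (auto simp: def)
    have fn: "Fun C D A" "Fun C D B" "Fun C D B'" "Fun D E A1" "Fun D E B1" "Fun D E B1'"
      using Trf_Fun n ob by blast+
    interpret A: functor_pair C D "fo A" "fa A" using pair ob fn by auto
    interpret B: functor_pair C D "fo B" "fa B" using pair ob fn by auto
    interpret B': functor_pair C D "fo B'" "fa B'" using pair ob fn by auto
    interpret A1: functor_pair D E "fo A1" "fa A1" using pair ob fn by auto
    interpret B1: functor_pair D E "fo B1" "fa B1" using pair ob fn by auto
    interpret B1': functor_pair D E "fo B1'" "fa B1'" using pair ob fn by auto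
    (* The interchange law at each component is naturality of \<zeta> at the component of \<eta>'. *)
    have "\<zeta>' (fo B' z) \<cdot>\<^bsub>E\<^esub> \<zeta> (fo B' z) \<cdot>\<^bsub>E\<^esub> fa A1 (\<eta>' z \<cdot>\<^bsub>D\<^esub> \<eta> z)
        = (\<zeta>' (fo B' z) \<cdot>\<^bsub>E\<^esub> fa B1 (\<eta>' z)) \<cdot>\<^bsub>E\<^esub> (\<zeta> (fo B z) \<cdot>\<^bsub>E\<^esub> fa A1 (\<eta> z))" if z: "z \<in> Obj C" for z
      using z Trf_natural[OF ob(2,3) n(3), of "\<eta>' z", THEN A1.D.reassoc]
        comp[OF ob(1,2) n(1) z] comp[OF ob(1,2) n(2) z] comp[OF ob(2,3) n(3)] comp[OF ob(2,3) n(4)]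
      by simp
    then show "hcmp TC (\<beta>' \<cdot>\<^bsub>TC\<^esub> \<beta>) (\<alpha>' \<cdot>\<^bsub>TC\<^esub> \<alpha>) = hcmp TC \<beta>' \<alpha>' \<cdot>\<^bsub>TC\<^esub> hcmp TC \<beta> \<alpha>"
      by (auto simp: def a fun_eq_iff fo_comp)
  next
    fix \<alpha> assume "\<alpha> \<in> Arrs TC"
    then obtain C D A B \<eta> where f: "\<alpha> = Arr (Arr C D A) (Arr C D B) \<eta>" "C \<in> Ob" "D \<in> Ob" "Trf C D A B \<eta>"
      by (auto simp: def)
    have fn: "Fun C D A" "Fun C D B" using Trf_Fun f by blast+
    interpret A: functor_pair C D "fo A" "fa A" using pair f fn by auto
    interpret B: functor_pair C D "fo B" "fa B" using pair f fn by auto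
    show "hcmp TC (idt TC (id1 TC (trg (src \<alpha>)))) \<alpha> = \<alpha>" "hcmp TC \<alpha> (idt TC (id1 TC (src (src \<alpha>)))) = \<alpha>"
      using f(2,3) fn comp[OF f(2-4)] Trf_ext[OF f(2-4)]
      by (auto simp: def f(1) comp_id_left comp_id_right fa_id fo_id intro!: ext_eqI)
  next
    fix \<alpha> \<beta> \<gamma> assume "composable2 TC \<beta> \<alpha>" "composable2 TC \<gamma> \<beta>"
    then obtain C D A B \<eta> E A1 B1 \<zeta> E' A2 B2 \<theta> where
      a: "\<alpha> = Arr (Arr C D A) (Arr C D B) \<eta>"
       "\<beta> = Arr (Arr D E A1) (Arr D E B1) \<zeta>" "\<gamma> = Arr (Arr E E' A2) (Arr E E' B2) \<theta>"
      and ob: "C \<in> Ob" "D \<in> Ob" "E \<in> Ob" "E' \<in> Ob"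
      and n: "Trf C D A B \<eta>" "Trf D E A1 B1 \<zeta>" "Trf E E' A2 B2 \<theta>"
      by (auto simp: def)
    have fn: "Fun C D A" "Fun C D B" "Fun D E A1" "Fun D E B1" "Fun E E' A2" "Fun E E' B2"
      using Trf_Fun n ob by blast+
    interpret A: functor_pair C D "fo A" "fa A" using pair ob fn by auto
    interpret B: functor_pair C D "fo B" "fa B" using pair ob fn by auto
    interpret A1: functor_pair D E "fo A1" "fa A1" using pair ob fn by auto
    interpret B1: functor_pair D E "fo B1" "fa B1" using pair ob fn by auto
    interpret A2: functor_pair E E' "fo A2" "fa A2" using pair ob fn by auto
    interpret B2: functor_pair E E' "fo B2" "fa B2" using pair ob fn by auto
    show "hcmp TC (hcmp TC \<gamma> \<beta>) \<alpha> = hcmp TC \<gamma> (hcmp TC \<beta> \<alpha>)"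
      using ob fn comp[OF ob(1,2) n(1)] comp[OF ob(2,3) n(2)] comp[OF ob(3,4) n(3)]
      by (auto simp: def a fun_eq_iff fo_comp fa_comp comp_assoc)
  next
    fix x y z a b c d assume "x \<in> Hom1 TC a b" "y \<in> Hom1 TC b c" "z \<in> Hom1 TC c d"
    then show "cmp1 TC (cmp1 TC z y) x = cmp1 TC z (cmp1 TC y x)"
      by (auto simp: def comp_assoc)
  next
    fix x y a b c assume "x \<in> Hom1 TC a b" "y \<in> Hom1 TC b c"
    then show "cmp1 TC y x \<in> Hom1 TC a c"
      by (auto simp: def intro: Fun_comp)
  qed (auto simp: def Trf_Fun Trf_id Trf_vcmp Fun_id Fun_comp comp_id_left comp_id_right)
qed

end


section \<open>Gray-monoids with a group of 0-cells\<close>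

sublocale two_category \<subseteq> H: strict_composition C "Obj0 C" src trg "id1 C" "cmp1 C" "hcmp C"
proof unfold_locales
  fix f i assume f: "f \<in> Arrs C"
  { assume "trg (src f) = i" then show "hcmp C (idt C (id1 C i)) f = f" using f hcmp_id_left by auto }
  { assume "src (src f) = i" then show "hcmp C f (idt C (id1 C i)) = f" using f hcmp_id_right by auto }
  show "src (trg f) = src (src f)" "trg (trg f) = trg (src f)" using f parallel by auto
next
  fix f g assume "f \<in> Arrs C" "g \<in> Arrs C" "src (src g) = trg (src f)"
  then have "hcmp C g f \<in> Hom C (cmp1 C (src g) (src f)) (cmp1 C (trg g) (trg f))"
    by (intro hcmp_closed) (auto simp: composable2_def)
  then show "hcmp C g f \<in> Arrs C" "src (hcmp C g f) = cmp1 C (src g) (src f)"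
    "trg (hcmp C g f) = cmp1 C (trg g) (trg f)" by (auto simp: Hom_def)
next
  fix x y assume *: "x \<in> Obj C" "y \<in> Obj C" "src y = trg x"
  then have "cmp1 C y x \<in> Hom1 C (src x) (trg y)"
    by (intro cmp1_closed) (auto simp: Hom1_def)
  then show "cmp1 C y x \<in> Obj C" "src (cmp1 C y x) = src x" "trg (cmp1 C y x) = trg y"
    by (auto simp: Hom1_def)
  show "hcmp C (idt C y) (idt C x) = idt C (cmp1 C y x)"
    using * by (intro hcmp_idt) (auto simp: composable1_def)
next
  fix x y z assume *: "x \<in> Obj C" "y \<in> Obj C" "z \<in> Obj C" "src y = trg x" "src z = trg y"
  then show "cmp1 C (cmp1 C z y) x = cmp1 C z (cmp1 C y x)"
    by (intro cmp1_assoc) (auto simp: Hom1_def)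
next
  fix x i assume x: "x \<in> Obj C"
  { assume "trg x = i" then show "cmp1 C (id1 C i) x = x" using x by (intro cmp1_id_left) (auto simp: Hom1_def) }
  { assume "src x = i" then show "cmp1 C x (id1 C i) = x" using x by (intro cmp1_id_right) (auto simp: Hom1_def) }
next
  fix i assume "i \<in> Obj0 C"
  then show "id1 C i \<in> Obj C" "src (id1 C i) = i" "trg (id1 C i) = i"
    using id1_closed by (auto simp: Hom1_def)
next
  fix f g f' g' assume "f \<in> Arrs C" "g \<in> Arrs C" "f' \<in> Arrs C" "g' \<in> Arrs C" "src f' = trg f"
    "src g' = trg g" "src (src g) = trg (src f)"
  then show "hcmp C (g' \<cdot> g) (f' \<cdot> f) = hcmp C g' f' \<cdot> hcmp C g f"
    by (intro interchange) (auto simp: Hom_def)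
next
  fix f g h assume "f \<in> Arrs C" "g \<in> Arrs C" "h \<in> Arrs C" "src (src g) = trg (src f)" "src (src h) = trg (src g)"
  then show "hcmp C (hcmp C h g) f = hcmp C h (hcmp C g f)"
    by (intro hcmp_assoc) (auto simp: composable2_def)
qed (auto simp: src1_closed trg1_closed)

declare (in two_category) H.ends [simp]

context gray_monoid
begin

lemma lten_simps [simp]:
  assumes "a \<in> Obj0 C"
  shows "x \<in> Obj C \<Longrightarrow> a \<triangleright> x \<in> Obj C" "x \<in> Obj C \<Longrightarrow> src (a \<triangleright> x) = a \<otimes>\<^sub>0 src x"
    "x \<in> Obj C \<Longrightarrow> trg (a \<triangleright> x) = a \<otimes>\<^sub>0 trg x"
    "b \<in> Obj0 C \<Longrightarrow> a \<triangleright> id1 C b = id1 C (a \<otimes>\<^sub>0 b)"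
    "\<lbrakk>x \<in> Obj C; y \<in> Obj C; src y = trg x\<rbrakk> \<Longrightarrow> a \<triangleright> (y \<bullet> x) = (a \<triangleright> y) \<bullet> (a \<triangleright> x)"
    "\<alpha> \<in> Arrs C \<Longrightarrow> a \<unrhd> \<alpha> \<in> Arrs C" "\<alpha> \<in> Arrs C \<Longrightarrow> src (a \<unrhd> \<alpha>) = a \<triangleright> src \<alpha>"
    "\<alpha> \<in> Arrs C \<Longrightarrow> trg (a \<unrhd> \<alpha>) = a \<triangleright> trg \<alpha>"
    "x \<in> Obj C \<Longrightarrow> a \<unrhd> idt C x = idt C (a \<triangleright> x)"
    "\<lbrakk>\<alpha> \<in> Arrs C; \<beta> \<in> Arrs C; src \<beta> = trg \<alpha>\<rbrakk> \<Longrightarrow> a \<unrhd> (\<beta> \<cdot> \<alpha>) = (a \<unrhd> \<beta>) \<cdot> (a \<unrhd> \<alpha>)"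
    "\<lbrakk>\<alpha> \<in> Arrs C; \<beta> \<in> Arrs C; src (src \<beta>) = trg (src \<alpha>)\<rbrakk> \<Longrightarrow> a \<unrhd> (\<beta> \<star> \<alpha>) = (a \<unrhd> \<beta>) \<star> (a \<unrhd> \<alpha>)"
  using lten_functor[OF assms]
  by (auto simp: strict_two_functor_def is_functor_def Hom_def Hom1_def composable1_def composable2_def)

lemma rten_simps [simp]:
  assumes "a \<in> Obj0 C"
  shows "x \<in> Obj C \<Longrightarrow> x \<triangleleft> a \<in> Obj C" "x \<in> Obj C \<Longrightarrow> src (x \<triangleleft> a) = src x \<otimes>\<^sub>0 a"
    "x \<in> Obj C \<Longrightarrow> trg (x \<triangleleft> a) = trg x \<otimes>\<^sub>0 a"
    "b \<in> Obj0 C \<Longrightarrow> id1 C b \<triangleleft> a = id1 C (b \<otimes>\<^sub>0 a)"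
    "\<lbrakk>x \<in> Obj C; y \<in> Obj C; src y = trg x\<rbrakk> \<Longrightarrow> (y \<bullet> x) \<triangleleft> a = (y \<triangleleft> a) \<bullet> (x \<triangleleft> a)"
    "\<alpha> \<in> Arrs C \<Longrightarrow> \<alpha> \<unlhd> a \<in> Arrs C" "\<alpha> \<in> Arrs C \<Longrightarrow> src (\<alpha> \<unlhd> a) = src \<alpha> \<triangleleft> a"
    "\<alpha> \<in> Arrs C \<Longrightarrow> trg (\<alpha> \<unlhd> a) = trg \<alpha> \<triangleleft> a"
    "x \<in> Obj C \<Longrightarrow> idt C x \<unlhd> a = idt C (x \<triangleleft> a)"
    "\<lbrakk>\<alpha> \<in> Arrs C; \<beta> \<in> Arrs C; src \<beta> = trg \<alpha>\<rbrakk> \<Longrightarrow> (\<beta> \<cdot> \<alpha>) \<unlhd> a = (\<beta> \<unlhd> a) \<cdot> (\<alpha> \<unlhd> a)"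
    "\<lbrakk>\<alpha> \<in> Arrs C; \<beta> \<in> Arrs C; src (src \<beta>) = trg (src \<alpha>)\<rbrakk> \<Longrightarrow> (\<beta> \<star> \<alpha>) \<unlhd> a = (\<beta> \<unlhd> a) \<star> (\<alpha> \<unlhd> a)"
  using rten_functor[OF assms]
  by (auto simp: strict_two_functor_def is_functor_def Hom_def Hom1_def composable1_def composable2_def)

lemma ten0_simps [simp]:
  "\<lbrakk>a \<in> Obj0 C; b \<in> Obj0 C\<rbrakk> \<Longrightarrow> a \<otimes>\<^sub>0 b \<in> Obj0 C"
  "\<lbrakk>a \<in> Obj0 C; b \<in> Obj0 C; c \<in> Obj0 C\<rbrakk> \<Longrightarrow> (a \<otimes>\<^sub>0 b) \<otimes>\<^sub>0 c = a \<otimes>\<^sub>0 (b \<otimes>\<^sub>0 c)"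
  "unit0 C \<in> Obj0 C" "a \<in> Obj0 C \<Longrightarrow> unit0 C \<otimes>\<^sub>0 a = a" "a \<in> Obj0 C \<Longrightarrow> a \<otimes>\<^sub>0 unit0 C = a"
  using ten0_closed ten0_assoc unit0_closed ten0_unit by auto

lemma ten_unit_simps [simp]:
  "x \<in> Obj C \<Longrightarrow> unit0 C \<triangleright> x = x" "x \<in> Obj C \<Longrightarrow> x \<triangleleft> unit0 C = x"
  "\<alpha> \<in> Arrs C \<Longrightarrow> unit0 C \<unrhd> \<alpha> = \<alpha>" "\<alpha> \<in> Arrs C \<Longrightarrow> \<alpha> \<unlhd> unit0 C = \<alpha>"
  using ten1_unit ten2_unit by auto

lemma ten_assoc_simps [simp]:
  assumes "a \<in> Obj0 C" "b \<in> Obj0 C"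
  shows "x \<in> Obj C \<Longrightarrow> (a \<otimes>\<^sub>0 b) \<triangleright> x = a \<triangleright> (b \<triangleright> x)"
    "x \<in> Obj C \<Longrightarrow> (a \<triangleright> x) \<triangleleft> b = a \<triangleright> (x \<triangleleft> b)"
    "x \<in> Obj C \<Longrightarrow> x \<triangleleft> (a \<otimes>\<^sub>0 b) = (x \<triangleleft> a) \<triangleleft> b"
    "\<alpha> \<in> Arrs C \<Longrightarrow> (a \<otimes>\<^sub>0 b) \<unrhd> \<alpha> = a \<unrhd> (b \<unrhd> \<alpha>)"
    "\<alpha> \<in> Arrs C \<Longrightarrow> (a \<unrhd> \<alpha>) \<unlhd> b = a \<unrhd> (\<alpha> \<unlhd> b)"
    "\<alpha> \<in> Arrs C \<Longrightarrow> \<alpha> \<unlhd> (a \<otimes>\<^sub>0 b) = (\<alpha> \<unlhd> a) \<unlhd> b"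
  using ten1_assoc[OF assms] ten2_assoc[OF assms] by auto

lemma ichg_simps [simp]:
  assumes "x \<in> Obj C" "y \<in> Obj C"
  shows "iso_arr C (ichg C x y)"
    "src (ichg C x y) = (x \<triangleleft> trg y) \<bullet> (src x \<triangleright> y)" "trg (ichg C x y) = (trg x \<triangleright> y) \<bullet> (x \<triangleleft> src y)"
  using ichg_iso[of x "src x" "trg x" y "src y" "trg y"] assms by (auto simp: Iso_iff Hom1_def)

lemma ichg_id_simps [simp]:
  "\<lbrakk>a \<in> Obj0 C; y \<in> Obj C\<rbrakk> \<Longrightarrow> ichg C (id1 C a) y = idt C (a \<triangleright> y)"
  "\<lbrakk>a \<in> Obj0 C; x \<in> Obj C\<rbrakk> \<Longrightarrow> ichg C x (id1 C a) = idt C (x \<triangleleft> a)"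
  using ichg_id_left ichg_id_right by auto

lemma ichg_nat:
  assumes "\<alpha> \<in> Arrs C" "\<beta> \<in> Arrs C"
  shows "ichg C (trg \<alpha>) (trg \<beta>) \<cdot> ((\<alpha> \<unlhd> trg (src \<beta>)) \<star> (src (src \<alpha>) \<unrhd> \<beta>))
    = ((trg (src \<alpha>) \<unrhd> \<beta>) \<star> (\<alpha> \<unlhd> src (src \<beta>))) \<cdot> ichg C (src \<alpha>) (src \<beta>)"
  using assms by (intro ichg_natural) (auto simp: Hom_def Hom1_def)

lemma ten1_simps [simp]:
  assumes "x \<in> Obj C" "y \<in> Obj C"
  shows "x \<otimes>\<^sub>1 y \<in> Obj C" "src (x \<otimes>\<^sub>1 y) = src x \<otimes>\<^sub>0 src y" "trg (x \<otimes>\<^sub>1 y) = trg x \<otimes>\<^sub>0 trg y"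
  using assms by (simp_all add: ten1_def)

lemma id_ten1 [simp]: "\<lbrakk>a \<in> Obj0 C; x \<in> Obj C\<rbrakk> \<Longrightarrow> id1 C a \<otimes>\<^sub>1 x = a \<triangleright> x"
  and ten1_id [simp]: "\<lbrakk>a \<in> Obj0 C; x \<in> Obj C\<rbrakk> \<Longrightarrow> x \<otimes>\<^sub>1 id1 C a = x \<triangleleft> a"
  and id_ten2 [simp]: "\<lbrakk>a \<in> Obj0 C; \<alpha> \<in> Arrs C\<rbrakk> \<Longrightarrow> idt C (id1 C a) \<otimes>\<^sub>2 \<alpha> = a \<unrhd> \<alpha>"
  and ten2_id [simp]: "\<lbrakk>a \<in> Obj0 C; \<alpha> \<in> Arrs C\<rbrakk> \<Longrightarrow> \<alpha> \<otimes>\<^sub>2 idt C (id1 C a) = \<alpha> \<unlhd> a"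
  by (simp_all add: ten1_def ten2_def del: H.tA_idt)

end

text \<open>
  The operation \<open>\<otimes>\<^sub>2\<close> is strictly functorial for vertical composition; it is with the composition
  of 1-cells that the tensor product is compatible only up to interchangers.
\<close>

sublocale gray_monoid \<subseteq> T: strict_composition C "UNIV :: unit set" "\<lambda>_. ()" "\<lambda>_. ()"
    "\<lambda>_. id1 C (unit0 C)" "ten1 C" "ten2 C"
proof unfold_locales
  fix x y z assume "x \<in> Obj C" "y \<in> Obj C" "z \<in> Obj C"
  then show "z \<otimes>\<^sub>1 y \<otimes>\<^sub>1 x = z \<otimes>\<^sub>1 (y \<otimes>\<^sub>1 x)" by (simp add: ten1_def)
next
  fix f g h assume "f \<in> Arrs C" "g \<in> Arrs C" "h \<in> Arrs C"
  then show "h \<otimes>\<^sub>2 g \<otimes>\<^sub>2 f = h \<otimes>\<^sub>2 (g \<otimes>\<^sub>2 f)" by (simp add: ten1_def ten2_def)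
qed (simp_all add: ten1_def ten2_def H.tA_vcmp)

locale pointed_gray = gray_monoid C + group G
  for G :: "('g, 'h) monoid_scheme" (structure) and C :: "('g, 'o, 'm) gray" +
  assumes Obj0_eq [simp]: "Obj0 C = carrier G" and unit0_eq [simp]: "unit0 C = \<one>"
    and ten0_eq [simp]: "\<lbrakk>g \<in> carrier G; h \<in> carrier G\<rbrakk> \<Longrightarrow> g \<otimes>\<^sub>0\<^bsub>C\<^esub> h = g \<otimes> h"

lemma strict_pointed_iff: "group G \<Longrightarrow> strict_pointed G C \<longleftrightarrow> pointed_gray G C"
  by (auto simp: strict_pointed_def pointed_gray_def pointed_gray_axioms_def)

context group
begin

lemma inv_cancel [simp]:
  "\<lbrakk>x \<in> carrier G; y \<in> carrier G\<rbrakk> \<Longrightarrow> inv x \<otimes> (x \<otimes> y) = y"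
  "\<lbrakk>x \<in> carrier G; y \<in> carrier G\<rbrakk> \<Longrightarrow> x \<otimes> (inv x \<otimes> y) = y"
  by (simp_all add: m_assoc[symmetric])

end

context pointed_gray
begin

lemmas [simp] = m_assoc inv_mult_group

lemma src_carrier [simp]: "x \<in> Obj C \<Longrightarrow> src x \<in> carrier G"
  and trg_carrier [simp]: "x \<in> Obj C \<Longrightarrow> trg x \<in> carrier G"
  using src1_closed trg1_closed by auto

lemma act_simps [simp]:
  assumes "a \<in> carrier G" "b \<in> carrier G"
  shows "x \<in> Obj C \<Longrightarrow> (a \<otimes> b) \<triangleright>\<^bsub>C\<^esub> x = a \<triangleright>\<^bsub>C\<^esub> (b \<triangleright>\<^bsub>C\<^esub> x)"
    "x \<in> Obj C \<Longrightarrow> x \<triangleleft>\<^bsub>C\<^esub> (a \<otimes> b) = (x \<triangleleft>\<^bsub>C\<^esub> a) \<triangleleft>\<^bsub>C\<^esub> b"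
    "\<alpha> \<in> Arrs C \<Longrightarrow> (a \<otimes> b) \<unrhd>\<^bsub>C\<^esub> \<alpha> = a \<unrhd>\<^bsub>C\<^esub> (b \<unrhd>\<^bsub>C\<^esub> \<alpha>)"
    "\<alpha> \<in> Arrs C \<Longrightarrow> \<alpha> \<unlhd>\<^bsub>C\<^esub> (a \<otimes> b) = (\<alpha> \<unlhd>\<^bsub>C\<^esub> a) \<unlhd>\<^bsub>C\<^esub> b"
  using ten_assoc_simps[of a b] assms by auto

lemma act_unit_simps [simp]:
  "x \<in> Obj C \<Longrightarrow> \<one> \<triangleright>\<^bsub>C\<^esub> x = x" "x \<in> Obj C \<Longrightarrow> x \<triangleleft>\<^bsub>C\<^esub> \<one> = x"
  "\<alpha> \<in> Arrs C \<Longrightarrow> \<one> \<unrhd>\<^bsub>C\<^esub> \<alpha> = \<alpha>" "\<alpha> \<in> Arrs C \<Longrightarrow> \<alpha> \<unlhd>\<^bsub>C\<^esub> \<one> = \<alpha>"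
  using ten_unit_simps by auto

lemma act_inv_simps [simp]:
  assumes "a \<in> carrier G"
  shows "x \<in> Obj C \<Longrightarrow> a \<triangleright>\<^bsub>C\<^esub> (inv a \<triangleright>\<^bsub>C\<^esub> x) = x" "x \<in> Obj C \<Longrightarrow> inv a \<triangleright>\<^bsub>C\<^esub> (a \<triangleright>\<^bsub>C\<^esub> x) = x"
    "x \<in> Obj C \<Longrightarrow> (x \<triangleleft>\<^bsub>C\<^esub> a) \<triangleleft>\<^bsub>C\<^esub> (inv a) = x" "x \<in> Obj C \<Longrightarrow> (x \<triangleleft>\<^bsub>C\<^esub> (inv a)) \<triangleleft>\<^bsub>C\<^esub> a = x"
    "\<alpha> \<in> Arrs C \<Longrightarrow> a \<unrhd>\<^bsub>C\<^esub> (inv a \<unrhd>\<^bsub>C\<^esub> \<alpha>) = \<alpha>" "\<alpha> \<in> Arrs C \<Longrightarrow> inv a \<unrhd>\<^bsub>C\<^esub> (a \<unrhd>\<^bsub>C\<^esub> \<alpha>) = \<alpha>"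
    "\<alpha> \<in> Arrs C \<Longrightarrow> (\<alpha> \<unlhd>\<^bsub>C\<^esub> a) \<unlhd>\<^bsub>C\<^esub> (inv a) = \<alpha>" "\<alpha> \<in> Arrs C \<Longrightarrow> (\<alpha> \<unlhd>\<^bsub>C\<^esub> (inv a)) \<unlhd>\<^bsub>C\<^esub> a = \<alpha>"
  using assms act_simps[of a "inv a"] act_simps[of "inv a" a] by (simp_all del: act_simps)

end

text \<open>
  The failure of the exchange law between the tensor product and the composition of 1-cells: a
  whiskered interchanger from \<open>(x2 \<bullet> x1) \<otimes>\<^sub>1 (y2 \<bullet> y1)\<close> to \<open>(x2 \<otimes>\<^sub>1 y2) \<bullet> (x1 \<otimes>\<^sub>1 y1)\<close>.
\<close>

definition exch ::
    "('a, 'b, 'c, 'z) gray_scheme \<Rightarrow> ('a, 'b) arr \<Rightarrow> ('a, 'b) arr \<Rightarrow> ('a, 'b) arr \<Rightarrow> ('a, 'b) arr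
     \<Rightarrow> (('a, 'b) arr, 'c) arr" where
  "exch C x1 x2 y1 y2 =
     idt C (x2 \<triangleleft>\<^bsub>C\<^esub> trg y2) \<star>\<^bsub>C\<^esub> ichg C x1 y2 \<star>\<^bsub>C\<^esub> idt C (src x1 \<triangleright>\<^bsub>C\<^esub> y1)"

context gray_monoid
begin

lemma exch_simps [simp]:
  assumes "x1 \<in> Obj C" "x2 \<in> Obj C" "y1 \<in> Obj C" "y2 \<in> Obj C" "src x2 = trg x1" "src y2 = trg y1"
  shows "iso_arr C (exch C x1 x2 y1 y2)"
    "src (exch C x1 x2 y1 y2) = (x2 \<bullet> x1) \<otimes>\<^sub>1 (y2 \<bullet> y1)"
    "trg (exch C x1 x2 y1 y2) = (x2 \<otimes>\<^sub>1 y2) \<bullet> (x1 \<otimes>\<^sub>1 y1)"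
  using assms by (simp_all add: exch_def ten1_def)

lemma exch_inv:
  assumes "x1 \<in> Obj C" "x2 \<in> Obj C" "y1 \<in> Obj C" "y2 \<in> Obj C" "src x2 = trg x1" "src y2 = trg y1"
  shows "inv_arr C (exch C x1 x2 y1 y2) = idt C (x2 \<triangleleft> trg y2) \<star> inv_arr C (ichg C x1 y2) \<star> idt C (src x1 \<triangleright> y1)"
  using assms by (simp add: exch_def H.inv_tA)

text \<open>
  Both sides are horizontal composites of three factors. The outer two agree, and naturality of
  the interchanger settles the middle one.
\<close>

lemma exch_natural:
  assumes "a1 \<in> Arrs C" "a2 \<in> Arrs C" "b1 \<in> Arrs C" "b2 \<in> Arrs C"
    "src (src a2) = trg (src a1)" "src (src b2) = trg (src b1)"
  shows "exch C (trg a1) (trg a2) (trg b1) (trg b2) \<cdot> ((a2 \<star> a1) \<otimes>\<^sub>2 (b2 \<star> b1))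
    = ((a2 \<otimes>\<^sub>2 b2) \<star> (a1 \<otimes>\<^sub>2 b1)) \<cdot> exch C (src a1) (src a2) (src b1) (src b2)"
proof -
  define A2 B1 where A2: "A2 = a2 \<unlhd> trg (src b2)" and B1: "B1 = src (src a1) \<unrhd> b1"
  define M where "M = (a1 \<unlhd> trg (src b2)) \<star> (src (src a1) \<unrhd> b2)"
  define N where "N = (trg (src a1) \<unrhd> b2) \<star> (a1 \<unlhd> src (src b2))"
  define i i' where i: "i = ichg C (src a1) (src b2)" and i': "i' = ichg C (trg a1) (trg b2)"
  have A2' [simp]: "A2 \<in> Arrs C" "src A2 = src a2 \<triangleleft> trg (src b2)" "trg A2 = trg a2 \<triangleleft> trg (src b2)"
    using assms by (simp_all add: A2)
  have B1' [simp]: "B1 \<in> Arrs C" "src B1 = src (src a1) \<triangleright> src b1" "trg B1 = src (src a1) \<triangleright> trg b1"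
    using assms by (simp_all add: B1)
  have M' [simp]: "M \<in> Arrs C" "src M = src i" "trg M = src i'" using assms by (simp_all add: M_def i i')
  have N' [simp]: "N \<in> Arrs C" "src N = trg i" "trg N = trg i'" using assms by (simp_all add: N_def i i')
  have i'' [simp]: "i \<in> Arrs C" "i' \<in> Arrs C" using assms by (simp_all add: i i')
  have MN: "i' \<cdot> M = N \<cdot> i" unfolding M_def N_def i i' using assms by (intro ichg_nat)
  have e [simp]: "src (src i) = src (src a1) \<otimes>\<^sub>0 src (src b2)" "trg (src i) = trg (src a1) \<otimes>\<^sub>0 trg (src b2)"
     "src (src i') = src (src a1) \<otimes>\<^sub>0 src (src b2)" "trg (src i') = trg (src a1) \<otimes>\<^sub>0 trg (src b2)"
    using assms by (simp_all add: i i')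
  have o: "src (src a2 \<triangleleft> trg (src b2)) = trg (src a1) \<otimes>\<^sub>0 trg (src b2)"
     "src (trg a2 \<triangleleft> trg (src b2)) = trg (src a1) \<otimes>\<^sub>0 trg (src b2)"
     "trg (src (src a1) \<triangleright> src b1) = src (src a1) \<otimes>\<^sub>0 src (src b2)"
     "trg (src (src a1) \<triangleright> trg b1) = src (src a1) \<otimes>\<^sub>0 src (src b2)"
    using assms by simp_all
  note o [simp]
  have o'' [simp]: "src a2 \<triangleleft> trg (src b2) \<in> Obj C" "trg a2 \<triangleleft> trg (src b2) \<in> Obj C"
    "src (src a1) \<triangleright> src b1 \<in> Obj C" "src (src a1) \<triangleright> trg b1 \<in> Obj C" using assms by simp_all
  have 1: "(a2 \<star> a1) \<otimes>\<^sub>2 (b2 \<star> b1) = A2 \<star> (M \<star> B1)"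
    using assms unfolding A2 B1 M_def by (simp add: ten2_def)
  have 2: "(a2 \<otimes>\<^sub>2 b2) \<star> (a1 \<otimes>\<^sub>2 b1) = A2 \<star> (N \<star> B1)"
    using assms unfolding A2 B1 N_def by (simp add: ten2_def)
  have 3: "exch C (src a1) (src a2) (src b1) (src b2) = idt C (src A2) \<star> (i \<star> idt C (src B1))"
    using assms by (simp add: exch_def i)
  have 4: "exch C (trg a1) (trg a2) (trg b1) (trg b2) = idt C (trg A2) \<star> (i' \<star> idt C (trg B1))"
    using assms by (simp add: exch_def i')
  have "(idt C (trg A2) \<star> (i' \<star> idt C (trg B1))) \<cdot> (A2 \<star> (M \<star> B1)) = A2 \<star> ((i' \<cdot> M) \<star> B1)"
    by (simp add: H.merge)
  also have "\<dots> = (A2 \<star> (N \<star> B1)) \<cdot> (idt C (src A2) \<star> (i \<star> idt C (src B1)))"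
    unfolding MN by (simp add: H.merge)
  finally show ?thesis unfolding 1 2 3 4 .
qed

lemma exch_id_right [simp]:
  "\<lbrakk>a \<in> Obj0 C; x1 \<in> Obj C; x2 \<in> Obj C; y1 \<in> Obj C; src x2 = trg x1; trg y1 = a\<rbrakk>
   \<Longrightarrow> exch C x1 x2 y1 (id1 C a) = idt C ((x2 \<bullet> x1) \<otimes>\<^sub>1 y1)"
  by (auto simp: exch_def ten1_def)

lemma exch_ids [simp]:
  "\<lbrakk>a \<in> Obj0 C; c \<in> Obj0 C; x \<in> Obj C; y \<in> Obj C; trg x = a; src y = c\<rbrakk>
   \<Longrightarrow> exch C x (id1 C a) (id1 C c) y = ichg C x y"
  by (auto simp: exch_def)

end


section \<open>Functors and transformations of Gray-monoids\<close>

text \<open>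
  A functor of Gray-monoids as two weak functors with the same underlying maps, one for the
  composition of 1-cells and one for the tensor product. Their compatibility \<open>mten_mcomp\<close> is
  written with the exchange cell on the side where it needs no inverse.
\<close>

locale pointed_functor = C: pointed_gray G C + D: pointed_gray G D +
    H: weak_functor C "Obj0 C" src trg "id1 C" "cmp1 C" "hcmp C"
      D "Obj0 D" src trg "id1 D" "cmp1 D" "hcmp D" "map1 A" "map2 A" "\<lambda>a. a" "munit A" "mcomp A" +
    T: weak_functor C "UNIV :: unit set" "\<lambda>_. ()" "\<lambda>_. ()" "\<lambda>_. id1 C (unit0 C)" "ten1 C" "ten2 C"
      D "UNIV :: unit set" "\<lambda>_. ()" "\<lambda>_. ()" "\<lambda>_. id1 D (unit0 D)" "ten1 D" "ten2 D"
      "map1 A" "map2 A" "\<lambda>_. ()" "\<lambda>_. munit A \<one>\<^bsub>G\<^esub>" "mten A"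
  for G :: "('g, 'h) monoid_scheme" and C D :: "('g, 'o, 'm) gray" and A :: "('g, 'o, 'm) fun3" +
  assumes map0_id [simp]: "g \<in> carrier G \<Longrightarrow> map0 A g = g"
    and mten_mcomp: "\<lbrakk>x1 \<in> Obj C; x2 \<in> Obj C; y1 \<in> Obj C; y2 \<in> Obj C; src x2 = trg x1; src y2 = trg y1\<rbrakk>
      \<Longrightarrow> mcomp A (x2 \<otimes>\<^sub>1\<^bsub>C\<^esub> y2) (x1 \<otimes>\<^sub>1\<^bsub>C\<^esub> y1) \<cdot>\<^bsub>D\<^esub> ((mten A x2 y2 \<star>\<^bsub>D\<^esub> mten A x1 y1)
           \<cdot>\<^bsub>D\<^esub> exch D (map1 A x1) (map1 A x2) (map1 A y1) (map1 A y2))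
         = map2 A (exch C x1 x2 y1 y2)
           \<cdot>\<^bsub>D\<^esub> (mten A (x2 \<bullet>\<^bsub>C\<^esub> x1) (y2 \<bullet>\<^bsub>C\<^esub> y1) \<cdot>\<^bsub>D\<^esub> (mcomp A x2 x1 \<otimes>\<^sub>2\<^bsub>D\<^esub> mcomp A y2 y1))"
    and mten_munit: "\<lbrakk>g \<in> carrier G; h \<in> carrier G\<rbrakk>
      \<Longrightarrow> mten A (id1 C g) (id1 C h) \<cdot>\<^bsub>D\<^esub> (munit A g \<otimes>\<^sub>2\<^bsub>D\<^esub> munit A h) = munit A (g \<otimes>\<^bsub>G\<^esub> h)"

declare (in pointed_functor) H.fun_ends [simp]

definition fun3_extensional :: "('g, 'o, 'm) gray \<Rightarrow> ('g, 'o, 'm) fun3 \<Rightarrow> bool" where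
  "fun3_extensional C A \<longleftrightarrow> map0 A \<in> extensional (Obj0 C) \<and> map1 A \<in> extensional (Obj C) \<and>
     map2 A \<in> extensional (Arrs C) \<and> munit A \<in> extensional (Obj0 C) \<and>
     (\<forall>x y. \<not> composable1 C y x \<longrightarrow> mcomp A y x = undefined) \<and>
     (\<forall>x y. \<not> (x \<in> Obj C \<and> y \<in> Obj C) \<longrightarrow> mten A x y = undefined)"

lemma pointed_functor_if_functor3:
  assumes "pointed_gray G C" "pointed_gray G D" "functor3 C D A"
  shows "pointed_functor G C D A" "fun3_extensional C A"
proof -
  interpret C: pointed_gray G C by fact
  interpret D: pointed_gray G D by fact
  interpret functor3 C D A by fact
  show "fun3_extensional C A"
    unfolding fun3_extensional_def using map0_ext map1_ext map2_ext munit_ext mcomp_ext mten_ext by blast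
  interpret P: functor_pair C D "map1 A" "map2 A" by unfold_locales (rule locally_functor)
  have m0 [simp]: "g \<in> carrier G \<Longrightarrow> map0 A g = g" for g using map0_id by auto
  have m1 [simp]: "src (map1 A x) = src x" "trg (map1 A x) = trg x" if "x \<in> Obj C" for x
    using map1_closed[OF that] that by (auto simp: Hom1_def)
  have mu [simp]: "iso_arr D (munit A g)" "src (munit A g) = id1 D g" "trg (munit A g) = map1 A (id1 C g)"
    if "g \<in> carrier G" for g
    using munit_iso[of g] that by (auto simp: D.Iso_iff)
  have mc [simp]: "iso_arr D (mcomp A y x)" "src (mcomp A y x) = map1 A y \<bullet>\<^bsub>D\<^esub> map1 A x"
     "trg (mcomp A y x) = map1 A (y \<bullet>\<^bsub>C\<^esub> x)" if "x \<in> Obj C" "y \<in> Obj C" "src y = trg x" for y x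
    using mcomp_iso[of y x] that by (auto simp: D.Iso_iff composable1_def)
  have mt [simp]: "iso_arr D (mten A x y)" "src (mten A x y) = map1 A x \<otimes>\<^sub>1\<^bsub>D\<^esub> map1 A y"
     "trg (mten A x y) = map1 A (x \<otimes>\<^sub>1\<^bsub>C\<^esub> y)" if "x \<in> Obj C" "y \<in> Obj C" for y x
    using mten_iso[of x y] that by (auto simp: D.Iso_iff)
  have mc' [simp]: "mcomp A y x \<in> Arrs D" if "x \<in> Obj C" "y \<in> Obj C" "src y = trg x" for x y
    using mc that by (intro D.iso_simps(1)) auto
  have mt' [simp]: "mten A x y \<in> Arrs D" if "x \<in> Obj C" "y \<in> Obj C" for x y
    using mt that by (intro D.iso_simps(1)) auto
  have mu' [simp]: "munit A g \<in> Arrs D" if "g \<in> carrier G" for g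
    using mu that by (intro D.iso_simps(1)) auto
  show "pointed_functor G C D A"
  proof unfold_locales
    fix f g assume "f \<in> Arrs C" "g \<in> Arrs C" "src (src g) = trg (src f)"
    then show "mcomp A (trg g) (trg f) \<cdot>\<^bsub>D\<^esub> (map2 A g \<star>\<^bsub>D\<^esub> map2 A f) = map2 A (g \<star>\<^bsub>C\<^esub> f) \<cdot>\<^bsub>D\<^esub> mcomp A (src g) (src f)"
      by (intro mcomp_natural) (auto simp: composable2_def)
  next
    fix x y z assume "x \<in> Obj C" "y \<in> Obj C" "z \<in> Obj C" "src y = trg x" "src z = trg y"
    then show "mcomp A z (y \<bullet>\<^bsub>C\<^esub> x) \<cdot>\<^bsub>D\<^esub> (idt D (map1 A z) \<star>\<^bsub>D\<^esub> mcomp A y x) =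
       mcomp A (z \<bullet>\<^bsub>C\<^esub> y) x \<cdot>\<^bsub>D\<^esub> (mcomp A z y \<star>\<^bsub>D\<^esub> idt D (map1 A x))"
      by (intro mcomp_assoc) (auto simp: composable1_def)
  next
    fix x i assume "x \<in> Obj C" "trg x = i"
    then show "mcomp A (id1 C i) x \<cdot>\<^bsub>D\<^esub> (munit A i \<star>\<^bsub>D\<^esub> idt D (map1 A x)) = idt D (map1 A x)"
      by (intro munit_left) (auto simp: Hom1_def)
  next
    fix x i assume "x \<in> Obj C" "src x = i"
    then show "mcomp A x (id1 C i) \<cdot>\<^bsub>D\<^esub> (idt D (map1 A x) \<star>\<^bsub>D\<^esub> munit A i) = idt D (map1 A x)"
      by (intro munit_right) (auto simp: Hom1_def)
  next
    fix f g assume "f \<in> Arrs C" "g \<in> Arrs C"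
    then show "mten A (trg g) (trg f) \<cdot>\<^bsub>D\<^esub> (map2 A g \<otimes>\<^sub>2\<^bsub>D\<^esub> map2 A f) = map2 A (g \<otimes>\<^sub>2\<^bsub>C\<^esub> f) \<cdot>\<^bsub>D\<^esub> mten A (src g) (src f)"
      by (intro mten_natural) (auto simp: Hom_def)
  next
    fix x y z assume "x \<in> Obj C" "y \<in> Obj C" "z \<in> Obj C"
    then show "mten A z (y \<otimes>\<^sub>1\<^bsub>C\<^esub> x) \<cdot>\<^bsub>D\<^esub> (idt D (map1 A z) \<otimes>\<^sub>2\<^bsub>D\<^esub> mten A y x) =
       mten A (z \<otimes>\<^sub>1\<^bsub>C\<^esub> y) x \<cdot>\<^bsub>D\<^esub> (mten A z y \<otimes>\<^sub>2\<^bsub>D\<^esub> idt D (map1 A x))"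
      using mten_assoc[of z y x] by simp
  next
    fix x assume "x \<in> Obj C"
    then show "mten A (id1 C (unit0 C)) x \<cdot>\<^bsub>D\<^esub> (munit A \<one>\<^bsub>G\<^esub> \<otimes>\<^sub>2\<^bsub>D\<^esub> idt D (map1 A x)) = idt D (map1 A x)"
      "mten A x (id1 C (unit0 C)) \<cdot>\<^bsub>D\<^esub> (idt D (map1 A x) \<otimes>\<^sub>2\<^bsub>D\<^esub> munit A \<one>\<^bsub>G\<^esub>) = idt D (map1 A x)"
      using mten_unit_left[of x] mten_unit_right[of x] by simp_all
  next
    fix x1 x2 y1 y2
    assume *: "x1 \<in> Obj C" "x2 \<in> Obj C" "y1 \<in> Obj C" "y2 \<in> Obj C" "src x2 = trg x1" "src y2 = trg y1"
    let ?p = "exch D (map1 A x1) (map1 A x2) (map1 A y1) (map1 A y2)"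
    let ?a = "map2 A (exch C x1 x2 y1 y2) \<cdot>\<^bsub>D\<^esub> (mten A (x2 \<bullet>\<^bsub>C\<^esub> x1) (y2 \<bullet>\<^bsub>C\<^esub> y1)
           \<cdot>\<^bsub>D\<^esub> (mcomp A x2 x1 \<otimes>\<^sub>2\<^bsub>D\<^esub> mcomp A y2 y1))"
    let ?b = "mcomp A (x2 \<otimes>\<^sub>1\<^bsub>C\<^esub> y2) (x1 \<otimes>\<^sub>1\<^bsub>C\<^esub> y1) \<cdot>\<^bsub>D\<^esub> (mten A x2 y2 \<star>\<^bsub>D\<^esub> mten A x1 y1)"
    have p: "iso_arr D ?p" using * by simp
    have E: "inv_arr D ?p = idt D (map1 A x2 \<triangleleft>\<^bsub>D\<^esub> trg (map1 A y2)) \<star>\<^bsub>D\<^esub> inv_arr D (ichg D (map1 A x1) (map1 A y2))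
        \<star>\<^bsub>D\<^esub> idt D (src (map1 A x1) \<triangleright>\<^bsub>D\<^esub> map1 A y1)"
      by (rule D.exch_inv) (use * in simp_all)
    have "?b = map2 A (exch C x1 x2 y1 y2) \<cdot>\<^bsub>D\<^esub> mten A (x2 \<bullet>\<^bsub>C\<^esub> x1) (y2 \<bullet>\<^bsub>C\<^esub> y1)
           \<cdot>\<^bsub>D\<^esub> (mcomp A x2 x1 \<otimes>\<^sub>2\<^bsub>D\<^esub> mcomp A y2 y1) \<cdot>\<^bsub>D\<^esub> inv_arr D ?p"
      unfolding E exch_def[of C] by (rule mten_comp) (use * in \<open>simp_all add: composable1_def\<close>)
    also have "\<dots> = ?a \<cdot>\<^bsub>D\<^esub> inv_arr D ?p" using * by simp
    finally have "?b = ?a \<cdot>\<^bsub>D\<^esub> inv_arr D ?p" .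
    then have "?b \<cdot>\<^bsub>D\<^esub> ?p = ?a"
      by (rule D.move_iso_left) (use p * in simp_all)
    then show "mcomp A (x2 \<otimes>\<^sub>1\<^bsub>C\<^esub> y2) (x1 \<otimes>\<^sub>1\<^bsub>C\<^esub> y1) \<cdot>\<^bsub>D\<^esub> ((mten A x2 y2 \<star>\<^bsub>D\<^esub> mten A x1 y1) \<cdot>\<^bsub>D\<^esub> ?p) = ?a"
      using * by simp
  next
    fix g h assume "g \<in> carrier G" "h \<in> carrier G"
    then show "mten A (id1 C g) (id1 C h) \<cdot>\<^bsub>D\<^esub> (munit A g \<otimes>\<^sub>2\<^bsub>D\<^esub> munit A h) = munit A (g \<otimes>\<^bsub>G\<^esub> h)"
      using mten_id[of g h] by simp
  qed (simp_all)
qed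

lemma functor3_if_pointed_functor:
  assumes "pointed_functor G C D A" "fun3_extensional C A"
  shows "functor3 C D A"
proof -
  interpret pointed_functor G C D A by fact
  show ?thesis
  proof unfold_locales
    fix x y assume "composable1 C y x"
    then show "mcomp A y x \<in> Iso D (map1 A y \<bullet>\<^bsub>D\<^esub> map1 A x) (map1 A (y \<bullet>\<^bsub>C\<^esub> x))"
      by (auto simp: D.Iso_iff composable1_def)
  next
    fix \<alpha> \<beta> assume "composable2 C \<beta> \<alpha>"
    then show "mcomp A (trg \<beta>) (trg \<alpha>) \<cdot>\<^bsub>D\<^esub> (map2 A \<beta> \<star>\<^bsub>D\<^esub> map2 A \<alpha>)
              = map2 A (\<beta> \<star>\<^bsub>C\<^esub> \<alpha>) \<cdot>\<^bsub>D\<^esub> mcomp A (src \<beta>) (src \<alpha>)"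
      by (auto simp: composable2_def intro: H.mu_natural)
  next
    fix x y z assume "composable1 C y x" "composable1 C z y"
    then show "mcomp A z (y \<bullet>\<^bsub>C\<^esub> x) \<cdot>\<^bsub>D\<^esub> (idt D (map1 A z) \<star>\<^bsub>D\<^esub> mcomp A y x)
              = mcomp A (z \<bullet>\<^bsub>C\<^esub> y) x \<cdot>\<^bsub>D\<^esub> (mcomp A z y \<star>\<^bsub>D\<^esub> idt D (map1 A x))"
      by (auto simp: composable1_def intro: H.mu_assoc)
  next
    fix x a b assume "x \<in> Hom1 C a b"
    then show "mcomp A (id1 C b) x \<cdot>\<^bsub>D\<^esub> (munit A b \<star>\<^bsub>D\<^esub> idt D (map1 A x)) = idt D (map1 A x)"
      "mcomp A x (id1 C a) \<cdot>\<^bsub>D\<^esub> (idt D (map1 A x) \<star>\<^bsub>D\<^esub> munit A a) = idt D (map1 A x)"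
      using H.mu_unit_left[of x b] H.mu_unit_right[of x a] by (auto simp: Hom1_def)
  next
    fix x y assume "x \<in> Obj C" "y \<in> Obj C"
    then show "mten A x y \<in> Iso D (map1 A x \<otimes>\<^sub>1\<^bsub>D\<^esub> map1 A y) (map1 A (x \<otimes>\<^sub>1\<^bsub>C\<^esub> y))"
      by (simp add: D.Iso_iff)
  next
    fix \<alpha> \<beta> x x' y y' assume "\<alpha> \<in> Hom C x x'" "\<beta> \<in> Hom C y y'"
    then show "mten A x' y' \<cdot>\<^bsub>D\<^esub> (map2 A \<alpha> \<otimes>\<^sub>2\<^bsub>D\<^esub> map2 A \<beta>) = map2 A (\<alpha> \<otimes>\<^sub>2\<^bsub>C\<^esub> \<beta>) \<cdot>\<^bsub>D\<^esub> mten A x y"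
      using T.mu_natural[of \<beta> \<alpha>] by (auto simp: Hom_def)
  next
    fix x y z assume "x \<in> Obj C" "y \<in> Obj C" "z \<in> Obj C"
    then show "mten A (x \<otimes>\<^sub>1\<^bsub>C\<^esub> y) z \<cdot>\<^bsub>D\<^esub> (mten A x y \<otimes>\<^sub>2\<^bsub>D\<^esub> idt D (map1 A z))
              = mten A x (y \<otimes>\<^sub>1\<^bsub>C\<^esub> z) \<cdot>\<^bsub>D\<^esub> (idt D (map1 A x) \<otimes>\<^sub>2\<^bsub>D\<^esub> mten A y z)"
      using T.mu_assoc[of z y x] by simp
  next
    fix x assume "x \<in> Obj C"
    then show "mten A (id1 C (unit0 C)) x \<cdot>\<^bsub>D\<^esub> (munit A (unit0 C) \<otimes>\<^sub>2\<^bsub>D\<^esub> idt D (map1 A x)) = idt D (map1 A x)"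
       "mten A x (id1 C (unit0 C)) \<cdot>\<^bsub>D\<^esub> (idt D (map1 A x) \<otimes>\<^sub>2\<^bsub>D\<^esub> munit A (unit0 C)) = idt D (map1 A x)"
      using T.mu_unit_left[of x] T.mu_unit_right[of x] by simp_all
  next
    fix x1 x2 y1 y2 assume "composable1 C x2 x1" "composable1 C y2 y1"
    then have *: "x1 \<in> Obj C" "x2 \<in> Obj C" "y1 \<in> Obj C" "y2 \<in> Obj C" "src x2 = trg x1" "src y2 = trg y1"
      by (auto simp: composable1_def)
    let ?p = "exch D (map1 A x1) (map1 A x2) (map1 A y1) (map1 A y2)"
    have p: "iso_arr D ?p" using * by simp
    have E: "inv_arr D ?p = idt D (map1 A x2 \<triangleleft>\<^bsub>D\<^esub> trg (map1 A y2)) \<star>\<^bsub>D\<^esub> inv_arr D (ichg D (map1 A x1) (map1 A y2))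
        \<star>\<^bsub>D\<^esub> idt D (src (map1 A x1) \<triangleright>\<^bsub>D\<^esub> map1 A y1)"
      by (rule D.exch_inv) (use * in simp_all)
    have "(mcomp A (x2 \<otimes>\<^sub>1\<^bsub>C\<^esub> y2) (x1 \<otimes>\<^sub>1\<^bsub>C\<^esub> y1) \<cdot>\<^bsub>D\<^esub> (mten A x2 y2 \<star>\<^bsub>D\<^esub> mten A x1 y1))
      = map2 A (exch C x1 x2 y1 y2) \<cdot>\<^bsub>D\<^esub> mten A (x2 \<bullet>\<^bsub>C\<^esub> x1) (y2 \<bullet>\<^bsub>C\<^esub> y1)
           \<cdot>\<^bsub>D\<^esub> (mcomp A x2 x1 \<otimes>\<^sub>2\<^bsub>D\<^esub> mcomp A y2 y1) \<cdot>\<^bsub>D\<^esub> inv_arr D ?p"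
      using * p arg_cong[OF mten_mcomp[OF *], of "\<lambda>z. z \<cdot>\<^bsub>D\<^esub> inv_arr D ?p"]
      by simp
    then show "mcomp A (x2 \<otimes>\<^sub>1\<^bsub>C\<^esub> y2) (x1 \<otimes>\<^sub>1\<^bsub>C\<^esub> y1) \<cdot>\<^bsub>D\<^esub> (mten A x2 y2 \<star>\<^bsub>D\<^esub> mten A x1 y1)
              = map2 A (idt C (x2 \<triangleleft>\<^bsub>C\<^esub> trg y2) \<star>\<^bsub>C\<^esub> ichg C x1 y2 \<star>\<^bsub>C\<^esub> idt C (src x1 \<triangleright>\<^bsub>C\<^esub> y1))
                \<cdot>\<^bsub>D\<^esub> mten A (x2 \<bullet>\<^bsub>C\<^esub> x1) (y2 \<bullet>\<^bsub>C\<^esub> y1)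
                \<cdot>\<^bsub>D\<^esub> (mcomp A x2 x1 \<otimes>\<^sub>2\<^bsub>D\<^esub> mcomp A y2 y1)
                \<cdot>\<^bsub>D\<^esub> (idt D (map1 A x2 \<triangleleft>\<^bsub>D\<^esub> trg (map1 A y2))
                    \<star>\<^bsub>D\<^esub> inv_arr D (ichg D (map1 A x1) (map1 A y2))
                    \<star>\<^bsub>D\<^esub> idt D (src (map1 A x1) \<triangleright>\<^bsub>D\<^esub> map1 A y1))"
      unfolding E exch_def[of C] .
  qed (use assms(2) H.functorial in
    \<open>auto simp: Hom1_def D.Iso_iff composable1_def fun3_extensional_def mten_munit\<close>)
qed

lemma functor3_iff:
  "\<lbrakk>pointed_gray G C; pointed_gray G D\<rbrakk>
   \<Longrightarrow> functor3 C D A \<longleftrightarrow> pointed_functor G C D A \<and> fun3_extensional C A"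
  using pointed_functor_if_functor3 functor3_if_pointed_functor by blast

lemma pointed_functor_id:
  assumes "pointed_gray G C" shows "pointed_functor G C C (id_fun3 C)"
proof -
  interpret pointed_gray G C by fact
  show ?thesis
    apply (intro pointed_functor.intro pointed_functor_axioms.intro)
        apply fact
       apply fact
      apply (rule H.weak_functor_identity; simp add: id_fun3_def composable1_def)
     apply (rule T.weak_functor_identity; simp add: id_fun3_def)
     apply (simp_all add: id_fun3_def composable1_def)
    done
qed

lemma fun3_extensional_id: "fun3_extensional C (id_fun3 C)"
  by (auto simp: fun3_extensional_def id_fun3_def)

lemma fun3_extensional_comp: "fun3_extensional C (comp_fun3 C E B A)"
  by (auto simp: fun3_extensional_def comp_fun3_def)

text \<open>
  For the exchange law, the law of \<open>A\<close> is mapped by \<open>B\<close> and the law of \<open>B\<close> is applied after the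
  cells of \<open>B\<close> have been moved past the images of those of \<open>A\<close> by naturality.
\<close>

lemma pointed_functor_comp:
  assumes "pointed_functor G C D A" "pointed_functor G D E B"
  shows "pointed_functor G C E (comp_fun3 C E B A)"
proof -
  interpret A: pointed_functor G C D A by fact
  interpret B: pointed_functor G D E B by fact
  let ?K = "comp_fun3 C E B A"
  have H: "weak_functor C (Obj0 C) src trg (id1 C) (cmp1 C) (hcmp C) E (Obj0 E) src trg (id1 E) (cmp1 E) (hcmp E)
      (map1 ?K) (map2 ?K) (\<lambda>a. a) (munit ?K) (mcomp ?K)"
    by (rule weak_functor_composite[OF A.H.weak_functor_axioms B.H.weak_functor_axioms])
      (simp_all add: comp_fun3_def composable1_def)
  have T: "weak_functor C (UNIV :: unit set) (\<lambda>_. ()) (\<lambda>_. ()) (\<lambda>_. id1 C (unit0 C)) (ten1 C) (ten2 C)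
      E (UNIV :: unit set) (\<lambda>_. ()) (\<lambda>_. ()) (\<lambda>_. id1 E (unit0 E)) (ten1 E) (ten2 E)
      (map1 ?K) (map2 ?K) (\<lambda>_. ()) (\<lambda>_. munit ?K \<one>\<^bsub>G\<^esub>) (mten ?K)"
    by (rule weak_functor_composite[OF A.T.weak_functor_axioms B.T.weak_functor_axioms])
      (simp_all add: comp_fun3_def)
  show ?thesis
  proof (intro pointed_functor.intro pointed_functor_axioms.intro)
    fix x1 x2 y1 y2
    assume *: "x1 \<in> Obj C" "x2 \<in> Obj C" "y1 \<in> Obj C" "y2 \<in> Obj C" "src x2 = trg x1" "src y2 = trg y1"
    let ?x1 = "map1 A x1" and ?x2 = "map1 A x2" and ?y1 = "map1 A y1" and ?y2 = "map1 A y2"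
    let ?e = "exch E (map1 B ?x1) (map1 B ?x2) (map1 B ?y1) (map1 B ?y2)"
    define a where "a = mcomp A (x2 \<otimes>\<^sub>1\<^bsub>C\<^esub> y2) (x1 \<otimes>\<^sub>1\<^bsub>C\<^esub> y1)"
    define t2 where "t2 = mten A x2 y2" define t1 where "t1 = mten A x1 y1"
    define c2 where "c2 = mcomp A y2 y1" define c1 where "c1 = mcomp A x2 x1"
    define t where "t = mten A (x2 \<bullet>\<^bsub>C\<^esub> x1) (y2 \<bullet>\<^bsub>C\<^esub> y1)"
    note defs = a_def t1_def t2_def c1_def c2_def t_def
    have ty [simp]: "a \<in> Arrs D" "t2 \<in> Arrs D" "t1 \<in> Arrs D" "c1 \<in> Arrs D" "c2 \<in> Arrs D" "t \<in> Arrs D"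
      "src a = map1 A (x2 \<otimes>\<^sub>1\<^bsub>C\<^esub> y2) \<bullet>\<^bsub>D\<^esub> map1 A (x1 \<otimes>\<^sub>1\<^bsub>C\<^esub> y1)" "trg a = map1 A ((x2 \<otimes>\<^sub>1\<^bsub>C\<^esub> y2) \<bullet>\<^bsub>C\<^esub> (x1 \<otimes>\<^sub>1\<^bsub>C\<^esub> y1))"
      "src t2 = ?x2 \<otimes>\<^sub>1\<^bsub>D\<^esub> ?y2" "trg t2 = map1 A (x2 \<otimes>\<^sub>1\<^bsub>C\<^esub> y2)"
      "src t1 = ?x1 \<otimes>\<^sub>1\<^bsub>D\<^esub> ?y1" "trg t1 = map1 A (x1 \<otimes>\<^sub>1\<^bsub>C\<^esub> y1)"
      "src c1 = ?x2 \<bullet>\<^bsub>D\<^esub> ?x1" "trg c1 = map1 A (x2 \<bullet>\<^bsub>C\<^esub> x1)"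
      "src c2 = ?y2 \<bullet>\<^bsub>D\<^esub> ?y1" "trg c2 = map1 A (y2 \<bullet>\<^bsub>C\<^esub> y1)"
      "src t = map1 A (x2 \<bullet>\<^bsub>C\<^esub> x1) \<otimes>\<^sub>1\<^bsub>D\<^esub> map1 A (y2 \<bullet>\<^bsub>C\<^esub> y1)" "trg t = map1 A ((x2 \<bullet>\<^bsub>C\<^esub> x1) \<otimes>\<^sub>1\<^bsub>C\<^esub> (y2 \<bullet>\<^bsub>C\<^esub> y1))"
      using * by (simp_all add: defs)
    have "mcomp ?K (x2 \<otimes>\<^sub>1\<^bsub>C\<^esub> y2) (x1 \<otimes>\<^sub>1\<^bsub>C\<^esub> y1) \<cdot>\<^bsub>E\<^esub> ((mten ?K x2 y2 \<star>\<^bsub>E\<^esub> mten ?K x1 y1) \<cdot>\<^bsub>E\<^esub>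
         exch E (map1 ?K x1) (map1 ?K x2) (map1 ?K y1) (map1 ?K y2))
      = map2 B a \<cdot>\<^bsub>E\<^esub> ((mcomp B (map1 A (x2 \<otimes>\<^sub>1\<^bsub>C\<^esub> y2)) (map1 A (x1 \<otimes>\<^sub>1\<^bsub>C\<^esub> y1)) \<cdot>\<^bsub>E\<^esub> (map2 B t2 \<star>\<^bsub>E\<^esub> map2 B t1))
         \<cdot>\<^bsub>E\<^esub> ((mten B ?x2 ?y2 \<star>\<^bsub>E\<^esub> mten B ?x1 ?y1) \<cdot>\<^bsub>E\<^esub> ?e))"
      using * by (simp add: comp_fun3_def composable1_def B.D.H.merge_r flip: defs)
    also have "\<dots> = map2 B a \<cdot>\<^bsub>E\<^esub> ((map2 B (t2 \<star>\<^bsub>D\<^esub> t1) \<cdot>\<^bsub>E\<^esub> mcomp B (?x2 \<otimes>\<^sub>1\<^bsub>D\<^esub> ?y2) (?x1 \<otimes>\<^sub>1\<^bsub>D\<^esub> ?y1))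
         \<cdot>\<^bsub>E\<^esub> ((mten B ?x2 ?y2 \<star>\<^bsub>E\<^esub> mten B ?x1 ?y1) \<cdot>\<^bsub>E\<^esub> ?e))"
      using * B.H.mu_natural[of t1 t2] by simp
    also have "\<dots> = (map2 B a \<cdot>\<^bsub>E\<^esub> map2 B (t2 \<star>\<^bsub>D\<^esub> t1)) \<cdot>\<^bsub>E\<^esub> (mcomp B (?x2 \<otimes>\<^sub>1\<^bsub>D\<^esub> ?y2) (?x1 \<otimes>\<^sub>1\<^bsub>D\<^esub> ?y1)
         \<cdot>\<^bsub>E\<^esub> ((mten B ?x2 ?y2 \<star>\<^bsub>E\<^esub> mten B ?x1 ?y1) \<cdot>\<^bsub>E\<^esub> ?e))"
      using * by simp
    also have "\<dots> = (map2 B a \<cdot>\<^bsub>E\<^esub> map2 B (t2 \<star>\<^bsub>D\<^esub> t1)) \<cdot>\<^bsub>E\<^esub> (map2 B (exch D ?x1 ?x2 ?y1 ?y2)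
         \<cdot>\<^bsub>E\<^esub> (mten B (?x2 \<bullet>\<^bsub>D\<^esub> ?x1) (?y2 \<bullet>\<^bsub>D\<^esub> ?y1) \<cdot>\<^bsub>E\<^esub> (mcomp B ?x2 ?x1 \<otimes>\<^sub>2\<^bsub>E\<^esub> mcomp B ?y2 ?y1)))"
      using * by (subst B.mten_mcomp) simp_all
    also have "\<dots> = map2 B (a \<cdot>\<^bsub>D\<^esub> ((t2 \<star>\<^bsub>D\<^esub> t1) \<cdot>\<^bsub>D\<^esub> exch D ?x1 ?x2 ?y1 ?y2))
         \<cdot>\<^bsub>E\<^esub> (mten B (?x2 \<bullet>\<^bsub>D\<^esub> ?x1) (?y2 \<bullet>\<^bsub>D\<^esub> ?y1) \<cdot>\<^bsub>E\<^esub> (mcomp B ?x2 ?x1 \<otimes>\<^sub>2\<^bsub>E\<^esub> mcomp B ?y2 ?y1))"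
      using * by simp
    also have "a \<cdot>\<^bsub>D\<^esub> ((t2 \<star>\<^bsub>D\<^esub> t1) \<cdot>\<^bsub>D\<^esub> exch D ?x1 ?x2 ?y1 ?y2) = map2 A (exch C x1 x2 y1 y2) \<cdot>\<^bsub>D\<^esub> (t \<cdot>\<^bsub>D\<^esub> (c1 \<otimes>\<^sub>2\<^bsub>D\<^esub> c2))"
      unfolding defs using * by (rule A.mten_mcomp)
    also have "map2 B (map2 A (exch C x1 x2 y1 y2) \<cdot>\<^bsub>D\<^esub> (t \<cdot>\<^bsub>D\<^esub> (c1 \<otimes>\<^sub>2\<^bsub>D\<^esub> c2)))
         \<cdot>\<^bsub>E\<^esub> (mten B (?x2 \<bullet>\<^bsub>D\<^esub> ?x1) (?y2 \<bullet>\<^bsub>D\<^esub> ?y1) \<cdot>\<^bsub>E\<^esub> (mcomp B ?x2 ?x1 \<otimes>\<^sub>2\<^bsub>E\<^esub> mcomp B ?y2 ?y1))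
       = map2 B (map2 A (exch C x1 x2 y1 y2)) \<cdot>\<^bsub>E\<^esub> (map2 B t \<cdot>\<^bsub>E\<^esub>
         ((map2 B (c1 \<otimes>\<^sub>2\<^bsub>D\<^esub> c2) \<cdot>\<^bsub>E\<^esub> mten B (?x2 \<bullet>\<^bsub>D\<^esub> ?x1) (?y2 \<bullet>\<^bsub>D\<^esub> ?y1)) \<cdot>\<^bsub>E\<^esub> (mcomp B ?x2 ?x1 \<otimes>\<^sub>2\<^bsub>E\<^esub> mcomp B ?y2 ?y1)))"
      using * by simp
    also have "map2 B (c1 \<otimes>\<^sub>2\<^bsub>D\<^esub> c2) \<cdot>\<^bsub>E\<^esub> mten B (?x2 \<bullet>\<^bsub>D\<^esub> ?x1) (?y2 \<bullet>\<^bsub>D\<^esub> ?y1)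
       = mten B (map1 A (x2 \<bullet>\<^bsub>C\<^esub> x1)) (map1 A (y2 \<bullet>\<^bsub>C\<^esub> y1)) \<cdot>\<^bsub>E\<^esub> (map2 B c1 \<otimes>\<^sub>2\<^bsub>E\<^esub> map2 B c2)"
      using * B.T.mu_natural[of c2 c1] by simp
    also have "map2 B (map2 A (exch C x1 x2 y1 y2)) \<cdot>\<^bsub>E\<^esub> (map2 B t \<cdot>\<^bsub>E\<^esub> (mten B (map1 A (x2 \<bullet>\<^bsub>C\<^esub> x1)) (map1 A (y2 \<bullet>\<^bsub>C\<^esub> y1)) \<cdot>\<^bsub>E\<^esub> (map2 B c1 \<otimes>\<^sub>2\<^bsub>E\<^esub> map2 B c2)
         \<cdot>\<^bsub>E\<^esub> (mcomp B ?x2 ?x1 \<otimes>\<^sub>2\<^bsub>E\<^esub> mcomp B ?y2 ?y1)))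
       = map2 ?K (exch C x1 x2 y1 y2) \<cdot>\<^bsub>E\<^esub> (mten ?K (x2 \<bullet>\<^bsub>C\<^esub> x1) (y2 \<bullet>\<^bsub>C\<^esub> y1) \<cdot>\<^bsub>E\<^esub> (mcomp ?K x2 x1 \<otimes>\<^sub>2\<^bsub>E\<^esub> mcomp ?K y2 y1))"
      using * by (simp add: comp_fun3_def composable1_def B.D.T.merge flip: defs)
    finally show "mcomp ?K (x2 \<otimes>\<^sub>1\<^bsub>C\<^esub> y2) (x1 \<otimes>\<^sub>1\<^bsub>C\<^esub> y1) \<cdot>\<^bsub>E\<^esub> ((mten ?K x2 y2 \<star>\<^bsub>E\<^esub> mten ?K x1 y1) \<cdot>\<^bsub>E\<^esub>
         exch E (map1 ?K x1) (map1 ?K x2) (map1 ?K y1) (map1 ?K y2))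
      = map2 ?K (exch C x1 x2 y1 y2) \<cdot>\<^bsub>E\<^esub> (mten ?K (x2 \<bullet>\<^bsub>C\<^esub> x1) (y2 \<bullet>\<^bsub>C\<^esub> y1) \<cdot>\<^bsub>E\<^esub> (mcomp ?K x2 x1 \<otimes>\<^sub>2\<^bsub>E\<^esub> mcomp ?K y2 y1))" .
  next
    fix g h assume *: "g \<in> carrier G" "h \<in> carrier G"
    let ?t = "mten A (id1 C g) (id1 C h)" and ?u = "munit A g" and ?v = "munit A h"
    have "mten ?K (id1 C g) (id1 C h) \<cdot>\<^bsub>E\<^esub> (munit ?K g \<otimes>\<^sub>2\<^bsub>E\<^esub> munit ?K h)
      = map2 B ?t \<cdot>\<^bsub>E\<^esub> ((mten B (map1 A (id1 C g)) (map1 A (id1 C h)) \<cdot>\<^bsub>E\<^esub> (map2 B ?u \<otimes>\<^sub>2\<^bsub>E\<^esub> map2 B ?v)) \<cdot>\<^bsub>E\<^esub> (munit B g \<otimes>\<^sub>2\<^bsub>E\<^esub> munit B h))"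
      using * by (simp add: comp_fun3_def B.D.T.merge)
    also have "mten B (map1 A (id1 C g)) (map1 A (id1 C h)) \<cdot>\<^bsub>E\<^esub> (map2 B ?u \<otimes>\<^sub>2\<^bsub>E\<^esub> map2 B ?v)
      = map2 B (?u \<otimes>\<^sub>2\<^bsub>D\<^esub> ?v) \<cdot>\<^bsub>E\<^esub> mten B (id1 D g) (id1 D h)"
      using * B.T.mu_natural[of ?v ?u] by simp
    also have "map2 B ?t \<cdot>\<^bsub>E\<^esub> (map2 B (?u \<otimes>\<^sub>2\<^bsub>D\<^esub> ?v) \<cdot>\<^bsub>E\<^esub> mten B (id1 D g) (id1 D h) \<cdot>\<^bsub>E\<^esub> (munit B g \<otimes>\<^sub>2\<^bsub>E\<^esub> munit B h))
      = map2 B (?t \<cdot>\<^bsub>D\<^esub> (?u \<otimes>\<^sub>2\<^bsub>D\<^esub> ?v)) \<cdot>\<^bsub>E\<^esub> (mten B (id1 D g) (id1 D h) \<cdot>\<^bsub>E\<^esub> (munit B g \<otimes>\<^sub>2\<^bsub>E\<^esub> munit B h))"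
      using * by simp
    also have "\<dots> = munit ?K (g \<otimes>\<^bsub>G\<^esub> h)"
      using * by (simp add: A.mten_munit B.mten_munit comp_fun3_def del: B.H.fa_vcmp)
    finally show "mten ?K (id1 C g) (id1 C h) \<cdot>\<^bsub>E\<^esub> (munit ?K g \<otimes>\<^sub>2\<^bsub>E\<^esub> munit ?K h) = munit ?K (g \<otimes>\<^bsub>G\<^esub> h)" .
  qed (use H T A.C.pointed_gray_axioms B.D.pointed_gray_axioms in \<open>auto simp: comp_fun3_def\<close>)
qed

locale pointed_transformation = A: pointed_functor G C D A + B: pointed_functor G C D B +
    H: weak_transformation C "Obj0 C" src trg "id1 C" "cmp1 C" "hcmp C"
      D "Obj0 D" src trg "id1 D" "cmp1 D" "hcmp D" "map1 A" "map2 A" "\<lambda>a. a" "munit A" "mcomp A"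
      "map1 B" "map2 B" "munit B" "mcomp B" \<eta> +
    T: weak_transformation C "UNIV :: unit set" "\<lambda>_. ()" "\<lambda>_. ()" "\<lambda>_. id1 C (unit0 C)" "ten1 C" "ten2 C"
      D "UNIV :: unit set" "\<lambda>_. ()" "\<lambda>_. ()" "\<lambda>_. id1 D (unit0 D)" "ten1 D" "ten2 D"
      "map1 A" "map2 A" "\<lambda>_. ()" "\<lambda>_. munit A \<one>\<^bsub>G\<^esub>" "mten A"
      "map1 B" "map2 B" "\<lambda>_. munit B \<one>\<^bsub>G\<^esub>" "mten B" \<eta>
  for G :: "('g, 'h) monoid_scheme" and C D :: "('g, 'o, 'm) gray" and A B :: "('g, 'o, 'm) fun3" and \<eta>

lemma transformation3_iff:
  assumes "pointed_gray G C" "pointed_gray G D"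
  shows "transformation3 C D A B \<eta> \<longleftrightarrow> pointed_transformation G C D A B \<eta> \<and>
    fun3_extensional C A \<and> fun3_extensional C B \<and> \<eta> \<in> extensional (Obj C)"
proof
  assume "transformation3 C D A B \<eta>"
  then interpret transformation3 C D A B \<eta> .
  interpret PA: pointed_functor G C D A using pointed_functor_if_functor3[OF assms A.functor3_axioms] by blast
  interpret PB: pointed_functor G C D B using pointed_functor_if_functor3[OF assms B.functor3_axioms] by blast
  have [simp]: "\<eta> x \<in> Arrs D" "src (\<eta> x) = map1 A x" "trg (\<eta> x) = map1 B x" if "x \<in> Obj C" for x
    using component[OF that] by (auto simp: Hom_def)
  have "pointed_transformation G C D A B \<eta>"
  proof unfold_locales
    fix f assume "f \<in> Arrs C"
    then show "\<eta> (trg f) \<cdot>\<^bsub>D\<^esub> map2 A f = map2 B f \<cdot>\<^bsub>D\<^esub> \<eta> (src f)"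
      by (intro natural) (auto simp: Hom_def)
  next
    fix x y assume "x \<in> Obj C" "y \<in> Obj C" "src y = trg x"
    then show "\<eta> (y \<bullet>\<^bsub>C\<^esub> x) \<cdot>\<^bsub>D\<^esub> mcomp A y x = mcomp B y x \<cdot>\<^bsub>D\<^esub> (\<eta> y \<star>\<^bsub>D\<^esub> \<eta> x)"
      by (intro respects_comp) (auto simp: composable1_def)
  qed (use respects_id[of "\<one>\<^bsub>G\<^esub>"] in \<open>simp_all add: respects_ten respects_id\<close>)
  then show "pointed_transformation G C D A B \<eta> \<and>
    fun3_extensional C A \<and> fun3_extensional C B \<and> \<eta> \<in> extensional (Obj C)"
    using pointed_functor_if_functor3[OF assms A.functor3_axioms]
      pointed_functor_if_functor3[OF assms B.functor3_axioms] ext by blast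
next
  assume *: "pointed_transformation G C D A B \<eta> \<and>
    fun3_extensional C A \<and> fun3_extensional C B \<and> \<eta> \<in> extensional (Obj C)"
  then interpret pointed_transformation G C D A B \<eta> by blast
  interpret A': functor3 C D A using functor3_if_pointed_functor[OF A.pointed_functor_axioms] * by blast
  interpret B': functor3 C D B using functor3_if_pointed_functor[OF B.pointed_functor_axioms] * by blast
  show "transformation3 C D A B \<eta>"
    by unfold_locales (use * in \<open>auto simp: Hom_def composable1_def H.nat H.resp_mu H.resp_eps T.resp_mu\<close>)
qed

lemma map_comp_fun3 [simp]:
  "x \<in> Obj C \<Longrightarrow> map1 (comp_fun3 C E B A) x = map1 B (map1 A x)"
  "\<alpha> \<in> Arrs C \<Longrightarrow> map2 (comp_fun3 C E B A) \<alpha> = map2 B (map2 A \<alpha>)"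
  "g \<in> Obj0 C \<Longrightarrow> munit (comp_fun3 C E B A) g = map2 B (munit A g) \<cdot>\<^bsub>E\<^esub> munit B (map0 A g)"
  "composable1 C y x \<Longrightarrow> mcomp (comp_fun3 C E B A) y x = map2 B (mcomp A y x) \<cdot>\<^bsub>E\<^esub> mcomp B (map1 A y) (map1 A x)"
  "\<lbrakk>x \<in> Obj C; y \<in> Obj C\<rbrakk> \<Longrightarrow> mten (comp_fun3 C E B A) x y = map2 B (mten A x y) \<cdot>\<^bsub>E\<^esub> mten B (map1 A x) (map1 A y)"
  by (simp_all add: comp_fun3_def)

lemma pointed_transformation_hcmp:
  assumes "pointed_transformation G C D A B \<eta>" "pointed_transformation G D E A' B' \<zeta>"
  shows "pointed_transformation G C E (comp_fun3 C E A' A) (comp_fun3 C E B' B)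
                (\<lambda>x \<in> Obj C. \<zeta> (map1 B x) \<cdot>\<^bsub>E\<^esub> map2 A' (\<eta> x))"
proof -
  interpret T: pointed_transformation G C D A B \<eta> by fact
  interpret S: pointed_transformation G D E A' B' \<zeta> by fact
  interpret AA: pointed_functor G C E "comp_fun3 C E A' A"
    using pointed_functor_comp T.A.pointed_functor_axioms S.A.pointed_functor_axioms .
  interpret BB: pointed_functor G C E "comp_fun3 C E B' B"
    using pointed_functor_comp T.B.pointed_functor_axioms S.B.pointed_functor_axioms .
  show ?thesis
    by (intro pointed_transformation.intro AA.pointed_functor_axioms BB.pointed_functor_axioms;
      rule weak_transformation_hcmp[OF T.H.weak_transformation_axioms S.H.weak_transformation_axioms
          AA.H.weak_functor_axioms BB.H.weak_functor_axioms]
        weak_transformation_hcmp[OF T.T.weak_transformation_axioms S.T.weak_transformation_axioms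
          AA.T.weak_functor_axioms BB.T.weak_functor_axioms];
      simp add: composable1_def)
qed

lemma pointed_transformation_vcmp:
  assumes "pointed_transformation G C D A B \<eta>" "pointed_transformation G C D B K \<zeta>"
  shows "pointed_transformation G C D A K (\<lambda>x \<in> Obj C. \<zeta> x \<cdot>\<^bsub>D\<^esub> \<eta> x)"
proof -
  interpret T: pointed_transformation G C D A B \<eta> by fact
  interpret S: pointed_transformation G C D B K \<zeta> by fact
  show ?thesis
    by (intro pointed_transformation.intro T.A.pointed_functor_axioms S.B.pointed_functor_axioms;
      rule weak_transformation_vcmp[OF T.H.weak_transformation_axioms S.H.weak_transformation_axioms]
        weak_transformation_vcmp[OF T.T.weak_transformation_axioms S.T.weak_transformation_axioms];
      simp)
qed

lemma pointed_transformation_id: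
  assumes "pointed_functor G C D A"
  shows "pointed_transformation G C D A A (\<lambda>x \<in> Obj C. idt D (map1 A x))"
proof -
  interpret pointed_functor G C D A by fact
  show ?thesis
    by (intro pointed_transformation.intro pointed_functor_axioms;
      rule H.identity_transformation T.identity_transformation; simp)
qed

lemma comp_fun3_id_left: "\<lbrakk>pointed_functor G C D A; fun3_extensional C A\<rbrakk> \<Longrightarrow> comp_fun3 C D (id_fun3 D) A = A"
proof -
  assume "pointed_functor G C D A" and ext: "fun3_extensional C A"
  then interpret pointed_functor G C D A by blast
  show ?thesis
    using ext by (intro fun3.equality)
     (auto simp: fun3_extensional_def comp_fun3_def id_fun3_def fun_eq_iff composable1_def extensional_def)
qed

lemma comp_fun3_id_right: "\<lbrakk>pointed_functor G C D A; fun3_extensional C A\<rbrakk> \<Longrightarrow> comp_fun3 C D A (id_fun3 C) = A"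
proof -
  assume "pointed_functor G C D A" and ext: "fun3_extensional C A"
  then interpret pointed_functor G C D A by blast
  show ?thesis
    using ext by (intro fun3.equality)
     (auto simp: fun3_extensional_def comp_fun3_def id_fun3_def fun_eq_iff composable1_def extensional_def)
qed

lemma comp_fun3_assoc:
  assumes "pointed_functor G C D A" "pointed_functor G D E B" "pointed_functor G E F K"
  shows "comp_fun3 C F (comp_fun3 D F K B) A = comp_fun3 C F K (comp_fun3 C E B A)"
proof -
  interpret A: pointed_functor G C D A by fact
  interpret B: pointed_functor G D E B by fact
  interpret K: pointed_functor G E F K by fact
  show ?thesis
    by (intro fun3.equality) (auto simp: comp_fun3_def fun_eq_iff composable1_def)
qed

lemma structured_ThreeCat:
  fixes G :: "('g, 'h) monoid_scheme"
  assumes "group G"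
  shows "structured_categories {C :: ('g, 'o, 'm) gray. strict_pointed G C} functor3 transformation3 map1 map2 id_fun3 comp_fun3"
proof -
  note ext = fun3_extensional_id fun3_extensional_comp
  note iffs = strict_pointed_iff[OF assms] functor3_iff[of G] transformation3_iff[of G]
  show ?thesis
  proof (intro structured_categories.intro, unfold mem_Collect_eq strict_pointed_iff[OF assms])
    fix C :: "('g, 'o, 'm) gray" assume "pointed_gray G C"
    then interpret pointed_gray G C .
    show "category C" by unfold_locales
    show "functor3 C C (id_fun3 C)"
      by (simp add: iffs pointed_gray_axioms pointed_functor_id ext)
  next
    fix C D :: "('g, 'o, 'm) gray" and A assume *: "pointed_gray G C" "pointed_gray G D" "functor3 C D A"
    then interpret pointed_functor G C D A by (simp add: iffs)
    show "is_functor C D (map1 A) (map2 A)" by (rule H.functorial)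
    show "comp_fun3 C D (id_fun3 D) A = A" "comp_fun3 C D A (id_fun3 C) = A"
      "transformation3 C D A A (\<lambda>x \<in> Obj C. idt D (map1 A x))"
      using * comp_fun3_id_left comp_fun3_id_right pointed_transformation_id by (auto simp: iffs)
  next
    fix C D E :: "('g, 'o, 'm) gray" and A B
    assume "pointed_gray G C" "pointed_gray G D" "pointed_gray G E" "functor3 C D A" "functor3 D E B"
    then show "functor3 C E (comp_fun3 C E B A)" by (auto simp: iffs pointed_functor_comp ext)
  next
    fix C D E E' :: "('g, 'o, 'm) gray" and A B K
    assume "pointed_gray G C" "pointed_gray G D" "pointed_gray G E" "pointed_gray G E'"
      "functor3 C D A" "functor3 D E B" "functor3 E E' K"
    then show "comp_fun3 C E' (comp_fun3 D E' K B) A = comp_fun3 C E' K (comp_fun3 C E B A)"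
      by (auto simp: iffs intro: comp_fun3_assoc)
  next
    fix C D :: "('g, 'o, 'm) gray" and A B \<eta>
    assume *: "pointed_gray G C" "pointed_gray G D" "transformation3 C D A B \<eta>"
    then interpret pointed_transformation G C D A B \<eta> by (simp add: iffs)
    show "functor3 C D A \<and> functor3 C D B" "\<eta> \<in> extensional (Obj C)"
      using * A.pointed_functor_axioms B.pointed_functor_axioms by (auto simp: iffs)
    show "x \<in> Obj C \<Longrightarrow> \<eta> x \<in> Hom D (map1 A x) (map1 B x)" for x by (simp add: Hom_def)
    show "f \<in> Arrs C \<Longrightarrow> \<eta> (trg f) \<cdot>\<^bsub>D\<^esub> map2 A f = map2 B f \<cdot>\<^bsub>D\<^esub> \<eta> (src f)" for f by (rule H.nat)
  next
    fix C D :: "('g, 'o, 'm) gray" and A B K \<eta> \<zeta>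
    assume "pointed_gray G C" "pointed_gray G D" "transformation3 C D A B \<eta>" "transformation3 C D B K \<zeta>"
    then show "transformation3 C D A K (\<lambda>x \<in> Obj C. \<zeta> x \<cdot>\<^bsub>D\<^esub> \<eta> x)"
      by (auto simp: iffs pointed_transformation_vcmp)
  next
    fix C D E :: "('g, 'o, 'm) gray" and A B A' B' \<eta> \<zeta>
    assume "pointed_gray G C" "pointed_gray G D" "pointed_gray G E"
      "transformation3 C D A B \<eta>" "transformation3 D E A' B' \<zeta>"
    then show "transformation3 C E (comp_fun3 C E A' A) (comp_fun3 C E B' B)
                (\<lambda>x \<in> Obj C. \<zeta> (map1 B x) \<cdot>\<^bsub>E\<^esub> map2 A' (\<eta> x))"
      by (auto simp: iffs pointed_transformation_hcmp ext)
  qed (simp_all add: id_fun3_def)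
qed

lemma ThreeCat_st_lax_eq:
  "ThreeCat_st_lax G = structured_two_cat {C. strict_pointed G C} functor3 transformation3 map1 map2 id_fun3 comp_fun3"
  by (simp add: ThreeCat_st_lax_def structured_two_cat_def)


section \<open>Strict crossed braided categories\<close>

text \<open>
  The axioms of a crossed braided category once all structure isomorphisms except the braiding
  are identities.
\<close>

locale strict_crossed = T: strict_composition C "UNIV :: unit set" "\<lambda>_. ()" "\<lambda>_. ()" "\<lambda>_. unitO C" "tenO C" "tenM C"
    + group G
  for G :: "('g, 'h) monoid_scheme" and C :: "('g, 'o, 'm) crsbrd" (structure) +
  assumes grade_carrier [simp]: "a \<in> Obj C \<Longrightarrow> fst a \<in> carrier G"
    and grade_trg [simp]: "f \<in> Arrs C \<Longrightarrow> fst (trg f) = fst (src f)"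
    and grade_tenO [simp]: "\<lbrakk>a \<in> Obj C; b \<in> Obj C\<rbrakk> \<Longrightarrow> fst (a \<otimes>\<^sub>o b) = fst a \<otimes>\<^bsub>G\<^esub> fst b"
    and grade_unitO [simp]: "fst (unitO C) = \<one>\<^bsub>G\<^esub>"
    and F_functor: "g \<in> carrier G \<Longrightarrow> is_functor C C (Fo C g) (Fm C g)"
    and F_grade [simp]: "\<lbrakk>g \<in> carrier G; a \<in> Obj C\<rbrakk> \<Longrightarrow> fst (Fo C g a) = g \<otimes>\<^bsub>G\<^esub> fst a \<otimes>\<^bsub>G\<^esub> inv\<^bsub>G\<^esub> g"
    and Fo_unit [simp]: "g \<in> carrier G \<Longrightarrow> Fo C g (unitO C) = unitO C"
    and Fo_ten [simp]: "\<lbrakk>g \<in> carrier G; a \<in> Obj C; b \<in> Obj C\<rbrakk> \<Longrightarrow> Fo C g (a \<otimes>\<^sub>o b) = Fo C g a \<otimes>\<^sub>o Fo C g b"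
    and Fm_ten [simp]: "\<lbrakk>g \<in> carrier G; f \<in> Arrs C; u \<in> Arrs C\<rbrakk> \<Longrightarrow> Fm C g (f \<otimes>\<^sub>m u) = Fm C g f \<otimes>\<^sub>m Fm C g u"
    and Fo_mult [simp]: "\<lbrakk>g \<in> carrier G; h \<in> carrier G; a \<in> Obj C\<rbrakk> \<Longrightarrow> Fo C (g \<otimes>\<^bsub>G\<^esub> h) a = Fo C g (Fo C h a)"
    and Fm_mult [simp]: "\<lbrakk>g \<in> carrier G; h \<in> carrier G; f \<in> Arrs C\<rbrakk> \<Longrightarrow> Fm C (g \<otimes>\<^bsub>G\<^esub> h) f = Fm C g (Fm C h f)"
    and Fo_one [simp]: "a \<in> Obj C \<Longrightarrow> Fo C \<one>\<^bsub>G\<^esub> a = a"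
    and Fm_one [simp]: "f \<in> Arrs C \<Longrightarrow> Fm C \<one>\<^bsub>G\<^esub> f = f"
    and brd_simps [simp]: "\<lbrakk>a \<in> Obj C; b \<in> Obj C\<rbrakk> \<Longrightarrow> iso_arr C (brd C a b)"
      "\<lbrakk>a \<in> Obj C; b \<in> Obj C\<rbrakk> \<Longrightarrow> src (brd C a b) = a \<otimes>\<^sub>o b"
      "\<lbrakk>a \<in> Obj C; b \<in> Obj C\<rbrakk> \<Longrightarrow> trg (brd C a b) = Fo C (fst a) b \<otimes>\<^sub>o a"
    and brd_nat: "\<lbrakk>f \<in> Arrs C; u \<in> Arrs C\<rbrakk>
       \<Longrightarrow> brd C (trg f) (trg u) \<cdot> (f \<otimes>\<^sub>m u) = (Fm C (fst (src f)) u \<otimes>\<^sub>m f) \<cdot> brd C (src f) (src u)"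
    and Fm_brd: "\<lbrakk>g \<in> carrier G; b \<in> Obj C; c \<in> Obj C\<rbrakk> \<Longrightarrow> Fm C g (brd C b c) = brd C (Fo C g b) (Fo C g c)"
    and brd_ten_right: "\<lbrakk>a \<in> Obj C; b \<in> Obj C; c \<in> Obj C\<rbrakk>
       \<Longrightarrow> brd C a (b \<otimes>\<^sub>o c) = (idt C (Fo C (fst a) b) \<otimes>\<^sub>m brd C a c) \<cdot> (brd C a b \<otimes>\<^sub>m idt C c)"
    and brd_ten_left: "\<lbrakk>a \<in> Obj C; b \<in> Obj C; c \<in> Obj C\<rbrakk>
       \<Longrightarrow> brd C (a \<otimes>\<^sub>o b) c = (brd C a (Fo C (fst b) c) \<otimes>\<^sub>m idt C b) \<cdot> (idt C a \<otimes>\<^sub>m brd C b c)"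
begin

lemmas [simp] = m_assoc inv_mult_group

lemma F_simps [simp]:
  assumes "g \<in> carrier G"
  shows "a \<in> Obj C \<Longrightarrow> Fo C g a \<in> Obj C" "a \<in> Obj C \<Longrightarrow> Fm C g (idt C a) = idt C (Fo C g a)"
    "f \<in> Arrs C \<Longrightarrow> Fm C g f \<in> Arrs C" "f \<in> Arrs C \<Longrightarrow> src (Fm C g f) = Fo C g (src f)"
    "f \<in> Arrs C \<Longrightarrow> trg (Fm C g f) = Fo C g (trg f)"
    "\<lbrakk>f \<in> Arrs C; u \<in> Arrs C; src u = trg f\<rbrakk> \<Longrightarrow> Fm C g (u \<cdot> f) = Fm C g u \<cdot> Fm C g f"
  using F_functor[OF assms] by (auto simp: is_functor_def Hom_def)

lemma F_iso [simp]: "\<lbrakk>g \<in> carrier G; iso_arr C f\<rbrakk> \<Longrightarrow> iso_arr C (Fm C g f)"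
proof -
  assume g: "g \<in> carrier G" and f: "iso_arr C f"
  interpret functor_pair C C "Fo C g" "Fm C g" by unfold_locales (rule F_functor[OF g])
  show ?thesis using f by simp
qed

lemma unitO_Obj [simp]: "unitO C \<in> Obj C"
  by simp

lemma F_inv_simps [simp]:
  assumes "g \<in> carrier G"
  shows "a \<in> Obj C \<Longrightarrow> Fo C g (Fo C (inv\<^bsub>G\<^esub> g) a) = a" "a \<in> Obj C \<Longrightarrow> Fo C (inv\<^bsub>G\<^esub> g) (Fo C g a) = a"
    "f \<in> Arrs C \<Longrightarrow> Fm C g (Fm C (inv\<^bsub>G\<^esub> g) f) = f" "f \<in> Arrs C \<Longrightarrow> Fm C (inv\<^bsub>G\<^esub> g) (Fm C g f) = f"
  using Fo_mult[of g "inv\<^bsub>G\<^esub> g" a] Fo_mult[of "inv\<^bsub>G\<^esub> g" g a]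
    Fm_mult[of g "inv\<^bsub>G\<^esub> g" f] Fm_mult[of "inv\<^bsub>G\<^esub> g" g f] assms by (simp_all del: Fo_mult Fm_mult)

text \<open>
  A hexagon with two unit objects says that the braiding with the unit is idempotent.
\<close>

lemma brd_unit_left [simp]: "b \<in> Obj C \<Longrightarrow> brd C (unitO C) b = idt C b"
  using T.idempotent_iso[of "brd C (unitO C) b"] brd_ten_left[of "unitO C" "unitO C" b] by simp

lemma brd_unit_right [simp]: "a \<in> Obj C \<Longrightarrow> brd C a (unitO C) = idt C a"
  using T.idempotent_iso[of "brd C a (unitO C)"] brd_ten_right[of a "unitO C" "unitO C"] by simp

end

definition strict_cells :: "('g, 'h) monoid_scheme \<Rightarrow> ('g, 'o, 'm) crsbrd \<Rightarrow> bool" where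
  "strict_cells G C \<longleftrightarrow>
     (\<forall>a \<in> Obj C. \<forall>b \<in> Obj C. \<forall>c \<in> Obj C. assr C a b c = idt C ((a \<otimes>\<^sub>o\<^bsub>C\<^esub> b) \<otimes>\<^sub>o\<^bsub>C\<^esub> c)) \<and>
     (\<forall>a \<in> Obj C. lunit C a = idt C a \<and> runit C a = idt C a \<and> Fiota C a = idt C a) \<and>
     (\<forall>g \<in> carrier G. Fi C g = idt C (unitO C)) \<and>
     (\<forall>g \<in> carrier G. \<forall>a \<in> Obj C. \<forall>b \<in> Obj C. Fpsi C g a b = idt C (Fo C g (a \<otimes>\<^sub>o\<^bsub>C\<^esub> b))) \<and>
     (\<forall>g \<in> carrier G. \<forall>h \<in> carrier G. \<forall>a \<in> Obj C. Fmu C g h a = idt C (Fo C (g \<otimes>\<^bsub>G\<^esub> h) a))"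

lemma strict_crossed_braided_alt:
  "strict_crossed_braided G C \<longleftrightarrow> crossed_braided G C \<and> strict_cells G C"
  by (simp add: strict_crossed_braided_def strict_cells_def)

text \<open>
  An identity has equal source and target, so the structure isomorphisms being identities gives
  the strict laws for objects; their naturality then gives those for morphisms.
\<close>

lemma strict_crossed_if_braided:
  assumes "crossed_braided G C" "strict_cells G C"
  shows "strict_crossed G C"
proof -
  interpret crossed_braided G C by fact
  have assr: "assr C a b c = idt C (a \<otimes>\<^sub>o\<^bsub>C\<^esub> b \<otimes>\<^sub>o\<^bsub>C\<^esub> c)" if "a \<in> Obj C" "b \<in> Obj C" "c \<in> Obj C" for a b c
    using assms(2) that by (simp add: strict_cells_def)
  have lunit: "lunit C a = idt C a" "runit C a = idt C a" "Fiota C a = idt C a" if "a \<in> Obj C" for a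
    using assms(2) that by (simp_all add: strict_cells_def)
  have Fi: "Fi C g = idt C (unitO C)" if "g \<in> carrier G" for g
    using assms(2) that by (simp add: strict_cells_def)
  have psi: "Fpsi C g a b = idt C (Fo C g (a \<otimes>\<^sub>o\<^bsub>C\<^esub> b))" if "g \<in> carrier G" "a \<in> Obj C" "b \<in> Obj C" for g a b
    using assms(2) that by (simp add: strict_cells_def)
  have Fmu: "Fmu C g h a = idt C (Fo C (g \<otimes>\<^bsub>G\<^esub> h) a)" if "g \<in> carrier G" "h \<in> carrier G" "a \<in> Obj C" for g h a
    using assms(2) that by (simp add: strict_cells_def)
  have tO [simp]: "a \<otimes>\<^sub>o\<^bsub>C\<^esub> b \<in> Obj C" "fst (a \<otimes>\<^sub>o\<^bsub>C\<^esub> b) = fst a \<otimes>\<^bsub>G\<^esub> fst b" if "a \<in> Obj C" "b \<in> Obj C" for a b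
    using tenO_closed that by auto
  have tM [simp]: "f \<otimes>\<^sub>m\<^bsub>C\<^esub> u \<in> Arrs C" "src (f \<otimes>\<^sub>m\<^bsub>C\<^esub> u) = src f \<otimes>\<^sub>o\<^bsub>C\<^esub> src u" "trg (f \<otimes>\<^sub>m\<^bsub>C\<^esub> u) = trg f \<otimes>\<^sub>o\<^bsub>C\<^esub> trg u"
    if "f \<in> Arrs C" "u \<in> Arrs C" for f u
    using tenM_closed[of f "src f" "trg f" u "src u" "trg u"] that by (auto simp: Hom_def)
  have [simp]: "unitO C \<in> Obj C" using unitO_closed by auto
  have assoc [simp]: "a \<otimes>\<^sub>o\<^bsub>C\<^esub> b \<otimes>\<^sub>o\<^bsub>C\<^esub> c = a \<otimes>\<^sub>o\<^bsub>C\<^esub> (b \<otimes>\<^sub>o\<^bsub>C\<^esub> c)" if "a \<in> Obj C" "b \<in> Obj C" "c \<in> Obj C" for a b c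
    using assr_iso[OF that] that by (simp add: assr Iso_iff)
  have unit [simp]: "unitO C \<otimes>\<^sub>o\<^bsub>C\<^esub> a = a" "a \<otimes>\<^sub>o\<^bsub>C\<^esub> unitO C = a" if "a \<in> Obj C" for a
    using lunit_iso[OF that] runit_iso[OF that] that by (simp_all add: lunit Iso_iff)
  have Fs [simp]: "Fo C g a \<in> Obj C" "Fm C g (idt C a) = idt C (Fo C g a)"
    "f \<in> Arrs C \<Longrightarrow> Fm C g f \<in> Arrs C" "f \<in> Arrs C \<Longrightarrow> src (Fm C g f) = Fo C g (src f)"
    "f \<in> Arrs C \<Longrightarrow> trg (Fm C g f) = Fo C g (trg f)"
    if "g \<in> carrier G" "a \<in> Obj C" for g a f
    using F_functor[OF that(1)] that by (auto simp: is_functor_def Hom_def)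
  have Fs' [simp]:
    "f \<in> Arrs C \<Longrightarrow> Fm C g f \<in> Arrs C" "f \<in> Arrs C \<Longrightarrow> src (Fm C g f) = Fo C g (src f)"
    "f \<in> Arrs C \<Longrightarrow> trg (Fm C g f) = Fo C g (trg f)"
    if "g \<in> carrier G" for g f
    using Fs[OF that, of "src f"] by auto
  have Fun [simp]: "Fo C g (unitO C) = unitO C" if "g \<in> carrier G" for g
    using Fi_iso[OF that] that by (simp add: Fi Iso_iff)
  have Ften [simp]: "Fo C g (a \<otimes>\<^sub>o\<^bsub>C\<^esub> b) = Fo C g a \<otimes>\<^sub>o\<^bsub>C\<^esub> Fo C g b" if "g \<in> carrier G" "a \<in> Obj C" "b \<in> Obj C" for g a b
    using Fpsi_iso[OF that] that by (simp add: psi Iso_iff)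
  have Fmult [simp]: "Fo C (g \<otimes>\<^bsub>G\<^esub> h) a = Fo C g (Fo C h a)" if "g \<in> carrier G" "h \<in> carrier G" "a \<in> Obj C" for g h a
    using Fmu_iso[OF that] that by (simp add: Fmu Iso_iff)
  have Fone [simp]: "Fo C \<one>\<^bsub>G\<^esub> a = a" if "a \<in> Obj C" for a
    using Fiota_iso[OF that] that by (simp add: lunit Iso_iff)
  have brd [simp]: "iso_arr C (brd C a b)" "src (brd C a b) = a \<otimes>\<^sub>o\<^bsub>C\<^esub> b" "trg (brd C a b) = Fo C (fst a) b \<otimes>\<^sub>o\<^bsub>C\<^esub> a"
    if "a \<in> Obj C" "b \<in> Obj C" for a b
    using brd_iso[OF that] by (auto simp: Iso_iff)
  have brdA [simp]: "brd C a b \<in> Arrs C" if "a \<in> Obj C" "b \<in> Obj C" for a b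
    using brd[OF that] by (intro iso_simps(1))
  note gr [simp] = grade_closed
  show ?thesis
  proof unfold_locales
    fix f g h assume "f \<in> Arrs C" "g \<in> Arrs C" "h \<in> Arrs C"
    then show "h \<otimes>\<^sub>m\<^bsub>C\<^esub> g \<otimes>\<^sub>m\<^bsub>C\<^esub> f = h \<otimes>\<^sub>m\<^bsub>C\<^esub> (g \<otimes>\<^sub>m\<^bsub>C\<^esub> f)"
      using assr_natural[of h "src h" "trg h" g "src g" "trg g" f "src f" "trg f"]
      by (simp add: Hom_def assr)
  next
    fix f assume "f \<in> Arrs C"
    then show "idt C (unitO C) \<otimes>\<^sub>m\<^bsub>C\<^esub> f = f" "f \<otimes>\<^sub>m\<^bsub>C\<^esub> idt C (unitO C) = f"
      using lunit_natural[of f "src f" "trg f"] runit_natural[of f "src f" "trg f"] by (simp_all add: Hom_def lunit)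
  next
    fix f g f' g' assume "f \<in> Arrs C" "g \<in> Arrs C" "f' \<in> Arrs C" "g' \<in> Arrs C" "src f' = trg f" "src g' = trg g"
    then show "(g' \<cdot>\<^bsub>C\<^esub> g) \<otimes>\<^sub>m\<^bsub>C\<^esub> (f' \<cdot>\<^bsub>C\<^esub> f) = g' \<otimes>\<^sub>m\<^bsub>C\<^esub> f' \<cdot>\<^bsub>C\<^esub> g \<otimes>\<^sub>m\<^bsub>C\<^esub> f"
      by (intro tenM_vcmp) (auto simp: Hom_def)
  next
    fix g f u assume "g \<in> carrier G" "f \<in> Arrs C" "u \<in> Arrs C"
    then show "Fm C g (f \<otimes>\<^sub>m\<^bsub>C\<^esub> u) = Fm C g f \<otimes>\<^sub>m\<^bsub>C\<^esub> Fm C g u"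
      using Fpsi_natural[of g f "src f" "trg f" u "src u" "trg u"] by (simp add: psi Hom_def)
  next
    fix g h f assume "g \<in> carrier G" "h \<in> carrier G" "f \<in> Arrs C"
    then show "Fm C (g \<otimes>\<^bsub>G\<^esub> h) f = Fm C g (Fm C h f)"
      using Fmu_natural[of g h f "src f" "trg f"] by (simp add: Fmu Hom_def)
  next
    fix f assume "f \<in> Arrs C"
    then show "Fm C \<one>\<^bsub>G\<^esub> f = f"
      using Fiota_natural[of f "src f" "trg f"] by (simp add: lunit Hom_def)
  next
    fix f u assume "f \<in> Arrs C" "u \<in> Arrs C"
    then show "brd C (trg f) (trg u) \<cdot>\<^bsub>C\<^esub> f \<otimes>\<^sub>m\<^bsub>C\<^esub> u = Fm C (fst (src f)) u \<otimes>\<^sub>m\<^bsub>C\<^esub> f \<cdot>\<^bsub>C\<^esub> brd C (src f) (src u)"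
      by (intro brd_natural) (auto simp: Hom_def)
  next
    fix g b c assume *: "g \<in> carrier G" "b \<in> Obj C" "c \<in> Obj C"
    have e: "g \<otimes>\<^bsub>G\<^esub> fst b \<otimes>\<^bsub>G\<^esub> inv\<^bsub>G\<^esub> g \<otimes>\<^bsub>G\<^esub> g = g \<otimes>\<^bsub>G\<^esub> fst b" using * by (simp add: m_assoc)
    have e2: "Fo C (g \<otimes>\<^bsub>G\<^esub> fst b \<otimes>\<^bsub>G\<^esub> inv\<^bsub>G\<^esub> g) (Fo C g c) = Fo C g (Fo C (fst b) c)"
      using * Fmult[of "g \<otimes>\<^bsub>G\<^esub> fst b \<otimes>\<^bsub>G\<^esub> inv\<^bsub>G\<^esub> g" g c] by (simp add: e del: Fmult) simp
    show "Fm C g (brd C b c) = brd C (Fo C g b) (Fo C g c)"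
      using brd_F[OF *, of "fst b"] * by (simp add: psi Fmu e e2 F_grade tenM_idt)
  next
    fix a b c assume "a \<in> Obj C" "b \<in> Obj C" "c \<in> Obj C"
    then show "brd C a (b \<otimes>\<^sub>o\<^bsub>C\<^esub> c) = (idt C (Fo C (fst a) b) \<otimes>\<^sub>m\<^bsub>C\<^esub> brd C a c) \<cdot>\<^bsub>C\<^esub> (brd C a b \<otimes>\<^sub>m\<^bsub>C\<^esub> idt C c)"
      using hexagon_right[of a b c "fst a"] by (simp add: psi assr tenM_idt)
  next
    fix a b c assume "a \<in> Obj C" "b \<in> Obj C" "c \<in> Obj C"
    then show "brd C (a \<otimes>\<^sub>o\<^bsub>C\<^esub> b) c = (brd C a (Fo C (fst b) c) \<otimes>\<^sub>m\<^bsub>C\<^esub> idt C b) \<cdot>\<^bsub>C\<^esub> (idt C a \<otimes>\<^sub>m\<^bsub>C\<^esub> brd C b c)"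
      using hexagon_left[of a b c "fst a" "fst b"] by (simp add: Fmu assr tenM_idt)
  qed (simp_all add: grade_arr F_functor F_grade unitO_closed tenM_idt)
qed

lemma braided_if_strict_crossed:
  assumes "strict_crossed G C" "strict_cells G C"
  shows "crossed_braided G C"
proof -
  interpret strict_crossed G C by fact
  have assr: "assr C a b c = idt C (a \<otimes>\<^sub>o\<^bsub>C\<^esub> b \<otimes>\<^sub>o\<^bsub>C\<^esub> c)" if "a \<in> Obj C" "b \<in> Obj C" "c \<in> Obj C" for a b c
    using assms(2) that by (simp add: strict_cells_def)
  have lunit: "lunit C a = idt C a" "runit C a = idt C a" "Fiota C a = idt C a" if "a \<in> Obj C" for a
    using assms(2) that by (simp_all add: strict_cells_def)
  have Fi: "Fi C g = idt C (unitO C)" if "g \<in> carrier G" for g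
    using assms(2) that by (simp add: strict_cells_def)
  have psi: "Fpsi C g a b = idt C (Fo C g (a \<otimes>\<^sub>o\<^bsub>C\<^esub> b))" if "g \<in> carrier G" "a \<in> Obj C" "b \<in> Obj C" for g a b
    using assms(2) that by (simp add: strict_cells_def)
  have Fmu: "Fmu C g h a = idt C (Fo C (g \<otimes>\<^bsub>G\<^esub> h) a)" if "g \<in> carrier G" "h \<in> carrier G" "a \<in> Obj C" for g h a
    using assms(2) that by (simp add: strict_cells_def)
  show ?thesis
    apply unfold_locales
    apply (simp_all add: F_functor T.Iso_iff assr lunit Fi psi Fmu del: One_nat_def)
    apply (auto simp: Hom_def T.tA_vcmp brd_nat Fm_brd brd_ten_left brd_ten_right assr lunit psi Fmu)
    done
qed

lemma strict_crossed_braided_iff: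
  "strict_crossed_braided G C \<longleftrightarrow> strict_crossed G C \<and> strict_cells G C"
  unfolding strict_crossed_braided_alt using strict_crossed_if_braided braided_if_strict_crossed by blast

locale strict_crossed_functor = C: strict_crossed G C + D: strict_crossed G D +
    T: weak_functor C "UNIV :: unit set" "\<lambda>_. ()" "\<lambda>_. ()" "\<lambda>_. unitO C" "tenO C" "tenM C"
      D "UNIV :: unit set" "\<lambda>_. ()" "\<lambda>_. ()" "\<lambda>_. unitO D" "tenO D" "tenM D"
      "cobj A" "carr A" "\<lambda>_. ()" "\<lambda>_. cunit A" "cten A"
  for G :: "('g, 'h) monoid_scheme" and C D :: "('g, 'o, 'm) crsbrd" and A :: "('g, 'o, 'm) crsfun" +
  assumes grade_cobj [simp]: "a \<in> Obj C \<Longrightarrow> fst (cobj A a) = fst a"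
    and cact_simps [simp]:
      "\<lbrakk>g \<in> carrier G; x \<in> Obj C\<rbrakk> \<Longrightarrow> iso_arr D (cact A g x)"
      "\<lbrakk>g \<in> carrier G; x \<in> Obj C\<rbrakk> \<Longrightarrow> src (cact A g x) = Fo D g (cobj A x)"
      "\<lbrakk>g \<in> carrier G; x \<in> Obj C\<rbrakk> \<Longrightarrow> trg (cact A g x) = cobj A (Fo C g x)"
    and cact_nat: "\<lbrakk>g \<in> carrier G; f \<in> Arrs C\<rbrakk>
       \<Longrightarrow> cact A g (trg f) \<cdot>\<^bsub>D\<^esub> Fm D g (carr A f) = carr A (Fm C g f) \<cdot>\<^bsub>D\<^esub> cact A g (src f)"
    and cact_cten: "\<lbrakk>g \<in> carrier G; x \<in> Obj C; y \<in> Obj C\<rbrakk>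
       \<Longrightarrow> cact A g (x \<otimes>\<^sub>o\<^bsub>C\<^esub> y) \<cdot>\<^bsub>D\<^esub> Fm D g (cten A x y)
           = cten A (Fo C g x) (Fo C g y) \<cdot>\<^bsub>D\<^esub> (cact A g x \<otimes>\<^sub>m\<^bsub>D\<^esub> cact A g y)"
    and cact_cunit: "g \<in> carrier G \<Longrightarrow> cact A g (unitO C) \<cdot>\<^bsub>D\<^esub> Fm D g (cunit A) = cunit A"
    and cact_mul: "\<lbrakk>g \<in> carrier G; h \<in> carrier G; x \<in> Obj C\<rbrakk>
       \<Longrightarrow> cact A (g \<otimes>\<^bsub>G\<^esub> h) x = cact A g (Fo C h x) \<cdot>\<^bsub>D\<^esub> Fm D g (cact A h x)"
    and carr_brd: "\<lbrakk>a \<in> Obj C; b \<in> Obj C\<rbrakk>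
       \<Longrightarrow> carr A (brd C a b) \<cdot>\<^bsub>D\<^esub> cten A a b = cten A (Fo C (fst a) b) a
           \<cdot>\<^bsub>D\<^esub> ((cact A (fst a) b \<otimes>\<^sub>m\<^bsub>D\<^esub> idt D (cobj A a)) \<cdot>\<^bsub>D\<^esub> brd D (cobj A a) (cobj A b))"

definition crsfun_extensional ::
    "('g, 'h) monoid_scheme \<Rightarrow> ('g, 'o, 'm) crsbrd \<Rightarrow> ('g, 'o, 'm) crsfun \<Rightarrow> bool" where
  "crsfun_extensional G C A \<longleftrightarrow> cobj A \<in> extensional (Obj C) \<and> carr A \<in> extensional (Arrs C) \<and>
     (\<forall>a b. \<not> (a \<in> Obj C \<and> b \<in> Obj C) \<longrightarrow> cten A a b = undefined) \<and>
     (\<forall>g x. \<not> (g \<in> carrier G \<and> x \<in> Obj C) \<longrightarrow> cact A g x = undefined)"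

lemma strict_functor_if_crossed_functor:
  assumes "strict_crossed_braided G C" "strict_crossed_braided G D" "crossed_functor G C D A"
  shows "strict_crossed_functor G C D A" "crsfun_extensional G C A"
proof -
  interpret crossed_functor G C D A by fact
  show "crsfun_extensional G C A"
    unfolding crsfun_extensional_def using cobj_ext carr_ext cten_ext cact_ext by blast
  interpret SC: strict_crossed G C using assms(1) by (simp add: strict_crossed_braided_iff)
  interpret SD: strict_crossed G D using assms(2) by (simp add: strict_crossed_braided_iff)
  note cells = assms(1,2)[unfolded strict_crossed_braided_iff strict_cells_def]
  interpret P: functor_pair C D "cobj A" "carr A" by unfold_locales (rule functorial)
  have [simp]: "iso_arr D (cunit A)" "src (cunit A) = unitO D" "trg (cunit A) = cobj A (unitO C)"
    using cunit_iso by (auto simp: D.Iso_iff)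
  have [simp]: "iso_arr D (cten A a b)" "src (cten A a b) = cobj A a \<otimes>\<^sub>o\<^bsub>D\<^esub> cobj A b"
    "trg (cten A a b) = cobj A (a \<otimes>\<^sub>o\<^bsub>C\<^esub> b)" if "a \<in> Obj C" "b \<in> Obj C" for a b
    using cten_iso[OF that] by (auto simp: D.Iso_iff)
  have [simp]: "iso_arr D (cact A g x)" "src (cact A g x) = Fo D g (cobj A x)"
      "trg (cact A g x) = cobj A (Fo C g x)" if "g \<in> carrier G" "x \<in> Obj C" for g x
    using cact_iso[OF that] by (auto simp: D.Iso_iff)
  have [simp]: "cunit A \<in> Arrs D" by (rule D.iso_simps(1)) simp
  have [simp]: "cten A a b \<in> Arrs D" if "a \<in> Obj C" "b \<in> Obj C" for a b
    by (rule D.iso_simps(1)) (simp add: that)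
  have [simp]: "cact A g x \<in> Arrs D" if "g \<in> carrier G" "x \<in> Obj C" for g x
    by (rule D.iso_simps(1)) (simp add: that)
  note gr [simp] = grade_preserving
  show "strict_crossed_functor G C D A"
  proof unfold_locales
    fix f g assume "f \<in> Arrs C" "g \<in> Arrs C"
    then show "cten A (trg g) (trg f) \<cdot>\<^bsub>D\<^esub> (carr A g \<otimes>\<^sub>m\<^bsub>D\<^esub> carr A f) = carr A (g \<otimes>\<^sub>m\<^bsub>C\<^esub> f) \<cdot>\<^bsub>D\<^esub> cten A (src g) (src f)"
      by (intro cten_natural) (auto simp: Hom_def)
  next
    fix x y z assume "x \<in> Obj C" "y \<in> Obj C" "z \<in> Obj C"
    then show "cten A z (y \<otimes>\<^sub>o\<^bsub>C\<^esub> x) \<cdot>\<^bsub>D\<^esub> (idt D (cobj A z) \<otimes>\<^sub>m\<^bsub>D\<^esub> cten A y x) =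
       cten A (z \<otimes>\<^sub>o\<^bsub>C\<^esub> y) x \<cdot>\<^bsub>D\<^esub> (cten A z y \<otimes>\<^sub>m\<^bsub>D\<^esub> idt D (cobj A x))"
      using cten_assr[of z y x] cells by simp
  next
    fix x assume "x \<in> Obj C"
    then show "cten A (unitO C) x \<cdot>\<^bsub>D\<^esub> (cunit A \<otimes>\<^sub>m\<^bsub>D\<^esub> idt D (cobj A x)) = idt D (cobj A x)"
      "cten A x (unitO C) \<cdot>\<^bsub>D\<^esub> (idt D (cobj A x) \<otimes>\<^sub>m\<^bsub>D\<^esub> cunit A) = idt D (cobj A x)"
      using cten_lunit[of x] cten_runit[of x] cells by simp_all
  next
    fix g f assume "g \<in> carrier G" "f \<in> Arrs C"
    then show "cact A g (trg f) \<cdot>\<^bsub>D\<^esub> Fm D g (carr A f) = carr A (Fm C g f) \<cdot>\<^bsub>D\<^esub> cact A g (src f)"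
      by (intro cact_natural) (auto simp: Hom_def)
  next
    fix g x y assume "g \<in> carrier G" "x \<in> Obj C" "y \<in> Obj C"
    then show "cact A g (x \<otimes>\<^sub>o\<^bsub>C\<^esub> y) \<cdot>\<^bsub>D\<^esub> Fm D g (cten A x y)
           = cten A (Fo C g x) (Fo C g y) \<cdot>\<^bsub>D\<^esub> (cact A g x \<otimes>\<^sub>m\<^bsub>D\<^esub> cact A g y)"
      using cact_ten[of g x y] cells by simp
  next
    fix g assume "g \<in> carrier G"
    then show "cact A g (unitO C) \<cdot>\<^bsub>D\<^esub> Fm D g (cunit A) = cunit A"
      using cact_unit[of g] cells by simp
  next
    fix g h x assume "g \<in> carrier G" "h \<in> carrier G" "x \<in> Obj C"
    then show "cact A (g \<otimes>\<^bsub>G\<^esub> h) x = cact A g (Fo C h x) \<cdot>\<^bsub>D\<^esub> Fm D g (cact A h x)"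
      using cact_mult[of g h x] cells by simp
  next
    fix a b assume "a \<in> Obj C" "b \<in> Obj C"
    then show "carr A (brd C a b) \<cdot>\<^bsub>D\<^esub> cten A a b = cten A (Fo C (fst a) b) a
           \<cdot>\<^bsub>D\<^esub> ((cact A (fst a) b \<otimes>\<^sub>m\<^bsub>D\<^esub> idt D (cobj A a)) \<cdot>\<^bsub>D\<^esub> brd D (cobj A a) (cobj A b))"
      using cact_brd[of a b "fst a"] by simp
  qed simp_all
qed

lemma crossed_functor_if_strict_functor:
  assumes "strict_crossed_braided G C" "strict_crossed_braided G D"
    "strict_crossed_functor G C D A" "crsfun_extensional G C A"
  shows "crossed_functor G C D A"
proof -
  interpret strict_crossed_functor G C D A by fact
  interpret SC: crossed_braided G C using assms(1) by (simp add: strict_crossed_braided_alt)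
  interpret SD: crossed_braided G D using assms(2) by (simp add: strict_crossed_braided_alt)
  note cells = assms(1,2)[unfolded strict_crossed_braided_iff strict_cells_def]
  show ?thesis
  proof unfold_locales
    fix f u a a' b b' assume "f \<in> Hom C a a'" "u \<in> Hom C b b'"
    then show "cten A a' b' \<cdot>\<^bsub>D\<^esub> (carr A f \<otimes>\<^sub>m\<^bsub>D\<^esub> carr A u) = carr A (f \<otimes>\<^sub>m\<^bsub>C\<^esub> u) \<cdot>\<^bsub>D\<^esub> cten A a b"
      using T.mu_natural[of u f] by (auto simp: Hom_def)
  next
    fix a b c assume "a \<in> Obj C" "b \<in> Obj C" "c \<in> Obj C"
    then show "carr A (assr C a b c) \<cdot>\<^bsub>D\<^esub> cten A (a \<otimes>\<^sub>o\<^bsub>C\<^esub> b) c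
                \<cdot>\<^bsub>D\<^esub> (cten A a b \<otimes>\<^sub>m\<^bsub>D\<^esub> idt D (cobj A c))
              = cten A a (b \<otimes>\<^sub>o\<^bsub>C\<^esub> c) \<cdot>\<^bsub>D\<^esub> (idt D (cobj A a) \<otimes>\<^sub>m\<^bsub>D\<^esub> cten A b c)
                \<cdot>\<^bsub>D\<^esub> assr D (cobj A a) (cobj A b) (cobj A c)"
      using T.mu_assoc[of c b a] cells by simp
  next
    fix a assume "a \<in> Obj C"
    then show "carr A (lunit C a) \<cdot>\<^bsub>D\<^esub> cten A (unitO C) a \<cdot>\<^bsub>D\<^esub> (cunit A \<otimes>\<^sub>m\<^bsub>D\<^esub> idt D (cobj A a)) = lunit D (cobj A a)"
      "carr A (runit C a) \<cdot>\<^bsub>D\<^esub> cten A a (unitO C) \<cdot>\<^bsub>D\<^esub> (idt D (cobj A a) \<otimes>\<^sub>m\<^bsub>D\<^esub> cunit A) = runit D (cobj A a)"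
      using T.mu_unit_left[of a] T.mu_unit_right[of a] cells by simp_all
  next
    fix g f x x' assume "g \<in> carrier G" "f \<in> Hom C x x'"
    then show "cact A g x' \<cdot>\<^bsub>D\<^esub> Fm D g (carr A f) = carr A (Fm C g f) \<cdot>\<^bsub>D\<^esub> cact A g x"
      using cact_nat[of g f] by (auto simp: Hom_def)
  next
    fix g x y assume "g \<in> carrier G" "x \<in> Obj C" "y \<in> Obj C"
    then show "cact A g (x \<otimes>\<^sub>o\<^bsub>C\<^esub> y) \<cdot>\<^bsub>D\<^esub> Fm D g (cten A x y) \<cdot>\<^bsub>D\<^esub> Fpsi D g (cobj A x) (cobj A y)
              = carr A (Fpsi C g x y) \<cdot>\<^bsub>D\<^esub> cten A (Fo C g x) (Fo C g y)
                \<cdot>\<^bsub>D\<^esub> (cact A g x \<otimes>\<^sub>m\<^bsub>D\<^esub> cact A g y)"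
      using cact_cten[of g x y] cells by simp
  next
    fix g assume "g \<in> carrier G"
    then show "cact A g (unitO C) \<cdot>\<^bsub>D\<^esub> Fm D g (cunit A) \<cdot>\<^bsub>D\<^esub> Fi D g = carr A (Fi C g) \<cdot>\<^bsub>D\<^esub> cunit A"
      using cact_cunit[of g] cells by simp
  next
    fix g h x assume "g \<in> carrier G" "h \<in> carrier G" "x \<in> Obj C"
    then show "cact A (g \<otimes>\<^bsub>G\<^esub> h) x \<cdot>\<^bsub>D\<^esub> Fmu D g h (cobj A x)
              = carr A (Fmu C g h x) \<cdot>\<^bsub>D\<^esub> cact A g (Fo C h x) \<cdot>\<^bsub>D\<^esub> Fm D g (cact A h x)"
      using cact_mul[of g h x] cells by simp
  next
    fix a b g assume "a \<in> Obj C" "b \<in> Obj C" "g = fst a"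
    then show "carr A (brd C a b) \<cdot>\<^bsub>D\<^esub> cten A a b
              = cten A (Fo C g b) a \<cdot>\<^bsub>D\<^esub> (cact A g b \<otimes>\<^sub>m\<^bsub>D\<^esub> idt D (cobj A a))
                \<cdot>\<^bsub>D\<^esub> brd D (cobj A a) (cobj A b)"
      using carr_brd[of a b] by simp
  qed (use assms(4) T.functorial in \<open>auto simp: crsfun_extensional_def D.T.Iso_iff\<close>)
qed

lemma crossed_functor_iff:
  "\<lbrakk>strict_crossed_braided G C; strict_crossed_braided G D\<rbrakk>
   \<Longrightarrow> crossed_functor G C D A \<longleftrightarrow> strict_crossed_functor G C D A \<and> crsfun_extensional G C A"
  using strict_functor_if_crossed_functor crossed_functor_if_strict_functor by blast

lemma crsfun_extensional_id: "crsfun_extensional G C (id_crsfun G C)"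
  by (auto simp: crsfun_extensional_def id_crsfun_def)

lemma crsfun_extensional_comp: "crsfun_extensional G C (comp_crsfun G C E B A)"
  by (auto simp: crsfun_extensional_def comp_crsfun_def)

lemma comp_crsfun_simps [simp]:
  "x \<in> Obj C \<Longrightarrow> cobj (comp_crsfun G C E B A) x = cobj B (cobj A x)"
  "f \<in> Arrs C \<Longrightarrow> carr (comp_crsfun G C E B A) f = carr B (carr A f)"
  "cunit (comp_crsfun G C E B A) = carr B (cunit A) \<cdot>\<^bsub>E\<^esub> cunit B"
  "\<lbrakk>x \<in> Obj C; y \<in> Obj C\<rbrakk> \<Longrightarrow> cten (comp_crsfun G C E B A) x y = carr B (cten A x y) \<cdot>\<^bsub>E\<^esub> cten B (cobj A x) (cobj A y)"
  "\<lbrakk>g \<in> carrier G; x \<in> Obj C\<rbrakk> \<Longrightarrow> cact (comp_crsfun G C E B A) g x = carr B (cact A g x) \<cdot>\<^bsub>E\<^esub> cact B g (cobj A x)"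
  by (simp_all add: comp_crsfun_def)

lemma strict_crossed_functor_id:
  assumes "strict_crossed G C" shows "strict_crossed_functor G C C (id_crsfun G C)"
proof -
  interpret strict_crossed G C by fact
  show ?thesis
    apply (intro strict_crossed_functor.intro strict_crossed_functor_axioms.intro)
    apply fact
    apply fact
    apply (rule T.weak_functor_identity; simp add: id_crsfun_def)
    apply (simp_all add: id_crsfun_def)
    done
qed

text \<open>
  Each law of the composite is the law of \<open>A\<close> mapped by \<open>B\<close>, followed by the law of \<open>B\<close>; between
  them stands naturality of \<open>cact B\<close> or \<open>cten B\<close> at a structure cell of \<open>A\<close>.
\<close>

lemma strict_crossed_functor_comp:
  assumes "strict_crossed_functor G C D A" "strict_crossed_functor G D E B"
  shows "strict_crossed_functor G C E (comp_crsfun G C E B A)"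
proof -
  interpret A: strict_crossed_functor G C D A by fact
  interpret B: strict_crossed_functor G D E B by fact
  let ?K = "comp_crsfun G C E B A"
  have T: "weak_functor C (UNIV :: unit set) (\<lambda>_. ()) (\<lambda>_. ()) (\<lambda>_. unitO C) (tenO C) (tenM C)
      E (UNIV :: unit set) (\<lambda>_. ()) (\<lambda>_. ()) (\<lambda>_. unitO E) (tenO E) (tenM E)
      (cobj ?K) (carr ?K) (\<lambda>_. ()) (\<lambda>_. cunit ?K) (cten ?K)"
    by (rule weak_functor_composite[OF A.T.weak_functor_axioms B.T.weak_functor_axioms]) simp_all
  show ?thesis
  proof (intro strict_crossed_functor.intro strict_crossed_functor_axioms.intro)
    fix g f assume *: "g \<in> carrier G" "f \<in> Arrs C"
    have "cact ?K g (trg f) \<cdot>\<^bsub>E\<^esub> Fm E g (carr ?K f)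
       = carr B (cact A g (trg f)) \<cdot>\<^bsub>E\<^esub> (carr B (Fm D g (carr A f)) \<cdot>\<^bsub>E\<^esub> cact B g (cobj A (src f)))"
      using * B.cact_nat[of g "carr A f"] by simp
    also have "\<dots> = carr B (cact A g (trg f) \<cdot>\<^bsub>D\<^esub> Fm D g (carr A f)) \<cdot>\<^bsub>E\<^esub> cact B g (cobj A (src f))"
      using * by simp
    also have "\<dots> = carr ?K (Fm C g f) \<cdot>\<^bsub>E\<^esub> cact ?K g (src f)"
      using * by (simp add: A.cact_nat)
    finally show "cact ?K g (trg f) \<cdot>\<^bsub>E\<^esub> Fm E g (carr ?K f) = carr ?K (Fm C g f) \<cdot>\<^bsub>E\<^esub> cact ?K g (src f)" .
  next
    fix g x y assume *: "g \<in> carrier G" "x \<in> Obj C" "y \<in> Obj C"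
    let ?m = "cten A x y" and ?x = "cobj A x" and ?y = "cobj A y"
    have "cact ?K g (x \<otimes>\<^sub>o\<^bsub>C\<^esub> y) \<cdot>\<^bsub>E\<^esub> Fm E g (cten ?K x y)
      = carr B (cact A g (x \<otimes>\<^sub>o\<^bsub>C\<^esub> y)) \<cdot>\<^bsub>E\<^esub> ((cact B g (cobj A (x \<otimes>\<^sub>o\<^bsub>C\<^esub> y)) \<cdot>\<^bsub>E\<^esub> Fm E g (carr B ?m)) \<cdot>\<^bsub>E\<^esub> Fm E g (cten B ?x ?y))"
      using * by simp
    also have "\<dots> = carr B (cact A g (x \<otimes>\<^sub>o\<^bsub>C\<^esub> y)) \<cdot>\<^bsub>E\<^esub> ((carr B (Fm D g ?m) \<cdot>\<^bsub>E\<^esub> cact B g (?x \<otimes>\<^sub>o\<^bsub>D\<^esub> ?y)) \<cdot>\<^bsub>E\<^esub> Fm E g (cten B ?x ?y))"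
      using * B.cact_nat[of g ?m] by simp
    also have "\<dots> = carr B (cact A g (x \<otimes>\<^sub>o\<^bsub>C\<^esub> y) \<cdot>\<^bsub>D\<^esub> Fm D g ?m) \<cdot>\<^bsub>E\<^esub> (cact B g (?x \<otimes>\<^sub>o\<^bsub>D\<^esub> ?y) \<cdot>\<^bsub>E\<^esub> Fm E g (cten B ?x ?y))"
      using * by simp
    also have "\<dots> = carr B (cten A (Fo C g x) (Fo C g y)) \<cdot>\<^bsub>E\<^esub> ((carr B (cact A g x \<otimes>\<^sub>m\<^bsub>D\<^esub> cact A g y)
        \<cdot>\<^bsub>E\<^esub> cten B (Fo D g ?x) (Fo D g ?y)) \<cdot>\<^bsub>E\<^esub> (cact B g ?x \<otimes>\<^sub>m\<^bsub>E\<^esub> cact B g ?y))"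
      using * by (simp add: A.cact_cten B.cact_cten)
    also have "carr B (cact A g x \<otimes>\<^sub>m\<^bsub>D\<^esub> cact A g y) \<cdot>\<^bsub>E\<^esub> cten B (Fo D g ?x) (Fo D g ?y)
       = cten B (cobj A (Fo C g x)) (cobj A (Fo C g y)) \<cdot>\<^bsub>E\<^esub> (carr B (cact A g x) \<otimes>\<^sub>m\<^bsub>E\<^esub> carr B (cact A g y))"
      using * B.T.mu_natural[of "cact A g y" "cact A g x"] by simp
    also have "carr B (cten A (Fo C g x) (Fo C g y)) \<cdot>\<^bsub>E\<^esub> (cten B (cobj A (Fo C g x)) (cobj A (Fo C g y))
         \<cdot>\<^bsub>E\<^esub> (carr B (cact A g x) \<otimes>\<^sub>m\<^bsub>E\<^esub> carr B (cact A g y)) \<cdot>\<^bsub>E\<^esub> (cact B g ?x \<otimes>\<^sub>m\<^bsub>E\<^esub> cact B g ?y))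
       = cten ?K (Fo C g x) (Fo C g y) \<cdot>\<^bsub>E\<^esub> (cact ?K g x \<otimes>\<^sub>m\<^bsub>E\<^esub> cact ?K g y)"
      using * by (simp add: B.D.T.merge)
    finally show "cact ?K g (x \<otimes>\<^sub>o\<^bsub>C\<^esub> y) \<cdot>\<^bsub>E\<^esub> Fm E g (cten ?K x y)
       = cten ?K (Fo C g x) (Fo C g y) \<cdot>\<^bsub>E\<^esub> (cact ?K g x \<otimes>\<^sub>m\<^bsub>E\<^esub> cact ?K g y)" .
  next
    fix g assume *: "g \<in> carrier G"
    have "cact ?K g (unitO C) \<cdot>\<^bsub>E\<^esub> Fm E g (cunit ?K)
      = carr B (cact A g (unitO C)) \<cdot>\<^bsub>E\<^esub> ((cact B g (cobj A (unitO C)) \<cdot>\<^bsub>E\<^esub> Fm E g (carr B (cunit A))) \<cdot>\<^bsub>E\<^esub> Fm E g (cunit B))"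
      using * by simp
    also have "\<dots> = carr B (cact A g (unitO C) \<cdot>\<^bsub>D\<^esub> Fm D g (cunit A)) \<cdot>\<^bsub>E\<^esub> (cact B g (unitO D) \<cdot>\<^bsub>E\<^esub> Fm E g (cunit B))"
      using * B.cact_nat[of g "cunit A"] by simp
    also have "\<dots> = cunit ?K" using * by (simp add: A.cact_cunit B.cact_cunit del: B.T.fa_vcmp)
    finally show "cact ?K g (unitO C) \<cdot>\<^bsub>E\<^esub> Fm E g (cunit ?K) = cunit ?K" .
  next
    fix g h x assume *: "g \<in> carrier G" "h \<in> carrier G" "x \<in> Obj C"
    have "cact ?K (g \<otimes>\<^bsub>G\<^esub> h) x = carr B (cact A g (Fo C h x)) \<cdot>\<^bsub>E\<^esub> ((carr B (Fm D g (cact A h x))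
        \<cdot>\<^bsub>E\<^esub> cact B g (Fo D h (cobj A x))) \<cdot>\<^bsub>E\<^esub> Fm E g (cact B h (cobj A x)))"
      using * by (simp add: A.cact_mul B.cact_mul)
    also have "carr B (Fm D g (cact A h x)) \<cdot>\<^bsub>E\<^esub> cact B g (Fo D h (cobj A x))
       = cact B g (cobj A (Fo C h x)) \<cdot>\<^bsub>E\<^esub> Fm E g (carr B (cact A h x))"
      using * B.cact_nat[of g "cact A h x"] by simp
    also have "carr B (cact A g (Fo C h x)) \<cdot>\<^bsub>E\<^esub> (cact B g (cobj A (Fo C h x)) \<cdot>\<^bsub>E\<^esub> Fm E g (carr B (cact A h x)) \<cdot>\<^bsub>E\<^esub> Fm E g (cact B h (cobj A x)))
       = cact ?K g (Fo C h x) \<cdot>\<^bsub>E\<^esub> Fm E g (cact ?K h x)"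
      using * by simp
    finally show "cact ?K (g \<otimes>\<^bsub>G\<^esub> h) x = cact ?K g (Fo C h x) \<cdot>\<^bsub>E\<^esub> Fm E g (cact ?K h x)" .
  next
    fix a b assume *: "a \<in> Obj C" "b \<in> Obj C"
    let ?g = "fst a" and ?a = "cobj A a" and ?b = "cobj A b"
    let ?w = "cact A ?g b \<otimes>\<^sub>m\<^bsub>D\<^esub> idt D ?a"
    have "carr ?K (brd C a b) \<cdot>\<^bsub>E\<^esub> cten ?K a b = carr B (carr A (brd C a b) \<cdot>\<^bsub>D\<^esub> cten A a b) \<cdot>\<^bsub>E\<^esub> cten B ?a ?b"
      using * by simp
    also have "\<dots> = carr B (cten A (Fo C ?g b) a) \<cdot>\<^bsub>E\<^esub> (carr B ?w \<cdot>\<^bsub>E\<^esub> (carr B (brd D ?a ?b) \<cdot>\<^bsub>E\<^esub> cten B ?a ?b))"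
      using * by (simp add: A.carr_brd)
    also have "\<dots> = carr B (cten A (Fo C ?g b) a) \<cdot>\<^bsub>E\<^esub> ((carr B ?w \<cdot>\<^bsub>E\<^esub> cten B (Fo D ?g ?b) ?a)
         \<cdot>\<^bsub>E\<^esub> ((cact B ?g ?b \<otimes>\<^sub>m\<^bsub>E\<^esub> idt E (cobj B ?a)) \<cdot>\<^bsub>E\<^esub> brd E (cobj B ?a) (cobj B ?b)))"
      using * by (simp add: B.carr_brd)
    also have "carr B ?w \<cdot>\<^bsub>E\<^esub> cten B (Fo D ?g ?b) ?a
       = cten B (cobj A (Fo C ?g b)) ?a \<cdot>\<^bsub>E\<^esub> (carr B (cact A ?g b) \<otimes>\<^sub>m\<^bsub>E\<^esub> idt E (cobj B ?a))"
      using * B.T.mu_natural[of "idt D ?a" "cact A ?g b"] by simp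
    also have "carr B (cten A (Fo C ?g b) a) \<cdot>\<^bsub>E\<^esub> (cten B (cobj A (Fo C ?g b)) ?a \<cdot>\<^bsub>E\<^esub> (carr B (cact A ?g b) \<otimes>\<^sub>m\<^bsub>E\<^esub> idt E (cobj B ?a))
         \<cdot>\<^bsub>E\<^esub> ((cact B ?g ?b \<otimes>\<^sub>m\<^bsub>E\<^esub> idt E (cobj B ?a)) \<cdot>\<^bsub>E\<^esub> brd E (cobj B ?a) (cobj B ?b)))
       = cten ?K (Fo C ?g b) a \<cdot>\<^bsub>E\<^esub> ((cact ?K ?g b \<otimes>\<^sub>m\<^bsub>E\<^esub> idt E (cobj ?K a)) \<cdot>\<^bsub>E\<^esub> brd E (cobj ?K a) (cobj ?K b))"
      using * by (simp add: B.D.T.merge_r)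
    finally show "carr ?K (brd C a b) \<cdot>\<^bsub>E\<^esub> cten ?K a b
       = cten ?K (Fo C ?g b) a \<cdot>\<^bsub>E\<^esub> ((cact ?K ?g b \<otimes>\<^sub>m\<^bsub>E\<^esub> idt E (cobj ?K a)) \<cdot>\<^bsub>E\<^esub> brd E (cobj ?K a) (cobj ?K b))" .
  qed (use T A.C.strict_crossed_axioms B.D.strict_crossed_axioms in simp_all)
qed

locale strict_crossed_transformation = A: strict_crossed_functor G C D A + B: strict_crossed_functor G C D B +
    T: weak_transformation C "UNIV :: unit set" "\<lambda>_. ()" "\<lambda>_. ()" "\<lambda>_. unitO C" "tenO C" "tenM C"
      D "UNIV :: unit set" "\<lambda>_. ()" "\<lambda>_. ()" "\<lambda>_. unitO D" "tenO D" "tenM D"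
      "cobj A" "carr A" "\<lambda>_. ()" "\<lambda>_. cunit A" "cten A"
      "cobj B" "carr B" "\<lambda>_. cunit B" "cten B" \<eta>
  for G :: "('g, 'h) monoid_scheme" and C D :: "('g, 'o, 'm) crsbrd" and A B :: "('g, 'o, 'm) crsfun" and \<eta> +
  assumes resp_act: "\<lbrakk>g \<in> carrier G; x \<in> Obj C\<rbrakk>
    \<Longrightarrow> \<eta> (Fo C g x) \<cdot>\<^bsub>D\<^esub> cact A g x = cact B g x \<cdot>\<^bsub>D\<^esub> Fm D g (\<eta> x)"

lemma crossed_transformation_iff:
  assumes "strict_crossed_braided G C" "strict_crossed_braided G D"
  shows "crossed_transformation G C D A B \<eta> \<longleftrightarrow> strict_crossed_transformation G C D A B \<eta> \<and>
    crsfun_extensional G C A \<and> crsfun_extensional G C B \<and> \<eta> \<in> extensional (Obj C)"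
proof
  assume "crossed_transformation G C D A B \<eta>"
  then interpret crossed_transformation G C D A B \<eta> .
  interpret PA: strict_crossed_functor G C D A using strict_functor_if_crossed_functor[OF assms A.crossed_functor_axioms] by blast
  interpret PB: strict_crossed_functor G C D B using strict_functor_if_crossed_functor[OF assms B.crossed_functor_axioms] by blast
  have [simp]: "\<eta> x \<in> Arrs D" "src (\<eta> x) = cobj A x" "trg (\<eta> x) = cobj B x" if "x \<in> Obj C" for x
    using component[OF that] by (auto simp: Hom_def)
  have "strict_crossed_transformation G C D A B \<eta>"
  proof unfold_locales
    fix f assume "f \<in> Arrs C"
    then show "\<eta> (trg f) \<cdot>\<^bsub>D\<^esub> carr A f = carr B f \<cdot>\<^bsub>D\<^esub> \<eta> (src f)"
      by (intro natural) (auto simp: Hom_def)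
  qed (simp_all add: respects_ten respects_unit respects_act)
  then show "strict_crossed_transformation G C D A B \<eta> \<and>
    crsfun_extensional G C A \<and> crsfun_extensional G C B \<and> \<eta> \<in> extensional (Obj C)"
    using strict_functor_if_crossed_functor[OF assms A.crossed_functor_axioms]
      strict_functor_if_crossed_functor[OF assms B.crossed_functor_axioms] ext by blast
next
  assume *: "strict_crossed_transformation G C D A B \<eta> \<and>
    crsfun_extensional G C A \<and> crsfun_extensional G C B \<and> \<eta> \<in> extensional (Obj C)"
  then interpret strict_crossed_transformation G C D A B \<eta> by blast
  interpret A': crossed_functor G C D A using crossed_functor_if_strict_functor[OF assms A.strict_crossed_functor_axioms] * by blast
  interpret B': crossed_functor G C D B using crossed_functor_if_strict_functor[OF assms B.strict_crossed_functor_axioms] * by blast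
  show "crossed_transformation G C D A B \<eta>"
    by unfold_locales (use * in \<open>auto simp: Hom_def T.nat T.resp_mu T.resp_eps resp_act\<close>)
qed

lemma strict_crossed_transformation_hcmp:
  assumes "strict_crossed_transformation G C D A B \<eta>" "strict_crossed_transformation G D E A' B' \<zeta>"
  shows "strict_crossed_transformation G C E (comp_crsfun G C E A' A) (comp_crsfun G C E B' B)
                (\<lambda>x \<in> Obj C. \<zeta> (cobj B x) \<cdot>\<^bsub>E\<^esub> carr A' (\<eta> x))"
proof -
  interpret T: strict_crossed_transformation G C D A B \<eta> by fact
  interpret S: strict_crossed_transformation G D E A' B' \<zeta> by fact
  interpret AA: strict_crossed_functor G C E "comp_crsfun G C E A' A"
    using strict_crossed_functor_comp T.A.strict_crossed_functor_axioms S.A.strict_crossed_functor_axioms .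
  interpret BB: strict_crossed_functor G C E "comp_crsfun G C E B' B"
    using strict_crossed_functor_comp T.B.strict_crossed_functor_axioms S.B.strict_crossed_functor_axioms .
  show ?thesis
  proof (intro strict_crossed_transformation.intro strict_crossed_transformation_axioms.intro
      AA.strict_crossed_functor_axioms BB.strict_crossed_functor_axioms)
    fix g x assume *: "g \<in> carrier G" "x \<in> Obj C"
    have "\<zeta> (cobj B (Fo C g x)) \<cdot>\<^bsub>E\<^esub> (carr A' (\<eta> (Fo C g x)) \<cdot>\<^bsub>E\<^esub> (carr A' (cact A g x) \<cdot>\<^bsub>E\<^esub> cact A' g (cobj A x)))
       = \<zeta> (cobj B (Fo C g x)) \<cdot>\<^bsub>E\<^esub> (carr A' (\<eta> (Fo C g x) \<cdot>\<^bsub>D\<^esub> cact A g x) \<cdot>\<^bsub>E\<^esub> cact A' g (cobj A x))"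
      using * by simp
    also have "\<dots> = (\<zeta> (cobj B (Fo C g x)) \<cdot>\<^bsub>E\<^esub> carr A' (cact B g x)) \<cdot>\<^bsub>E\<^esub> (carr A' (Fm D g (\<eta> x)) \<cdot>\<^bsub>E\<^esub> cact A' g (cobj A x))"
      using * by (simp add: T.resp_act)
    also have "\<dots> = (carr B' (cact B g x) \<cdot>\<^bsub>E\<^esub> \<zeta> (Fo D g (cobj B x))) \<cdot>\<^bsub>E\<^esub> (cact A' g (cobj B x) \<cdot>\<^bsub>E\<^esub> Fm E g (carr A' (\<eta> x)))"
      using * S.T.nat[of "cact B g x"] S.A.cact_nat[of g "\<eta> x"] by simp
    also have "\<dots> = carr B' (cact B g x) \<cdot>\<^bsub>E\<^esub> ((\<zeta> (Fo D g (cobj B x)) \<cdot>\<^bsub>E\<^esub> cact A' g (cobj B x)) \<cdot>\<^bsub>E\<^esub> Fm E g (carr A' (\<eta> x)))"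
      using * by simp
    also have "\<dots> = carr B' (cact B g x) \<cdot>\<^bsub>E\<^esub> (cact B' g (cobj B x) \<cdot>\<^bsub>E\<^esub> (Fm E g (\<zeta> (cobj B x)) \<cdot>\<^bsub>E\<^esub> Fm E g (carr A' (\<eta> x))))"
      using * by (simp add: S.resp_act)
    finally show "restrict (\<lambda>x. \<zeta> (cobj B x) \<cdot>\<^bsub>E\<^esub> carr A' (\<eta> x)) (Obj C) (Fo C g x) \<cdot>\<^bsub>E\<^esub> cact (comp_crsfun G C E A' A) g x
      = cact (comp_crsfun G C E B' B) g x \<cdot>\<^bsub>E\<^esub> Fm E g (restrict (\<lambda>x. \<zeta> (cobj B x) \<cdot>\<^bsub>E\<^esub> carr A' (\<eta> x)) (Obj C) x)"
      using * by simp
  qed (rule weak_transformation_hcmp[OF T.T.weak_transformation_axioms S.T.weak_transformation_axioms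
          AA.T.weak_functor_axioms BB.T.weak_functor_axioms]; simp)
qed

lemma strict_crossed_transformation_vcmp:
  assumes "strict_crossed_transformation G C D A B \<eta>" "strict_crossed_transformation G C D B K \<zeta>"
  shows "strict_crossed_transformation G C D A K (\<lambda>x \<in> Obj C. \<zeta> x \<cdot>\<^bsub>D\<^esub> \<eta> x)"
proof -
  interpret T: strict_crossed_transformation G C D A B \<eta> by fact
  interpret S: strict_crossed_transformation G C D B K \<zeta> by fact
  show ?thesis
  proof (intro strict_crossed_transformation.intro strict_crossed_transformation_axioms.intro
      T.A.strict_crossed_functor_axioms S.B.strict_crossed_functor_axioms)
    fix g x assume "g \<in> carrier G" "x \<in> Obj C"
    then show "restrict (\<lambda>x. \<zeta> x \<cdot>\<^bsub>D\<^esub> \<eta> x) (Obj C) (Fo C g x) \<cdot>\<^bsub>D\<^esub> cact A g x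
       = cact K g x \<cdot>\<^bsub>D\<^esub> Fm D g (restrict (\<lambda>x. \<zeta> x \<cdot>\<^bsub>D\<^esub> \<eta> x) (Obj C) x)"
      by (simp add: T.resp_act S.resp_act[THEN T.A.D.T.reassoc])
  qed (rule weak_transformation_vcmp[OF T.T.weak_transformation_axioms S.T.weak_transformation_axioms]; simp)
qed

lemma strict_crossed_transformation_id:
  assumes "strict_crossed_functor G C D A"
  shows "strict_crossed_transformation G C D A A (\<lambda>x \<in> Obj C. idt D (cobj A x))"
proof -
  interpret strict_crossed_functor G C D A by fact
  show ?thesis
    by (intro strict_crossed_transformation.intro strict_crossed_transformation_axioms.intro
        strict_crossed_functor_axioms T.identity_transformation; simp)
qed

lemma comp_crsfun_id:
  assumes "strict_crossed_functor G C D A" "crsfun_extensional G C A"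
  shows "comp_crsfun G C D (id_crsfun G D) A = A" "comp_crsfun G C D A (id_crsfun G C) = A"
proof -
  interpret strict_crossed_functor G C D A by fact
  show "comp_crsfun G C D (id_crsfun G D) A = A" "comp_crsfun G C D A (id_crsfun G C) = A"
    using assms(2) by (intro crsfun.equality;
      auto simp: crsfun_extensional_def comp_crsfun_def id_crsfun_def fun_eq_iff extensional_def)+
qed

lemma comp_crsfun_assoc:
  assumes "strict_crossed_functor G C D A" "strict_crossed_functor G D E B" "strict_crossed_functor G E F K"
  shows "comp_crsfun G C F (comp_crsfun G D F K B) A = comp_crsfun G C F K (comp_crsfun G C E B A)"
proof -
  interpret A: strict_crossed_functor G C D A by fact
  interpret B: strict_crossed_functor G D E B by fact
  interpret K: strict_crossed_functor G E F K by fact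
  show ?thesis
    by (intro crsfun.equality) (auto simp: comp_crsfun_def fun_eq_iff)
qed

lemma structured_GCrsBrd:
  fixes G :: "('g, 'h) monoid_scheme"
  shows "structured_categories {C :: ('g, 'o, 'm) crsbrd. strict_crossed_braided G C}
     (crossed_functor G) (crossed_transformation G) cobj carr (id_crsfun G) (comp_crsfun G)"
proof -
  note ext = crsfun_extensional_id crsfun_extensional_comp
  note iffs = crossed_functor_iff crossed_transformation_iff
  show ?thesis
  proof (intro structured_categories.intro, unfold mem_Collect_eq)
    fix C :: "('g, 'o, 'm) crsbrd" assume *: "strict_crossed_braided G C"
    then interpret strict_crossed G C by (simp add: strict_crossed_braided_iff)
    show "category C" by unfold_locales
    show "crossed_functor G C C (id_crsfun G C)"
      using * by (simp add: iffs strict_crossed_axioms strict_crossed_functor_id ext)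
  next
    fix C D :: "('g, 'o, 'm) crsbrd" and A assume *: "strict_crossed_braided G C" "strict_crossed_braided G D" "crossed_functor G C D A"
    then interpret strict_crossed_functor G C D A by (simp add: iffs)
    show "is_functor C D (cobj A) (carr A)" by (rule T.functorial)
    show "comp_crsfun G C D (id_crsfun G D) A = A" "comp_crsfun G C D A (id_crsfun G C) = A"
      "crossed_transformation G C D A A (\<lambda>x \<in> Obj C. idt D (cobj A x))"
      using * comp_crsfun_id strict_crossed_transformation_id by (auto simp: iffs)
  next
    fix C D E :: "('g, 'o, 'm) crsbrd" and A B
    assume "strict_crossed_braided G C" "strict_crossed_braided G D" "strict_crossed_braided G E"
       "crossed_functor G C D A" "crossed_functor G D E B"
    then show "crossed_functor G C E (comp_crsfun G C E B A)" by (auto simp: iffs strict_crossed_functor_comp ext)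
  next
    fix C D E E' :: "('g, 'o, 'm) crsbrd" and A B K
    assume "strict_crossed_braided G C" "strict_crossed_braided G D" "strict_crossed_braided G E" "strict_crossed_braided G E'"
      "crossed_functor G C D A" "crossed_functor G D E B" "crossed_functor G E E' K"
    then show "comp_crsfun G C E' (comp_crsfun G D E' K B) A = comp_crsfun G C E' K (comp_crsfun G C E B A)"
      by (auto simp: iffs intro: comp_crsfun_assoc)
  next
    fix C D :: "('g, 'o, 'm) crsbrd" and A B \<eta>
    assume *: "strict_crossed_braided G C" "strict_crossed_braided G D" "crossed_transformation G C D A B \<eta>"
    then interpret strict_crossed_transformation G C D A B \<eta> by (simp add: iffs)
    show "crossed_functor G C D A \<and> crossed_functor G C D B" "\<eta> \<in> extensional (Obj C)"
      using * A.strict_crossed_functor_axioms B.strict_crossed_functor_axioms by (auto simp: iffs)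
    show "x \<in> Obj C \<Longrightarrow> \<eta> x \<in> Hom D (cobj A x) (cobj B x)" for x by (simp add: Hom_def)
    show "f \<in> Arrs C \<Longrightarrow> \<eta> (trg f) \<cdot>\<^bsub>D\<^esub> carr A f = carr B f \<cdot>\<^bsub>D\<^esub> \<eta> (src f)" for f by (rule T.nat)
  next
    fix C D :: "('g, 'o, 'm) crsbrd" and A B K \<eta> \<zeta>
    assume "strict_crossed_braided G C" "strict_crossed_braided G D"
      "crossed_transformation G C D A B \<eta>" "crossed_transformation G C D B K \<zeta>"
    then show "crossed_transformation G C D A K (\<lambda>x \<in> Obj C. \<zeta> x \<cdot>\<^bsub>D\<^esub> \<eta> x)"
      by (auto simp: iffs strict_crossed_transformation_vcmp)
  next
    fix C D E :: "('g, 'o, 'm) crsbrd" and A B A' B' \<eta> \<zeta>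
    assume "strict_crossed_braided G C" "strict_crossed_braided G D" "strict_crossed_braided G E"
      "crossed_transformation G C D A B \<eta>" "crossed_transformation G D E A' B' \<zeta>"
    then show "crossed_transformation G C E (comp_crsfun G C E A' A) (comp_crsfun G C E B' B)
                (\<lambda>x \<in> Obj C. \<zeta> (cobj B x) \<cdot>\<^bsub>E\<^esub> carr A' (\<eta> x))"
      by (auto simp: iffs strict_crossed_transformation_hcmp ext)
  qed (simp_all add: id_crsfun_def)
qed

lemma GCrsBrd_st_eq:
  "GCrsBrd_st G = structured_two_cat {C. strict_crossed_braided G C} (crossed_functor G) (crossed_transformation G)
     cobj carr (id_crsfun G) (comp_crsfun G)"
  unfolding GCrsBrd_st_def GCrsBrd_def full_sub_two_category_def structured_two_cat_def
  by (auto simp: strict_crossed_braided_def)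


section \<open>Monoidal functors that preserve a group of invertible objects\<close>

text \<open>
  The objects \<open>p g\<close> and \<open>q g\<close> multiply strictly as the elements of the group, so they are
  invertible, and \<open>u\<close> says that the functor preserves them up to coherent isomorphism. In the
  application they are the identity 1-cells of the 0-cells of two Gray-monoids, multiplied by the
  tensor product, and \<open>u\<close> is \<open>munit\<close>.
\<close>

locale point_functor = weak_functor C "UNIV :: unit set" "\<lambda>_. ()" "\<lambda>_. ()" "\<lambda>_. one" tO tA
      D "UNIV :: unit set" "\<lambda>_. ()" "\<lambda>_. ()" "\<lambda>_. one'" tO' tA' fo fa "\<lambda>_. ()" "\<lambda>_. eps" mu + group G
  for G :: "('g, 'h) monoid_scheme" and C :: "('v, 'e, 'z) cat_scheme" and one
    and tO :: "'v \<Rightarrow> 'v \<Rightarrow> 'v" (infixl "\<odot>" 70)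
    and tA :: "('v, 'e) arr \<Rightarrow> ('v, 'e) arr \<Rightarrow> ('v, 'e) arr" (infixl "\<diamondop>" 70)
    and D :: "('w, 'f, 'y) cat_scheme" and one'
    and tO' :: "'w \<Rightarrow> 'w \<Rightarrow> 'w" (infixl "\<odot>''" 70)
    and tA' :: "('w, 'f) arr \<Rightarrow> ('w, 'f) arr \<Rightarrow> ('w, 'f) arr" (infixl "\<diamondop>''" 70)
    and fo fa eps mu +
  fixes p :: "'g \<Rightarrow> 'v" and q :: "'g \<Rightarrow> 'w" and u :: "'g \<Rightarrow> ('w, 'f) arr"
  assumes p_Obj [simp]: "g \<in> carrier G \<Longrightarrow> p g \<in> Obj C"
    and p_mult [simp]: "\<lbrakk>g \<in> carrier G; h \<in> carrier G\<rbrakk> \<Longrightarrow> p (g \<otimes>\<^bsub>G\<^esub> h) = p g \<odot> p h"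
    and p_one [simp]: "p \<one>\<^bsub>G\<^esub> = one"
    and q_Obj [simp]: "g \<in> carrier G \<Longrightarrow> q g \<in> Obj D"
    and q_mult [simp]: "\<lbrakk>g \<in> carrier G; h \<in> carrier G\<rbrakk> \<Longrightarrow> q (g \<otimes>\<^bsub>G\<^esub> h) = q g \<odot>' q h"
    and q_one [simp]: "q \<one>\<^bsub>G\<^esub> = one'"
    and u_iso [simp]: "g \<in> carrier G \<Longrightarrow> iso_arr D (u g)"
    and u_src [simp]: "g \<in> carrier G \<Longrightarrow> src (u g) = q g"
    and u_trg [simp]: "g \<in> carrier G \<Longrightarrow> trg (u g) = fo (p g)"
    and u_mult: "\<lbrakk>g \<in> carrier G; h \<in> carrier G\<rbrakk>
      \<Longrightarrow> mu (p g) (p h) \<cdot>\<^bsub>D\<^esub> (u g \<diamondop>' u h) = u (g \<otimes>\<^bsub>G\<^esub> h)"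
    and u_one [simp]: "u \<one>\<^bsub>G\<^esub> = eps"
begin

lemma unit_simps [simp]:
  "one \<in> Obj C" "one' \<in> Obj D" "iso_arr D eps" "eps \<in> Arrs D" "src eps = one'" "trg eps = fo one"
  "\<And>x. x \<in> Obj C \<Longrightarrow> one \<odot> x = x" "\<And>x. x \<in> Obj C \<Longrightarrow> x \<odot> one = x"
  "\<And>x. x \<in> Obj D \<Longrightarrow> one' \<odot>' x = x" "\<And>x. x \<in> Obj D \<Longrightarrow> x \<odot>' one' = x"
  "\<And>f. f \<in> Arrs C \<Longrightarrow> idt C one \<diamondop> f = f" "\<And>f. f \<in> Arrs C \<Longrightarrow> f \<diamondop> idt C one = f"
  "\<And>f. f \<in> Arrs D \<Longrightarrow> idt D one' \<diamondop>' f = f" "\<And>f. f \<in> Arrs D \<Longrightarrow> f \<diamondop>' idt D one' = f"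
  using C.e_Obj[OF UNIV_I] D.e_Obj[OF UNIV_I] eps_iso[OF UNIV_I] eps_Arrs[OF UNIV_I]
    eps_src[OF UNIV_I] eps_trg[OF UNIV_I] by auto

lemma p_inv [simp]:
  assumes "g \<in> carrier G"
  shows "p g \<odot> p (inv\<^bsub>G\<^esub> g) = one" "p (inv\<^bsub>G\<^esub> g) \<odot> p g = one"
    "x \<in> Obj C \<Longrightarrow> p g \<odot> (p (inv\<^bsub>G\<^esub> g) \<odot> x) = x" "x \<in> Obj C \<Longrightarrow> p (inv\<^bsub>G\<^esub> g) \<odot> (p g \<odot> x) = x"
proof -
  show 1: "p g \<odot> p (inv\<^bsub>G\<^esub> g) = one" "p (inv\<^bsub>G\<^esub> g) \<odot> p g = one"
    using p_mult[of g "inv\<^bsub>G\<^esub> g"] p_mult[of "inv\<^bsub>G\<^esub> g" g] assms by (simp_all del: p_mult)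
  show "x \<in> Obj C \<Longrightarrow> p g \<odot> (p (inv\<^bsub>G\<^esub> g) \<odot> x) = x" "x \<in> Obj C \<Longrightarrow> p (inv\<^bsub>G\<^esub> g) \<odot> (p g \<odot> x) = x"
    using assms by (simp_all add: 1 flip: C.tO_assoc)
qed

lemma q_inv [simp]:
  assumes "g \<in> carrier G"
  shows "q g \<odot>' q (inv\<^bsub>G\<^esub> g) = one'" "q (inv\<^bsub>G\<^esub> g) \<odot>' q g = one'"
    "x \<in> Obj D \<Longrightarrow> q g \<odot>' (q (inv\<^bsub>G\<^esub> g) \<odot>' x) = x" "x \<in> Obj D \<Longrightarrow> q (inv\<^bsub>G\<^esub> g) \<odot>' (q g \<odot>' x) = x"
proof -
  show 1: "q g \<odot>' q (inv\<^bsub>G\<^esub> g) = one'" "q (inv\<^bsub>G\<^esub> g) \<odot>' q g = one'"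
    using q_mult[of g "inv\<^bsub>G\<^esub> g"] q_mult[of "inv\<^bsub>G\<^esub> g" g] assms by (simp_all del: q_mult)
  show "x \<in> Obj D \<Longrightarrow> q g \<odot>' (q (inv\<^bsub>G\<^esub> g) \<odot>' x) = x" "x \<in> Obj D \<Longrightarrow> q (inv\<^bsub>G\<^esub> g) \<odot>' (q g \<odot>' x) = x"
    using assms by (simp_all add: 1 flip: D.tO_assoc)
qed

text \<open>
  \<open>L\<close>, \<open>R\<close> and the cell \<open>c\<close> defined later compare the functor before and after multiplication by
  \<open>p g\<close> on the left, on the right, and conjugation by \<open>p g\<close>.
\<close>

definition L where "L g x = mu (p g) x \<cdot>\<^bsub>D\<^esub> (u g \<diamondop>' idt D (fo x))"
definition R where "R x g = mu x (p g) \<cdot>\<^bsub>D\<^esub> (idt D (fo x) \<diamondop>' u g)"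

lemma LR_simps [simp]:
  assumes "g \<in> carrier G" "x \<in> Obj C"
  shows "iso_arr D (L g x)" "src (L g x) = q g \<odot>' fo x" "trg (L g x) = fo (p g \<odot> x)"
    "iso_arr D (R x g)" "src (R x g) = fo x \<odot>' q g" "trg (R x g) = fo (x \<odot> p g)"
  using assms by (simp_all add: L_def R_def)

lemma LR_Arrs [simp]:
  assumes "g \<in> carrier G" "x \<in> Obj C" shows "L g x \<in> Arrs D" "R x g \<in> Arrs D"
  using assms by (auto intro: D.iso_simps(1))

lemma L_nat:
  assumes "g \<in> carrier G" "f \<in> Arrs C"
  shows "L g (trg f) \<cdot>\<^bsub>D\<^esub> (idt D (q g) \<diamondop>' fa f) = fa (idt C (p g) \<diamondop> f) \<cdot>\<^bsub>D\<^esub> L g (src f)"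
proof -
  have "L g (trg f) \<cdot>\<^bsub>D\<^esub> (idt D (q g) \<diamondop>' fa f)
    = (mu (p g) (trg f) \<cdot>\<^bsub>D\<^esub> (fa (idt C (p g)) \<diamondop>' fa f)) \<cdot>\<^bsub>D\<^esub> (u g \<diamondop>' idt D (fo (src f)))"
    using assms by (simp add: L_def D.merge)
  also have "\<dots> = fa (idt C (p g) \<diamondop> f) \<cdot>\<^bsub>D\<^esub> L g (src f)"
    using assms mu_natural[of f "idt C (p g)"] by (simp add: L_def)
  finally show ?thesis .
qed

lemma R_nat:
  assumes "g \<in> carrier G" "f \<in> Arrs C"
  shows "R (trg f) g \<cdot>\<^bsub>D\<^esub> (fa f \<diamondop>' idt D (q g)) = fa (f \<diamondop> idt C (p g)) \<cdot>\<^bsub>D\<^esub> R (src f) g"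
proof -
  have "R (trg f) g \<cdot>\<^bsub>D\<^esub> (fa f \<diamondop>' idt D (q g))
    = (mu (trg f) (p g) \<cdot>\<^bsub>D\<^esub> (fa f \<diamondop>' fa (idt C (p g)))) \<cdot>\<^bsub>D\<^esub> (idt D (fo (src f)) \<diamondop>' u g)"
    using assms by (simp add: R_def D.merge)
  also have "\<dots> = fa (f \<diamondop> idt C (p g)) \<cdot>\<^bsub>D\<^esub> R (src f) g"
    using assms mu_natural[of "idt C (p g)" f] by (simp add: R_def)
  finally show ?thesis .
qed

text \<open>
  This lemma and the next two are associativity of \<open>mu\<close> with the invertible object in first, last
  and middle position.
\<close>

lemma mu_L:
  assumes "g \<in> carrier G" "x \<in> Obj C" "y \<in> Obj C"
  shows "mu (p g \<odot> x) y \<cdot>\<^bsub>D\<^esub> (L g x \<diamondop>' idt D (fo y)) = L g (x \<odot> y) \<cdot>\<^bsub>D\<^esub> (idt D (q g) \<diamondop>' mu x y)"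
proof -
  have "mu (p g \<odot> x) y \<cdot>\<^bsub>D\<^esub> (L g x \<diamondop>' idt D (fo y))
    = mu (p g \<odot> x) y \<cdot>\<^bsub>D\<^esub> ((mu (p g) x \<diamondop>' idt D (fo y)) \<cdot>\<^bsub>D\<^esub> (u g \<diamondop>' idt D (fo x \<odot>' fo y)))"
    using assms by (simp add: L_def D.whisker_right)
  also have "\<dots> = mu (p g) (x \<odot> y) \<cdot>\<^bsub>D\<^esub> ((idt D (fo (p g)) \<diamondop>' mu x y) \<cdot>\<^bsub>D\<^esub> (u g \<diamondop>' idt D (fo x \<odot>' fo y)))"
    using assms mu_assoc[of y x "p g", symmetric, THEN D.reassoc] by simp
  also have "\<dots> = L g (x \<odot> y) \<cdot>\<^bsub>D\<^esub> (idt D (q g) \<diamondop>' mu x y)"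
    using assms by (simp add: L_def D.merge)
  finally show ?thesis .
qed

lemma mu_R:
  assumes "g \<in> carrier G" "x \<in> Obj C" "y \<in> Obj C"
  shows "mu x (y \<odot> p g) \<cdot>\<^bsub>D\<^esub> (idt D (fo x) \<diamondop>' R y g) = R (x \<odot> y) g \<cdot>\<^bsub>D\<^esub> (mu x y \<diamondop>' idt D (q g))"
proof -
  have "mu x (y \<odot> p g) \<cdot>\<^bsub>D\<^esub> (idt D (fo x) \<diamondop>' R y g)
    = mu x (y \<odot> p g) \<cdot>\<^bsub>D\<^esub> ((idt D (fo x) \<diamondop>' mu y (p g)) \<cdot>\<^bsub>D\<^esub> (idt D (fo x \<odot>' fo y) \<diamondop>' u g))"
    using assms by (simp add: R_def D.whisker_left flip: D.tA_assoc)
  also have "\<dots> = mu (x \<odot> y) (p g) \<cdot>\<^bsub>D\<^esub> ((mu x y \<diamondop>' idt D (fo (p g))) \<cdot>\<^bsub>D\<^esub> (idt D (fo x \<odot>' fo y) \<diamondop>' u g))"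
    using assms mu_assoc[of "p g" y x, THEN D.reassoc] by simp
  also have "\<dots> = R (x \<odot> y) g \<cdot>\<^bsub>D\<^esub> (mu x y \<diamondop>' idt D (q g))"
    using assms by (simp add: R_def D.merge)
  finally show ?thesis .
qed

lemma mu_mid:
  assumes "g \<in> carrier G" "x \<in> Obj C" "y \<in> Obj C"
  shows "mu (x \<odot> p g) y \<cdot>\<^bsub>D\<^esub> (R x g \<diamondop>' idt D (fo y)) = mu x (p g \<odot> y) \<cdot>\<^bsub>D\<^esub> (idt D (fo x) \<diamondop>' L g y)"
proof -
  have "mu (x \<odot> p g) y \<cdot>\<^bsub>D\<^esub> (R x g \<diamondop>' idt D (fo y))
    = mu (x \<odot> p g) y \<cdot>\<^bsub>D\<^esub> ((mu x (p g) \<diamondop>' idt D (fo y)) \<cdot>\<^bsub>D\<^esub> (idt D (fo x) \<diamondop>' (u g \<diamondop>' idt D (fo y))))"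
    using assms by (simp add: R_def D.whisker_right)
  also have "\<dots> = mu x (p g \<odot> y) \<cdot>\<^bsub>D\<^esub> ((idt D (fo x) \<diamondop>' mu (p g) y) \<cdot>\<^bsub>D\<^esub> (idt D (fo x) \<diamondop>' (u g \<diamondop>' idt D (fo y))))"
    using assms mu_assoc[of y "p g" x, symmetric, THEN D.reassoc] by simp
  also have "\<dots> = mu x (p g \<odot> y) \<cdot>\<^bsub>D\<^esub> (idt D (fo x) \<diamondop>' L g y)"
    using assms by (simp add: L_def D.whisker_left)
  finally show ?thesis .
qed

lemma L_u:
  assumes "g \<in> carrier G" "h \<in> carrier G"
  shows "L g (p h) \<cdot>\<^bsub>D\<^esub> (idt D (q g) \<diamondop>' u h) = u (g \<otimes>\<^bsub>G\<^esub> h)"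
  using assms by (simp add: L_def D.merge u_mult)

lemma R_u:
  assumes "g \<in> carrier G" "h \<in> carrier G"
  shows "R (p g) h \<cdot>\<^bsub>D\<^esub> (u g \<diamondop>' idt D (q h)) = u (g \<otimes>\<^bsub>G\<^esub> h)"
  using assms by (simp add: R_def D.merge u_mult)

lemma L_mult:
  assumes "g \<in> carrier G" "h \<in> carrier G" "x \<in> Obj C"
  shows "L g (p h \<odot> x) \<cdot>\<^bsub>D\<^esub> (idt D (q g) \<diamondop>' L h x) = L (g \<otimes>\<^bsub>G\<^esub> h) x"
proof -
  have "L g (p h \<odot> x) \<cdot>\<^bsub>D\<^esub> (idt D (q g) \<diamondop>' L h x)
    = L g (p h \<odot> x) \<cdot>\<^bsub>D\<^esub> ((idt D (q g) \<diamondop>' mu (p h) x) \<cdot>\<^bsub>D\<^esub> (idt D (q g) \<diamondop>' (u h \<diamondop>' idt D (fo x))))"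
    using assms by (simp add: L_def[of h] D.whisker_left)
  also have "\<dots> = mu (p g \<odot> p h) x \<cdot>\<^bsub>D\<^esub> ((L g (p h) \<diamondop>' idt D (fo x)) \<cdot>\<^bsub>D\<^esub> ((idt D (q g) \<diamondop>' u h) \<diamondop>' idt D (fo x)))"
    using assms mu_L[of g "p h" x, symmetric, THEN D.reassoc] by simp
  also have "\<dots> = L (g \<otimes>\<^bsub>G\<^esub> h) x"
    using assms by (simp add: L_def[of "g \<otimes>\<^bsub>G\<^esub> h"] D.merge L_u del: D.tA_assoc)
  finally show ?thesis .
qed

lemma R_mult:
  assumes "g \<in> carrier G" "h \<in> carrier G" "x \<in> Obj C"
  shows "R (x \<odot> p g) h \<cdot>\<^bsub>D\<^esub> (R x g \<diamondop>' idt D (q h)) = R x (g \<otimes>\<^bsub>G\<^esub> h)"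
proof -
  have "R (x \<odot> p g) h \<cdot>\<^bsub>D\<^esub> (R x g \<diamondop>' idt D (q h))
    = R (x \<odot> p g) h \<cdot>\<^bsub>D\<^esub> ((mu x (p g) \<diamondop>' idt D (q h)) \<cdot>\<^bsub>D\<^esub> (idt D (fo x) \<diamondop>' (u g \<diamondop>' idt D (q h))))"
    using assms by (simp add: R_def[of _ g] D.whisker_right)
  also have "\<dots> = mu x (p g \<odot> p h) \<cdot>\<^bsub>D\<^esub> ((idt D (fo x) \<diamondop>' R (p g) h) \<cdot>\<^bsub>D\<^esub> (idt D (fo x) \<diamondop>' (u g \<diamondop>' idt D (q h))))"
    using assms mu_R[of h x "p g", symmetric, THEN D.reassoc] by simp
  also have "\<dots> = R x (g \<otimes>\<^bsub>G\<^esub> h)"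
    using assms by (simp add: R_def[of _ "g \<otimes>\<^bsub>G\<^esub> h"] D.merge R_u)
  finally show ?thesis .
qed

lemma L_one [simp]: "x \<in> Obj C \<Longrightarrow> L \<one>\<^bsub>G\<^esub> x = idt D (fo x)"
  using mu_unit_left[of x] by (simp add: L_def)

lemma R_one [simp]: "x \<in> Obj C \<Longrightarrow> R x \<one>\<^bsub>G\<^esub> = idt D (fo x)"
  using mu_unit_right[of x] by (simp add: R_def)

text \<open>
  Associativity of \<open>mu\<close> with invertible objects in the two outer positions. It allows the two
  halves of a conjugation to be formed in either order, which gives \<open>c_alt\<close>.
\<close>

lemma L_R:
  assumes "g \<in> carrier G" "h \<in> carrier G" "x \<in> Obj C"
  shows "L g (x \<odot> p h) \<cdot>\<^bsub>D\<^esub> (idt D (q g) \<diamondop>' R x h) = R (p g \<odot> x) h \<cdot>\<^bsub>D\<^esub> (L g x \<diamondop>' idt D (q h))"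
proof -
  have "L g (x \<odot> p h) \<cdot>\<^bsub>D\<^esub> (idt D (q g) \<diamondop>' R x h)
    = L g (x \<odot> p h) \<cdot>\<^bsub>D\<^esub> ((idt D (q g) \<diamondop>' mu x (p h)) \<cdot>\<^bsub>D\<^esub> (idt D (q g \<odot>' fo x) \<diamondop>' u h))"
    using assms by (simp add: R_def D.whisker_left flip: D.tA_assoc)
  also have "\<dots> = mu (p g \<odot> x) (p h) \<cdot>\<^bsub>D\<^esub> ((L g x \<diamondop>' idt D (fo (p h))) \<cdot>\<^bsub>D\<^esub> (idt D (q g \<odot>' fo x) \<diamondop>' u h))"
    using assms mu_L[of g x "p h", symmetric, THEN D.reassoc] by simp
  also have "\<dots> = R (p g \<odot> x) h \<cdot>\<^bsub>D\<^esub> (L g x \<diamondop>' idt D (q h))"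
    using assms by (simp add: R_def D.merge)
  finally show ?thesis .
qed

abbreviation "ad g x \<equiv> p g \<odot> (x \<odot> p (inv\<^bsub>G\<^esub> g))"
abbreviation "ad' g x \<equiv> q g \<odot>' (x \<odot>' q (inv\<^bsub>G\<^esub> g))"
abbreviation "Ad g f \<equiv> idt C (p g) \<diamondop> (f \<diamondop> idt C (p (inv\<^bsub>G\<^esub> g)))"
abbreviation "Ad' g f \<equiv> idt D (q g) \<diamondop>' (f \<diamondop>' idt D (q (inv\<^bsub>G\<^esub> g)))"

definition c where "c g x = L g (x \<odot> p (inv\<^bsub>G\<^esub> g)) \<cdot>\<^bsub>D\<^esub> (idt D (q g) \<diamondop>' R x (inv\<^bsub>G\<^esub> g))"

lemma c_alt: "\<lbrakk>g \<in> carrier G; x \<in> Obj C\<rbrakk>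
  \<Longrightarrow> c g x = R (p g \<odot> x) (inv\<^bsub>G\<^esub> g) \<cdot>\<^bsub>D\<^esub> (L g x \<diamondop>' idt D (q (inv\<^bsub>G\<^esub> g)))"
  by (simp add: c_def L_R)

lemma c_simps [simp]:
  assumes "g \<in> carrier G" "x \<in> Obj C"
  shows "iso_arr D (c g x)" "src (c g x) = ad' g (fo x)" "trg (c g x) = fo (ad g x)"
  using assms by (simp_all add: c_def)

lemma c_Arrs [simp]:
  assumes "g \<in> carrier G" "x \<in> Obj C" shows "c g x \<in> Arrs D"
  using assms by (auto intro: D.iso_simps(1))

lemma c_nat:
  assumes "g \<in> carrier G" "f \<in> Arrs C"
  shows "c g (trg f) \<cdot>\<^bsub>D\<^esub> Ad' g (fa f) = fa (Ad g f) \<cdot>\<^bsub>D\<^esub> c g (src f)"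
proof -
  let ?h = "inv\<^bsub>G\<^esub> g"
  have "c g (trg f) \<cdot>\<^bsub>D\<^esub> Ad' g (fa f) = L g (trg f \<odot> p ?h) \<cdot>\<^bsub>D\<^esub> (idt D (q g) \<diamondop>' (R (trg f) ?h \<cdot>\<^bsub>D\<^esub> (fa f \<diamondop>' idt D (q ?h))))"
    using assms by (simp add: c_def D.merge)
  also have "\<dots> = L g (trg f \<odot> p ?h) \<cdot>\<^bsub>D\<^esub> ((idt D (q g) \<diamondop>' fa (f \<diamondop> idt C (p ?h))) \<cdot>\<^bsub>D\<^esub> (idt D (q g) \<diamondop>' R (src f) ?h))"
    using assms by (simp add: R_nat D.whisker_left)
  also have "\<dots> = fa (Ad g f) \<cdot>\<^bsub>D\<^esub> c g (src f)"
    using assms L_nat[of g "f \<diamondop> idt C (p ?h)", THEN D.reassoc] by (simp add: c_def)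
  finally show ?thesis .
qed

text \<open>
  Between the two conjugates the factors \<open>p (inv g)\<close> and \<open>p g\<close> cancel: \<open>mu_mid\<close> turns the right
  cell of the first conjugate into a left cell on the second, where \<open>L_mult\<close> absorbs it.
\<close>

lemma c_ten:
  assumes "g \<in> carrier G" "x \<in> Obj C" "y \<in> Obj C"
  shows "c g (x \<odot> y) \<cdot>\<^bsub>D\<^esub> Ad' g (mu x y) = mu (ad g x) (ad g y) \<cdot>\<^bsub>D\<^esub> (c g x \<diamondop>' c g y)"
proof -
  let ?h = "inv\<^bsub>G\<^esub> g"
  let ?q = "idt D (q ?h)" and ?q' = "idt D (q g)"
  have "mu (ad g x) (ad g y) \<cdot>\<^bsub>D\<^esub> (c g x \<diamondop>' c g y)
    = mu (p g \<odot> x \<odot> p ?h) (ad g y) \<cdot>\<^bsub>D\<^esub> ((R (p g \<odot> x) ?h \<diamondop>' idt D (fo (ad g y))) \<cdot>\<^bsub>D\<^esub> ((L g x \<diamondop>' ?q) \<diamondop>' c g y))"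
    using assms by (simp add: c_alt D.merge del: D.tA_assoc)
  also have "\<dots> = mu (p g \<odot> x) (y \<odot> p ?h) \<cdot>\<^bsub>D\<^esub> ((idt D (fo (p g \<odot> x)) \<diamondop>' L ?h (ad g y)) \<cdot>\<^bsub>D\<^esub> (L g x \<diamondop>' (?q \<diamondop>' c g y)))"
    using assms mu_mid[of ?h "p g \<odot> x" "ad g y", THEN D.reassoc] by simp
  also have "\<dots> = mu (p g \<odot> x) (y \<odot> p ?h) \<cdot>\<^bsub>D\<^esub> (L g x \<diamondop>' (L ?h (ad g y) \<cdot>\<^bsub>D\<^esub> (?q \<diamondop>' c g y)))"
    using assms by (simp add: D.merge)
  also have "L ?h (ad g y) \<cdot>\<^bsub>D\<^esub> (?q \<diamondop>' c g y) = (L ?h (ad g y) \<cdot>\<^bsub>D\<^esub> (?q \<diamondop>' L g (y \<odot> p ?h))) \<cdot>\<^bsub>D\<^esub> ((?q \<diamondop>' ?q') \<diamondop>' R y ?h)"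
    using assms by (simp add: c_def D.whisker_left del: D.tA_idt)
  also have "\<dots> = R y ?h"
    using assms by (subst L_mult) (simp_all)
  also have "mu (p g \<odot> x) (y \<odot> p ?h) \<cdot>\<^bsub>D\<^esub> (L g x \<diamondop>' R y ?h)
    = mu (p g \<odot> x) (y \<odot> p ?h) \<cdot>\<^bsub>D\<^esub> ((idt D (fo (p g \<odot> x)) \<diamondop>' R y ?h) \<cdot>\<^bsub>D\<^esub> (L g x \<diamondop>' idt D (fo y \<odot>' q ?h)))"
    using assms by (simp add: D.merge)
  also have "\<dots> = R (p g \<odot> x \<odot> y) ?h \<cdot>\<^bsub>D\<^esub> ((mu (p g \<odot> x) y \<diamondop>' ?q) \<cdot>\<^bsub>D\<^esub> ((L g x \<diamondop>' idt D (fo y)) \<diamondop>' ?q))"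
    using assms mu_R[of ?h "p g \<odot> x" y, THEN D.reassoc] by simp
  also have "\<dots> = R (p g \<odot> x \<odot> y) ?h \<cdot>\<^bsub>D\<^esub> ((L g (x \<odot> y) \<diamondop>' ?q) \<cdot>\<^bsub>D\<^esub> ((?q' \<diamondop>' mu x y) \<diamondop>' ?q))"
    using assms by (simp add: D.merge mu_L del: D.tA_assoc)
  also have "\<dots> = c g (x \<odot> y) \<cdot>\<^bsub>D\<^esub> Ad' g (mu x y)"
    using assms by (simp add: c_alt)
  finally show ?thesis ..
qed

text \<open>
  \<open>L_R\<close> exchanges the inner pair of cells, after which \<open>L_mult\<close> and \<open>R_mult\<close> merge the left and
  the right ones.
\<close>

lemma c_mult:
  assumes "g \<in> carrier G" "h \<in> carrier G" "x \<in> Obj C"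
  shows "c (g \<otimes>\<^bsub>G\<^esub> h) x = c g (ad h x) \<cdot>\<^bsub>D\<^esub> Ad' g (c h x)"
proof -
  let ?g = "inv\<^bsub>G\<^esub> g" and ?h = "inv\<^bsub>G\<^esub> h"
  have X: "L g (ad h x) \<cdot>\<^bsub>D\<^esub> (idt D (q g) \<diamondop>' c h x)
     = L (g \<otimes>\<^bsub>G\<^esub> h) (x \<odot> p ?h) \<cdot>\<^bsub>D\<^esub> (idt D (q (g \<otimes>\<^bsub>G\<^esub> h)) \<diamondop>' R x ?h)"
  proof -
    have "L g (ad h x) \<cdot>\<^bsub>D\<^esub> (idt D (q g) \<diamondop>' c h x)
      = (L g (ad h x) \<cdot>\<^bsub>D\<^esub> (idt D (q g) \<diamondop>' L h (x \<odot> p ?h))) \<cdot>\<^bsub>D\<^esub> ((idt D (q g) \<diamondop>' idt D (q h)) \<diamondop>' R x ?h)"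
      using assms by (simp add: c_def D.whisker_left del: D.tA_idt)
    also have "\<dots> = L (g \<otimes>\<^bsub>G\<^esub> h) (x \<odot> p ?h) \<cdot>\<^bsub>D\<^esub> (idt D (q (g \<otimes>\<^bsub>G\<^esub> h)) \<diamondop>' R x ?h)"
      using assms by (subst L_mult) simp_all
    finally show ?thesis .
  qed
  have "c g (ad h x) \<cdot>\<^bsub>D\<^esub> Ad' g (c h x)
    = R (p g \<odot> ad h x) ?g \<cdot>\<^bsub>D\<^esub> ((L g (ad h x) \<cdot>\<^bsub>D\<^esub> (idt D (q g) \<diamondop>' c h x)) \<diamondop>' idt D (q ?g))"
    using assms by (simp add: c_alt[of g] D.whisker_right)
  also note X
  also have "R (p g \<odot> ad h x) ?g \<cdot>\<^bsub>D\<^esub> ((L (g \<otimes>\<^bsub>G\<^esub> h) (x \<odot> p ?h) \<cdot>\<^bsub>D\<^esub> (idt D (q (g \<otimes>\<^bsub>G\<^esub> h)) \<diamondop>' R x ?h)) \<diamondop>' idt D (q ?g))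
     = R (p (g \<otimes>\<^bsub>G\<^esub> h) \<odot> x \<odot> p ?h) ?g \<cdot>\<^bsub>D\<^esub> ((R (p (g \<otimes>\<^bsub>G\<^esub> h) \<odot> x) ?h
         \<cdot>\<^bsub>D\<^esub> (L (g \<otimes>\<^bsub>G\<^esub> h) x \<diamondop>' idt D (q ?h))) \<diamondop>' idt D (q ?g))"
    using assms L_R[of "g \<otimes>\<^bsub>G\<^esub> h" ?h x] by simp
  also have "\<dots> = (R (p (g \<otimes>\<^bsub>G\<^esub> h) \<odot> x \<odot> p ?h) ?g \<cdot>\<^bsub>D\<^esub> (R (p (g \<otimes>\<^bsub>G\<^esub> h) \<odot> x) ?h \<diamondop>' idt D (q ?g)))
         \<cdot>\<^bsub>D\<^esub> (L (g \<otimes>\<^bsub>G\<^esub> h) x \<diamondop>' (idt D (q ?h) \<diamondop>' idt D (q ?g)))"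
    using assms by (simp add: D.whisker_right del: D.tA_idt)
  also have "\<dots> = c (g \<otimes>\<^bsub>G\<^esub> h) x"
    using assms R_mult[of ?h ?g "p (g \<otimes>\<^bsub>G\<^esub> h) \<odot> x"] by (simp add: c_alt inv_mult_group)
  finally show ?thesis ..
qed

lemma c_unit:
  assumes "g \<in> carrier G"
  shows "c g one \<cdot>\<^bsub>D\<^esub> Ad' g eps = eps"
proof -
  let ?h = "inv\<^bsub>G\<^esub> g"
  have "c g one \<cdot>\<^bsub>D\<^esub> Ad' g eps = R (p g) ?h \<cdot>\<^bsub>D\<^esub> ((L g one \<cdot>\<^bsub>D\<^esub> (idt D (q g) \<diamondop>' eps)) \<diamondop>' idt D (q ?h))"
    using assms by (simp add: c_alt D.whisker_right)
  also have "\<dots> = eps" using assms L_u[of g "\<one>\<^bsub>G\<^esub>"] R_u[of g ?h] by simp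
  finally show ?thesis .
qed

text \<open>
  Multiplying a conjugate by \<open>p g\<close> on the right cancels its right half.
\<close>

lemma R_c:
  assumes "g \<in> carrier G" "x \<in> Obj C"
  shows "R (ad g x) g \<cdot>\<^bsub>D\<^esub> (c g x \<diamondop>' idt D (q g)) = L g x"
proof -
  let ?h = "inv\<^bsub>G\<^esub> g"
  have "R (ad g x) g \<cdot>\<^bsub>D\<^esub> (c g x \<diamondop>' idt D (q g))
    = (R (p g \<odot> x \<odot> p ?h) g \<cdot>\<^bsub>D\<^esub> (R (p g \<odot> x) ?h \<diamondop>' idt D (q g))) \<cdot>\<^bsub>D\<^esub> (L g x \<diamondop>' (idt D (q ?h) \<diamondop>' idt D (q g)))"
    using assms by (simp add: c_alt D.whisker_right del: D.tA_idt)
  also have "\<dots> = L g x" using assms by (subst R_mult) simp_all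
  finally show ?thesis .
qed

text \<open>
  Expresses \<open>mu\<close> at two shifted objects by \<open>mu\<close> at unshifted ones. Moving \<open>p a\<close> past \<open>y\<close>
  conjugates \<open>y\<close>, and this is how the action isomorphisms of a crossed braided functor enter.
\<close>

lemma mu_R_R:
  assumes "a \<in> carrier G" "b \<in> carrier G" "x \<in> Obj C" "y \<in> Obj C"
  shows "mu (x \<odot> p a) (y \<odot> p b) \<cdot>\<^bsub>D\<^esub> (R x a \<diamondop>' R y b)
    = R (x \<odot> ad a y) (a \<otimes>\<^bsub>G\<^esub> b) \<cdot>\<^bsub>D\<^esub> ((mu x (ad a y) \<cdot>\<^bsub>D\<^esub> (idt D (fo x) \<diamondop>' c a y)) \<diamondop>' idt D (q (a \<otimes>\<^bsub>G\<^esub> b)))"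
proof -
  let ?fx = "idt D (fo x)" and ?qb = "idt D (q b)" and ?qa = "idt D (q a)"
  have "mu (x \<odot> p a) (y \<odot> p b) \<cdot>\<^bsub>D\<^esub> (R x a \<diamondop>' R y b)
    = (mu (x \<odot> p a) (y \<odot> p b) \<cdot>\<^bsub>D\<^esub> (R x a \<diamondop>' idt D (fo (y \<odot> p b)))) \<cdot>\<^bsub>D\<^esub> (idt D (fo x \<odot>' q a) \<diamondop>' R y b)"
    using assms by (simp add: D.merge)
  also have "\<dots> = mu x (p a \<odot> y \<odot> p b) \<cdot>\<^bsub>D\<^esub> (?fx \<diamondop>' (L a (y \<odot> p b) \<cdot>\<^bsub>D\<^esub> (?qa \<diamondop>' R y b)))"
    using assms by (simp add: mu_mid D.whisker_left flip: D.tA_assoc)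
  also have "L a (y \<odot> p b) \<cdot>\<^bsub>D\<^esub> (?qa \<diamondop>' R y b) = R (p a \<odot> y) b \<cdot>\<^bsub>D\<^esub> (L a y \<diamondop>' ?qb)"
    using assms by (simp add: L_R)
  also have "L a y \<diamondop>' ?qb = (R (ad a y) a \<diamondop>' ?qb) \<cdot>\<^bsub>D\<^esub> (c a y \<diamondop>' (?qa \<diamondop>' ?qb))"
    using assms by (simp add: R_c[symmetric] D.whisker_right del: D.tA_idt)
  also have "R (p a \<odot> y) b \<cdot>\<^bsub>D\<^esub> ((R (ad a y) a \<diamondop>' ?qb) \<cdot>\<^bsub>D\<^esub> (c a y \<diamondop>' (?qa \<diamondop>' ?qb)))
    = (R (ad a y \<odot> p a) b \<cdot>\<^bsub>D\<^esub> (R (ad a y) a \<diamondop>' ?qb)) \<cdot>\<^bsub>D\<^esub> (c a y \<diamondop>' (?qa \<diamondop>' ?qb))"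
    using assms by (simp del: D.tA_idt)
  also have "\<dots> = R (ad a y) (a \<otimes>\<^bsub>G\<^esub> b) \<cdot>\<^bsub>D\<^esub> (c a y \<diamondop>' idt D (q (a \<otimes>\<^bsub>G\<^esub> b)))"
    using assms by (subst R_mult) simp_all
  also have "mu x (p a \<odot> y \<odot> p b) \<cdot>\<^bsub>D\<^esub> (?fx \<diamondop>' (R (ad a y) (a \<otimes>\<^bsub>G\<^esub> b) \<cdot>\<^bsub>D\<^esub> (c a y \<diamondop>' idt D (q (a \<otimes>\<^bsub>G\<^esub> b)))))
    = (mu x (ad a y \<odot> p (a \<otimes>\<^bsub>G\<^esub> b)) \<cdot>\<^bsub>D\<^esub> (?fx \<diamondop>' R (ad a y) (a \<otimes>\<^bsub>G\<^esub> b))) \<cdot>\<^bsub>D\<^esub> ((?fx \<diamondop>' c a y) \<diamondop>' idt D (q (a \<otimes>\<^bsub>G\<^esub> b)))"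
    using assms by (simp add: D.whisker_left)
  also have "\<dots> = R (x \<odot> ad a y) (a \<otimes>\<^bsub>G\<^esub> b) \<cdot>\<^bsub>D\<^esub> ((mu x (ad a y) \<diamondop>' idt D (q (a \<otimes>\<^bsub>G\<^esub> b))) \<cdot>\<^bsub>D\<^esub> ((?fx \<diamondop>' c a y) \<diamondop>' idt D (q (a \<otimes>\<^bsub>G\<^esub> b))))"
    using assms by (subst mu_R) simp_all
  also have "\<dots> = R (x \<odot> ad a y) (a \<otimes>\<^bsub>G\<^esub> b) \<cdot>\<^bsub>D\<^esub> ((mu x (ad a y) \<cdot>\<^bsub>D\<^esub> (?fx \<diamondop>' c a y)) \<diamondop>' idt D (q (a \<otimes>\<^bsub>G\<^esub> b)))"
    using assms by (simp add: D.whisker_right)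
  finally show ?thesis .
qed

end


section \<open>From Gray-monoids to crossed braided categories\<close>

text \<open>
  An object \<open>(g, a)\<close> of grade \<open>g\<close> and a 1-cell named \<open>a\<close> from the unit to \<open>g\<close> are the same data.
  \<open>lift1\<close>, \<open>lift2\<close>, \<open>drop1\<close> and \<open>drop2\<close> translate between these encodings.
\<close>

definition lift1 :: "('g, 'h) monoid_scheme \<Rightarrow> 'g \<times> 'o \<Rightarrow> ('g, 'o) arr" where
  "lift1 G a = Arr \<one>\<^bsub>G\<^esub> (fst a) (snd a)"

definition drop1 :: "('g, 'o) arr \<Rightarrow> 'g \<times> 'o" where
  "drop1 x = (trg x, lab x)"

definition lift2 :: "('g, 'h) monoid_scheme \<Rightarrow> ('g \<times> 'o, 'm) arr \<Rightarrow> (('g, 'o) arr, 'm) arr" where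
  "lift2 G f = Arr (lift1 G (src f)) (lift1 G (trg f)) (lab f)"

definition drop2 :: "(('g, 'o) arr, 'm) arr \<Rightarrow> ('g \<times> 'o, 'm) arr" where
  "drop2 \<alpha> = Arr (drop1 (src \<alpha>)) (drop1 (trg \<alpha>)) (lab \<alpha>)"

lemma lift_simps [simp]:
  "src (lift1 G a) = \<one>\<^bsub>G\<^esub>" "trg (lift1 G a) = fst a" "drop1 (lift1 G a) = a"
  "src (lift2 G f) = lift1 G (src f)" "trg (lift2 G f) = lift1 G (trg f)" "drop2 (lift2 G f) = f"
  "fst (drop1 x) = trg x" "src (drop2 \<alpha>) = drop1 (src \<alpha>)" "trg (drop2 \<alpha>) = drop1 (trg \<alpha>)"
  by (simp_all add: lift1_def lift2_def drop1_def drop2_def)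

lemma lift1_drop1 [simp]: "src x = \<one>\<^bsub>G\<^esub> \<Longrightarrow> lift1 G (drop1 x) = x"
  by (cases x) (auto simp: lift1_def drop1_def)

lemma lift2_drop2' : "\<lbrakk>src (src \<alpha>) = \<one>\<^bsub>G\<^esub>; src (trg \<alpha>) = \<one>\<^bsub>G\<^esub>\<rbrakk> \<Longrightarrow> lift2 G (drop2 \<alpha>) = \<alpha>"
  by (cases \<alpha>) (auto simp: lift2_def drop2_def)

definition crossed_of :: "('g, 'h) monoid_scheme \<Rightarrow> ('g, 'o, 'm) gray \<Rightarrow> ('g, 'o, 'm) crsbrd" where
  "crossed_of G C =
     \<lparr> Obj = {a. lift1 G a \<in> Obj C}, Arrs = {f. lift2 G f \<in> Arrs C},
       idt = (\<lambda>a. drop2 (idt C (lift1 G a))),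
       vcmp = (\<lambda>g f. drop2 (lift2 G g \<cdot>\<^bsub>C\<^esub> lift2 G f)),
       tenO = (\<lambda>a b. drop1 (lift1 G a \<otimes>\<^sub>1\<^bsub>C\<^esub> lift1 G b)),
       tenM = (\<lambda>f u. drop2 (lift2 G f \<otimes>\<^sub>2\<^bsub>C\<^esub> lift2 G u)),
       assr = (\<lambda>a b c. drop2 (idt C (lift1 G a \<otimes>\<^sub>1\<^bsub>C\<^esub> lift1 G b \<otimes>\<^sub>1\<^bsub>C\<^esub> lift1 G c))),
       unitO = drop1 (id1 C \<one>\<^bsub>G\<^esub>),
       lunit = (\<lambda>a. drop2 (idt C (lift1 G a))),
       runit = (\<lambda>a. drop2 (idt C (lift1 G a))),
       Fo = (\<lambda>g a. drop1 (g \<triangleright>\<^bsub>C\<^esub> (lift1 G a \<triangleleft>\<^bsub>C\<^esub> (inv\<^bsub>G\<^esub> g)))),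
       Fm = (\<lambda>g f. drop2 (g \<unrhd>\<^bsub>C\<^esub> (lift2 G f \<unlhd>\<^bsub>C\<^esub> (inv\<^bsub>G\<^esub> g)))),
       Fi = (\<lambda>g. drop2 (idt C (id1 C \<one>\<^bsub>G\<^esub>))),
       Fpsi = (\<lambda>g a b. drop2 (idt C (g \<triangleright>\<^bsub>C\<^esub> ((lift1 G a \<otimes>\<^sub>1\<^bsub>C\<^esub> lift1 G b) \<triangleleft>\<^bsub>C\<^esub> (inv\<^bsub>G\<^esub> g))))),
       Fmu = (\<lambda>g h a. drop2 (idt C ((g \<otimes>\<^bsub>G\<^esub> h) \<triangleright>\<^bsub>C\<^esub> (lift1 G a \<triangleleft>\<^bsub>C\<^esub> (inv\<^bsub>G\<^esub> (g \<otimes>\<^bsub>G\<^esub> h)))))),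
       Fiota = (\<lambda>a. drop2 (idt C (lift1 G a))),
       brd = (\<lambda>a b. drop2 (ichg C (lift1 G a) (lift1 G b))) \<rparr>"

context pointed_gray
begin

lemma lift2_drop2 [simp]: "\<lbrakk>\<alpha> \<in> Arrs C; src (src \<alpha>) = \<one>\<rbrakk> \<Longrightarrow> lift2 G (drop2 \<alpha>) = \<alpha>"
  by (simp add: lift2_drop2')

lemma lift2_parallel: "lift2 G f \<in> Arrs C \<Longrightarrow> fst (trg f) = fst (src f)"
  using H.t_trg[of "lift2 G f"] by simp

lemma lift1_closed [simp]: "lift2 G f \<in> Arrs C \<Longrightarrow> lift1 G (src f) \<in> Obj C"
   "lift2 G f \<in> Arrs C \<Longrightarrow> lift1 G (trg f) \<in> Obj C"
  using src_Obj[of "lift2 G f"] trg_Obj[of "lift2 G f"] by (simp_all del: src_Obj trg_Obj)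

lemma fst_carrier [simp]: "lift1 G a \<in> Obj C \<Longrightarrow> fst a \<in> carrier G"
  using trg_carrier[of "lift1 G a"] by simp

text \<open>
  With \<open>src y = \<one>\<close> the right-hand side is the target of the interchanger of \<open>x\<close> and \<open>y\<close>, which
  thereby has the type of a crossed braiding.
\<close>

lemma ten1_tensor: "\<lbrakk>g \<in> carrier G; x \<in> Obj C; y \<in> Obj C; trg x = g; src x = \<one>\<rbrakk>
   \<Longrightarrow> (g \<triangleright>\<^bsub>C\<^esub> (y \<triangleleft>\<^bsub>C\<^esub> (inv g))) \<otimes>\<^sub>1\<^bsub>C\<^esub> x = (g \<triangleright>\<^bsub>C\<^esub> y) \<bullet>\<^bsub>C\<^esub> ((g \<otimes> (src y \<otimes> inv g)) \<triangleright>\<^bsub>C\<^esub> x)"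
  by (simp add: ten1_def)

lemma crossed_of_category: "category (crossed_of G C)"
  by unfold_locales (auto simp: crossed_of_def Hom_def)

lemma crossed_of_inverse:
  assumes "inverse_arrs C \<alpha> \<beta>" "src (src \<alpha>) = \<one>"
  shows "inverse_arrs (crossed_of G C) (drop2 \<alpha>) (drop2 \<beta>)"
proof -
  interpret K: category "crossed_of G C" by (rule crossed_of_category)
  have [simp]: "\<alpha> \<in> Arrs C" "\<beta> \<in> Arrs C" "src \<beta> = trg \<alpha>" "trg \<beta> = src \<alpha>" "\<beta> \<cdot>\<^bsub>C\<^esub> \<alpha> = idt C (src \<alpha>)"
     "\<alpha> \<cdot>\<^bsub>C\<^esub> \<beta> = idt C (trg \<alpha>)"
    using assms by (simp_all add: inverse_arrs_iff)
  show ?thesis unfolding K.inverse_arrs_iff using assms(2) by (simp add: crossed_of_def)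
qed

lemma crossed_of_iso:
  assumes "iso_arr C \<alpha>" "src (src \<alpha>) = \<one>"
  shows "iso_arr (crossed_of G C) (drop2 \<alpha>)"
  using crossed_of_inverse[OF inverse_arrs_inv_arr] assms by (auto simp: iso_arr_def)

lemma iso_lift2:
  assumes "iso_arr (crossed_of G C) f"
  shows "iso_arr C (lift2 G f)"
proof -
  interpret K: category "crossed_of G C" by (rule crossed_of_category)
  let ?g = "inv_arr (crossed_of G C) f"
  have f: "lift2 G f \<in> Arrs C" "lift2 G ?g \<in> Arrs C"
    using K.iso_simps(1,2)[OF assms] by (simp_all add: crossed_of_def)
  have 1: "src ?g = trg f" "trg ?g = src f" using K.iso_simps(3,4)[OF assms] by simp_all
  have "drop2 (lift2 G ?g \<cdot>\<^bsub>C\<^esub> lift2 G f) = drop2 (idt C (lift1 G (src f)))"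
    "drop2 (lift2 G f \<cdot>\<^bsub>C\<^esub> lift2 G ?g) = drop2 (idt C (lift1 G (trg f)))"
    using K.iso_simps(5,6)[OF assms] by (simp_all add: crossed_of_def)
  from this[THEN arg_cong[of _ _ "lift2 G"]]
  have "inverse_arrs C (lift2 G f) (lift2 G ?g)"
    unfolding inverse_arrs_iff using f 1 by simp
  then show ?thesis by (auto simp: iso_arr_def)
qed

text \<open>
  The action preserves the braiding because interchangers are compatible with tensoring by
  0-cells. The two hexagons are the compatibility of interchangers with composition of 1-cells:
  for 1-cells out of the unit, \<open>x \<otimes>\<^sub>1 y\<close> is the composite of \<open>y\<close> and a shift of \<open>x\<close>.
\<close>

lemma crossed_of_strict: "strict_crossed G (crossed_of G C)"
proof -
  interpret K: category "crossed_of G C" by (rule crossed_of_category)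
  show ?thesis
  proof unfold_locales
    fix f g f' g' assume "f \<in> Arrs (crossed_of G C)" "g \<in> Arrs (crossed_of G C)"
      "f' \<in> Arrs (crossed_of G C)" "g' \<in> Arrs (crossed_of G C)" "src f' = trg f" "src g' = trg g"
    then show "tenM (crossed_of G C) (g' \<cdot>\<^bsub>crossed_of G C\<^esub> g) (f' \<cdot>\<^bsub>crossed_of G C\<^esub> f)
      = tenM (crossed_of G C) g' f' \<cdot>\<^bsub>crossed_of G C\<^esub> tenM (crossed_of G C) g f"
      by (simp add: crossed_of_def T.merge)
  next
    fix g assume "g \<in> carrier G"
    then show "is_functor (crossed_of G C) (crossed_of G C) (Fo (crossed_of G C) g) (Fm (crossed_of G C) g)"
      by (simp add: is_functor_def crossed_of_def Hom_def)
  next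
    fix a b assume *: "a \<in> Obj (crossed_of G C)" "b \<in> Obj (crossed_of G C)"
    then show "iso_arr (crossed_of G C) (brd (crossed_of G C) a b)"
      using crossed_of_iso[of "ichg C (lift1 G a) (lift1 G b)"] by (simp add: crossed_of_def)
    from * show "src (brd (crossed_of G C) a b) = tenO (crossed_of G C) a b"
      "trg (brd (crossed_of G C) a b) = tenO (crossed_of G C) (Fo (crossed_of G C) (fst a) b) a"
      by (simp_all add: crossed_of_def ten1_def)
  next
    fix f u assume "f \<in> Arrs (crossed_of G C)" "u \<in> Arrs (crossed_of G C)"
    then show "brd (crossed_of G C) (trg f) (trg u) \<cdot>\<^bsub>crossed_of G C\<^esub> tenM (crossed_of G C) f u =
      tenM (crossed_of G C) (Fm (crossed_of G C) (fst (src f)) u) f \<cdot>\<^bsub>crossed_of G C\<^esub> brd (crossed_of G C) (src f) (src u)"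
      using ichg_nat[of "lift2 G f" "lift2 G u"] by (simp add: crossed_of_def ten2_def ten1_def)
  next
    fix g b c assume "g \<in> carrier G" "b \<in> Obj (crossed_of G C)" "c \<in> Obj (crossed_of G C)"
    then show "Fm (crossed_of G C) g (brd (crossed_of G C) b c) =
       brd (crossed_of G C) (Fo (crossed_of G C) g b) (Fo (crossed_of G C) g c)"
      using ichg_tensor[of g "lift1 G b \<triangleleft>\<^bsub>C\<^esub> (inv g)" "g \<triangleright>\<^bsub>C\<^esub> (lift1 G c \<triangleleft>\<^bsub>C\<^esub> (inv g))"]
        ichg_tensor[of "inv g" "lift1 G b" "g \<triangleright>\<^bsub>C\<^esub> (lift1 G c \<triangleleft>\<^bsub>C\<^esub> (inv g))"]
        ichg_tensor[of "inv g" "lift1 G b" "lift1 G c"]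
      by (simp add: crossed_of_def)
  next
    fix a b c assume "a \<in> Obj (crossed_of G C)" "b \<in> Obj (crossed_of G C)" "c \<in> Obj (crossed_of G C)"
    then have *: "lift1 G a \<in> Obj C" "lift1 G b \<in> Obj C" "lift1 G c \<in> Obj C" by (simp_all add: crossed_of_def)
    have "ichg C (lift1 G a) (lift1 G b \<otimes>\<^sub>1\<^bsub>C\<^esub> lift1 G c) =
      (idt C (fst a \<triangleright>\<^bsub>C\<^esub> (lift1 G b \<triangleleft>\<^bsub>C\<^esub> fst c)) \<star>\<^bsub>C\<^esub> ichg C (lift1 G a) (lift1 G c)) \<cdot>\<^bsub>C\<^esub>
        ((ichg C (lift1 G a) (lift1 G b) \<unlhd>\<^bsub>C\<^esub> fst c) \<star>\<^bsub>C\<^esub> idt C (lift1 G c))"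
      using * ichg_comp_right[of "lift1 G a" \<one> "fst a" "lift1 G c" \<one> "fst c" "lift1 G b \<triangleleft>\<^bsub>C\<^esub> fst c" "fst b \<otimes> fst c"]
         ichg_tensor[of "fst c" "lift1 G a" "lift1 G b"]
      by (simp add: Hom1_def ten1_def)
    then show "brd (crossed_of G C) a (tenO (crossed_of G C) b c) =
       tenM (crossed_of G C) (idt (crossed_of G C) (Fo (crossed_of G C) (fst a) b)) (brd (crossed_of G C) a c)
       \<cdot>\<^bsub>crossed_of G C\<^esub> tenM (crossed_of G C) (brd (crossed_of G C) a b) (idt (crossed_of G C) c)"
      using * by (simp add: crossed_of_def ten2_def)
    have "ichg C (lift1 G a \<otimes>\<^sub>1\<^bsub>C\<^esub> lift1 G b) (lift1 G c) =
      (ichg C (lift1 G a) (fst b \<triangleright>\<^bsub>C\<^esub> lift1 G c) \<star>\<^bsub>C\<^esub> idt C (lift1 G b)) \<cdot>\<^bsub>C\<^esub>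
        (idt C ((lift1 G a \<triangleleft>\<^bsub>C\<^esub> fst b) \<triangleleft>\<^bsub>C\<^esub> fst c) \<star>\<^bsub>C\<^esub> ichg C (lift1 G b) (lift1 G c))"
      using * ichg_comp_left[of "lift1 G b" \<one> "fst b" "lift1 G a \<triangleleft>\<^bsub>C\<^esub> fst b" "fst a \<otimes> fst b" "lift1 G c" \<one> "fst c"]
         ichg_tensor[of "fst b" "lift1 G a" "lift1 G c"]
      by (simp add: Hom1_def ten1_def)
    moreover have "ichg C (lift1 G a) (fst b \<triangleright>\<^bsub>C\<^esub> lift1 G c) = ichg C (lift1 G a) (fst b \<triangleright>\<^bsub>C\<^esub> (lift1 G c \<triangleleft>\<^bsub>C\<^esub> (inv (fst b)))) \<unlhd>\<^bsub>C\<^esub> fst b"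
      using * ichg_tensor[of "fst b" "lift1 G a" "fst b \<triangleright>\<^bsub>C\<^esub> (lift1 G c \<triangleleft>\<^bsub>C\<^esub> (inv (fst b)))"] by simp
    ultimately show "brd (crossed_of G C) (tenO (crossed_of G C) a b) c =
       tenM (crossed_of G C) (brd (crossed_of G C) a (Fo (crossed_of G C) (fst b) c)) (idt (crossed_of G C) b)
       \<cdot>\<^bsub>crossed_of G C\<^esub> tenM (crossed_of G C) (idt (crossed_of G C) a) (brd (crossed_of G C) b c)"
      using * by (simp add: crossed_of_def ten2_def ten1_def)
  next
    fix g a b assume "g \<in> carrier G" "a \<in> Obj (crossed_of G C)" "b \<in> Obj (crossed_of G C)"
    then show "Fo (crossed_of G C) g (tenO (crossed_of G C) a b)
      = tenO (crossed_of G C) (Fo (crossed_of G C) g a) (Fo (crossed_of G C) g b)"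
      by (simp add: crossed_of_def ten1_def)
  next
    fix g f u assume "g \<in> carrier G" "f \<in> Arrs (crossed_of G C)" "u \<in> Arrs (crossed_of G C)"
    then show "Fm (crossed_of G C) g (tenM (crossed_of G C) f u)
      = tenM (crossed_of G C) (Fm (crossed_of G C) g f) (Fm (crossed_of G C) g u)"
      by (simp add: crossed_of_def ten2_def)
  qed (simp_all add: crossed_of_def lift2_parallel)
qed

lemma crossed_of_braided: "strict_crossed_braided G (crossed_of G C)"
  unfolding strict_crossed_braided_iff using crossed_of_strict
  by (simp add: strict_cells_def crossed_of_def)

end

text \<open>
  Since \<open>A\<close> preserves the identity 1-cell of \<open>g\<close> only up to \<open>munit A g\<close>, it commutes with
  tensoring by \<open>g\<close> on the left, on the right, and with conjugation by \<open>g\<close> up to the cells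
  \<open>lcell\<close>, \<open>rcell\<close> and \<open>acell\<close>. They are the cells \<open>L\<close>, \<open>R\<close> and \<open>c\<close> of a monoidal functor that
  preserves invertible objects (\<open>P_cells\<close>).
\<close>

definition lcell :: "('g, 'o, 'm) gray \<Rightarrow> ('g, 'o, 'm) gray \<Rightarrow> ('g, 'o, 'm) fun3 \<Rightarrow> 'g \<Rightarrow> ('g, 'o) arr
    \<Rightarrow> (('g, 'o) arr, 'm) arr" where
  "lcell C D A g x = mten A (id1 C g) x \<cdot>\<^bsub>D\<^esub> (munit A g \<otimes>\<^sub>2\<^bsub>D\<^esub> idt D (map1 A x))"

definition rcell :: "('g, 'o, 'm) gray \<Rightarrow> ('g, 'o, 'm) gray \<Rightarrow> ('g, 'o, 'm) fun3 \<Rightarrow> ('g, 'o) arr \<Rightarrow> 'g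
    \<Rightarrow> (('g, 'o) arr, 'm) arr" where
  "rcell C D A x g = mten A x (id1 C g) \<cdot>\<^bsub>D\<^esub> (idt D (map1 A x) \<otimes>\<^sub>2\<^bsub>D\<^esub> munit A g)"

definition acell :: "('g, 'h) monoid_scheme \<Rightarrow> ('g, 'o, 'm) gray \<Rightarrow> ('g, 'o, 'm) gray \<Rightarrow> ('g, 'o, 'm) fun3 \<Rightarrow> 'g
    \<Rightarrow> ('g, 'o) arr \<Rightarrow> (('g, 'o) arr, 'm) arr" where
  "acell G C D A g x = lcell C D A g (x \<triangleleft>\<^bsub>C\<^esub> (inv\<^bsub>G\<^esub> g)) \<cdot>\<^bsub>D\<^esub> (g \<unrhd>\<^bsub>D\<^esub> rcell C D A x (inv\<^bsub>G\<^esub> g))"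

definition crsfun_of :: "('g, 'h) monoid_scheme \<Rightarrow> ('g, 'o, 'm) gray \<Rightarrow> ('g, 'o, 'm) gray
    \<Rightarrow> ('g, 'o, 'm) fun3 \<Rightarrow> ('g, 'o, 'm) crsfun" where
  "crsfun_of G C D A =
     \<lparr> cobj = (\<lambda>a \<in> Obj (crossed_of G C). drop1 (map1 A (lift1 G a))),
       carr = (\<lambda>f \<in> Arrs (crossed_of G C). drop2 (map2 A (lift2 G f))),
       cunit = drop2 (munit A \<one>\<^bsub>G\<^esub>),
       cten = (\<lambda>a b. if a \<in> Obj (crossed_of G C) \<and> b \<in> Obj (crossed_of G C)
                 then drop2 (mten A (lift1 G a) (lift1 G b)) else undefined),
       cact = (\<lambda>g a. if g \<in> carrier G \<and> a \<in> Obj (crossed_of G C)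
                 then drop2 (acell G C D A g (lift1 G a)) else undefined) \<rparr>"

lemma crossed_of_mem:
  "a \<in> Obj (crossed_of G C) \<longleftrightarrow> lift1 G a \<in> Obj C" "f \<in> Arrs (crossed_of G C) \<longleftrightarrow> lift2 G f \<in> Arrs C"
  by (simp_all add: crossed_of_def)

lemma crsfun_extensional_of: "crsfun_extensional G (crossed_of G C) (crsfun_of G C D A)"
  by (auto simp: crsfun_extensional_def crsfun_of_def)

sublocale pointed_functor \<subseteq> P: point_functor G C "id1 C (unit0 C)" "ten1 C" "ten2 C" D "id1 D (unit0 D)"
    "ten1 D" "ten2 D" "map1 A" "map2 A" "munit A \<one>\<^bsub>G\<^esub>" "mten A" "id1 C" "id1 D" "munit A"
  by unfold_locales (simp_all add: mten_munit)

(* Simplification turns tensoring with an identity 1-cell into the action of its 0-cell, and the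
   unit 0-cell into the unit of the group; these rules would undo that. *)
declare (in pointed_functor) P.p_mult [simp del] P.q_mult [simp del] P.p_one [simp del] P.q_one [simp del] P.u_one [simp del]

context pointed_functor
begin

lemma P_cells:
  "P.L g x = lcell C D A g x" "P.R x g = rcell C D A x g"
  "\<lbrakk>g \<in> carrier G; x \<in> Obj C\<rbrakk> \<Longrightarrow> P.c g x = acell G C D A g x"
proof -
  show 1: "P.L g x = lcell C D A g x" for g x by (simp add: P.L_def lcell_def)
  show 2: "P.R x g = rcell C D A x g" for g x by (simp add: P.R_def rcell_def)
  assume "g \<in> carrier G" "x \<in> Obj C"
  then show "P.c g x = acell G C D A g x"
    using P.LR_Arrs(2)[of "inv\<^bsub>G\<^esub> g" x] by (simp add: P.c_def acell_def 1 2)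
qed

lemma lcell_simps [simp]:
  assumes "g \<in> carrier G" "x \<in> Obj C"
  shows "iso_arr D (lcell C D A g x)" "src (lcell C D A g x) = g \<triangleright>\<^bsub>D\<^esub> map1 A x"
    "trg (lcell C D A g x) = map1 A (g \<triangleright>\<^bsub>C\<^esub> x)" "lcell C D A g x \<in> Arrs D"
  using P.LR_simps[OF assms] P.LR_Arrs[OF assms] assms by (simp_all add: P_cells)

lemma rcell_simps [simp]:
  assumes "g \<in> carrier G" "x \<in> Obj C"
  shows "iso_arr D (rcell C D A x g)" "src (rcell C D A x g) = map1 A x \<triangleleft>\<^bsub>D\<^esub> g"
    "trg (rcell C D A x g) = map1 A (x \<triangleleft>\<^bsub>C\<^esub> g)" "rcell C D A x g \<in> Arrs D"
  using P.LR_simps[OF assms] P.LR_Arrs[OF assms] assms by (simp_all add: P_cells)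

lemma acell_simps [simp]:
  assumes "g \<in> carrier G" "x \<in> Obj C"
  shows "iso_arr D (acell G C D A g x)" "src (acell G C D A g x) = g \<triangleright>\<^bsub>D\<^esub> (map1 A x \<triangleleft>\<^bsub>D\<^esub> (inv\<^bsub>G\<^esub> g))"
    "trg (acell G C D A g x) = map1 A (g \<triangleright>\<^bsub>C\<^esub> (x \<triangleleft>\<^bsub>C\<^esub> (inv\<^bsub>G\<^esub> g)))" "acell G C D A g x \<in> Arrs D"
  using P.c_simps[OF assms] P.c_Arrs[OF assms] assms by (simp_all add: P_cells)

text \<open>
  The cells for composition determine those for the tensor product, because \<open>x \<otimes>\<^sub>1 y\<close> is itself a
  composite. This is the exchange law for \<open>x \<bullet> id\<close> and \<open>id \<bullet> y\<close>, where the exchange cell of \<open>C\<close>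
  is an identity.
\<close>

lemma mten_as_mcomp:
  assumes x: "x \<in> Obj C" and y: "y \<in> Obj C"
  shows "mcomp A (x \<triangleleft>\<^bsub>C\<^esub> trg y) (src x \<triangleright>\<^bsub>C\<^esub> y) \<cdot>\<^bsub>D\<^esub> (rcell C D A x (trg y) \<star>\<^bsub>D\<^esub> lcell C D A (src x) y) = mten A x y"
proof -
  let ?a = "src x" and ?d = "trg y" and ?X = "map1 A x" and ?Y = "map1 A y"
  let ?ia = "id1 C ?a" and ?id = "id1 C ?d"
  (* Composing with ?W inserts the unit cells that the unit laws of mcomp cancel. *)
  let ?W = "(idt D ?X \<star>\<^bsub>D\<^esub> munit A ?a) \<otimes>\<^sub>2\<^bsub>D\<^esub> (munit A ?d \<star>\<^bsub>D\<^esub> idt D ?Y)"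
  let ?m = "mcomp A (x \<otimes>\<^sub>1\<^bsub>C\<^esub> ?id) (?ia \<otimes>\<^sub>1\<^bsub>C\<^esub> y)"
  have 1: "?m \<cdot>\<^bsub>D\<^esub> ((mten A x ?id \<star>\<^bsub>D\<^esub> mten A ?ia y) \<cdot>\<^bsub>D\<^esub> exch D (map1 A ?ia) ?X ?Y (map1 A ?id))
      = mten A x y \<cdot>\<^bsub>D\<^esub> (mcomp A x ?ia \<otimes>\<^sub>2\<^bsub>D\<^esub> mcomp A ?id y)"
    using mten_mcomp[of ?ia x y ?id] x y by simp
  have 2: "exch D (map1 A ?ia) ?X ?Y (map1 A ?id) \<cdot>\<^bsub>D\<^esub> ?W
     = (idt D ?X \<otimes>\<^sub>2\<^bsub>D\<^esub> munit A ?d) \<star>\<^bsub>D\<^esub> (munit A ?a \<otimes>\<^sub>2\<^bsub>D\<^esub> idt D ?Y)" (is "_ = ?Z")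
  proof -
    have "?X \<otimes>\<^sub>1\<^bsub>D\<^esub> ?Y = (?X \<triangleleft>\<^bsub>D\<^esub> ?d) \<bullet>\<^bsub>D\<^esub> (?a \<triangleright>\<^bsub>D\<^esub> ?Y)" using x y by (simp add: ten1_def)
    then have "?Z \<cdot>\<^bsub>D\<^esub> idt D (?X \<otimes>\<^sub>1\<^bsub>D\<^esub> ?Y) = ?Z" using x y by (intro D.vcmp_idt) simp_all
    then show ?thesis
      using D.exch_natural[of "munit A ?a" "idt D ?X" "idt D ?Y" "munit A ?d"] x y by simp
  qed
  have "mten A x y = mten A x y \<cdot>\<^bsub>D\<^esub> ((mcomp A x ?ia \<otimes>\<^sub>2\<^bsub>D\<^esub> mcomp A ?id y) \<cdot>\<^bsub>D\<^esub> ?W)"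
    using x y H.mu_unit_right[of x ?a] H.mu_unit_left[of y ?d] by (simp add: D.T.merge)
  also have "\<dots> = (mten A x y \<cdot>\<^bsub>D\<^esub> (mcomp A x ?ia \<otimes>\<^sub>2\<^bsub>D\<^esub> mcomp A ?id y)) \<cdot>\<^bsub>D\<^esub> ?W"
    using x y by simp
  also have "\<dots> = ?m \<cdot>\<^bsub>D\<^esub> ((mten A x ?id \<star>\<^bsub>D\<^esub> mten A ?ia y) \<cdot>\<^bsub>D\<^esub> (exch D (map1 A ?ia) ?X ?Y (map1 A ?id) \<cdot>\<^bsub>D\<^esub> ?W))"
    unfolding 1[symmetric] using x y by simp
  also have "\<dots> = ?m \<cdot>\<^bsub>D\<^esub> ((mten A x ?id \<cdot>\<^bsub>D\<^esub> (idt D ?X \<otimes>\<^sub>2\<^bsub>D\<^esub> munit A ?d)) \<star>\<^bsub>D\<^esub> (mten A ?ia y \<cdot>\<^bsub>D\<^esub> (munit A ?a \<otimes>\<^sub>2\<^bsub>D\<^esub> idt D ?Y)))"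
    unfolding 2 using x y by (simp add: D.H.merge)
  finally show ?thesis using x y by (simp add: lcell_def rcell_def)
qed

text \<open>
  The functor preserves interchangers. This is the exchange law for \<open>id \<bullet> x\<close> and \<open>y \<bullet> id\<close>, where
  the exchange cell of \<open>C\<close> is the interchanger.
\<close>

lemma map2_ichg:
  assumes x: "x \<in> Obj C" and y: "y \<in> Obj C"
  shows "mcomp A (trg x \<triangleright>\<^bsub>C\<^esub> y) (x \<triangleleft>\<^bsub>C\<^esub> src y) \<cdot>\<^bsub>D\<^esub> ((lcell C D A (trg x) y \<star>\<^bsub>D\<^esub> rcell C D A x (src y))
       \<cdot>\<^bsub>D\<^esub> ichg D (map1 A x) (map1 A y)) = map2 A (ichg C x y) \<cdot>\<^bsub>D\<^esub> mten A x y"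
proof -
  let ?b = "trg x" and ?c = "src y" and ?X = "map1 A x" and ?Y = "map1 A y"
  let ?ib = "id1 C ?b" and ?ic = "id1 C ?c"
  let ?W = "(munit A ?b \<star>\<^bsub>D\<^esub> idt D ?X) \<otimes>\<^sub>2\<^bsub>D\<^esub> (idt D ?Y \<star>\<^bsub>D\<^esub> munit A ?c)"
  let ?m = "mcomp A (?ib \<otimes>\<^sub>1\<^bsub>C\<^esub> y) (x \<otimes>\<^sub>1\<^bsub>C\<^esub> ?ic)"
  let ?e = "exch D ?X (map1 A ?ib) (map1 A ?ic) ?Y"
  have 1: "?m \<cdot>\<^bsub>D\<^esub> ((mten A ?ib y \<star>\<^bsub>D\<^esub> mten A x ?ic) \<cdot>\<^bsub>D\<^esub> ?e)
      = map2 A (ichg C x y) \<cdot>\<^bsub>D\<^esub> (mten A x y \<cdot>\<^bsub>D\<^esub> (mcomp A ?ib x \<otimes>\<^sub>2\<^bsub>D\<^esub> mcomp A y ?ic))"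
    using mten_mcomp[of x ?ib ?ic y] x y by simp
  have 2: "?e \<cdot>\<^bsub>D\<^esub> ?W
     = ((munit A ?b \<otimes>\<^sub>2\<^bsub>D\<^esub> idt D ?Y) \<star>\<^bsub>D\<^esub> (idt D ?X \<otimes>\<^sub>2\<^bsub>D\<^esub> munit A ?c)) \<cdot>\<^bsub>D\<^esub> ichg D ?X ?Y"
    using D.exch_natural[of "idt D ?X" "munit A ?b" "munit A ?c" "idt D ?Y"] x y by simp
  have t: "trg (mten A x y) = src (map2 A (ichg C x y))" using x y by (simp add: ten1_def)
  have "map2 A (ichg C x y) \<cdot>\<^bsub>D\<^esub> mten A x y
    = map2 A (ichg C x y) \<cdot>\<^bsub>D\<^esub> (mten A x y \<cdot>\<^bsub>D\<^esub> ((mcomp A ?ib x \<otimes>\<^sub>2\<^bsub>D\<^esub> mcomp A y ?ic) \<cdot>\<^bsub>D\<^esub> ?W))"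
    using x y H.mu_unit_right[of y ?c] H.mu_unit_left[of x ?b] by (simp add: D.T.merge)
  also have "\<dots> = (map2 A (ichg C x y) \<cdot>\<^bsub>D\<^esub> (mten A x y \<cdot>\<^bsub>D\<^esub> (mcomp A ?ib x \<otimes>\<^sub>2\<^bsub>D\<^esub> mcomp A y ?ic))) \<cdot>\<^bsub>D\<^esub> ?W"
    using x y t by (simp del: H.fa_src H.fa_trg T.mu_trg)
  also have "\<dots> = ?m \<cdot>\<^bsub>D\<^esub> ((mten A ?ib y \<star>\<^bsub>D\<^esub> mten A x ?ic) \<cdot>\<^bsub>D\<^esub> (?e \<cdot>\<^bsub>D\<^esub> ?W))"
    unfolding 1[symmetric] using x y by simp
  also have "\<dots> = ?m \<cdot>\<^bsub>D\<^esub> (((mten A ?ib y \<cdot>\<^bsub>D\<^esub> (munit A ?b \<otimes>\<^sub>2\<^bsub>D\<^esub> idt D ?Y)) \<star>\<^bsub>D\<^esub> (mten A x ?ic \<cdot>\<^bsub>D\<^esub> (idt D ?X \<otimes>\<^sub>2\<^bsub>D\<^esub> munit A ?c))) \<cdot>\<^bsub>D\<^esub> ichg D ?X ?Y)"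
    unfolding 2 using x y by (simp add: D.H.merge_r)
  finally show ?thesis using x y by (simp add: lcell_def rcell_def)
qed

lemma rcell_one [simp]: "x \<in> Obj C \<Longrightarrow> rcell C D A x \<one>\<^bsub>G\<^esub> = idt D (map1 A x)"
  and lcell_one [simp]: "x \<in> Obj C \<Longrightarrow> lcell C D A \<one>\<^bsub>G\<^esub> x = idt D (map1 A x)"
  using P.R_one[of x] P.L_one[of x] by (simp_all add: P_cells)

lemma rcell_nat: "\<lbrakk>g \<in> carrier G; f \<in> Arrs C\<rbrakk>
  \<Longrightarrow> rcell C D A (trg f) g \<cdot>\<^bsub>D\<^esub> (map2 A f \<unlhd>\<^bsub>D\<^esub> g) = map2 A (f \<unlhd>\<^bsub>C\<^esub> g) \<cdot>\<^bsub>D\<^esub> rcell C D A (src f) g"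
  using P.R_nat[of g f] by (simp add: P_cells)

lemma rcell_munit: "\<lbrakk>g \<in> carrier G; h \<in> carrier G\<rbrakk>
  \<Longrightarrow> rcell C D A (id1 C g) h \<cdot>\<^bsub>D\<^esub> (munit A g \<unlhd>\<^bsub>D\<^esub> h) = munit A (g \<otimes>\<^bsub>G\<^esub> h)"
  using P.R_u[of g h] by (simp add: P_cells)

lemma acell_nat: "\<lbrakk>g \<in> carrier G; f \<in> Arrs C\<rbrakk>
  \<Longrightarrow> acell G C D A g (trg f) \<cdot>\<^bsub>D\<^esub> (g \<unrhd>\<^bsub>D\<^esub> (map2 A f \<unlhd>\<^bsub>D\<^esub> (inv\<^bsub>G\<^esub> g)))
    = map2 A (g \<unrhd>\<^bsub>C\<^esub> (f \<unlhd>\<^bsub>C\<^esub> (inv\<^bsub>G\<^esub> g))) \<cdot>\<^bsub>D\<^esub> acell G C D A g (src f)"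
  using P.c_nat[of g f] by (simp add: P_cells)

lemma acell_mten: "\<lbrakk>g \<in> carrier G; x \<in> Obj C; y \<in> Obj C\<rbrakk>
  \<Longrightarrow> acell G C D A g (x \<otimes>\<^sub>1\<^bsub>C\<^esub> y) \<cdot>\<^bsub>D\<^esub> (g \<unrhd>\<^bsub>D\<^esub> (mten A x y \<unlhd>\<^bsub>D\<^esub> (inv\<^bsub>G\<^esub> g)))
    = mten A (g \<triangleright>\<^bsub>C\<^esub> (x \<triangleleft>\<^bsub>C\<^esub> (inv\<^bsub>G\<^esub> g))) (g \<triangleright>\<^bsub>C\<^esub> (y \<triangleleft>\<^bsub>C\<^esub> (inv\<^bsub>G\<^esub> g)))
        \<cdot>\<^bsub>D\<^esub> (acell G C D A g x \<otimes>\<^sub>2\<^bsub>D\<^esub> acell G C D A g y)"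
  using P.c_ten[of g x y] by (simp add: P_cells)

lemma acell_mult: "\<lbrakk>g \<in> carrier G; h \<in> carrier G; x \<in> Obj C\<rbrakk>
  \<Longrightarrow> acell G C D A (g \<otimes>\<^bsub>G\<^esub> h) x = acell G C D A g (h \<triangleright>\<^bsub>C\<^esub> (x \<triangleleft>\<^bsub>C\<^esub> (inv\<^bsub>G\<^esub> h)))
        \<cdot>\<^bsub>D\<^esub> (g \<unrhd>\<^bsub>D\<^esub> (acell G C D A h x \<unlhd>\<^bsub>D\<^esub> (inv\<^bsub>G\<^esub> g)))"
  using P.c_mult[of g h x] by (simp add: P_cells)

lemma acell_munit: "g \<in> carrier G
  \<Longrightarrow> acell G C D A g (id1 C \<one>\<^bsub>G\<^esub>) \<cdot>\<^bsub>D\<^esub> (g \<unrhd>\<^bsub>D\<^esub> (munit A \<one>\<^bsub>G\<^esub> \<unlhd>\<^bsub>D\<^esub> (inv\<^bsub>G\<^esub> g))) = munit A \<one>\<^bsub>G\<^esub>"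
  using P.c_unit[of g] by (simp add: P_cells)

lemma rcell_acell: "\<lbrakk>g \<in> carrier G; x \<in> Obj C\<rbrakk>
  \<Longrightarrow> rcell C D A (g \<triangleright>\<^bsub>C\<^esub> (x \<triangleleft>\<^bsub>C\<^esub> (inv\<^bsub>G\<^esub> g))) g \<cdot>\<^bsub>D\<^esub> (acell G C D A g x \<unlhd>\<^bsub>D\<^esub> g) = lcell C D A g x"
  using P.R_c[of g x] by (simp add: P_cells)

lemma mten_rcell: "\<lbrakk>a \<in> carrier G; b \<in> carrier G; x \<in> Obj C; y \<in> Obj C\<rbrakk>
  \<Longrightarrow> mten A (x \<triangleleft>\<^bsub>C\<^esub> a) (y \<triangleleft>\<^bsub>C\<^esub> b) \<cdot>\<^bsub>D\<^esub> (rcell C D A x a \<otimes>\<^sub>2\<^bsub>D\<^esub> rcell C D A y b)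
    = rcell C D A (x \<otimes>\<^sub>1\<^bsub>C\<^esub> (a \<triangleright>\<^bsub>C\<^esub> (y \<triangleleft>\<^bsub>C\<^esub> (inv\<^bsub>G\<^esub> a)))) (a \<otimes>\<^bsub>G\<^esub> b)
       \<cdot>\<^bsub>D\<^esub> ((mten A x (a \<triangleright>\<^bsub>C\<^esub> (y \<triangleleft>\<^bsub>C\<^esub> (inv\<^bsub>G\<^esub> a))) \<cdot>\<^bsub>D\<^esub> (idt D (map1 A x) \<otimes>\<^sub>2\<^bsub>D\<^esub> acell G C D A a y)) \<unlhd>\<^bsub>D\<^esub> (a \<otimes>\<^bsub>G\<^esub> b))"
  using P.mu_R_R[of a b x y] by (simp add: P_cells del: D.rten_simps(10) D.act_simps C.act_simps)

text \<open>
  The compatibility of \<open>crsfun_of\<close> with the braiding. By \<open>rcell_acell\<close> the left cell in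
  \<open>map2_ichg\<close> is a right cell after an action cell, and the right cell becomes part of \<open>mten\<close>.
\<close>

lemma map2_ichg_acell:
  assumes x: "x \<in> Obj C" "src x = \<one>\<^bsub>G\<^esub>" and y: "y \<in> Obj C" "src y = \<one>\<^bsub>G\<^esub>"
  shows "map2 A (ichg C x y) \<cdot>\<^bsub>D\<^esub> mten A x y = mten A (trg x \<triangleright>\<^bsub>C\<^esub> (y \<triangleleft>\<^bsub>C\<^esub> (inv\<^bsub>G\<^esub> (trg x)))) x
     \<cdot>\<^bsub>D\<^esub> ((acell G C D A (trg x) y \<otimes>\<^sub>2\<^bsub>D\<^esub> idt D (map1 A x)) \<cdot>\<^bsub>D\<^esub> ichg D (map1 A x) (map1 A y))"
proof -
  let ?g = "trg x"
  let ?y = "?g \<triangleright>\<^bsub>C\<^esub> (y \<triangleleft>\<^bsub>C\<^esub> (inv\<^bsub>G\<^esub> ?g))" and ?X = "map1 A x"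
  let ?m = "mcomp A (?g \<triangleright>\<^bsub>C\<^esub> y) x" and ?i = "ichg D ?X (map1 A y)"
  have 1: "mten A ?y x = ?m \<cdot>\<^bsub>D\<^esub> (rcell C D A ?y ?g \<star>\<^bsub>D\<^esub> idt D ?X)"
    using mten_as_mcomp[of ?y x] x y by simp
  have 2: "acell G C D A ?g y \<otimes>\<^sub>2\<^bsub>D\<^esub> idt D ?X = (acell G C D A ?g y \<unlhd>\<^bsub>D\<^esub> ?g) \<star>\<^bsub>D\<^esub> idt D ?X"
    using x y by (simp add: ten2_def)
  have "map2 A (ichg C x y) \<cdot>\<^bsub>D\<^esub> mten A x y = ?m \<cdot>\<^bsub>D\<^esub> ((lcell C D A ?g y \<star>\<^bsub>D\<^esub> idt D ?X) \<cdot>\<^bsub>D\<^esub> ?i)"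
    using map2_ichg[of x y] x y by simp
  also have "lcell C D A ?g y \<star>\<^bsub>D\<^esub> idt D ?X
     = (rcell C D A ?y ?g \<star>\<^bsub>D\<^esub> idt D ?X) \<cdot>\<^bsub>D\<^esub> ((acell G C D A ?g y \<unlhd>\<^bsub>D\<^esub> ?g) \<star>\<^bsub>D\<^esub> idt D ?X)"
    using x y by (simp add: rcell_acell[symmetric] D.H.whisker_right)
  finally show ?thesis unfolding 1 2 using x y by simp
qed

lemma crsfun_of_functor: "strict_crossed_functor G (crossed_of G C) (crossed_of G D) (crsfun_of G C D A)"
proof -
  interpret KC: strict_crossed G "crossed_of G C" by (rule C.crossed_of_strict)
  interpret KD: strict_crossed G "crossed_of G D" by (rule D.crossed_of_strict)
  note iso = D.crossed_of_iso
  note ds = crossed_of_def crsfun_of_def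
  show ?thesis
  proof unfold_locales
    show "is_functor (crossed_of G C) (crossed_of G D) (cobj (crsfun_of G C D A)) (carr (crsfun_of G C D A))"
      by (simp add: is_functor_def ds Hom_def)
    show "iso_arr (crossed_of G D) (cunit (crsfun_of G C D A))"
      using iso[of "munit A \<one>\<^bsub>G\<^esub>"] by (simp add: ds)
  next
    fix x y assume "x \<in> Obj (crossed_of G C)" "y \<in> Obj (crossed_of G C)"
    then show "iso_arr (crossed_of G D) (cten (crsfun_of G C D A) y x)"
      using iso[of "mten A (lift1 G y) (lift1 G x)"] by (simp add: ds)
  next
    fix g x assume "g \<in> carrier G" "x \<in> Obj (crossed_of G C)"
    then show "iso_arr (crossed_of G D) (cact (crsfun_of G C D A) g x)"
      using iso[of "acell G C D A g (lift1 G x)"] by (simp add: ds)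
  next
    fix f g assume "f \<in> Arrs (crossed_of G C)" "g \<in> Arrs (crossed_of G C)"
    then show "cten (crsfun_of G C D A) (trg g) (trg f) \<cdot>\<^bsub>crossed_of G D\<^esub>
         tenM (crossed_of G D) (carr (crsfun_of G C D A) g) (carr (crsfun_of G C D A) f)
       = carr (crsfun_of G C D A) (tenM (crossed_of G C) g f) \<cdot>\<^bsub>crossed_of G D\<^esub> cten (crsfun_of G C D A) (src g) (src f)"
      using T.mu_natural[of "lift2 G f" "lift2 G g"] by (simp add: ds)
  next
    fix x y z assume "x \<in> Obj (crossed_of G C)" "y \<in> Obj (crossed_of G C)" "z \<in> Obj (crossed_of G C)"
    then show "cten (crsfun_of G C D A) z (tenO (crossed_of G C) y x) \<cdot>\<^bsub>crossed_of G D\<^esub>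
       tenM (crossed_of G D) (idt (crossed_of G D) (cobj (crsfun_of G C D A) z)) (cten (crsfun_of G C D A) y x) =
       cten (crsfun_of G C D A) (tenO (crossed_of G C) z y) x \<cdot>\<^bsub>crossed_of G D\<^esub>
       tenM (crossed_of G D) (cten (crsfun_of G C D A) z y) (idt (crossed_of G D) (cobj (crsfun_of G C D A) x))"
      using T.mu_assoc[of "lift1 G x" "lift1 G y" "lift1 G z"] by (simp add: ds)
  next
    fix x assume "x \<in> Obj (crossed_of G C)"
    then show "cten (crsfun_of G C D A) (unitO (crossed_of G C)) x \<cdot>\<^bsub>crossed_of G D\<^esub>
       tenM (crossed_of G D) (cunit (crsfun_of G C D A)) (idt (crossed_of G D) (cobj (crsfun_of G C D A) x))
       = idt (crossed_of G D) (cobj (crsfun_of G C D A) x)"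
      "cten (crsfun_of G C D A) x (unitO (crossed_of G C)) \<cdot>\<^bsub>crossed_of G D\<^esub>
       tenM (crossed_of G D) (idt (crossed_of G D) (cobj (crsfun_of G C D A) x)) (cunit (crsfun_of G C D A))
       = idt (crossed_of G D) (cobj (crsfun_of G C D A) x)"
      using T.mu_unit_left[of "lift1 G x"] T.mu_unit_right[of "lift1 G x"] by (simp_all add: ds)
  next
    fix g f assume "g \<in> carrier G" "f \<in> Arrs (crossed_of G C)"
    then show "cact (crsfun_of G C D A) g (trg f) \<cdot>\<^bsub>crossed_of G D\<^esub> Fm (crossed_of G D) g (carr (crsfun_of G C D A) f)
       = carr (crsfun_of G C D A) (Fm (crossed_of G C) g f) \<cdot>\<^bsub>crossed_of G D\<^esub> cact (crsfun_of G C D A) g (src f)"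
      using acell_nat[of g "lift2 G f"] by (simp add: ds)
  next
    fix g x y assume "g \<in> carrier G" "x \<in> Obj (crossed_of G C)" "y \<in> Obj (crossed_of G C)"
    then show "cact (crsfun_of G C D A) g (tenO (crossed_of G C) x y) \<cdot>\<^bsub>crossed_of G D\<^esub> Fm (crossed_of G D) g (cten (crsfun_of G C D A) x y)
       = cten (crsfun_of G C D A) (Fo (crossed_of G C) g x) (Fo (crossed_of G C) g y)
        \<cdot>\<^bsub>crossed_of G D\<^esub> tenM (crossed_of G D) (cact (crsfun_of G C D A) g x) (cact (crsfun_of G C D A) g y)"
      using acell_mten[of g "lift1 G x" "lift1 G y"] by (simp add: ds)
  next
    fix g assume "g \<in> carrier G"
    then show "cact (crsfun_of G C D A) g (unitO (crossed_of G C)) \<cdot>\<^bsub>crossed_of G D\<^esub> Fm (crossed_of G D) g (cunit (crsfun_of G C D A))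
       = cunit (crsfun_of G C D A)"
      using acell_munit[of g] by (simp add: ds)
  next
    fix g h x assume "g \<in> carrier G" "h \<in> carrier G" "x \<in> Obj (crossed_of G C)"
    then show "cact (crsfun_of G C D A) (g \<otimes>\<^bsub>G\<^esub> h) x
       = cact (crsfun_of G C D A) g (Fo (crossed_of G C) h x) \<cdot>\<^bsub>crossed_of G D\<^esub> Fm (crossed_of G D) g (cact (crsfun_of G C D A) h x)"
      using acell_mult[of g h "lift1 G x"] by (simp add: ds)
  next
    fix a b assume "a \<in> Obj (crossed_of G C)" "b \<in> Obj (crossed_of G C)"
    then show "carr (crsfun_of G C D A) (brd (crossed_of G C) a b) \<cdot>\<^bsub>crossed_of G D\<^esub> cten (crsfun_of G C D A) a b
       = cten (crsfun_of G C D A) (Fo (crossed_of G C) (fst a) b) a \<cdot>\<^bsub>crossed_of G D\<^esub>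
         (tenM (crossed_of G D) (cact (crsfun_of G C D A) (fst a) b) (idt (crossed_of G D) (cobj (crsfun_of G C D A) a))
         \<cdot>\<^bsub>crossed_of G D\<^esub> brd (crossed_of G D) (cobj (crsfun_of G C D A) a) (cobj (crsfun_of G C D A) b))"
      using map2_ichg_acell[of "lift1 G a" "lift1 G b"] by (simp add: ds D.ten1_tensor)
  qed (simp_all add: ds)
qed

end

lemma crsfun_of_id:
  assumes "pointed_gray G C"
  shows "crsfun_of G C C (id_fun3 C) = id_crsfun G (crossed_of G C)"
proof -
  interpret pointed_gray G C by fact
  show ?thesis
    by (intro crsfun.equality)
     (auto simp: crsfun_of_def id_crsfun_def crossed_of_def id_fun3_def fun_eq_iff acell_def lcell_def rcell_def)
qed

lemma crsfun_of_comp: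
  assumes "pointed_functor G C D A" "pointed_functor G D E B"
  shows "crsfun_of G C E (comp_fun3 C E B A)
       = comp_crsfun G (crossed_of G C) (crossed_of G E) (crsfun_of G D E B) (crsfun_of G C D A)"
proof -
  interpret A: pointed_functor G C D A by fact
  interpret B: pointed_functor G D E B by fact
  let ?K = "comp_fun3 C E B A"
  (* The cells of the composite are composites of the cells, by naturality of mten B and of the
     left cell of B. *)
  have l: "lcell C E ?K g x = map2 B (lcell C D A g x) \<cdot>\<^bsub>E\<^esub> lcell D E B g (map1 A x)"
    if "g \<in> carrier G" "x \<in> Obj C" for g x
  proof -
    let ?u = "munit A g" and ?x = "map1 A x"
    have "lcell C E ?K g x = map2 B (mten A (id1 C g) x) \<cdot>\<^bsub>E\<^esub> ((mten B (map1 A (id1 C g)) ?x \<cdot>\<^bsub>E\<^esub> (map2 B ?u \<otimes>\<^sub>2\<^bsub>E\<^esub> map2 B (idt D ?x)))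
       \<cdot>\<^bsub>E\<^esub> (munit B g \<otimes>\<^sub>2\<^bsub>E\<^esub> idt E (map1 B ?x)))"
      using that by (simp add: lcell_def B.D.T.merge)
    also have "\<dots> = map2 B (lcell C D A g x) \<cdot>\<^bsub>E\<^esub> lcell D E B g ?x"
      using that B.T.mu_natural[of "idt D ?x" ?u] by (simp add: lcell_def del: B.H.fa_idt)
    finally show ?thesis .
  qed
  have r: "rcell C E ?K x g = map2 B (rcell C D A x g) \<cdot>\<^bsub>E\<^esub> rcell D E B (map1 A x) g"
    if "g \<in> carrier G" "x \<in> Obj C" for g x
  proof -
    let ?u = "munit A g" and ?x = "map1 A x"
    have "rcell C E ?K x g = map2 B (mten A x (id1 C g)) \<cdot>\<^bsub>E\<^esub> ((mten B ?x (map1 A (id1 C g)) \<cdot>\<^bsub>E\<^esub> (map2 B (idt D ?x) \<otimes>\<^sub>2\<^bsub>E\<^esub> map2 B ?u))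
       \<cdot>\<^bsub>E\<^esub> (idt E (map1 B ?x) \<otimes>\<^sub>2\<^bsub>E\<^esub> munit B g))"
      using that by (simp add: rcell_def B.D.T.merge)
    also have "\<dots> = map2 B (rcell C D A x g) \<cdot>\<^bsub>E\<^esub> rcell D E B ?x g"
      using that B.T.mu_natural[of ?u "idt D ?x"] by (simp add: rcell_def del: B.H.fa_idt)
    finally show ?thesis .
  qed
  have a: "acell G C E ?K g x = map2 B (acell G C D A g x) \<cdot>\<^bsub>E\<^esub> acell G D E B g (map1 A x)"
    if "g \<in> carrier G" "x \<in> Obj C" for g x
  proof -
    let ?h = "inv\<^bsub>G\<^esub> g" and ?x = "map1 A x"
    have "acell G C E ?K g x = map2 B (lcell C D A g (x \<triangleleft>\<^bsub>C\<^esub> ?h)) \<cdot>\<^bsub>E\<^esub> ((lcell D E B g (map1 A (x \<triangleleft>\<^bsub>C\<^esub> ?h)) \<cdot>\<^bsub>E\<^esub> (g \<unrhd>\<^bsub>E\<^esub> map2 B (rcell C D A x ?h)))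
       \<cdot>\<^bsub>E\<^esub> (g \<unrhd>\<^bsub>E\<^esub> rcell D E B ?x ?h))"
      using that by (simp add: acell_def l r)
    also have "\<dots> = map2 B (acell G C D A g x) \<cdot>\<^bsub>E\<^esub> acell G D E B g ?x"
      using that B.P.L_nat[of g "rcell C D A x ?h"] by (simp add: acell_def B.P_cells)
    finally show ?thesis .
  qed
  show ?thesis
    by (intro crsfun.equality) (auto simp: crsfun_of_def crossed_of_def comp_crsfun_def fun_eq_iff a)
qed

definition trans_of :: "('g, 'h) monoid_scheme \<Rightarrow> ('g, 'o, 'm) gray \<Rightarrow> (('g, 'o) arr \<Rightarrow> (('g, 'o) arr, 'm) arr)
    \<Rightarrow> 'g \<times> 'o \<Rightarrow> ('g \<times> 'o, 'm) arr" where
  "trans_of G C \<eta> = (\<lambda>a \<in> Obj (crossed_of G C). drop2 (\<eta> (lift1 G a)))"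

context pointed_transformation
begin

lemma lcell_trans:
  assumes "g \<in> carrier G" "x \<in> Obj C"
  shows "\<eta> (g \<triangleright>\<^bsub>C\<^esub> x) \<cdot>\<^bsub>D\<^esub> lcell C D A g x = lcell C D B g x \<cdot>\<^bsub>D\<^esub> (g \<unrhd>\<^bsub>D\<^esub> \<eta> x)"
proof -
  have "\<eta> (g \<triangleright>\<^bsub>C\<^esub> x) \<cdot>\<^bsub>D\<^esub> lcell C D A g x = (\<eta> (g \<triangleright>\<^bsub>C\<^esub> x) \<cdot>\<^bsub>D\<^esub> mten A (id1 C g) x) \<cdot>\<^bsub>D\<^esub> (munit A g \<otimes>\<^sub>2\<^bsub>D\<^esub> idt D (map1 A x))"
    using assms by (simp add: lcell_def)
  also have "\<dots> = mten B (id1 C g) x \<cdot>\<^bsub>D\<^esub> ((\<eta> (id1 C g) \<cdot>\<^bsub>D\<^esub> munit A g) \<otimes>\<^sub>2\<^bsub>D\<^esub> \<eta> x)"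
    using assms T.resp_mu[of x "id1 C g"] by (simp add: A.D.T.merge)
  also have "\<dots> = mten B (id1 C g) x \<cdot>\<^bsub>D\<^esub> ((munit B g \<otimes>\<^sub>2\<^bsub>D\<^esub> idt D (map1 B x)) \<cdot>\<^bsub>D\<^esub> (idt D (id1 D g) \<otimes>\<^sub>2\<^bsub>D\<^esub> \<eta> x))"
    using assms by (simp add: H.resp_eps A.D.T.merge del: A.D.id_ten2)
  finally show ?thesis using assms by (simp add: lcell_def)
qed

lemma rcell_trans:
  assumes "g \<in> carrier G" "x \<in> Obj C"
  shows "\<eta> (x \<triangleleft>\<^bsub>C\<^esub> g) \<cdot>\<^bsub>D\<^esub> rcell C D A x g = rcell C D B x g \<cdot>\<^bsub>D\<^esub> (\<eta> x \<unlhd>\<^bsub>D\<^esub> g)"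
proof -
  have "\<eta> (x \<triangleleft>\<^bsub>C\<^esub> g) \<cdot>\<^bsub>D\<^esub> rcell C D A x g = (\<eta> (x \<triangleleft>\<^bsub>C\<^esub> g) \<cdot>\<^bsub>D\<^esub> mten A x (id1 C g)) \<cdot>\<^bsub>D\<^esub> (idt D (map1 A x) \<otimes>\<^sub>2\<^bsub>D\<^esub> munit A g)"
    using assms by (simp add: rcell_def)
  also have "\<dots> = mten B x (id1 C g) \<cdot>\<^bsub>D\<^esub> (\<eta> x \<otimes>\<^sub>2\<^bsub>D\<^esub> (\<eta> (id1 C g) \<cdot>\<^bsub>D\<^esub> munit A g))"
    using assms T.resp_mu[of "id1 C g" x] by (simp add: A.D.T.merge)
  also have "\<dots> = mten B x (id1 C g) \<cdot>\<^bsub>D\<^esub> ((idt D (map1 B x) \<otimes>\<^sub>2\<^bsub>D\<^esub> munit B g) \<cdot>\<^bsub>D\<^esub> (\<eta> x \<otimes>\<^sub>2\<^bsub>D\<^esub> idt D (id1 D g)))"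
    using assms by (simp add: H.resp_eps A.D.T.merge del: A.D.ten2_id)
  finally show ?thesis using assms by (simp add: rcell_def)
qed

lemma acell_trans:
  assumes "g \<in> carrier G" "x \<in> Obj C"
  shows "\<eta> (g \<triangleright>\<^bsub>C\<^esub> (x \<triangleleft>\<^bsub>C\<^esub> (inv\<^bsub>G\<^esub> g))) \<cdot>\<^bsub>D\<^esub> acell G C D A g x
    = acell G C D B g x \<cdot>\<^bsub>D\<^esub> (g \<unrhd>\<^bsub>D\<^esub> (\<eta> x \<unlhd>\<^bsub>D\<^esub> (inv\<^bsub>G\<^esub> g)))"
proof -
  let ?h = "inv\<^bsub>G\<^esub> g"
  have "\<eta> (g \<triangleright>\<^bsub>C\<^esub> (x \<triangleleft>\<^bsub>C\<^esub> ?h)) \<cdot>\<^bsub>D\<^esub> acell G C D A g x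
    = (\<eta> (g \<triangleright>\<^bsub>C\<^esub> (x \<triangleleft>\<^bsub>C\<^esub> ?h)) \<cdot>\<^bsub>D\<^esub> lcell C D A g (x \<triangleleft>\<^bsub>C\<^esub> ?h)) \<cdot>\<^bsub>D\<^esub> (g \<unrhd>\<^bsub>D\<^esub> rcell C D A x ?h)"
    using assms by (simp add: acell_def)
  also have "\<dots> = lcell C D B g (x \<triangleleft>\<^bsub>C\<^esub> ?h) \<cdot>\<^bsub>D\<^esub> (g \<unrhd>\<^bsub>D\<^esub> (\<eta> (x \<triangleleft>\<^bsub>C\<^esub> ?h) \<cdot>\<^bsub>D\<^esub> rcell C D A x ?h))"
    using assms lcell_trans[of g "x \<triangleleft>\<^bsub>C\<^esub> ?h"] by simp
  also have "\<dots> = acell G C D B g x \<cdot>\<^bsub>D\<^esub> (g \<unrhd>\<^bsub>D\<^esub> (\<eta> x \<unlhd>\<^bsub>D\<^esub> ?h))"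
    using assms rcell_trans[of ?h x] by (simp add: acell_def)
  finally show ?thesis .
qed

lemma trans_of_transformation:
  "strict_crossed_transformation G (crossed_of G C) (crossed_of G D) (crsfun_of G C D A) (crsfun_of G C D B) (trans_of G C \<eta>)"
proof -
  interpret KA: strict_crossed_functor G "crossed_of G C" "crossed_of G D" "crsfun_of G C D A"
    by (rule A.crsfun_of_functor)
  interpret KB: strict_crossed_functor G "crossed_of G C" "crossed_of G D" "crsfun_of G C D B"
    by (rule B.crsfun_of_functor)
  note ds = crossed_of_def crsfun_of_def trans_of_def
  show ?thesis
  proof unfold_locales
    fix f assume "f \<in> Arrs (crossed_of G C)"
    then show "trans_of G C \<eta> (trg f) \<cdot>\<^bsub>crossed_of G D\<^esub> carr (crsfun_of G C D A) f
      = carr (crsfun_of G C D B) f \<cdot>\<^bsub>crossed_of G D\<^esub> trans_of G C \<eta> (src f)"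
      using H.nat[of "lift2 G f"] by (simp add: ds)
  next
    show "trans_of G C \<eta> (unitO (crossed_of G C)) \<cdot>\<^bsub>crossed_of G D\<^esub> cunit (crsfun_of G C D A) = cunit (crsfun_of G C D B)"
      using H.resp_eps[of "\<one>\<^bsub>G\<^esub>"] by (simp add: ds)
  next
    fix x y assume "x \<in> Obj (crossed_of G C)" "y \<in> Obj (crossed_of G C)"
    then show "trans_of G C \<eta> (tenO (crossed_of G C) y x) \<cdot>\<^bsub>crossed_of G D\<^esub> cten (crsfun_of G C D A) y x
      = cten (crsfun_of G C D B) y x \<cdot>\<^bsub>crossed_of G D\<^esub> tenM (crossed_of G D) (trans_of G C \<eta> y) (trans_of G C \<eta> x)"
      using T.resp_mu[of "lift1 G x" "lift1 G y"] by (simp add: ds)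
  next
    fix g x assume "g \<in> carrier G" "x \<in> Obj (crossed_of G C)"
    then show "trans_of G C \<eta> (Fo (crossed_of G C) g x) \<cdot>\<^bsub>crossed_of G D\<^esub> cact (crsfun_of G C D A) g x
      = cact (crsfun_of G C D B) g x \<cdot>\<^bsub>crossed_of G D\<^esub> Fm (crossed_of G D) g (trans_of G C \<eta> x)"
      using acell_trans[of g "lift1 G x"] by (simp add: ds)
  qed (simp_all add: ds)
qed

end


section \<open>Transformations are determined by their components on 1-cells out of the unit\<close>

context pointed_gray
begin

lemma ten2_shift:
  assumes "f \<in> Arrs C" "u \<in> Arrs C" "a \<in> carrier G" "b \<in> carrier G" "src (src f) = \<one>"
  shows "((f \<otimes>\<^sub>2\<^bsub>C\<^esub> (a \<unrhd>\<^bsub>C\<^esub> (u \<unlhd>\<^bsub>C\<^esub> (inv a)))) \<unlhd>\<^bsub>C\<^esub> a) \<unlhd>\<^bsub>C\<^esub> b = (f \<unlhd>\<^bsub>C\<^esub> a) \<otimes>\<^sub>2\<^bsub>C\<^esub> (u \<unlhd>\<^bsub>C\<^esub> b)"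
  using assms by (simp add: ten2_def)

lemma ten1_shift:
  assumes "x \<in> Obj C" "y \<in> Obj C" "a \<in> carrier G" "b \<in> carrier G" "src x = \<one>"
  shows "((x \<otimes>\<^sub>1\<^bsub>C\<^esub> (a \<triangleright>\<^bsub>C\<^esub> (y \<triangleleft>\<^bsub>C\<^esub> (inv a)))) \<triangleleft>\<^bsub>C\<^esub> a) \<triangleleft>\<^bsub>C\<^esub> b = (x \<triangleleft>\<^bsub>C\<^esub> a) \<otimes>\<^sub>1\<^bsub>C\<^esub> (y \<triangleleft>\<^bsub>C\<^esub> b)"
  using assms by (simp add: ten1_def)

lemma rten_functor_pair: "g \<in> carrier G \<Longrightarrow> functor_pair C C (\<lambda>x. x \<triangleleft>\<^bsub>C\<^esub> g) (\<lambda>f. f \<unlhd>\<^bsub>C\<^esub> g)"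
  by unfold_locales (simp add: is_functor_def Hom_def)

lemma rten_iso [simp]: "\<lbrakk>g \<in> carrier G; iso_arr C f\<rbrakk> \<Longrightarrow> iso_arr C (f \<unlhd>\<^bsub>C\<^esub> g)"
  using functor_pair.iso_fa[OF rten_functor_pair] .

end

text \<open>
  The component at \<open>y \<triangleleft> g\<close>, where \<open>y\<close> starts at the unit, is forced by \<open>rcell_trans\<close>: the cells
  \<open>rcell\<close> identify the values of both functors there with \<open>A y \<triangleleft> g\<close> and \<open>B y \<triangleleft> g\<close>.
\<close>

definition trans_ext :: "('g, 'h) monoid_scheme \<Rightarrow> ('g, 'o, 'm) gray \<Rightarrow> ('g, 'o, 'm) gray
    \<Rightarrow> ('g, 'o, 'm) fun3 \<Rightarrow> ('g, 'o, 'm) fun3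
    \<Rightarrow> ('g \<times> 'o \<Rightarrow> ('g \<times> 'o, 'm) arr) \<Rightarrow> ('g, 'o) arr \<Rightarrow> (('g, 'o) arr, 'm) arr" where
  "trans_ext G C D A B \<theta> = (\<lambda>x \<in> Obj C. let g = src x; y = x \<triangleleft>\<^bsub>C\<^esub> (inv\<^bsub>G\<^esub> g) in
      rcell C D B y g \<cdot>\<^bsub>D\<^esub> (lift2 G (\<theta> (drop1 y)) \<unlhd>\<^bsub>D\<^esub> g) \<cdot>\<^bsub>D\<^esub> inv_arr D (rcell C D A y g))"

locale crossed_trans_of_functors = A: pointed_functor G C D A + B: pointed_functor G C D B +
    S: strict_crossed_transformation G "crossed_of G C" "crossed_of G D" "crsfun_of G C D A" "crsfun_of G C D B" \<theta>
  for G :: "('g, 'h) monoid_scheme" and C D :: "('g, 'o, 'm) gray" and A B :: "('g, 'o, 'm) fun3" and \<theta>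
begin

abbreviation "th y \<equiv> lift2 G (\<theta> (drop1 y))"
abbreviation "eta \<equiv> trans_ext G C D A B \<theta>"

lemma drop1_mem: "\<lbrakk>y \<in> Obj C; src y = \<one>\<^bsub>G\<^esub>\<rbrakk> \<Longrightarrow> drop1 y \<in> Obj (crossed_of G C)"
  by (simp add: crossed_of_def)

lemma drop2_mem: "\<lbrakk>f \<in> Arrs C; src (src f) = \<one>\<^bsub>G\<^esub>\<rbrakk> \<Longrightarrow> drop2 f \<in> Arrs (crossed_of G C)"
  by (simp add: crossed_of_def)

lemma th_simps [simp]:
  assumes "y \<in> Obj C" "src y = \<one>\<^bsub>G\<^esub>"
  shows "th y \<in> Arrs D" "lift1 G (src (\<theta> (drop1 y))) = map1 A y" "lift1 G (trg (\<theta> (drop1 y))) = map1 B y"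
  using S.T.comp_Arrs[OF drop1_mem[OF assms]] S.T.comp_src[OF drop1_mem[OF assms]]
    S.T.comp_trg[OF drop1_mem[OF assms]] assms
  by (simp_all add: crossed_of_def crsfun_of_def del: S.T.comp_Arrs S.T.comp_src S.T.comp_trg)

lemma th_nat:
  assumes "f \<in> Arrs C" "src (src f) = \<one>\<^bsub>G\<^esub>"
  shows "th (trg f) \<cdot>\<^bsub>D\<^esub> map2 A f = map2 B f \<cdot>\<^bsub>D\<^esub> th (src f)"
  using arg_cong[OF S.T.nat[OF drop2_mem[OF assms]], of "lift2 G"] assms
  by (simp add: crossed_of_def crsfun_of_def)

lemma th_unit: "th (id1 C \<one>\<^bsub>G\<^esub>) \<cdot>\<^bsub>D\<^esub> munit A \<one>\<^bsub>G\<^esub> = munit B \<one>\<^bsub>G\<^esub>"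
  using arg_cong[OF S.T.resp_eps[OF UNIV_I], of "lift2 G"]
  by (simp add: crossed_of_def crsfun_of_def)

lemma th_ten:
  assumes "x \<in> Obj C" "src x = \<one>\<^bsub>G\<^esub>" "y \<in> Obj C" "src y = \<one>\<^bsub>G\<^esub>"
  shows "th (x \<otimes>\<^sub>1\<^bsub>C\<^esub> y) \<cdot>\<^bsub>D\<^esub> mten A x y = mten B x y \<cdot>\<^bsub>D\<^esub> (th x \<otimes>\<^sub>2\<^bsub>D\<^esub> th y)"
  using arg_cong[OF S.T.resp_mu[OF drop1_mem drop1_mem, of y x], of "lift2 G"] assms
  by (simp add: crossed_of_def crsfun_of_def)

lemma th_act:
  assumes "g \<in> carrier G" "x \<in> Obj C" "src x = \<one>\<^bsub>G\<^esub>"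
  shows "th (g \<triangleright>\<^bsub>C\<^esub> (x \<triangleleft>\<^bsub>C\<^esub> (inv\<^bsub>G\<^esub> g))) \<cdot>\<^bsub>D\<^esub> acell G C D A g x
    = acell G C D B g x \<cdot>\<^bsub>D\<^esub> (g \<unrhd>\<^bsub>D\<^esub> (th x \<unlhd>\<^bsub>D\<^esub> (inv\<^bsub>G\<^esub> g)))"
  using arg_cong[OF S.resp_act[OF assms(1) drop1_mem[OF assms(2,3)]], of "lift2 G"] assms
  by (simp add: crossed_of_def crsfun_of_def)

lemma eta_simps [simp]:
  assumes "x \<in> Obj C"
  shows "eta x \<in> Arrs D" "src (eta x) = map1 A x" "trg (eta x) = map1 B x"
  using assms by (simp_all add: trans_ext_def Let_def)

text \<open>
  Characterises \<open>eta\<close>. The laws for \<open>eta\<close> below are proved after composing with invertible cells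
  \<open>rcell\<close>, which this equation moves past \<open>eta\<close>.
\<close>

lemma eta_rcell:
  assumes "y \<in> Obj C" "src y = \<one>\<^bsub>G\<^esub>" "g \<in> carrier G"
  shows "eta (y \<triangleleft>\<^bsub>C\<^esub> g) \<cdot>\<^bsub>D\<^esub> rcell C D A y g = rcell C D B y g \<cdot>\<^bsub>D\<^esub> (th y \<unlhd>\<^bsub>D\<^esub> g)"
  using assms by (simp add: trans_ext_def Let_def)

lemma eta_th: "\<lbrakk>y \<in> Obj C; src y = \<one>\<^bsub>G\<^esub>\<rbrakk> \<Longrightarrow> eta y = th y"
  using eta_rcell[of y "\<one>\<^bsub>G\<^esub>"] by simp

lemma eta_nat:
  assumes f: "f \<in> Arrs C"
  shows "eta (trg f) \<cdot>\<^bsub>D\<^esub> map2 A f = map2 B f \<cdot>\<^bsub>D\<^esub> eta (src f)"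
proof -
  let ?g = "src (src f)"
  define h where "h = f \<unlhd>\<^bsub>C\<^esub> (inv\<^bsub>G\<^esub> ?g)"
  have h: "h \<in> Arrs C" "src (src h) = \<one>\<^bsub>G\<^esub>" "f = h \<unlhd>\<^bsub>C\<^esub> ?g" "?g \<in> carrier G"
    using f by (simp_all add: h_def)
  have "eta (trg h \<triangleleft>\<^bsub>C\<^esub> g) \<cdot>\<^bsub>D\<^esub> map2 A (h \<unlhd>\<^bsub>C\<^esub> g) = map2 B (h \<unlhd>\<^bsub>C\<^esub> g) \<cdot>\<^bsub>D\<^esub> eta (src h \<triangleleft>\<^bsub>C\<^esub> g)"
    if g: "g \<in> carrier G" for g
  proof (rule A.D.iso_cancel_right[where f = "rcell C D A (src h) g"])
    have "eta (trg h \<triangleleft>\<^bsub>C\<^esub> g) \<cdot>\<^bsub>D\<^esub> map2 A (h \<unlhd>\<^bsub>C\<^esub> g) \<cdot>\<^bsub>D\<^esub> rcell C D A (src h) g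
       = (eta (trg h \<triangleleft>\<^bsub>C\<^esub> g) \<cdot>\<^bsub>D\<^esub> rcell C D A (trg h) g) \<cdot>\<^bsub>D\<^esub> (map2 A h \<unlhd>\<^bsub>D\<^esub> g)"
      using h g A.rcell_nat[of g h] by simp
    also have "\<dots> = rcell C D B (trg h) g \<cdot>\<^bsub>D\<^esub> ((th (trg h) \<cdot>\<^bsub>D\<^esub> map2 A h) \<unlhd>\<^bsub>D\<^esub> g)"
      using h g eta_rcell[of "trg h" g] by simp
    also have "\<dots> = (rcell C D B (trg h) g \<cdot>\<^bsub>D\<^esub> (map2 B h \<unlhd>\<^bsub>D\<^esub> g)) \<cdot>\<^bsub>D\<^esub> (th (src h) \<unlhd>\<^bsub>D\<^esub> g)"
      using h g by (simp add: th_nat)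
    also have "\<dots> = map2 B (h \<unlhd>\<^bsub>C\<^esub> g) \<cdot>\<^bsub>D\<^esub> eta (src h \<triangleleft>\<^bsub>C\<^esub> g) \<cdot>\<^bsub>D\<^esub> rcell C D A (src h) g"
      using h g B.rcell_nat[of g h] eta_rcell[of "src h" g] by simp
    finally show "eta (trg h \<triangleleft>\<^bsub>C\<^esub> g) \<cdot>\<^bsub>D\<^esub> map2 A (h \<unlhd>\<^bsub>C\<^esub> g) \<cdot>\<^bsub>D\<^esub> rcell C D A (src h) g
      = map2 B (h \<unlhd>\<^bsub>C\<^esub> g) \<cdot>\<^bsub>D\<^esub> eta (src h \<triangleleft>\<^bsub>C\<^esub> g) \<cdot>\<^bsub>D\<^esub> rcell C D A (src h) g" .
  qed (use h g in simp_all)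
  from this[OF h(4)] show ?thesis
    using f by (simp add: h_def)
qed

lemma eta_munit:
  assumes g: "g \<in> carrier G"
  shows "eta (id1 C g) \<cdot>\<^bsub>D\<^esub> munit A g = munit B g"
proof -
  have "eta (id1 C g) \<cdot>\<^bsub>D\<^esub> munit A g = (eta (id1 C \<one>\<^bsub>G\<^esub> \<triangleleft>\<^bsub>C\<^esub> g) \<cdot>\<^bsub>D\<^esub> rcell C D A (id1 C \<one>\<^bsub>G\<^esub>) g) \<cdot>\<^bsub>D\<^esub> (munit A \<one>\<^bsub>G\<^esub> \<unlhd>\<^bsub>D\<^esub> g)"
    using g A.rcell_munit[of "\<one>\<^bsub>G\<^esub>" g] by simp
  also have "\<dots> = rcell C D B (id1 C \<one>\<^bsub>G\<^esub>) g \<cdot>\<^bsub>D\<^esub> ((th (id1 C \<one>\<^bsub>G\<^esub>) \<cdot>\<^bsub>D\<^esub> munit A \<one>\<^bsub>G\<^esub>) \<unlhd>\<^bsub>D\<^esub> g)"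
    using g by (subst eta_rcell) simp_all
  also have "\<dots> = munit B g"
    unfolding th_unit using g B.rcell_munit[of "\<one>\<^bsub>G\<^esub>" g] by simp
  finally show ?thesis .
qed

text \<open>
  Both cells \<open>mten\<close> are brought into the form \<open>mten_rcell\<close>. There the law for \<open>\<theta>\<close> and tensor
  products applies, and the conjugation of the second factor is dealt with by the law for \<open>\<theta>\<close> and
  the action.
\<close>

lemma eta_mten:
  assumes xy: "x \<in> Obj C" "y \<in> Obj C"
  shows "eta (x \<otimes>\<^sub>1\<^bsub>C\<^esub> y) \<cdot>\<^bsub>D\<^esub> mten A x y = mten B x y \<cdot>\<^bsub>D\<^esub> (eta x \<otimes>\<^sub>2\<^bsub>D\<^esub> eta y)"
proof -
  have main: "eta ((v \<triangleleft>\<^bsub>C\<^esub> a) \<otimes>\<^sub>1\<^bsub>C\<^esub> (w \<triangleleft>\<^bsub>C\<^esub> b)) \<cdot>\<^bsub>D\<^esub> mten A (v \<triangleleft>\<^bsub>C\<^esub> a) (w \<triangleleft>\<^bsub>C\<^esub> b)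
    = mten B (v \<triangleleft>\<^bsub>C\<^esub> a) (w \<triangleleft>\<^bsub>C\<^esub> b) \<cdot>\<^bsub>D\<^esub> (eta (v \<triangleleft>\<^bsub>C\<^esub> a) \<otimes>\<^sub>2\<^bsub>D\<^esub> eta (w \<triangleleft>\<^bsub>C\<^esub> b))"
    if a: "a \<in> carrier G" and b: "b \<in> carrier G" and v: "v \<in> Obj C" "src v = \<one>\<^bsub>G\<^esub>" and w: "w \<in> Obj C" "src w = \<one>\<^bsub>G\<^esub>" for v w a b
  proof (rule A.D.iso_cancel_right[where f = "rcell C D A v a \<otimes>\<^sub>2\<^bsub>D\<^esub> rcell C D A w b"])
    define w' where "w' = a \<triangleright>\<^bsub>C\<^esub> (w \<triangleleft>\<^bsub>C\<^esub> (inv\<^bsub>G\<^esub> a))"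
    define t where "t = a \<unrhd>\<^bsub>D\<^esub> (th w \<unlhd>\<^bsub>D\<^esub> (inv\<^bsub>G\<^esub> a))"
    define k where "k = acell G C D A a w" define k' where "k' = acell G C D B a w"
    let ?ab = "a \<otimes>\<^bsub>G\<^esub> b"
    have w' [simp]: "w' \<in> Obj C" "src w' = \<one>\<^bsub>G\<^esub>" using a w by (simp_all add: w'_def)
    have t' [simp]: "t \<in> Arrs D" "src t = src k" "trg t = src k'" using a w by (simp_all add: t_def k_def k'_def)
    have k [simp]: "k \<in> Arrs D" "trg k = map1 A w'" using a w by (simp_all add: k_def w'_def)
    have k' [simp]: "k' \<in> Arrs D" "trg k' = map1 B w'" using a w by (simp_all add: k'_def w'_def)
    note ab [simp] = a b v w
    have act: "th w' \<cdot>\<^bsub>D\<^esub> k = k' \<cdot>\<^bsub>D\<^esub> t" using th_act[OF a w] by (simp add: w'_def k_def k'_def t_def)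
    have RA: "mten A (v \<triangleleft>\<^bsub>C\<^esub> a) (w \<triangleleft>\<^bsub>C\<^esub> b) \<cdot>\<^bsub>D\<^esub> (rcell C D A v a \<otimes>\<^sub>2\<^bsub>D\<^esub> rcell C D A w b)
      = rcell C D A (v \<otimes>\<^sub>1\<^bsub>C\<^esub> w') ?ab \<cdot>\<^bsub>D\<^esub> ((mten A v w' \<cdot>\<^bsub>D\<^esub> (idt D (map1 A v) \<otimes>\<^sub>2\<^bsub>D\<^esub> k)) \<unlhd>\<^bsub>D\<^esub> ?ab)"
      unfolding w'_def k_def by (rule A.mten_rcell[OF a b v(1) w(1)])
    have RB: "mten B (v \<triangleleft>\<^bsub>C\<^esub> a) (w \<triangleleft>\<^bsub>C\<^esub> b) \<cdot>\<^bsub>D\<^esub> (rcell C D B v a \<otimes>\<^sub>2\<^bsub>D\<^esub> rcell C D B w b)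
      = rcell C D B (v \<otimes>\<^sub>1\<^bsub>C\<^esub> w') ?ab \<cdot>\<^bsub>D\<^esub> ((mten B v w' \<cdot>\<^bsub>D\<^esub> (idt D (map1 B v) \<otimes>\<^sub>2\<^bsub>D\<^esub> k')) \<unlhd>\<^bsub>D\<^esub> ?ab)"
      unfolding w'_def k'_def by (rule B.mten_rcell[OF a b v(1) w(1)])
    have s: "(v \<triangleleft>\<^bsub>C\<^esub> a) \<otimes>\<^sub>1\<^bsub>C\<^esub> (w \<triangleleft>\<^bsub>C\<^esub> b) = (v \<otimes>\<^sub>1\<^bsub>C\<^esub> w') \<triangleleft>\<^bsub>C\<^esub> ?ab"
      using A.C.ten1_shift[of v w a b] by (simp add: w'_def)
    have s2: "(th v \<otimes>\<^sub>2\<^bsub>D\<^esub> t) \<unlhd>\<^bsub>D\<^esub> ?ab = (th v \<unlhd>\<^bsub>D\<^esub> a) \<otimes>\<^sub>2\<^bsub>D\<^esub> (th w \<unlhd>\<^bsub>D\<^esub> b)"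
      using A.D.ten2_shift[of "th v" "th w" a b] by (simp add: t_def)
    have m: "th (v \<otimes>\<^sub>1\<^bsub>C\<^esub> w') \<cdot>\<^bsub>D\<^esub> (mten A v w' \<cdot>\<^bsub>D\<^esub> (idt D (map1 A v) \<otimes>\<^sub>2\<^bsub>D\<^esub> k))
       = (mten B v w' \<cdot>\<^bsub>D\<^esub> (idt D (map1 B v) \<otimes>\<^sub>2\<^bsub>D\<^esub> k')) \<cdot>\<^bsub>D\<^esub> (th v \<otimes>\<^sub>2\<^bsub>D\<^esub> t)"
      by (simp add: th_ten[THEN A.D.reassoc] A.D.T.merge act)
    have "eta ((v \<triangleleft>\<^bsub>C\<^esub> a) \<otimes>\<^sub>1\<^bsub>C\<^esub> (w \<triangleleft>\<^bsub>C\<^esub> b)) \<cdot>\<^bsub>D\<^esub> mten A (v \<triangleleft>\<^bsub>C\<^esub> a) (w \<triangleleft>\<^bsub>C\<^esub> b) \<cdot>\<^bsub>D\<^esub> (rcell C D A v a \<otimes>\<^sub>2\<^bsub>D\<^esub> rcell C D A w b)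
      = eta ((v \<otimes>\<^sub>1\<^bsub>C\<^esub> w') \<triangleleft>\<^bsub>C\<^esub> ?ab) \<cdot>\<^bsub>D\<^esub> (mten A (v \<triangleleft>\<^bsub>C\<^esub> a) (w \<triangleleft>\<^bsub>C\<^esub> b) \<cdot>\<^bsub>D\<^esub> (rcell C D A v a \<otimes>\<^sub>2\<^bsub>D\<^esub> rcell C D A w b))"
      unfolding s using s by simp
    also have "\<dots> = (eta ((v \<otimes>\<^sub>1\<^bsub>C\<^esub> w') \<triangleleft>\<^bsub>C\<^esub> ?ab) \<cdot>\<^bsub>D\<^esub> rcell C D A (v \<otimes>\<^sub>1\<^bsub>C\<^esub> w') ?ab)
       \<cdot>\<^bsub>D\<^esub> ((mten A v w' \<cdot>\<^bsub>D\<^esub> (idt D (map1 A v) \<otimes>\<^sub>2\<^bsub>D\<^esub> k)) \<unlhd>\<^bsub>D\<^esub> ?ab)"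
      unfolding RA by simp
    also have "\<dots> = rcell C D B (v \<otimes>\<^sub>1\<^bsub>C\<^esub> w') ?ab \<cdot>\<^bsub>D\<^esub> ((th (v \<otimes>\<^sub>1\<^bsub>C\<^esub> w') \<cdot>\<^bsub>D\<^esub> (mten A v w' \<cdot>\<^bsub>D\<^esub> (idt D (map1 A v) \<otimes>\<^sub>2\<^bsub>D\<^esub> k))) \<unlhd>\<^bsub>D\<^esub> ?ab)"
      by (subst eta_rcell) simp_all
    also have "\<dots> = (rcell C D B (v \<otimes>\<^sub>1\<^bsub>C\<^esub> w') ?ab \<cdot>\<^bsub>D\<^esub> ((mten B v w' \<cdot>\<^bsub>D\<^esub> (idt D (map1 B v) \<otimes>\<^sub>2\<^bsub>D\<^esub> k')) \<unlhd>\<^bsub>D\<^esub> ?ab))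
       \<cdot>\<^bsub>D\<^esub> ((th v \<otimes>\<^sub>2\<^bsub>D\<^esub> t) \<unlhd>\<^bsub>D\<^esub> ?ab)"
      unfolding m by simp
    also have "\<dots> = mten B (v \<triangleleft>\<^bsub>C\<^esub> a) (w \<triangleleft>\<^bsub>C\<^esub> b) \<cdot>\<^bsub>D\<^esub> ((rcell C D B v a \<cdot>\<^bsub>D\<^esub> (th v \<unlhd>\<^bsub>D\<^esub> a)) \<otimes>\<^sub>2\<^bsub>D\<^esub> (rcell C D B w b \<cdot>\<^bsub>D\<^esub> (th w \<unlhd>\<^bsub>D\<^esub> b)))"
      unfolding RB[symmetric] s2 by (simp add: A.D.T.merge)
    also have "\<dots> = mten B (v \<triangleleft>\<^bsub>C\<^esub> a) (w \<triangleleft>\<^bsub>C\<^esub> b) \<cdot>\<^bsub>D\<^esub> (eta (v \<triangleleft>\<^bsub>C\<^esub> a) \<otimes>\<^sub>2\<^bsub>D\<^esub> eta (w \<triangleleft>\<^bsub>C\<^esub> b)) \<cdot>\<^bsub>D\<^esub> (rcell C D A v a \<otimes>\<^sub>2\<^bsub>D\<^esub> rcell C D A w b)"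
      by (simp add: A.D.T.merge eta_rcell)
    finally show "eta ((v \<triangleleft>\<^bsub>C\<^esub> a) \<otimes>\<^sub>1\<^bsub>C\<^esub> (w \<triangleleft>\<^bsub>C\<^esub> b)) \<cdot>\<^bsub>D\<^esub> mten A (v \<triangleleft>\<^bsub>C\<^esub> a) (w \<triangleleft>\<^bsub>C\<^esub> b) \<cdot>\<^bsub>D\<^esub> (rcell C D A v a \<otimes>\<^sub>2\<^bsub>D\<^esub> rcell C D A w b)
      = mten B (v \<triangleleft>\<^bsub>C\<^esub> a) (w \<triangleleft>\<^bsub>C\<^esub> b) \<cdot>\<^bsub>D\<^esub> (eta (v \<triangleleft>\<^bsub>C\<^esub> a) \<otimes>\<^sub>2\<^bsub>D\<^esub> eta (w \<triangleleft>\<^bsub>C\<^esub> b)) \<cdot>\<^bsub>D\<^esub> (rcell C D A v a \<otimes>\<^sub>2\<^bsub>D\<^esub> rcell C D A w b)" .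
  qed (use a b v w in simp_all)
  show ?thesis
    using main[of "src x" "src y" "x \<triangleleft>\<^bsub>C\<^esub> (inv\<^bsub>G\<^esub> (src x))" "y \<triangleleft>\<^bsub>C\<^esub> (inv\<^bsub>G\<^esub> (src y))"] xy by simp
qed

text \<open>
  Composition is a special case of the tensor product: if \<open>y\<close> is a shift of the 1-cell \<open>v\<close> out of
  the unit, then \<open>y \<bullet> x = v \<otimes>\<^sub>1 x\<close>.
\<close>

lemma eta_mcomp:
  assumes xy: "x \<in> Obj C" "y \<in> Obj C" "src y = trg x"
  shows "eta (y \<bullet>\<^bsub>C\<^esub> x) \<cdot>\<^bsub>D\<^esub> mcomp A y x = mcomp B y x \<cdot>\<^bsub>D\<^esub> (eta y \<star>\<^bsub>D\<^esub> eta x)"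
proof -
  let ?b = "src y"
  define v where "v = y \<triangleleft>\<^bsub>C\<^esub> (inv\<^bsub>G\<^esub> ?b)"
  have v [simp]: "v \<in> Obj C" "src v = \<one>\<^bsub>G\<^esub>" and y: "v \<triangleleft>\<^bsub>C\<^esub> ?b = y" using xy by (simp_all add: v_def)
  note [simp] = xy(1,2)
  have vx: "v \<otimes>\<^sub>1\<^bsub>C\<^esub> x = y \<bullet>\<^bsub>C\<^esub> x" using y xy by (simp add: ten1_def)
  have [simp]: "trg (rcell C D A v ?b) = map1 A y" "trg (rcell C D B v ?b) = map1 B y"
    using y by simp_all
  have sv: "trg x = src y" using xy by simp
  have MA: "mcomp A y x \<cdot>\<^bsub>D\<^esub> (rcell C D A v ?b \<star>\<^bsub>D\<^esub> idt D (map1 A x)) = mten A v x"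
    using A.mten_as_mcomp[of v x] y sv by simp
  have MB: "mcomp B y x \<cdot>\<^bsub>D\<^esub> (rcell C D B v ?b \<star>\<^bsub>D\<^esub> idt D (map1 B x)) = mten B v x"
    using B.mten_as_mcomp[of v x] y sv by simp
  have t: "th v \<otimes>\<^sub>2\<^bsub>D\<^esub> eta x = (th v \<unlhd>\<^bsub>D\<^esub> ?b) \<star>\<^bsub>D\<^esub> eta x" using sv by (simp add: ten2_def)
  have e: "eta y \<cdot>\<^bsub>D\<^esub> rcell C D A v ?b = rcell C D B v ?b \<cdot>\<^bsub>D\<^esub> (th v \<unlhd>\<^bsub>D\<^esub> ?b)"
    using eta_rcell[of v ?b] y by simp
  show ?thesis
  proof (rule A.D.iso_cancel_right[where f = "rcell C D A v ?b \<star>\<^bsub>D\<^esub> idt D (map1 A x)"])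
    have "eta (y \<bullet>\<^bsub>C\<^esub> x) \<cdot>\<^bsub>D\<^esub> mcomp A y x \<cdot>\<^bsub>D\<^esub> (rcell C D A v ?b \<star>\<^bsub>D\<^esub> idt D (map1 A x)) = eta (v \<otimes>\<^sub>1\<^bsub>C\<^esub> x) \<cdot>\<^bsub>D\<^esub> mten A v x"
      using sv by (simp add: MA vx)
    also have "\<dots> = mten B v x \<cdot>\<^bsub>D\<^esub> (th v \<otimes>\<^sub>2\<^bsub>D\<^esub> eta x)" by (simp add: eta_mten eta_th)
    also have "\<dots> = mcomp B y x \<cdot>\<^bsub>D\<^esub> ((rcell C D B v ?b \<cdot>\<^bsub>D\<^esub> (th v \<unlhd>\<^bsub>D\<^esub> ?b)) \<star>\<^bsub>D\<^esub> eta x)"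
      unfolding t MB[symmetric] using sv by (simp add: A.D.H.merge)
    also have "\<dots> = mcomp B y x \<cdot>\<^bsub>D\<^esub> (eta y \<star>\<^bsub>D\<^esub> eta x) \<cdot>\<^bsub>D\<^esub> (rcell C D A v ?b \<star>\<^bsub>D\<^esub> idt D (map1 A x))"
      unfolding e[symmetric] using sv by (simp add: A.D.H.merge)
    finally show "eta (y \<bullet>\<^bsub>C\<^esub> x) \<cdot>\<^bsub>D\<^esub> mcomp A y x \<cdot>\<^bsub>D\<^esub> (rcell C D A v ?b \<star>\<^bsub>D\<^esub> idt D (map1 A x))
      = mcomp B y x \<cdot>\<^bsub>D\<^esub> (eta y \<star>\<^bsub>D\<^esub> eta x) \<cdot>\<^bsub>D\<^esub> (rcell C D A v ?b \<star>\<^bsub>D\<^esub> idt D (map1 A x))" .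
  qed (use sv in simp_all)
qed

lemma eta_transformation: "pointed_transformation G C D A B eta"
  by unfold_locales (simp_all add: eta_nat eta_munit eta_mten eta_mcomp)

lemma trans_of_eta:
  assumes "\<theta> \<in> extensional (Obj (crossed_of G C))"
  shows "trans_of G C eta = \<theta>"
proof
  fix a show "trans_of G C eta a = \<theta> a"
  proof (cases "lift1 G a \<in> Obj C")
    case True
    then show ?thesis using eta_th[of "lift1 G a"] by (simp add: trans_of_def crossed_of_mem)
  next
    case False
    then show ?thesis using extensional_arb[OF assms, of a] by (simp add: trans_of_def crossed_of_mem)
  qed
qed

end

lemma trans_of_inj:
  assumes "pointed_transformation G C D A B \<eta>" "pointed_transformation G C D A B \<zeta>"
    and ext: "\<eta> \<in> extensional (Obj C)" "\<zeta> \<in> extensional (Obj C)"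
    and eq: "trans_of G C \<eta> = trans_of G C \<zeta>"
  shows "\<eta> = \<zeta>"
proof -
  interpret E: pointed_transformation G C D A B \<eta> by fact
  interpret Z: pointed_transformation G C D A B \<zeta> by fact
  have 1: "\<eta> y = \<zeta> y" if "y \<in> Obj C" "src y = \<one>\<^bsub>G\<^esub>" for y
  proof -
    have "drop2 (\<eta> y) = drop2 (\<zeta> y)"
      using fun_cong[OF eq, of "drop1 y"] that by (simp add: trans_of_def crossed_of_def)
    from arg_cong[OF this, of "lift2 G"] show ?thesis using that by simp
  qed
  have "\<eta> x = \<zeta> x" if x: "x \<in> Obj C" for x
  proof (rule E.A.D.iso_cancel_right[where f = "rcell C D A (x \<triangleleft>\<^bsub>C\<^esub> (inv\<^bsub>G\<^esub> (src x))) (src x)"])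
    show "\<eta> x \<cdot>\<^bsub>D\<^esub> rcell C D A (x \<triangleleft>\<^bsub>C\<^esub> (inv\<^bsub>G\<^esub> (src x))) (src x) = \<zeta> x \<cdot>\<^bsub>D\<^esub> rcell C D A (x \<triangleleft>\<^bsub>C\<^esub> (inv\<^bsub>G\<^esub> (src x))) (src x)"
      using E.rcell_trans[of "src x" "x \<triangleleft>\<^bsub>C\<^esub> (inv\<^bsub>G\<^esub> (src x))"] Z.rcell_trans[of "src x" "x \<triangleleft>\<^bsub>C\<^esub> (inv\<^bsub>G\<^esub> (src x))"]
        1[of "x \<triangleleft>\<^bsub>C\<^esub> (inv\<^bsub>G\<^esub> (src x))"] x by simp
  qed (use x in simp_all)
  with ext show ?thesis by (rule extensionalityI)
qed


section \<open>Every crossed braided functor comes from a functor of Gray-monoids\<close>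

text \<open>
  \<open>down1\<close> shifts a 1-cell so that it starts at the unit. Shifting back by \<open>up1\<close> requires the
  source, which is lost.
\<close>

definition down1 :: "('g, 'h) monoid_scheme \<Rightarrow> ('g, 'o, 'm) gray \<Rightarrow> ('g, 'o) arr \<Rightarrow> 'g \<times> 'o" where
  "down1 G C x = drop1 (x \<triangleleft>\<^bsub>C\<^esub> (inv\<^bsub>G\<^esub> (src x)))"

definition down2 :: "('g, 'h) monoid_scheme \<Rightarrow> ('g, 'o, 'm) gray \<Rightarrow> (('g, 'o) arr, 'm) arr \<Rightarrow> ('g \<times> 'o, 'm) arr" where
  "down2 G C \<alpha> = drop2 (\<alpha> \<unlhd>\<^bsub>C\<^esub> (inv\<^bsub>G\<^esub> (src (src \<alpha>))))"

definition up1 :: "('g, 'h) monoid_scheme \<Rightarrow> ('g, 'o, 'm) gray \<Rightarrow> 'g \<Rightarrow> 'g \<times> 'o \<Rightarrow> ('g, 'o) arr" where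
  "up1 G C g a = lift1 G a \<triangleleft>\<^bsub>C\<^esub> g"

definition up2 :: "('g, 'h) monoid_scheme \<Rightarrow> ('g, 'o, 'm) gray \<Rightarrow> 'g \<Rightarrow> ('g \<times> 'o, 'm) arr \<Rightarrow> (('g, 'o) arr, 'm) arr" where
  "up2 G C g f = lift2 G f \<unlhd>\<^bsub>C\<^esub> g"

context pointed_gray
begin

abbreviation "K \<equiv> crossed_of G C"

lemma down1_simps [simp]:
  assumes "x \<in> Obj C"
  shows "down1 G C x \<in> Obj K" "fst (down1 G C x) = trg x \<otimes> inv (src x)"
    "a = src x \<Longrightarrow> up1 G C a (down1 G C x) = x"
  using assms by (simp_all add: down1_def up1_def crossed_of_def)

lemma down2_simps [simp]:
  assumes "\<alpha> \<in> Arrs C"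
  shows "down2 G C \<alpha> \<in> Arrs K" "src (down2 G C \<alpha>) = down1 G C (src \<alpha>)" "trg (down2 G C \<alpha>) = down1 G C (trg \<alpha>)"
    "a = src (src \<alpha>) \<Longrightarrow> up2 G C a (down2 G C \<alpha>) = \<alpha>"
  using assms by (simp_all add: down1_def down2_def up2_def crossed_of_def)

lemma up1_simps [simp]:
  assumes "a \<in> Obj K" "g \<in> carrier G"
  shows "up1 G C g a \<in> Obj C" "src (up1 G C g a) = g" "trg (up1 G C g a) = fst a \<otimes> g"
    "down1 G C (up1 G C g a) = a"
  using assms by (simp_all add: down1_def up1_def crossed_of_def)

lemma up2_simps [simp]:
  assumes "f \<in> Arrs K" "g \<in> carrier G"
  shows "up2 G C g f \<in> Arrs C" "src (up2 G C g f) = up1 G C g (src f)" "trg (up2 G C g f) = up1 G C g (trg f)"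
    "down2 G C (up2 G C g f) = f"
  using assms by (simp_all add: down1_def up1_def down2_def up2_def crossed_of_def)

lemma up2_iso [simp]: "\<lbrakk>iso_arr K f; g \<in> carrier G\<rbrakk> \<Longrightarrow> iso_arr C (up2 G C g f)"
  unfolding up2_def by (intro rten_iso iso_lift2)

text \<open>
  Equations between parallel 2-cells may be checked after shifting, in the crossed braided
  category.
\<close>

lemma down2_inj:
  assumes "down2 G C \<alpha> = down2 G C \<beta>" "\<alpha> \<in> Arrs C" "\<beta> \<in> Arrs C" "src (src \<alpha>) = src (src \<beta>)"
  shows "\<alpha> = \<beta>"
proof -
  have "\<alpha> = up2 G C (src (src \<alpha>)) (down2 G C \<alpha>)" by (rule down2_simps(4)[symmetric]) (use assms in auto)
  also have "\<dots> = up2 G C (src (src \<beta>)) (down2 G C \<beta>)" by (simp only: assms)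
  also have "\<dots> = \<beta>" by (rule down2_simps(4)) (use assms in auto)
  finally show ?thesis .
qed

text \<open>
  If \<open>y\<close> is a shift of \<open>v\<close>, then \<open>y \<bullet> x = v \<otimes>\<^sub>1 x\<close>, so composites become tensor products. In
  \<open>x \<otimes>\<^sub>1 y\<close> the source of \<open>x\<close> stands in front of \<open>y\<close>; moving it to the end, where shifting
  removes it, conjugates \<open>y\<close>.
\<close>

lemma down1_ops:
  "\<lbrakk>x \<in> Obj C; y \<in> Obj C; src y = trg x\<rbrakk> \<Longrightarrow> down1 G C (y \<bullet>\<^bsub>C\<^esub> x) = tenO K (down1 G C y) (down1 G C x)"
  "\<lbrakk>x \<in> Obj C; y \<in> Obj C\<rbrakk> \<Longrightarrow> down1 G C (x \<otimes>\<^sub>1\<^bsub>C\<^esub> y) = tenO K (down1 G C x) (Fo K (src x) (down1 G C y))"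
  "\<lbrakk>g \<in> carrier G; x \<in> Obj C\<rbrakk> \<Longrightarrow> down1 G C (g \<triangleright>\<^bsub>C\<^esub> x) = Fo K g (down1 G C x)"
  "\<lbrakk>g \<in> carrier G; x \<in> Obj C\<rbrakk> \<Longrightarrow> down1 G C (x \<triangleleft>\<^bsub>C\<^esub> g) = down1 G C x"
  "g \<in> carrier G \<Longrightarrow> down1 G C (id1 C g) = unitO K"
  by (simp_all add: down1_def crossed_of_def ten1_def)

lemma down2_ops:
  "\<lbrakk>\<alpha> \<in> Arrs C; \<beta> \<in> Arrs C; src \<beta> = trg \<alpha>\<rbrakk> \<Longrightarrow> down2 G C (\<beta> \<cdot>\<^bsub>C\<^esub> \<alpha>) = down2 G C \<beta> \<cdot>\<^bsub>K\<^esub> down2 G C \<alpha>"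
  "\<lbrakk>\<alpha> \<in> Arrs C; \<beta> \<in> Arrs C; src (src \<beta>) = trg (src \<alpha>)\<rbrakk> \<Longrightarrow> down2 G C (\<beta> \<star>\<^bsub>C\<^esub> \<alpha>) = tenM K (down2 G C \<beta>) (down2 G C \<alpha>)"
  "\<lbrakk>\<alpha> \<in> Arrs C; \<beta> \<in> Arrs C\<rbrakk> \<Longrightarrow> down2 G C (\<alpha> \<otimes>\<^sub>2\<^bsub>C\<^esub> \<beta>) = tenM K (down2 G C \<alpha>) (Fm K (src (src \<alpha>)) (down2 G C \<beta>))"
  "\<lbrakk>g \<in> carrier G; \<alpha> \<in> Arrs C\<rbrakk> \<Longrightarrow> down2 G C (g \<unrhd>\<^bsub>C\<^esub> \<alpha>) = Fm K g (down2 G C \<alpha>)"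
  "\<lbrakk>g \<in> carrier G; \<alpha> \<in> Arrs C\<rbrakk> \<Longrightarrow> down2 G C (\<alpha> \<unlhd>\<^bsub>C\<^esub> g) = down2 G C \<alpha>"
  "x \<in> Obj C \<Longrightarrow> down2 G C (idt C x) = idt K (down1 G C x)"
  by (simp_all add: down1_def down2_def crossed_of_def ten2_def)

text \<open>
  A 0-cell can be moved from the right of \<open>x\<close> to the left of \<open>y\<close> inside an interchanger, and from
  the right of \<open>y\<close> to the outside.
\<close>

lemma down2_ichg:
  assumes "x \<in> Obj C" "y \<in> Obj C"
  shows "down2 G C (ichg C x y) = brd K (down1 G C x) (Fo K (src x) (down1 G C y))"
proof -
  let ?a = "src x" and ?c = "src y"
  let ?z = "(y \<triangleleft>\<^bsub>C\<^esub> (inv ?c)) \<triangleleft>\<^bsub>C\<^esub> (inv ?a)"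
  have "(ichg C x y \<unlhd>\<^bsub>C\<^esub> (inv ?c)) \<unlhd>\<^bsub>C\<^esub> (inv ?a) = ichg C x ?z"
    using assms ichg_tensor[of "inv ?c" x y] ichg_tensor[of "inv ?a" x "y \<triangleleft>\<^bsub>C\<^esub> (inv ?c)"] by simp
  moreover have "ichg C (x \<triangleleft>\<^bsub>C\<^esub> (inv ?a)) (?a \<triangleright>\<^bsub>C\<^esub> ?z) = ichg C x ?z"
    using assms ichg_tensor[of "inv ?a" x "?a \<triangleright>\<^bsub>C\<^esub> ?z"] by simp
  ultimately show ?thesis
    using assms by (simp add: down1_def down2_def crossed_of_def)
qed

lemma down2_exch:
  assumes "x1 \<in> Obj C" "x2 \<in> Obj C" "y1 \<in> Obj C" "y2 \<in> Obj C" "src x2 = trg x1" "src y2 = trg y1"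
  shows "down2 G C (exch C x1 x2 y1 y2) = tenM K (idt K (down1 G C x2))
     (tenM K (brd K (down1 G C x1) (Fo K (src x1) (down1 G C y2))) (idt K (Fo K (src x1) (down1 G C y1))))"
  using assms by (simp add: exch_def down2_ops down1_ops down2_ichg)

end

text \<open>
  Brings the two inner factors together, so that a braiding can act on them.
\<close>

lemma (in weak_functor) mu_four:
  assumes "x \<in> Obj C" "y \<in> Obj C" "z \<in> Obj C" "w \<in> Obj C" "s x = t y" "s y = t z" "s z = t w"
  shows "mu (x \<odot> y) (z \<odot> w) \<cdot>\<^bsub>D\<^esub> (mu x y \<diamondop>' mu z w)
    = mu x (y \<odot> (z \<odot> w)) \<cdot>\<^bsub>D\<^esub> (idt D (fo x) \<diamondop>' (mu (y \<odot> z) w \<cdot>\<^bsub>D\<^esub> (mu y z \<diamondop>' idt D (fo w))))"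
proof -
  note [simp] = C.ends D.ends fun_ends
  have "mu (x \<odot> y) (z \<odot> w) \<cdot>\<^bsub>D\<^esub> (mu x y \<diamondop>' mu z w)
    = mu (x \<odot> y) (z \<odot> w) \<cdot>\<^bsub>D\<^esub> ((mu x y \<diamondop>' idt D (fo (z \<odot> w))) \<cdot>\<^bsub>D\<^esub> (idt D (fo x \<odot>' fo y) \<diamondop>' mu z w))"
    using assms by (simp add: D.merge)
  also have "\<dots> = mu x (y \<odot> (z \<odot> w)) \<cdot>\<^bsub>D\<^esub> ((idt D (fo x) \<diamondop>' mu y (z \<odot> w)) \<cdot>\<^bsub>D\<^esub> (idt D (fo x) \<diamondop>' (idt D (fo y) \<diamondop>' mu z w)))"
    using assms mu_assoc[of "z \<odot> w" y x, symmetric, THEN D.reassoc] by (simp flip: D.tA_assoc)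
  also have "\<dots> = mu x (y \<odot> (z \<odot> w)) \<cdot>\<^bsub>D\<^esub> (idt D (fo x) \<diamondop>' (mu y (z \<odot> w) \<cdot>\<^bsub>D\<^esub> (idt D (fo y) \<diamondop>' mu z w)))"
    using assms by (simp add: D.whisker_left)
  also have "mu y (z \<odot> w) \<cdot>\<^bsub>D\<^esub> (idt D (fo y) \<diamondop>' mu z w) = mu (y \<odot> z) w \<cdot>\<^bsub>D\<^esub> (mu y z \<diamondop>' idt D (fo w))"
    using assms by (simp add: mu_assoc)
  finally show ?thesis .
qed

context strict_crossed_functor
begin

lemma cact_one [simp]: "x \<in> Obj C \<Longrightarrow> cact A \<one>\<^bsub>G\<^esub> x = idt D (cobj A x)"
  using D.T.idempotent_iso[of "cact A \<one>\<^bsub>G\<^esub> x"] cact_mul[of "\<one>\<^bsub>G\<^esub>" "\<one>\<^bsub>G\<^esub>" x] by simp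

text \<open>
  The value that \<open>down1_ops\<close> forces on the tensor cell of a functor of Gray-monoids at 1-cells
  that shift to \<open>x\<close> and \<open>y\<close>, the first with source \<open>a\<close>.
\<close>

definition mt where "mt a x y = cten A x (Fo C a y) \<cdot>\<^bsub>D\<^esub> (idt D (cobj A x) \<otimes>\<^sub>m\<^bsub>D\<^esub> cact A a y)"

lemma mt_simps [simp]:
  assumes "a \<in> carrier G" "x \<in> Obj C" "y \<in> Obj C"
  shows "iso_arr D (mt a x y)" "src (mt a x y) = cobj A x \<otimes>\<^sub>o\<^bsub>D\<^esub> Fo D a (cobj A y)"
    "trg (mt a x y) = cobj A (x \<otimes>\<^sub>o\<^bsub>C\<^esub> Fo C a y)" "mt a x y \<in> Arrs D"
proof -
  show 1: "iso_arr D (mt a x y)" "src (mt a x y) = cobj A x \<otimes>\<^sub>o\<^bsub>D\<^esub> Fo D a (cobj A y)"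
    "trg (mt a x y) = cobj A (x \<otimes>\<^sub>o\<^bsub>C\<^esub> Fo C a y)"
    using assms by (simp_all add: mt_def)
  show "mt a x y \<in> Arrs D" by (rule D.T.iso_simps(1)[OF 1(1)])
qed

lemma mt_nat:
  assumes "a \<in> carrier G" "f \<in> Arrs C" "u \<in> Arrs C"
  shows "mt a (trg f) (trg u) \<cdot>\<^bsub>D\<^esub> (carr A f \<otimes>\<^sub>m\<^bsub>D\<^esub> Fm D a (carr A u))
     = carr A (f \<otimes>\<^sub>m\<^bsub>C\<^esub> Fm C a u) \<cdot>\<^bsub>D\<^esub> mt a (src f) (src u)"
proof -
  have "mt a (trg f) (trg u) \<cdot>\<^bsub>D\<^esub> (carr A f \<otimes>\<^sub>m\<^bsub>D\<^esub> Fm D a (carr A u))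
    = cten A (trg f) (Fo C a (trg u)) \<cdot>\<^bsub>D\<^esub> (carr A f \<otimes>\<^sub>m\<^bsub>D\<^esub> (cact A a (trg u) \<cdot>\<^bsub>D\<^esub> Fm D a (carr A u)))"
    using assms by (simp add: mt_def D.T.merge)
  also have "\<dots> = (cten A (trg f) (Fo C a (trg u)) \<cdot>\<^bsub>D\<^esub> (carr A f \<otimes>\<^sub>m\<^bsub>D\<^esub> carr A (Fm C a u))) \<cdot>\<^bsub>D\<^esub> (idt D (cobj A (src f)) \<otimes>\<^sub>m\<^bsub>D\<^esub> cact A a (src u))"
    using assms by (simp add: cact_nat D.T.merge)
  also have "\<dots> = carr A (f \<otimes>\<^sub>m\<^bsub>C\<^esub> Fm C a u) \<cdot>\<^bsub>D\<^esub> mt a (src f) (src u)"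
    using assms T.mu_natural[of "Fm C a u" f] by (simp add: mt_def)
  finally show ?thesis .
qed

text \<open>
  Apart from associativity of \<open>cten\<close> this uses that the action cells are monoidal and
  multiplicative in the group element.
\<close>

lemma mt_assoc:
  assumes "a \<in> carrier G" "b \<in> carrier G" "x \<in> Obj C" "y \<in> Obj C" "z \<in> Obj C"
  shows "mt b z (y \<otimes>\<^sub>o\<^bsub>C\<^esub> Fo C a x) \<cdot>\<^bsub>D\<^esub> (idt D (cobj A z) \<otimes>\<^sub>m\<^bsub>D\<^esub> Fm D b (mt a y x))
     = mt (b \<otimes>\<^bsub>G\<^esub> a) (z \<otimes>\<^sub>o\<^bsub>C\<^esub> Fo C b y) x \<cdot>\<^bsub>D\<^esub> (mt b z y \<otimes>\<^sub>m\<^bsub>D\<^esub> idt D (Fo D (b \<otimes>\<^bsub>G\<^esub> a) (cobj A x)))"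
proof -
  let ?iz = "idt D (cobj A z)" and ?m = "cten A"
  let ?y = "Fo C b y" and ?x = "Fo C b (Fo C a x)"
  have "mt b z (y \<otimes>\<^sub>o\<^bsub>C\<^esub> Fo C a x) \<cdot>\<^bsub>D\<^esub> (?iz \<otimes>\<^sub>m\<^bsub>D\<^esub> Fm D b (mt a y x))
    = ?m z (?y \<otimes>\<^sub>o\<^bsub>C\<^esub> ?x) \<cdot>\<^bsub>D\<^esub> (?iz \<otimes>\<^sub>m\<^bsub>D\<^esub> ((cact A b (y \<otimes>\<^sub>o\<^bsub>C\<^esub> Fo C a x) \<cdot>\<^bsub>D\<^esub> Fm D b (?m y (Fo C a x)))
        \<cdot>\<^bsub>D\<^esub> (idt D (Fo D b (cobj A y)) \<otimes>\<^sub>m\<^bsub>D\<^esub> Fm D b (cact A a x))))"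
    using assms by (simp add: mt_def D.T.merge)
  also have "\<dots> = ?m z (?y \<otimes>\<^sub>o\<^bsub>C\<^esub> ?x) \<cdot>\<^bsub>D\<^esub> ((?iz \<otimes>\<^sub>m\<^bsub>D\<^esub> ?m ?y ?x) \<cdot>\<^bsub>D\<^esub> (?iz \<otimes>\<^sub>m\<^bsub>D\<^esub> (cact A b y \<otimes>\<^sub>m\<^bsub>D\<^esub> cact A (b \<otimes>\<^bsub>G\<^esub> a) x)))"
    using assms by (simp add: cact_cten cact_mul D.T.merge)
  also have "\<dots> = ?m (z \<otimes>\<^sub>o\<^bsub>C\<^esub> ?y) ?x \<cdot>\<^bsub>D\<^esub> ((?m z ?y \<otimes>\<^sub>m\<^bsub>D\<^esub> idt D (cobj A ?x)) \<cdot>\<^bsub>D\<^esub> ((?iz \<otimes>\<^sub>m\<^bsub>D\<^esub> cact A b y) \<otimes>\<^sub>m\<^bsub>D\<^esub> cact A (b \<otimes>\<^bsub>G\<^esub> a) x))"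
    using assms T.mu_assoc[of ?x ?y z, THEN D.T.reassoc] by simp
  also have "\<dots> = mt (b \<otimes>\<^bsub>G\<^esub> a) (z \<otimes>\<^sub>o\<^bsub>C\<^esub> ?y) x \<cdot>\<^bsub>D\<^esub> (mt b z y \<otimes>\<^sub>m\<^bsub>D\<^esub> idt D (Fo D (b \<otimes>\<^bsub>G\<^esub> a) (cobj A x)))"
    using assms by (simp add: mt_def D.T.merge del: D.T.tA_assoc)
  finally show ?thesis .
qed

lemma mt_unit_left: "x \<in> Obj C \<Longrightarrow> mt \<one>\<^bsub>G\<^esub> (unitO C) x \<cdot>\<^bsub>D\<^esub> (cunit A \<otimes>\<^sub>m\<^bsub>D\<^esub> idt D (cobj A x)) = idt D (cobj A x)"
  using T.mu_unit_left[of x "()"] by (simp add: mt_def)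

lemma mt_unit_right:
  assumes "a \<in> carrier G" "x \<in> Obj C"
  shows "mt a x (unitO C) \<cdot>\<^bsub>D\<^esub> (idt D (cobj A x) \<otimes>\<^sub>m\<^bsub>D\<^esub> Fm D a (cunit A)) = idt D (cobj A x)"
  using assms T.mu_unit_right[of x "()"] by (simp add: mt_def D.T.merge cact_cunit)

lemma mt_unit:
  assumes "g \<in> carrier G"
  shows "mt g (unitO C) (unitO C) \<cdot>\<^bsub>D\<^esub> (cunit A \<otimes>\<^sub>m\<^bsub>D\<^esub> Fm D g (cunit A)) = cunit A"
proof -
  have "mt g (unitO C) (unitO C) \<cdot>\<^bsub>D\<^esub> (cunit A \<otimes>\<^sub>m\<^bsub>D\<^esub> Fm D g (cunit A))
    = (mt g (unitO C) (unitO C) \<cdot>\<^bsub>D\<^esub> (idt D (cobj A (unitO C)) \<otimes>\<^sub>m\<^bsub>D\<^esub> Fm D g (cunit A))) \<cdot>\<^bsub>D\<^esub> (cunit A \<otimes>\<^sub>m\<^bsub>D\<^esub> idt D (unitO D))"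
    using assms T.eps_src[of "()"] T.eps_trg[of "()"] T.eps_Arrs[of "()"] by (simp add: D.T.merge del: D.T.tA_unit_right)
  also have "\<dots> = cunit A" using assms T.eps_src[of "()"] T.eps_trg[of "()"] T.eps_Arrs[of "()"] by (simp add: mt_unit_right)
  finally show ?thesis .
qed

text \<open>
  The exchange law of \<open>fun3_of\<close>, after shifting. Once \<open>mu_four\<close> has isolated the two inner
  factors, what remains is the compatibility \<open>br\<close> of the functor with the braiding.
\<close>

lemma mt_exchange:
  assumes a: "a \<in> carrier G" and b: "b = fst x1 \<otimes>\<^bsub>G\<^esub> a"
    and ob: "x1 \<in> Obj C" "x2 \<in> Obj C" "y1 \<in> Obj C" "y2 \<in> Obj C"
  shows "cten A (x2 \<otimes>\<^sub>o\<^bsub>C\<^esub> Fo C b y2) (x1 \<otimes>\<^sub>o\<^bsub>C\<^esub> Fo C a y1) \<cdot>\<^bsub>D\<^esub> ((mt b x2 y2 \<otimes>\<^sub>m\<^bsub>D\<^esub> mt a x1 y1)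
      \<cdot>\<^bsub>D\<^esub> (idt D (cobj A x2) \<otimes>\<^sub>m\<^bsub>D\<^esub> (brd D (cobj A x1) (Fo D a (cobj A y2)) \<otimes>\<^sub>m\<^bsub>D\<^esub> idt D (Fo D a (cobj A y1)))))
    = carr A (idt C x2 \<otimes>\<^sub>m\<^bsub>C\<^esub> (brd C x1 (Fo C a y2) \<otimes>\<^sub>m\<^bsub>C\<^esub> idt C (Fo C a y1)))
      \<cdot>\<^bsub>D\<^esub> (mt a (x2 \<otimes>\<^sub>o\<^bsub>C\<^esub> x1) (y2 \<otimes>\<^sub>o\<^bsub>C\<^esub> y1) \<cdot>\<^bsub>D\<^esub> (cten A x2 x1 \<otimes>\<^sub>m\<^bsub>D\<^esub> Fm D a (cten A y2 y1)))"
proof -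
  let ?f = "fst x1" and ?m = "cten A" and ?A = "cobj A"
  let ?i1 = "idt D (?A x1)" and ?i2 = "idt D (?A x2)"
  define z1 z2 w where z: "z1 = Fo C a y1" "z2 = Fo C a y2" "w = Fo C b y2"
  define k1 k2 l where k: "k1 = cact A a y1" "k2 = cact A a y2" "l = cact A b y2"
  have w: "w = Fo C ?f z2" using a ob by (simp add: z b)
  have f: "?f \<in> carrier G" and b': "b \<in> carrier G" using a ob by (simp_all add: b)
  note [simp] = ob f a b'
  have zO [simp]: "z1 \<in> Obj C" "z2 \<in> Obj C" "w \<in> Obj C" by (simp_all add: z)
  have k' [simp]: "k1 \<in> Arrs D" "k2 \<in> Arrs D" "l \<in> Arrs D" "trg k1 = ?A z1" "trg k2 = ?A z2" "trg l = ?A w"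
    "src k1 = Fo D a (?A y1)" "src k2 = Fo D a (?A y2)" "src l = Fo D b (?A y2)"
    by (simp_all add: k z)
  have l: "cact A ?f z2 \<cdot>\<^bsub>D\<^esub> Fm D ?f k2 = l" by (simp add: k z b cact_mul)
  have srcl: "Fo D b (?A y2) = Fo D ?f (Fo D a (?A y2))" by (simp add: b)
  define \<beta> \<beta>' where \<beta>: "\<beta> = brd C x1 z2" "\<beta>' = brd D (?A x1) (Fo D a (?A y2))"
  have \<beta>' [simp]: "\<beta> \<in> Arrs C" "src \<beta> = x1 \<otimes>\<^sub>o\<^bsub>C\<^esub> z2" "trg \<beta> = w \<otimes>\<^sub>o\<^bsub>C\<^esub> x1"
    "\<beta>' \<in> Arrs D" "src \<beta>' = ?A x1 \<otimes>\<^sub>o\<^bsub>D\<^esub> Fo D a (?A y2)" "trg \<beta>' = Fo D b (?A y2) \<otimes>\<^sub>o\<^bsub>D\<^esub> ?A x1"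
    by (simp_all add: \<beta> w srcl)
  (* Compatibility with the braiding, after naturality of the braiding has moved the action cell
     k2 past it. *)
  have br: "carr A \<beta> \<cdot>\<^bsub>D\<^esub> (?m x1 z2 \<cdot>\<^bsub>D\<^esub> (?i1 \<otimes>\<^sub>m\<^bsub>D\<^esub> k2)) = ?m w x1 \<cdot>\<^bsub>D\<^esub> ((l \<otimes>\<^sub>m\<^bsub>D\<^esub> ?i1) \<cdot>\<^bsub>D\<^esub> \<beta>')"
  proof -
    have "carr A \<beta> \<cdot>\<^bsub>D\<^esub> (?m x1 z2 \<cdot>\<^bsub>D\<^esub> (?i1 \<otimes>\<^sub>m\<^bsub>D\<^esub> k2)) = (carr A \<beta> \<cdot>\<^bsub>D\<^esub> ?m x1 z2) \<cdot>\<^bsub>D\<^esub> (?i1 \<otimes>\<^sub>m\<^bsub>D\<^esub> k2)" by simp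
    also have "\<dots> = ?m w x1 \<cdot>\<^bsub>D\<^esub> ((cact A ?f z2 \<otimes>\<^sub>m\<^bsub>D\<^esub> ?i1) \<cdot>\<^bsub>D\<^esub> (brd D (?A x1) (?A z2) \<cdot>\<^bsub>D\<^esub> (?i1 \<otimes>\<^sub>m\<^bsub>D\<^esub> k2)))"
      by (simp add: \<beta>(1) carr_brd flip: w)
    also have "brd D (?A x1) (?A z2) \<cdot>\<^bsub>D\<^esub> (?i1 \<otimes>\<^sub>m\<^bsub>D\<^esub> k2) = (Fm D ?f k2 \<otimes>\<^sub>m\<^bsub>D\<^esub> ?i1) \<cdot>\<^bsub>D\<^esub> \<beta>'"
      using D.brd_nat[of ?i1 k2] by (simp add: \<beta>(2))
    also have "?m w x1 \<cdot>\<^bsub>D\<^esub> ((cact A ?f z2 \<otimes>\<^sub>m\<^bsub>D\<^esub> ?i1) \<cdot>\<^bsub>D\<^esub> ((Fm D ?f k2 \<otimes>\<^sub>m\<^bsub>D\<^esub> ?i1) \<cdot>\<^bsub>D\<^esub> \<beta>'))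
       = ?m w x1 \<cdot>\<^bsub>D\<^esub> ((l \<otimes>\<^sub>m\<^bsub>D\<^esub> ?i1) \<cdot>\<^bsub>D\<^esub> \<beta>')"
      by (simp add: D.T.merge_r l srcl w)
    finally show ?thesis .
  qed
  have four1: "?m (x2 \<otimes>\<^sub>o\<^bsub>C\<^esub> w) (x1 \<otimes>\<^sub>o\<^bsub>C\<^esub> z1) \<cdot>\<^bsub>D\<^esub> (?m x2 w \<otimes>\<^sub>m\<^bsub>D\<^esub> ?m x1 z1)
    = ?m x2 (w \<otimes>\<^sub>o\<^bsub>C\<^esub> (x1 \<otimes>\<^sub>o\<^bsub>C\<^esub> z1)) \<cdot>\<^bsub>D\<^esub> (?i2 \<otimes>\<^sub>m\<^bsub>D\<^esub> (?m (w \<otimes>\<^sub>o\<^bsub>C\<^esub> x1) z1 \<cdot>\<^bsub>D\<^esub> (?m w x1 \<otimes>\<^sub>m\<^bsub>D\<^esub> idt D (?A z1))))"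
    by (rule T.mu_four) simp_all
  have four2: "?m (x2 \<otimes>\<^sub>o\<^bsub>C\<^esub> x1) (z2 \<otimes>\<^sub>o\<^bsub>C\<^esub> z1) \<cdot>\<^bsub>D\<^esub> (?m x2 x1 \<otimes>\<^sub>m\<^bsub>D\<^esub> ?m z2 z1)
    = ?m x2 (x1 \<otimes>\<^sub>o\<^bsub>C\<^esub> (z2 \<otimes>\<^sub>o\<^bsub>C\<^esub> z1)) \<cdot>\<^bsub>D\<^esub> (?i2 \<otimes>\<^sub>m\<^bsub>D\<^esub> (?m (x1 \<otimes>\<^sub>o\<^bsub>C\<^esub> z2) z1 \<cdot>\<^bsub>D\<^esub> (?m x1 z2 \<otimes>\<^sub>m\<^bsub>D\<^esub> idt D (?A z1))))"
    by (rule T.mu_four) simp_all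
  have "carr A (idt C x2 \<otimes>\<^sub>m\<^bsub>C\<^esub> (\<beta> \<otimes>\<^sub>m\<^bsub>C\<^esub> idt C z1)) \<cdot>\<^bsub>D\<^esub> (mt a (x2 \<otimes>\<^sub>o\<^bsub>C\<^esub> x1) (y2 \<otimes>\<^sub>o\<^bsub>C\<^esub> y1) \<cdot>\<^bsub>D\<^esub> (?m x2 x1 \<otimes>\<^sub>m\<^bsub>D\<^esub> Fm D a (?m y2 y1)))
    = carr A (idt C x2 \<otimes>\<^sub>m\<^bsub>C\<^esub> (\<beta> \<otimes>\<^sub>m\<^bsub>C\<^esub> idt C z1)) \<cdot>\<^bsub>D\<^esub> (?m (x2 \<otimes>\<^sub>o\<^bsub>C\<^esub> x1) (z2 \<otimes>\<^sub>o\<^bsub>C\<^esub> z1)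
        \<cdot>\<^bsub>D\<^esub> (?m x2 x1 \<otimes>\<^sub>m\<^bsub>D\<^esub> (cact A a (y2 \<otimes>\<^sub>o\<^bsub>C\<^esub> y1) \<cdot>\<^bsub>D\<^esub> Fm D a (?m y2 y1))))"
    by (simp add: mt_def D.T.merge z)
  also have "?m x2 x1 \<otimes>\<^sub>m\<^bsub>D\<^esub> (cact A a (y2 \<otimes>\<^sub>o\<^bsub>C\<^esub> y1) \<cdot>\<^bsub>D\<^esub> Fm D a (?m y2 y1))
    = (?m x2 x1 \<otimes>\<^sub>m\<^bsub>D\<^esub> ?m z2 z1) \<cdot>\<^bsub>D\<^esub> (idt D (?A x2 \<otimes>\<^sub>o\<^bsub>D\<^esub> ?A x1) \<otimes>\<^sub>m\<^bsub>D\<^esub> (k2 \<otimes>\<^sub>m\<^bsub>D\<^esub> k1))"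
    by (simp add: cact_cten D.T.merge flip: z k)
  also have "carr A (idt C x2 \<otimes>\<^sub>m\<^bsub>C\<^esub> (\<beta> \<otimes>\<^sub>m\<^bsub>C\<^esub> idt C z1)) \<cdot>\<^bsub>D\<^esub> (?m (x2 \<otimes>\<^sub>o\<^bsub>C\<^esub> x1) (z2 \<otimes>\<^sub>o\<^bsub>C\<^esub> z1) \<cdot>\<^bsub>D\<^esub>
      ((?m x2 x1 \<otimes>\<^sub>m\<^bsub>D\<^esub> ?m z2 z1) \<cdot>\<^bsub>D\<^esub> (idt D (?A x2 \<otimes>\<^sub>o\<^bsub>D\<^esub> ?A x1) \<otimes>\<^sub>m\<^bsub>D\<^esub> (k2 \<otimes>\<^sub>m\<^bsub>D\<^esub> k1))))
    = (carr A (idt C x2 \<otimes>\<^sub>m\<^bsub>C\<^esub> (\<beta> \<otimes>\<^sub>m\<^bsub>C\<^esub> idt C z1)) \<cdot>\<^bsub>D\<^esub> ?m x2 (x1 \<otimes>\<^sub>o\<^bsub>C\<^esub> (z2 \<otimes>\<^sub>o\<^bsub>C\<^esub> z1))) \<cdot>\<^bsub>D\<^esub>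
      ((?i2 \<otimes>\<^sub>m\<^bsub>D\<^esub> (?m (x1 \<otimes>\<^sub>o\<^bsub>C\<^esub> z2) z1 \<cdot>\<^bsub>D\<^esub> (?m x1 z2 \<otimes>\<^sub>m\<^bsub>D\<^esub> idt D (?A z1)))) \<cdot>\<^bsub>D\<^esub> (?i2 \<otimes>\<^sub>m\<^bsub>D\<^esub> ((?i1 \<otimes>\<^sub>m\<^bsub>D\<^esub> k2) \<otimes>\<^sub>m\<^bsub>D\<^esub> k1)))"
    using four2[THEN D.T.reassoc] by (simp flip: D.T.tA_idt)
  also have "carr A (idt C x2 \<otimes>\<^sub>m\<^bsub>C\<^esub> (\<beta> \<otimes>\<^sub>m\<^bsub>C\<^esub> idt C z1)) \<cdot>\<^bsub>D\<^esub> ?m x2 (x1 \<otimes>\<^sub>o\<^bsub>C\<^esub> (z2 \<otimes>\<^sub>o\<^bsub>C\<^esub> z1))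
     = ?m x2 (w \<otimes>\<^sub>o\<^bsub>C\<^esub> (x1 \<otimes>\<^sub>o\<^bsub>C\<^esub> z1)) \<cdot>\<^bsub>D\<^esub> (?i2 \<otimes>\<^sub>m\<^bsub>D\<^esub> carr A (\<beta> \<otimes>\<^sub>m\<^bsub>C\<^esub> idt C z1))"
    using T.mu_natural[of "\<beta> \<otimes>\<^sub>m\<^bsub>C\<^esub> idt C z1" "idt C x2"] by simp
  also have "?m x2 (w \<otimes>\<^sub>o\<^bsub>C\<^esub> (x1 \<otimes>\<^sub>o\<^bsub>C\<^esub> z1)) \<cdot>\<^bsub>D\<^esub> (?i2 \<otimes>\<^sub>m\<^bsub>D\<^esub> carr A (\<beta> \<otimes>\<^sub>m\<^bsub>C\<^esub> idt C z1)) \<cdot>\<^bsub>D\<^esub>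
      ((?i2 \<otimes>\<^sub>m\<^bsub>D\<^esub> (?m (x1 \<otimes>\<^sub>o\<^bsub>C\<^esub> z2) z1 \<cdot>\<^bsub>D\<^esub> (?m x1 z2 \<otimes>\<^sub>m\<^bsub>D\<^esub> idt D (?A z1)))) \<cdot>\<^bsub>D\<^esub> (?i2 \<otimes>\<^sub>m\<^bsub>D\<^esub> ((?i1 \<otimes>\<^sub>m\<^bsub>D\<^esub> k2) \<otimes>\<^sub>m\<^bsub>D\<^esub> k1)))
    = ?m x2 (w \<otimes>\<^sub>o\<^bsub>C\<^esub> (x1 \<otimes>\<^sub>o\<^bsub>C\<^esub> z1)) \<cdot>\<^bsub>D\<^esub> (?i2 \<otimes>\<^sub>m\<^bsub>D\<^esub> ((carr A (\<beta> \<otimes>\<^sub>m\<^bsub>C\<^esub> idt C z1) \<cdot>\<^bsub>D\<^esub> ?m (x1 \<otimes>\<^sub>o\<^bsub>C\<^esub> z2) z1)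
        \<cdot>\<^bsub>D\<^esub> ((?m x1 z2 \<cdot>\<^bsub>D\<^esub> (?i1 \<otimes>\<^sub>m\<^bsub>D\<^esub> k2)) \<otimes>\<^sub>m\<^bsub>D\<^esub> k1)))"
    by (simp add: D.T.merge del: D.T.tA_assoc)
  also have "carr A (\<beta> \<otimes>\<^sub>m\<^bsub>C\<^esub> idt C z1) \<cdot>\<^bsub>D\<^esub> ?m (x1 \<otimes>\<^sub>o\<^bsub>C\<^esub> z2) z1 = ?m (w \<otimes>\<^sub>o\<^bsub>C\<^esub> x1) z1 \<cdot>\<^bsub>D\<^esub> (carr A \<beta> \<otimes>\<^sub>m\<^bsub>D\<^esub> idt D (?A z1))"
    using T.mu_natural[of "idt C z1" \<beta>] by simp
  also have "?m (w \<otimes>\<^sub>o\<^bsub>C\<^esub> x1) z1 \<cdot>\<^bsub>D\<^esub> (carr A \<beta> \<otimes>\<^sub>m\<^bsub>D\<^esub> idt D (?A z1)) \<cdot>\<^bsub>D\<^esub> ((?m x1 z2 \<cdot>\<^bsub>D\<^esub> (?i1 \<otimes>\<^sub>m\<^bsub>D\<^esub> k2)) \<otimes>\<^sub>m\<^bsub>D\<^esub> k1)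
    = ?m (w \<otimes>\<^sub>o\<^bsub>C\<^esub> x1) z1 \<cdot>\<^bsub>D\<^esub> ((carr A \<beta> \<cdot>\<^bsub>D\<^esub> (?m x1 z2 \<cdot>\<^bsub>D\<^esub> (?i1 \<otimes>\<^sub>m\<^bsub>D\<^esub> k2))) \<otimes>\<^sub>m\<^bsub>D\<^esub> k1)"
    by (simp add: D.T.merge)
  also have "\<dots> = (?m (w \<otimes>\<^sub>o\<^bsub>C\<^esub> x1) z1 \<cdot>\<^bsub>D\<^esub> (?m w x1 \<otimes>\<^sub>m\<^bsub>D\<^esub> idt D (?A z1))) \<cdot>\<^bsub>D\<^esub> (((l \<otimes>\<^sub>m\<^bsub>D\<^esub> ?i1) \<cdot>\<^bsub>D\<^esub> \<beta>') \<otimes>\<^sub>m\<^bsub>D\<^esub> k1)"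
    unfolding br by (simp add: D.T.merge)
  also have "?m x2 (w \<otimes>\<^sub>o\<^bsub>C\<^esub> (x1 \<otimes>\<^sub>o\<^bsub>C\<^esub> z1)) \<cdot>\<^bsub>D\<^esub> (?i2 \<otimes>\<^sub>m\<^bsub>D\<^esub> (?m (w \<otimes>\<^sub>o\<^bsub>C\<^esub> x1) z1 \<cdot>\<^bsub>D\<^esub> (?m w x1 \<otimes>\<^sub>m\<^bsub>D\<^esub> idt D (?A z1)) \<cdot>\<^bsub>D\<^esub> (((l \<otimes>\<^sub>m\<^bsub>D\<^esub> ?i1) \<cdot>\<^bsub>D\<^esub> \<beta>') \<otimes>\<^sub>m\<^bsub>D\<^esub> k1)))
    = (?m x2 (w \<otimes>\<^sub>o\<^bsub>C\<^esub> (x1 \<otimes>\<^sub>o\<^bsub>C\<^esub> z1)) \<cdot>\<^bsub>D\<^esub> (?i2 \<otimes>\<^sub>m\<^bsub>D\<^esub> (?m (w \<otimes>\<^sub>o\<^bsub>C\<^esub> x1) z1 \<cdot>\<^bsub>D\<^esub> (?m w x1 \<otimes>\<^sub>m\<^bsub>D\<^esub> idt D (?A z1)))))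
       \<cdot>\<^bsub>D\<^esub> (?i2 \<otimes>\<^sub>m\<^bsub>D\<^esub> (((l \<otimes>\<^sub>m\<^bsub>D\<^esub> ?i1) \<cdot>\<^bsub>D\<^esub> \<beta>') \<otimes>\<^sub>m\<^bsub>D\<^esub> k1))"
    by (simp add: D.T.whisker_left)
  also have "\<dots> = ?m (x2 \<otimes>\<^sub>o\<^bsub>C\<^esub> w) (x1 \<otimes>\<^sub>o\<^bsub>C\<^esub> z1) \<cdot>\<^bsub>D\<^esub> ((?m x2 w \<otimes>\<^sub>m\<^bsub>D\<^esub> ?m x1 z1) \<cdot>\<^bsub>D\<^esub>
       ((?i2 \<otimes>\<^sub>m\<^bsub>D\<^esub> ((l \<otimes>\<^sub>m\<^bsub>D\<^esub> ?i1) \<otimes>\<^sub>m\<^bsub>D\<^esub> k1)) \<cdot>\<^bsub>D\<^esub> (?i2 \<otimes>\<^sub>m\<^bsub>D\<^esub> (\<beta>' \<otimes>\<^sub>m\<^bsub>D\<^esub> idt D (Fo D a (?A y1))))))"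
    unfolding four1[symmetric] by (simp add: D.T.merge del: D.T.tA_assoc)
  also have "\<dots> = ?m (x2 \<otimes>\<^sub>o\<^bsub>C\<^esub> w) (x1 \<otimes>\<^sub>o\<^bsub>C\<^esub> z1) \<cdot>\<^bsub>D\<^esub> (((?m x2 w \<otimes>\<^sub>m\<^bsub>D\<^esub> ?m x1 z1) \<cdot>\<^bsub>D\<^esub>
       ((?i2 \<otimes>\<^sub>m\<^bsub>D\<^esub> l) \<otimes>\<^sub>m\<^bsub>D\<^esub> (?i1 \<otimes>\<^sub>m\<^bsub>D\<^esub> k1))) \<cdot>\<^bsub>D\<^esub> (?i2 \<otimes>\<^sub>m\<^bsub>D\<^esub> (\<beta>' \<otimes>\<^sub>m\<^bsub>D\<^esub> idt D (Fo D a (?A y1)))))"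
    by simp
  also have "(?m x2 w \<otimes>\<^sub>m\<^bsub>D\<^esub> ?m x1 z1) \<cdot>\<^bsub>D\<^esub> ((?i2 \<otimes>\<^sub>m\<^bsub>D\<^esub> l) \<otimes>\<^sub>m\<^bsub>D\<^esub> (?i1 \<otimes>\<^sub>m\<^bsub>D\<^esub> k1)) = mt b x2 y2 \<otimes>\<^sub>m\<^bsub>D\<^esub> mt a x1 y1"
    by (simp add: mt_def D.T.merge del: D.T.tA_assoc flip: z k)
  finally show ?thesis unfolding z \<beta> ..
qed

text \<open>
  Recovers the action cell as the left cell of \<open>fun3_of\<close>.
\<close>

lemma mt_cunit:
  assumes "g \<in> carrier G" "x \<in> Obj C"
  shows "mt g (unitO C) x \<cdot>\<^bsub>D\<^esub> (cunit A \<otimes>\<^sub>m\<^bsub>D\<^esub> idt D (Fo D g (cobj A x))) = cact A g x"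
proof -
  have u [simp]: "cunit A \<in> Arrs D" "src (cunit A) = unitO D" "trg (cunit A) = cobj A (unitO C)"
    using T.eps_src[of "()"] T.eps_trg[of "()"] T.eps_Arrs[of "()"] by simp_all
  have "mt g (unitO C) x \<cdot>\<^bsub>D\<^esub> (cunit A \<otimes>\<^sub>m\<^bsub>D\<^esub> idt D (Fo D g (cobj A x)))
    = cten A (unitO C) (Fo C g x) \<cdot>\<^bsub>D\<^esub> ((cunit A \<otimes>\<^sub>m\<^bsub>D\<^esub> idt D (cobj A (Fo C g x))) \<cdot>\<^bsub>D\<^esub> (idt D (unitO D) \<otimes>\<^sub>m\<^bsub>D\<^esub> cact A g x))"
    using assms by (simp add: mt_def D.T.merge del: D.T.tA_unit_left)
  also have "\<dots> = (cten A (unitO C) (Fo C g x) \<cdot>\<^bsub>D\<^esub> (cunit A \<otimes>\<^sub>m\<^bsub>D\<^esub> idt D (cobj A (Fo C g x)))) \<cdot>\<^bsub>D\<^esub> cact A g x"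
    using assms by simp
  also have "\<dots> = cact A g x"
    using assms T.mu_unit_left[of "Fo C g x" "()"] by simp
  finally show ?thesis .
qed

end

text \<open>
  Each cell is shifted down, sent to the other side by the crossed braided functor, and shifted
  up by the source it had.
\<close>

definition fun3_of :: "('g, 'h) monoid_scheme \<Rightarrow> ('g, 'o, 'm) gray \<Rightarrow> ('g, 'o, 'm) gray
    \<Rightarrow> ('g, 'o, 'm) crsfun \<Rightarrow> ('g, 'o, 'm) fun3" where
  "fun3_of G C D A =
     \<lparr> map0 = (\<lambda>a \<in> Obj0 C. a),
       map1 = (\<lambda>x \<in> Obj C. up1 G D (src x) (cobj A (down1 G C x))),
       map2 = (\<lambda>\<alpha> \<in> Arrs C. up2 G D (src (src \<alpha>)) (carr A (down2 G C \<alpha>))),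
       munit = (\<lambda>g \<in> Obj0 C. up2 G D g (cunit A)),
       mcomp = (\<lambda>y x. if composable1 C y x
          then up2 G D (src x) (cten A (down1 G C y) (down1 G C x)) else undefined),
       mten = (\<lambda>x y. if x \<in> Obj C \<and> y \<in> Obj C
          then up2 G D (src x \<otimes>\<^bsub>G\<^esub> src y)
            (strict_crossed_functor.mt (crossed_of G C) (crossed_of G D) A (src x) (down1 G C x) (down1 G C y))
          else undefined) \<rparr>"

lemma (in pointed_gray) up1_eqI:
  "\<lbrakk>z \<in> Obj C; src z = g; down1 G C z = a\<rbrakk> \<Longrightarrow> up1 G C g a = z"
  using down1_simps(3) by blast

lemma (in pointed_gray) drop_down:
  "\<lbrakk>z \<in> Obj C; src z = \<one>\<rbrakk> \<Longrightarrow> drop1 z = down1 G C z"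
  "\<lbrakk>f \<in> Arrs C; src (src f) = \<one>\<rbrakk> \<Longrightarrow> drop2 f = down2 G C f"
  by (simp_all add: down1_def down2_def)

locale crossed_functor_of_grays = C: pointed_gray G C + D: pointed_gray G D +
    F: strict_crossed_functor G "crossed_of G C" "crossed_of G D" A
  for G :: "('g, 'h) monoid_scheme" and C D :: "('g, 'o, 'm) gray" and A :: "('g, 'o, 'm) crsfun"
begin

abbreviation "Q \<equiv> fun3_of G C D A"
abbreviation "dn \<equiv> down1 G C"

lemma cunit_simps [simp]:
  "iso_arr D.K (cunit A)" "cunit A \<in> Arrs D.K" "src (cunit A) = unitO D.K" "trg (cunit A) = cobj A (unitO C.K)"
  using F.T.eps_src[of "()"] F.T.eps_trg[of "()"] F.T.eps_iso[of "()"] F.T.eps_Arrs[of "()"] by simp_all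

lemma Q_map0 [simp]: "g \<in> carrier G \<Longrightarrow> map0 Q g = g"
  by (simp add: fun3_of_def)

lemma Q_map1 [simp]:
  assumes "x \<in> Obj C"
  shows "map1 Q x \<in> Obj D" "src (map1 Q x) = src x" "trg (map1 Q x) = trg x"
    "down1 G D (map1 Q x) = cobj A (dn x)"
  using assms by (simp_all add: fun3_of_def)

lemma Q_map2 [simp]:
  assumes "f \<in> Arrs C"
  shows "map2 Q f \<in> Arrs D" "src (map2 Q f) = map1 Q (src f)" "trg (map2 Q f) = map1 Q (trg f)"
    "down2 G D (map2 Q f) = carr A (down2 G C f)"
  using assms by (simp_all add: fun3_of_def)

lemma Q_munit [simp]:
  assumes "g \<in> carrier G"
  shows "iso_arr D (munit Q g)" "munit Q g \<in> Arrs D" "src (munit Q g) = id1 D g" "trg (munit Q g) = map1 Q (id1 C g)"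
    "down2 G D (munit Q g) = cunit A"
  using assms by (auto simp: fun3_of_def D.down1_ops C.down1_ops intro!: D.up1_eqI)

lemma Q_mcomp [simp]:
  assumes "x \<in> Obj C" "y \<in> Obj C" "src y = trg x"
  shows "iso_arr D (mcomp Q y x)" "mcomp Q y x \<in> Arrs D" "src (mcomp Q y x) = map1 Q y \<bullet>\<^bsub>D\<^esub> map1 Q x"
    "trg (mcomp Q y x) = map1 Q (y \<bullet>\<^bsub>C\<^esub> x)" "down2 G D (mcomp Q y x) = cten A (dn y) (dn x)"
proof -
  have e: "mcomp Q y x = up2 G D (src x) (cten A (dn y) (dn x))"
    using assms by (simp add: fun3_of_def composable1_def)
  show "iso_arr D (mcomp Q y x)" "mcomp Q y x \<in> Arrs D" "down2 G D (mcomp Q y x) = cten A (dn y) (dn x)"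
    unfolding e using assms by simp_all
  show "src (mcomp Q y x) = map1 Q y \<bullet>\<^bsub>D\<^esub> map1 Q x" "trg (mcomp Q y x) = map1 Q (y \<bullet>\<^bsub>C\<^esub> x)"
    unfolding e using assms by (auto simp: D.down1_ops C.down1_ops intro!: D.up1_eqI)
qed

lemma Q_mten [simp]:
  assumes "x \<in> Obj C" "y \<in> Obj C"
  shows "iso_arr D (mten Q x y)" "mten Q x y \<in> Arrs D" "src (mten Q x y) = map1 Q x \<otimes>\<^sub>1\<^bsub>D\<^esub> map1 Q y"
    "trg (mten Q x y) = map1 Q (x \<otimes>\<^sub>1\<^bsub>C\<^esub> y)" "down2 G D (mten Q x y) = F.mt (src x) (dn x) (dn y)"
proof -
  have e: "mten Q x y = up2 G D (src x \<otimes>\<^bsub>G\<^esub> src y) (F.mt (src x) (dn x) (dn y))"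
    using assms by (simp add: fun3_of_def)
  show "iso_arr D (mten Q x y)" "mten Q x y \<in> Arrs D" "down2 G D (mten Q x y) = F.mt (src x) (dn x) (dn y)"
    unfolding e using assms by simp_all
  show "src (mten Q x y) = map1 Q x \<otimes>\<^sub>1\<^bsub>D\<^esub> map1 Q y" "trg (mten Q x y) = map1 Q (x \<otimes>\<^sub>1\<^bsub>C\<^esub> y)"
    unfolding e using assms by (auto simp: D.down1_ops C.down1_ops intro!: D.up1_eqI)
qed

lemmas dops = D.down2_ops D.down1_ops C.down2_ops C.down1_ops

text \<open>
  By \<open>down2_inj\<close> every equation may be shifted down, where it is one of the laws of \<open>A\<close> or of
  \<open>mt\<close>.
\<close>

lemma fun3_of_functor: "pointed_functor G C D Q"
proof unfold_locales
  show "is_functor C D (map1 Q) (map2 Q)"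
    unfolding is_functor_def
  proof (intro conjI ballI impI)
    fix a assume "a \<in> Obj C"
    then show "map1 Q a \<in> Obj D" "map2 Q (idt C a) = idt D (map1 Q a)"
      by (auto intro: D.down2_inj simp: dops)
  next
    fix f assume "f \<in> Arrs C" then show "map2 Q f \<in> Hom D (map1 Q (src f)) (map1 Q (trg f))" by (simp add: Hom_def)
  next
    fix f g assume "f \<in> Arrs C" "g \<in> Arrs C" "src g = trg f"
    then show "map2 Q (g \<cdot>\<^bsub>C\<^esub> f) = map2 Q g \<cdot>\<^bsub>D\<^esub> map2 Q f"
      by (intro D.down2_inj) (simp_all add: dops)
  qed
next
  fix f g assume "f \<in> Arrs C" "g \<in> Arrs C" "src (src g) = trg (src f)"
  then show "mcomp Q (trg g) (trg f) \<cdot>\<^bsub>D\<^esub> (map2 Q g \<star>\<^bsub>D\<^esub> map2 Q f) = map2 Q (g \<star>\<^bsub>C\<^esub> f) \<cdot>\<^bsub>D\<^esub> mcomp Q (src g) (src f)"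
    using F.T.mu_natural[of "down2 G C f" "down2 G C g"] by (intro D.down2_inj) (simp_all add: dops)
next
  fix x y z assume "x \<in> Obj C" "y \<in> Obj C" "z \<in> Obj C" "src y = trg x" "src z = trg y"
  then show "mcomp Q z (y \<bullet>\<^bsub>C\<^esub> x) \<cdot>\<^bsub>D\<^esub> (idt D (map1 Q z) \<star>\<^bsub>D\<^esub> mcomp Q y x)
       = mcomp Q (z \<bullet>\<^bsub>C\<^esub> y) x \<cdot>\<^bsub>D\<^esub> (mcomp Q z y \<star>\<^bsub>D\<^esub> idt D (map1 Q x))"
    using F.T.mu_assoc[of "dn x" "dn y" "dn z"] by (intro D.down2_inj) (simp_all add: dops)
next
  fix x i assume x: "x \<in> Obj C" and i: "trg x = i"
  show "mcomp Q (id1 C i) x \<cdot>\<^bsub>D\<^esub> (munit Q i \<star>\<^bsub>D\<^esub> idt D (map1 Q x)) = idt D (map1 Q x)"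
    using F.T.mu_unit_left[of "dn x" "()"] x unfolding i[symmetric] by (intro D.down2_inj) (simp_all add: dops)
next
  fix x i assume x: "x \<in> Obj C" and i: "src x = i"
  show "mcomp Q x (id1 C i) \<cdot>\<^bsub>D\<^esub> (idt D (map1 Q x) \<star>\<^bsub>D\<^esub> munit Q i) = idt D (map1 Q x)"
    using F.T.mu_unit_right[of "dn x" "()"] x unfolding i[symmetric] by (intro D.down2_inj) (simp_all add: dops)
next
  fix f g assume "f \<in> Arrs C" "g \<in> Arrs C"
  then show "mten Q (trg g) (trg f) \<cdot>\<^bsub>D\<^esub> (map2 Q g \<otimes>\<^sub>2\<^bsub>D\<^esub> map2 Q f) = map2 Q (g \<otimes>\<^sub>2\<^bsub>C\<^esub> f) \<cdot>\<^bsub>D\<^esub> mten Q (src g) (src f)"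
    using F.mt_nat[of "src (src g)" "down2 G C g" "down2 G C f"] by (intro D.down2_inj) (simp_all add: dops)
next
  fix x y z assume "x \<in> Obj C" "y \<in> Obj C" "z \<in> Obj C"
  then show "mten Q z (y \<otimes>\<^sub>1\<^bsub>C\<^esub> x) \<cdot>\<^bsub>D\<^esub> (idt D (map1 Q z) \<otimes>\<^sub>2\<^bsub>D\<^esub> mten Q y x)
       = mten Q (z \<otimes>\<^sub>1\<^bsub>C\<^esub> y) x \<cdot>\<^bsub>D\<^esub> (mten Q z y \<otimes>\<^sub>2\<^bsub>D\<^esub> idt D (map1 Q x))"
    using F.mt_assoc[of "src y" "src z" "dn x" "dn y" "dn z"] by (intro D.down2_inj) (simp_all add: dops)
next
  fix x assume "x \<in> Obj C"
  then show "mten Q (id1 C (unit0 C)) x \<cdot>\<^bsub>D\<^esub> (munit Q \<one>\<^bsub>G\<^esub> \<otimes>\<^sub>2\<^bsub>D\<^esub> idt D (map1 Q x)) = idt D (map1 Q x)"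
    using F.mt_unit_left[of "dn x"] by (intro D.down2_inj) (simp_all add: dops)
next
  fix x assume "x \<in> Obj C"
  then show "mten Q x (id1 C (unit0 C)) \<cdot>\<^bsub>D\<^esub> (idt D (map1 Q x) \<otimes>\<^sub>2\<^bsub>D\<^esub> munit Q \<one>\<^bsub>G\<^esub>) = idt D (map1 Q x)"
    using F.mt_unit_right[of "src x" "dn x"] by (intro D.down2_inj) (simp_all add: dops)
next
  fix g h assume "g \<in> carrier G" "h \<in> carrier G"
  then show "mten Q (id1 C g) (id1 C h) \<cdot>\<^bsub>D\<^esub> (munit Q g \<otimes>\<^sub>2\<^bsub>D\<^esub> munit Q h) = munit Q (g \<otimes>\<^bsub>G\<^esub> h)"
    using F.mt_unit[of g] by (intro D.down2_inj) (simp_all add: dops)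
next
  fix x1 x2 y1 y2
  assume *: "x1 \<in> Obj C" "x2 \<in> Obj C" "y1 \<in> Obj C" "y2 \<in> Obj C" "src x2 = trg x1" "src y2 = trg y1"
  show "mcomp Q (x2 \<otimes>\<^sub>1\<^bsub>C\<^esub> y2) (x1 \<otimes>\<^sub>1\<^bsub>C\<^esub> y1) \<cdot>\<^bsub>D\<^esub> ((mten Q x2 y2 \<star>\<^bsub>D\<^esub> mten Q x1 y1)
           \<cdot>\<^bsub>D\<^esub> exch D (map1 Q x1) (map1 Q x2) (map1 Q y1) (map1 Q y2))
         = map2 Q (exch C x1 x2 y1 y2)
           \<cdot>\<^bsub>D\<^esub> (mten Q (x2 \<bullet>\<^bsub>C\<^esub> x1) (y2 \<bullet>\<^bsub>C\<^esub> y1) \<cdot>\<^bsub>D\<^esub> (mcomp Q x2 x1 \<otimes>\<^sub>2\<^bsub>D\<^esub> mcomp Q y2 y1))"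
    using F.mt_exchange[of "src x1" "src x2" "dn x1" "dn x2" "dn y1" "dn y2"] *
    by (intro D.down2_inj) (simp_all add: dops C.down2_exch D.down2_exch)
qed simp_all

lemma fun3_extensional_of: "fun3_extensional C Q"
  by (auto simp: fun3_extensional_def fun3_of_def)

text \<open>
  Shifting does nothing to cells out of the unit. Only the action cells need an argument: the
  right half of \<open>acell\<close> shifts to an identity and the left half to \<open>cact A\<close>.
\<close>

lemma crsfun_of_fun3_of:
  assumes ext: "crsfun_extensional G C.K A"
  shows "crsfun_of G C D Q = A"
proof -
  interpret Q: pointed_functor G C D Q by (rule fun3_of_functor)
  have l [simp]: "dn (lift1 G a) = a" if "lift1 G a \<in> Obj C" for a
    using that C.drop_down(1)[of "lift1 G a"] by simp
  have l2 [simp]: "down2 G C (lift2 G f) = f" if "lift2 G f \<in> Arrs C" for f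
    using that C.drop_down(2)[of "lift2 G f"] by simp
  have cobj: "drop1 (map1 Q (lift1 G a)) = cobj A a" if "lift1 G a \<in> Obj C" for a
    using that by (simp add: D.drop_down)
  have carr: "drop2 (map2 Q (lift2 G f)) = carr A f" if "lift2 G f \<in> Arrs C" for f
    using that by (simp add: D.drop_down)
  have cunit: "drop2 (munit Q \<one>\<^bsub>G\<^esub>) = cunit A"
    by (simp add: D.drop_down)
  have cten: "drop2 (mten Q (lift1 G a) (lift1 G b)) = cten A a b" if "lift1 G a \<in> Obj C" "lift1 G b \<in> Obj C" for a b
    using that that[THEN crossed_of_mem(1)[THEN iffD2]] by (simp add: D.drop_down F.mt_def)
  have cact: "drop2 (acell G C D Q g (lift1 G a)) = cact A g a" if g: "g \<in> carrier G" and a: "lift1 G a \<in> Obj C" for g a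
  proof -
    let ?x = "lift1 G a" and ?h = "inv\<^bsub>G\<^esub> g"
    have a': "a \<in> Obj C.K" using a by (simp add: crossed_of_mem(1))
    have r: "down2 G D (rcell C D Q ?x ?h) = idt D.K (cobj A a)"
      using F.mt_unit_right[of "\<one>\<^bsub>G\<^esub>" a] g a a' by (simp add: rcell_def dops del: D.ten2_id)
    have l: "down2 G D (lcell C D Q g (?x \<triangleleft>\<^bsub>C\<^esub> ?h)) = cact A g a"
      using F.mt_cunit[of g a] g a a' by (simp add: lcell_def dops del: D.id_ten2)
    show ?thesis
      using g a a' Q.acell_simps[of g ?x] by (simp add: D.drop_down acell_def dops r l)
  qed
  show ?thesis
  proof (intro crsfun.equality ext)
    show "cobj (crsfun_of G C D Q) = cobj A"
      by (rule extensionalityI[of _ "Obj C.K"]) (use ext cobj in \<open>auto simp: crsfun_of_def crsfun_extensional_def crossed_of_mem\<close>)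
    show "carr (crsfun_of G C D Q) = carr A"
      by (rule extensionalityI[of _ "Arrs C.K"]) (use ext carr in \<open>auto simp: crsfun_of_def crsfun_extensional_def crossed_of_mem\<close>)
    show "cten (crsfun_of G C D Q) = cten A"
      using ext cten by (intro HOL.ext) (simp add: crsfun_of_def crsfun_extensional_def crossed_of_mem del: split_paired_All)
    show "cact (crsfun_of G C D Q) = cact A"
      using ext cact by (intro HOL.ext) (simp add: crsfun_of_def crsfun_extensional_def crossed_of_mem del: split_paired_All)
  qed (simp_all add: crsfun_of_def cunit)
qed

end


section \<open>Every strict crossed braided category comes from a Gray-monoid\<close>

text \<open>
  In \<open>gray_of G C\<close> below, a 1-cell from \<open>g\<close> to \<open>h\<close> bears the name of an object of grade
  \<open>h \<otimes> inv g\<close>. The four maps translate; they play the part of \<open>down1\<close>, \<open>down2\<close>, \<open>up1\<close> and \<open>up2\<close>,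
  but exist before there is a Gray-monoid.
\<close>

definition gd1 :: "('g, 'h) monoid_scheme \<Rightarrow> ('g, 'o) arr \<Rightarrow> 'g \<times> 'o" where
  "gd1 G x = (trg x \<otimes>\<^bsub>G\<^esub> inv\<^bsub>G\<^esub> (src x), lab x)"

definition gd2 :: "('g, 'h) monoid_scheme \<Rightarrow> (('g, 'o) arr, 'm) arr \<Rightarrow> ('g \<times> 'o, 'm) arr" where
  "gd2 G \<alpha> = Arr (gd1 G (src \<alpha>)) (gd1 G (trg \<alpha>)) (lab \<alpha>)"

definition gu1 :: "'g \<Rightarrow> 'g \<Rightarrow> 'g \<times> 'o \<Rightarrow> ('g, 'o) arr" where
  "gu1 g h a = Arr g h (snd a)"

definition gu2 :: "'g \<Rightarrow> 'g \<Rightarrow> ('g \<times> 'o, 'm) arr \<Rightarrow> (('g, 'o) arr, 'm) arr" where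
  "gu2 g h f = Arr (gu1 g h (src f)) (gu1 g h (trg f)) (lab f)"

lemma gu_simps [simp]:
  "src (gu1 g h a) = g" "trg (gu1 g h a) = h"
  "src (gu2 g h f) = gu1 g h (src f)" "trg (gu2 g h f) = gu1 g h (trg f)"
  "src (gd2 G \<alpha>) = gd1 G (src \<alpha>)" "trg (gd2 G \<alpha>) = gd1 G (trg \<alpha>)"
  "fst (gd1 G x) = trg x \<otimes>\<^bsub>G\<^esub> inv\<^bsub>G\<^esub> (src x)"
  by (simp_all add: gu1_def gu2_def gd2_def gd1_def)

lemma gd1_gu1 [simp]: "fst a = h \<otimes>\<^bsub>G\<^esub> inv\<^bsub>G\<^esub> g \<Longrightarrow> gd1 G (gu1 g h a) = a"
  by (simp add: gd1_def gu1_def prod_eq_iff)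

lemma gd2_gu2 [simp]: "\<lbrakk>fst (src f) = h \<otimes>\<^bsub>G\<^esub> inv\<^bsub>G\<^esub> g; fst (trg f) = h \<otimes>\<^bsub>G\<^esub> inv\<^bsub>G\<^esub> g\<rbrakk> \<Longrightarrow> gd2 G (gu2 g h f) = f"
  by (cases f) (simp add: gd2_def gu2_def)

lemma gu1_gd1 [simp]: "\<lbrakk>src x = g; trg x = h\<rbrakk> \<Longrightarrow> gu1 g h (gd1 G x) = x"
  by (cases x) (simp add: gd1_def gu1_def)

lemma gu2_gd2 [simp]:
  "\<lbrakk>src (src \<alpha>) = g; trg (src \<alpha>) = h; src (trg \<alpha>) = g; trg (trg \<alpha>) = h\<rbrakk> \<Longrightarrow> gu2 g h (gd2 G \<alpha>) = \<alpha>"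
  by (cases \<alpha>) (simp add: gd2_def gu2_def)

text \<open>
  The Gray-monoid dictated by \<open>down1_ops\<close>, \<open>down2_ops\<close> and \<open>down2_ichg\<close>: composition is the
  tensor product, 0-cells act on the left through \<open>F\<close> and on the right by moving the endpoints
  only, and the interchanger of \<open>x\<close> and \<open>y\<close> is the braiding with the conjugate of \<open>y\<close> by the
  source of \<open>x\<close>.
\<close>

definition gray_of :: "('g, 'h) monoid_scheme \<Rightarrow> ('g, 'o, 'm) crsbrd \<Rightarrow> ('g, 'o, 'm) gray" where
  "gray_of G C =
     \<lparr> Obj = {x. src x \<in> carrier G \<and> trg x \<in> carrier G \<and> gd1 G x \<in> Obj C},
       Arrs = {\<alpha>. src (src \<alpha>) \<in> carrier G \<and> trg (src \<alpha>) \<in> carrier G \<and> src (trg \<alpha>) = src (src \<alpha>)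
                  \<and> trg (trg \<alpha>) = trg (src \<alpha>) \<and> gd2 G \<alpha> \<in> Arrs C},
       idt = (\<lambda>x. gu2 (src x) (trg x) (idt C (gd1 G x))),
       vcmp = (\<lambda>\<beta> \<alpha>. gu2 (src (src \<alpha>)) (trg (src \<alpha>)) (gd2 G \<beta> \<cdot>\<^bsub>C\<^esub> gd2 G \<alpha>)),
       Obj0 = carrier G,
       id1 = (\<lambda>g. gu1 g g (unitO C)),
       cmp1 = (\<lambda>y x. gu1 (src x) (trg y) (gd1 G y \<otimes>\<^sub>o\<^bsub>C\<^esub> gd1 G x)),
       hcmp = (\<lambda>\<beta> \<alpha>. gu2 (src (src \<alpha>)) (trg (src \<beta>)) (gd2 G \<beta> \<otimes>\<^sub>m\<^bsub>C\<^esub> gd2 G \<alpha>)),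
       unit0 = \<one>\<^bsub>G\<^esub>,
       ten0 = (\<lambda>g h. g \<otimes>\<^bsub>G\<^esub> h),
       lten1 = (\<lambda>a x. gu1 (a \<otimes>\<^bsub>G\<^esub> src x) (a \<otimes>\<^bsub>G\<^esub> trg x) (Fo C a (gd1 G x))),
       rten1 = (\<lambda>x a. gu1 (src x \<otimes>\<^bsub>G\<^esub> a) (trg x \<otimes>\<^bsub>G\<^esub> a) (gd1 G x)),
       lten2 = (\<lambda>a \<alpha>. gu2 (a \<otimes>\<^bsub>G\<^esub> src (src \<alpha>)) (a \<otimes>\<^bsub>G\<^esub> trg (src \<alpha>)) (Fm C a (gd2 G \<alpha>))),
       rten2 = (\<lambda>\<alpha> a. gu2 (src (src \<alpha>) \<otimes>\<^bsub>G\<^esub> a) (trg (src \<alpha>) \<otimes>\<^bsub>G\<^esub> a) (gd2 G \<alpha>)),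
       ichg = (\<lambda>x y. gu2 (src x \<otimes>\<^bsub>G\<^esub> src y) (trg x \<otimes>\<^bsub>G\<^esub> trg y) (brd C (gd1 G x) (Fo C (src x) (gd1 G y)))) \<rparr>"

context strict_crossed
begin

abbreviation "D \<equiv> gray_of G C"

lemma gd1_Obj [simp]: "gd2 G \<alpha> \<in> Arrs C \<Longrightarrow> gd1 G (src \<alpha>) \<in> Obj C"
  "gd2 G \<alpha> \<in> Arrs C \<Longrightarrow> gd1 G (trg \<alpha>) \<in> Obj C"
  using T.src_Obj[of "gd2 G \<alpha>"] T.trg_Obj[of "gd2 G \<alpha>"] by (simp_all del: T.src_Obj T.trg_Obj)

lemma gray_category: "category D"
proof unfold_locales
  fix f g h a b c d assume "f \<in> Hom D a b" "g \<in> Hom D b c" "h \<in> Hom D c d"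
  then show "h \<cdot>\<^bsub>D\<^esub> g \<cdot>\<^bsub>D\<^esub> f = h \<cdot>\<^bsub>D\<^esub> (g \<cdot>\<^bsub>D\<^esub> f)"
    by (auto simp: gray_of_def Hom_def)
next
  fix f assume "f \<in> Arrs D"
  then show "src f \<in> Obj D" "trg f \<in> Obj D"
    by (auto simp: gray_of_def)
qed (auto simp: gray_of_def Hom_def)

lemma gray_two_category: "two_category D"
proof -
  interpret D: category D by (rule gray_category)
  show ?thesis
  proof unfold_locales
    fix \<alpha> \<alpha>' x x' x'' \<beta> \<beta>' y y' y''
    assume "\<alpha> \<in> Hom D x x'" "\<alpha>' \<in> Hom D x' x''" "\<beta> \<in> Hom D y y'" "\<beta>' \<in> Hom D y' y''" "src y = trg x"
    then show "(\<beta>' \<cdot>\<^bsub>D\<^esub> \<beta>) \<star>\<^bsub>D\<^esub> (\<alpha>' \<cdot>\<^bsub>D\<^esub> \<alpha>) = (\<beta>' \<star>\<^bsub>D\<^esub> \<alpha>') \<cdot>\<^bsub>D\<^esub> (\<beta> \<star>\<^bsub>D\<^esub> \<alpha>)"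
      by (auto simp: gray_of_def Hom_def T.merge)
  qed (auto simp: gray_of_def Hom_def Hom1_def composable1_def composable2_def)
qed

lemma gray_inverse:
  assumes "inverse_arrs C f f'" "g \<in> carrier G" "h \<in> carrier G" "fst (src f) = h \<otimes>\<^bsub>G\<^esub> inv\<^bsub>G\<^esub> g"
  shows "inverse_arrs D (gu2 g h f) (gu2 g h f')"
proof -
  interpret D: category D by (rule gray_category)
  have [simp]: "f \<in> Arrs C" "f' \<in> Arrs C" "src f' = trg f" "trg f' = src f" "f' \<cdot> f = idt C (src f)" "f \<cdot> f' = idt C (trg f)"
    using assms by (simp_all add: T.inverse_arrs_iff)
  have [simp]: "fst (trg f) = h \<otimes>\<^bsub>G\<^esub> inv\<^bsub>G\<^esub> g" using assms by simp
  show ?thesis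
    unfolding D.inverse_arrs_iff using assms by (simp add: gray_of_def)
qed

lemma gray_iso:
  assumes "iso_arr C f" "g \<in> carrier G" "h \<in> carrier G" "fst (src f) = h \<otimes>\<^bsub>G\<^esub> inv\<^bsub>G\<^esub> g"
  shows "iso_arr D (gu2 g h f)"
  using gray_inverse[OF T.inverse_arrs_inv_arr[OF assms(1)] assms(2-4)] unfolding iso_arr_def by blast

text \<open>
  The axioms for the interchanger are naturality of the braiding, the two hexagons, and
  invariance under the action. In most of them \<open>F\<close> at \<open>b \<otimes> inv a\<close> after \<open>F\<close> at \<open>a\<close> has to be
  recognised as \<open>F\<close> at \<open>b\<close>, which is why \<open>Fo_mult\<close> is used at chosen instances and not as a
  simplification rule.
\<close>

lemma gray_gray_monoid: "gray_monoid D"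
proof -
  interpret D: category D by (rule gray_category)
  show ?thesis
  proof (intro gray_monoid.intro gray_monoid_axioms.intro gray_two_category)
    fix a assume "a \<in> Obj0 D"
    then show "strict_two_functor D D (\<lambda>b. a \<otimes>\<^sub>0\<^bsub>D\<^esub> b) (\<lambda>x. a \<triangleright>\<^bsub>D\<^esub> x) (\<lambda>\<alpha>. a \<unrhd>\<^bsub>D\<^esub> \<alpha>)"
      "strict_two_functor D D (\<lambda>b. b \<otimes>\<^sub>0\<^bsub>D\<^esub> a) (\<lambda>x. x \<triangleleft>\<^bsub>D\<^esub> a) (\<lambda>\<alpha>. \<alpha> \<unlhd>\<^bsub>D\<^esub> a)"
      by (auto simp: gray_of_def Hom_def Hom1_def composable1_def composable2_def strict_two_functor_def is_functor_def)
  next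
    fix x y a b c d assume "x \<in> Hom1 D a b" "y \<in> Hom1 D c d"
    then show "ichg D x y \<in> Iso D ((x \<triangleleft>\<^bsub>D\<^esub> d) \<bullet>\<^bsub>D\<^esub> (a \<triangleright>\<^bsub>D\<^esub> y)) ((b \<triangleright>\<^bsub>D\<^esub> y) \<bullet>\<^bsub>D\<^esub> (x \<triangleleft>\<^bsub>D\<^esub> c))"
      unfolding D.Iso_iff
      using gray_iso[of "brd C (gd1 G x) (Fo C (src x) (gd1 G y))" "src x \<otimes>\<^bsub>G\<^esub> src y" "trg x \<otimes>\<^bsub>G\<^esub> trg y"]
        Fo_mult[of "trg x \<otimes>\<^bsub>G\<^esub> inv\<^bsub>G\<^esub> (src x)" "src x" "gd1 G y"]
      by (auto simp: gray_of_def Hom1_def simp del: Fo_mult)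
  next
    fix x y a b c d \<alpha> \<beta> x' y' assume "x \<in> Hom1 D a b" "y \<in> Hom1 D c d" "\<alpha> \<in> Hom D x x'" "\<beta> \<in> Hom D y y'"
    then show "ichg D x' y' \<cdot>\<^bsub>D\<^esub> ((\<alpha> \<unlhd>\<^bsub>D\<^esub> d) \<star>\<^bsub>D\<^esub> (a \<unrhd>\<^bsub>D\<^esub> \<beta>)) = ((b \<unrhd>\<^bsub>D\<^esub> \<beta>) \<star>\<^bsub>D\<^esub> (\<alpha> \<unlhd>\<^bsub>D\<^esub> c)) \<cdot>\<^bsub>D\<^esub> ichg D x y"
      using brd_nat[of "gd2 G \<alpha>" "Fm C a (gd2 G \<beta>)"]
        Fm_mult[of "b \<otimes>\<^bsub>G\<^esub> inv\<^bsub>G\<^esub> a" a "gd2 G \<beta>"] Fo_mult[of "b \<otimes>\<^bsub>G\<^esub> inv\<^bsub>G\<^esub> a" a "gd1 G y"] Fo_mult[of "b \<otimes>\<^bsub>G\<^esub> inv\<^bsub>G\<^esub> a" a "gd1 G y'"]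
      by (auto simp: gray_of_def Hom1_def Hom_def simp del: Fo_mult Fm_mult)
  next
    fix x x' y a b b' c d assume "x \<in> Hom1 D a b" "x' \<in> Hom1 D b b'" "y \<in> Hom1 D c d"
    then show "ichg D (x' \<bullet>\<^bsub>D\<^esub> x) y = (ichg D x' y \<star>\<^bsub>D\<^esub> idt D (x \<triangleleft>\<^bsub>D\<^esub> c)) \<cdot>\<^bsub>D\<^esub> (idt D (x' \<triangleleft>\<^bsub>D\<^esub> d) \<star>\<^bsub>D\<^esub> ichg D x y)"
      using brd_ten_left[of "gd1 G x'" "gd1 G x" "Fo C a (gd1 G y)"]
        Fo_mult[of "b \<otimes>\<^bsub>G\<^esub> inv\<^bsub>G\<^esub> a" a "gd1 G y"] Fo_mult[of "b' \<otimes>\<^bsub>G\<^esub> inv\<^bsub>G\<^esub> b" b "gd1 G y"]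
      by (auto simp: gray_of_def Hom1_def simp del: Fo_mult)
  next
    fix x y y' a b c d d' assume "x \<in> Hom1 D a b" "y \<in> Hom1 D c d" "y' \<in> Hom1 D d d'"
    then show "ichg D x (y' \<bullet>\<^bsub>D\<^esub> y) = (idt D (b \<triangleright>\<^bsub>D\<^esub> y') \<star>\<^bsub>D\<^esub> ichg D x y) \<cdot>\<^bsub>D\<^esub> (ichg D x y' \<star>\<^bsub>D\<^esub> idt D (a \<triangleright>\<^bsub>D\<^esub> y))"
      using brd_ten_right[of "gd1 G x" "Fo C a (gd1 G y')" "Fo C a (gd1 G y)"]
        Fo_mult[of "b \<otimes>\<^bsub>G\<^esub> inv\<^bsub>G\<^esub> a" a "gd1 G y"] Fo_mult[of "b \<otimes>\<^bsub>G\<^esub> inv\<^bsub>G\<^esub> a" a "gd1 G y'"]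
      by (auto simp: gray_of_def Hom1_def simp del: Fo_mult)
  next
    fix a x y assume *: "a \<in> Obj0 D" "x \<in> Obj D" "y \<in> Obj D"
    then have "ichg D (a \<triangleright>\<^bsub>D\<^esub> x) y = a \<unrhd>\<^bsub>D\<^esub> ichg D x y"
      using Fo_mult[of "trg x \<otimes>\<^bsub>G\<^esub> inv\<^bsub>G\<^esub> (src x)" "src x" "gd1 G y"]
      by (simp add: gray_of_def Fm_brd)
    moreover have "ichg D (x \<triangleleft>\<^bsub>D\<^esub> a) y = ichg D x (a \<triangleright>\<^bsub>D\<^esub> y)" using * by (simp add: gray_of_def)
    moreover have "ichg D x (y \<triangleleft>\<^bsub>D\<^esub> a) = ichg D x y \<unlhd>\<^bsub>D\<^esub> a"
      using * Fo_mult[of "trg x \<otimes>\<^bsub>G\<^esub> inv\<^bsub>G\<^esub> (src x)" "src x" "gd1 G y"] by (simp add: gray_of_def)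
    ultimately show "ichg D (a \<triangleright>\<^bsub>D\<^esub> x) y = a \<unrhd>\<^bsub>D\<^esub> ichg D x y \<and> ichg D (x \<triangleleft>\<^bsub>D\<^esub> a) y = ichg D x (a \<triangleright>\<^bsub>D\<^esub> y)
       \<and> ichg D x (y \<triangleleft>\<^bsub>D\<^esub> a) = ichg D x y \<unlhd>\<^bsub>D\<^esub> a" by blast
  qed (auto simp: gray_of_def)
qed

lemma gray_pointed: "pointed_gray G D"
  by (intro pointed_gray.intro pointed_gray_axioms.intro gray_gray_monoid group_axioms)
    (simp_all add: gray_of_def)

end

text \<open>
  Equality up to values outside the intended domains, which \<open>crossed_of G (gray_of G C)\<close> does not
  share with \<open>C\<close>. The structure isomorphisms do not occur, because strictness determines them.
\<close>

definition crs_agree :: "('g, 'h) monoid_scheme \<Rightarrow> ('g, 'o, 'm) crsbrd \<Rightarrow> ('g, 'o, 'm) crsbrd \<Rightarrow> bool" where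
  "crs_agree G C C' \<longleftrightarrow> Obj C = Obj C' \<and> Arrs C = Arrs C' \<and> unitO C = unitO C' \<and>
     (\<forall>a \<in> Obj C. idt C a = idt C' a) \<and>
     (\<forall>f \<in> Arrs C. \<forall>g \<in> Arrs C. src g = trg f \<longrightarrow> g \<cdot>\<^bsub>C\<^esub> f = g \<cdot>\<^bsub>C'\<^esub> f) \<and>
     (\<forall>a \<in> Obj C. \<forall>b \<in> Obj C. a \<otimes>\<^sub>o\<^bsub>C\<^esub> b = a \<otimes>\<^sub>o\<^bsub>C'\<^esub> b \<and> brd C a b = brd C' a b) \<and>
     (\<forall>f \<in> Arrs C. \<forall>g \<in> Arrs C. f \<otimes>\<^sub>m\<^bsub>C\<^esub> g = f \<otimes>\<^sub>m\<^bsub>C'\<^esub> g) \<and>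
     (\<forall>g \<in> carrier G. \<forall>a \<in> Obj C. Fo C g a = Fo C' g a) \<and>
     (\<forall>g \<in> carrier G. \<forall>f \<in> Arrs C. Fm C g f = Fm C' g f)"

lemma crs_agree_sym: "crs_agree G C C' \<Longrightarrow> crs_agree G C' C"
  unfolding crs_agree_def by simp

lemma crs_agree_functor:
  assumes "crs_agree G C C'" "strict_crossed G C" "strict_crossed G C'"
  shows "strict_crossed_functor G C C' (id_crsfun G C)"
proof -
  interpret C: strict_crossed G C by fact
  interpret C': strict_crossed G C' by fact
  have O: "Obj C' = Obj C" "Arrs C' = Arrs C" "unitO C' = unitO C"
    using assms(1) by (simp_all add: crs_agree_def)
  note ag = crs_agree_sym[OF assms(1), unfolded crs_agree_def O]
  have I: "idt C' a = idt C a" if "a \<in> Obj C" for a using ag that by blast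
  have V: "g \<cdot>\<^bsub>C'\<^esub> f = g \<cdot>\<^bsub>C\<^esub> f" if "f \<in> Arrs C" "g \<in> Arrs C" "src g = trg f" for f g using ag that by blast
  have T: "a \<otimes>\<^sub>o\<^bsub>C'\<^esub> b = a \<otimes>\<^sub>o\<^bsub>C\<^esub> b" "brd C' a b = brd C a b" if "a \<in> Obj C" "b \<in> Obj C" for a b using ag that by blast+
  have M: "f \<otimes>\<^sub>m\<^bsub>C'\<^esub> g = f \<otimes>\<^sub>m\<^bsub>C\<^esub> g" if "f \<in> Arrs C" "g \<in> Arrs C" for f g using ag that by blast
  have F: "a \<in> Obj C \<Longrightarrow> Fo C' g a = Fo C g a" "f \<in> Arrs C \<Longrightarrow> Fm C' g f = Fm C g f" if "g \<in> carrier G" for g a f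
    using ag that by blast+
  note [simp] = O I V T M F
  have iso [simp]: "iso_arr C' (idt C a)" if "a \<in> Obj C" for a
    using C'.T.iso_idt[of a] that by simp
  show ?thesis
    by unfold_locales (simp_all add: id_crsfun_def is_functor_def Hom_def)
qed

lemma (in strict_crossed) crossed_of_gray_agree: "crs_agree G (crossed_of G D) C"
proof -
  have l [simp]: "gd1 G (lift1 G a) = a" if "fst a \<in> carrier G" for a
    using that by (simp add: gd1_def lift1_def prod_eq_iff)
  have l2 [simp]: "gd2 G (lift2 G f) = f" if "fst (src f) \<in> carrier G" "fst (trg f) \<in> carrier G" for f
    using that by (cases f) (simp add: gd2_def lift2_def)
  have d: "drop1 (gu1 \<one>\<^bsub>G\<^esub> h a) = a" if "fst a = h" for h a
    using that by (simp add: gu1_def drop1_def prod_eq_iff)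
  have d2: "drop2 (gu2 \<one>\<^bsub>G\<^esub> h f) = f" if "fst (src f) = h" "fst (trg f) = h" for h f
    using that by (cases f) (simp add: gu2_def drop2_def d)
  have O: "lift1 G a \<in> Obj D \<longleftrightarrow> a \<in> Obj C" for a
    by (auto simp: gray_of_def)
  have A: "lift2 G f \<in> Arrs D \<longleftrightarrow> f \<in> Arrs C" for f
  proof
    assume "lift2 G f \<in> Arrs D" then show "f \<in> Arrs C" by (auto simp: gray_of_def)
  next
    assume "f \<in> Arrs C" then show "lift2 G f \<in> Arrs D" by (simp add: gray_of_def)
  qed
  have "Obj (crossed_of G D) = Obj C" "Arrs (crossed_of G D) = Arrs C"
    by (auto simp: crossed_of_def O A)
  then show ?thesis
    unfolding crs_agree_def
    apply (simp add: crossed_of_def O A)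
    apply (simp add: gray_of_def ten1_def ten2_def d d2)
    done
qed

text \<open>
  The identity data form functors in both directions, whose composites are identities.
\<close>

lemma crs_agree_equivalent:
  fixes G :: "('g, 'h) monoid_scheme" and C C' :: "('g, 'o, 'm) crsbrd"
  assumes ag: "crs_agree G C C'" and C: "strict_crossed_braided G C" and C': "strict_crossed_braided G C'"
  shows "equivalent0 (GCrsBrd_st G) C C'"
proof -
  interpret S: structured_categories "{C :: ('g, 'o, 'm) crsbrd. strict_crossed_braided G C}"
     "crossed_functor G" "crossed_transformation G" cobj carr "id_crsfun G" "comp_crsfun G"
    by (rule structured_GCrsBrd)
  interpret X: two_category "GCrsBrd_st G :: ('g, 'o, 'm) crsbrd_two_cat"
    unfolding GCrsBrd_st_eq by (rule S.two_category_TC)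
  have fn: "crossed_functor G K K' (id_crsfun G K)"
    if "crs_agree G K K'" "strict_crossed_braided G K" "strict_crossed_braided G K'" for K K' :: "('g, 'o, 'm) crsbrd"
    using that crs_agree_functor[OF that(1)] crsfun_extensional_id
    by (auto simp: crossed_functor_iff strict_crossed_braided_iff)
  have cmp: "comp_crsfun G K K (id_crsfun G K') (id_crsfun G K) = id_crsfun G K"
    if ag: "crs_agree G K K'" and K: "strict_crossed_braided G K" for K K' :: "('g, 'o, 'm) crsbrd"
  proof -
    interpret K: strict_crossed G K using K by (simp add: strict_crossed_braided_iff)
    have O: "Obj K' = Obj K" "Arrs K' = Arrs K" "unitO K' = unitO K"
      using ag by (simp_all add: crs_agree_def)
    note ag' = crs_agree_sym[OF ag, unfolded crs_agree_def O]
    have I: "idt K' a = idt K a" if "a \<in> Obj K" for a using ag' that by blast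
    have T: "a \<otimes>\<^sub>o\<^bsub>K'\<^esub> b = a \<otimes>\<^sub>o\<^bsub>K\<^esub> b" if "a \<in> Obj K" "b \<in> Obj K" for a b using ag' that by blast
    have F: "Fo K' g a = Fo K g a" if "g \<in> carrier G" "a \<in> Obj K" for g a using ag' that by blast
    show ?thesis
      by (intro crsfun.equality) (auto simp: comp_crsfun_def id_crsfun_def fun_eq_iff O I T F)
  qed
  have iso: "isomorphic1 (GCrsBrd_st G) x x" if "x \<in> Obj (GCrsBrd_st G)" for x :: "(('g, 'o, 'm) crsbrd, ('g, 'o, 'm) crsfun) arr"
    unfolding isomorphic1_def X.Iso_iff using that by (intro exI[of _ "idt (GCrsBrd_st G) x"]) simp
  have ag': "crs_agree G C' C" using crs_agree_sym[OF ag] .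
  let ?x = "Arr C C' (id_crsfun G C)" and ?y = "Arr C' C (id_crsfun G C')"
  have x: "?x \<in> Hom1 (GCrsBrd_st G) C C'" and y: "?y \<in> Hom1 (GCrsBrd_st G) C' C"
    using fn[OF ag C C'] fn[OF ag' C' C] C C' by (auto simp: Hom1_def GCrsBrd_st_eq structured_two_cat_def)
  have ob: "id1 (GCrsBrd_st G) C \<in> Obj (GCrsBrd_st G)" "id1 (GCrsBrd_st G) C' \<in> Obj (GCrsBrd_st G)"
    using C C' by (auto simp: GCrsBrd_st_eq structured_two_cat_def intro: S.Fun_id)
  have yx: "cmp1 (GCrsBrd_st G) ?y ?x = id1 (GCrsBrd_st G) C" "cmp1 (GCrsBrd_st G) ?x ?y = id1 (GCrsBrd_st G) C'"
    using cmp[OF ag C] cmp[OF ag' C'] by (simp_all add: GCrsBrd_st_eq structured_two_cat_def)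
  show ?thesis
    unfolding equivalent0_def using x y iso[OF ob(1)] iso[OF ob(2)] yx by metis
qed


section \<open>Strict equivalences of 2-categories and invertible 2-cells\<close>

text \<open>
  A strict 2-functor is a pseudofunctor with identities as coherence cells.
\<close>

lemma equivalence_if_strict:
  fixes X :: "('a, 'b, 'c) two_cat" and Y :: "('d, 'e, 'f) two_cat"
  assumes X: "two_category X" and Y: "two_category Y" and F: "strict_two_functor X Y F0 F1 F2"
    and ess: "\<And>d. d \<in> Obj0 Y \<Longrightarrow> \<exists>c \<in> Obj0 X. equivalent0 Y (F0 c) d"
    and surj: "\<And>a b y. \<lbrakk>a \<in> Obj0 X; b \<in> Obj0 X; y \<in> Hom1 Y (F0 a) (F0 b)\<rbrakk> \<Longrightarrow> \<exists>x \<in> Hom1 X a b. F1 x = y"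
    and ff: "\<And>a b x x' \<gamma>. \<lbrakk>x \<in> Hom1 X a b; x' \<in> Hom1 X a b; \<gamma> \<in> Hom Y (F1 x) (F1 x')\<rbrakk>
       \<Longrightarrow> \<exists>!\<alpha>. \<alpha> \<in> Hom X x x' \<and> F2 \<alpha> = \<gamma>"
  shows "equivalent_two_categories X Y"
proof -
  interpret X: two_category X by fact
  interpret Y: two_category Y by fact
  let ?F = "\<lparr> map0 = F0, map1 = F1, map2 = F2, munit = \<lambda>a. idt Y (id1 Y (F0 a)),
     mcomp = \<lambda>y x. idt Y (cmp1 Y (F1 y) (F1 x)) \<rparr>"
  have fn: "is_functor X Y F1 F2" using F by (simp add: strict_two_functor_def)
  interpret P: functor_pair X Y F1 F2 by unfold_locales (rule fn)
  have F0 [simp]: "F0 a \<in> Obj0 Y" "F1 (id1 X a) = id1 Y (F0 a)" if "a \<in> Obj0 X" for a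
    using F that by (simp_all add: strict_two_functor_def)
  have F1 [simp]: "src (F1 x) = F0 (src x)" "trg (F1 x) = F0 (trg x)" if "x \<in> Obj X" for x
    using F that by (auto simp: strict_two_functor_def Hom1_def)
  have Fc [simp]: "F1 (y \<bullet>\<^bsub>X\<^esub> x) = F1 y \<bullet>\<^bsub>Y\<^esub> F1 x" if "x \<in> Obj X" "y \<in> Obj X" "src y = trg x" for x y
    using F that by (simp add: strict_two_functor_def composable1_def)
  have Fh [simp]: "F2 (\<beta> \<star>\<^bsub>X\<^esub> \<alpha>) = F2 \<beta> \<star>\<^bsub>Y\<^esub> F2 \<alpha>" if "\<alpha> \<in> Arrs X" "\<beta> \<in> Arrs X" "src (src \<beta>) = trg (src \<alpha>)" for \<alpha> \<beta>
    using F that by (simp add: strict_two_functor_def composable2_def)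
  have iso: "isomorphic1 Y y y" if "y \<in> Obj Y" for y
    unfolding isomorphic1_def Y.Iso_iff using that by (intro exI[of _ "idt Y y"]) simp
  have "equivalence_pseudofunctor X Y ?F"
  proof unfold_locales
    fix a b y assume *: "a \<in> Obj0 X" "b \<in> Obj0 X" "y \<in> Hom1 Y (map0 ?F a) (map0 ?F b)"
    then obtain x where "x \<in> Hom1 X a b" "F1 x = y" using surj[of a b y] by auto
    then show "\<exists>x \<in> Hom1 X a b. isomorphic1 Y (map1 ?F x) y" using iso[of y] * by (auto simp: Hom1_def)
  next
    fix x x' a b \<gamma> assume "x \<in> Hom1 X a b" "x' \<in> Hom1 X a b" "\<gamma> \<in> Hom Y (map1 ?F x) (map1 ?F x')"
    then show "\<exists>!\<alpha>. \<alpha> \<in> Hom X x x' \<and> map2 ?F \<alpha> = \<gamma>" using ff by simp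
  next
    fix d assume "d \<in> Obj0 Y" then show "\<exists>c \<in> Obj0 X. equivalent0 Y (map0 ?F c) d" using ess by simp
  qed (use fn in \<open>auto simp: Hom1_def Y.Iso_iff composable1_def composable2_def\<close>)
  then show ?thesis unfolding equivalent_two_categories_def by blast
qed

lemma core_simps:
  fixes C :: "('a, 'b, 'c) two_cat"
  shows
  "Obj (two_one_core C) = Obj C" "idt (two_one_core C) = idt C" "vcmp (two_one_core C) = vcmp C"
  "Obj0 (two_one_core C) = Obj0 C" "id1 (two_one_core C) = id1 C" "cmp1 (two_one_core C) = cmp1 C"
  "hcmp (two_one_core C) = hcmp C" "Arrs (two_one_core C) = {\<alpha> \<in> Arrs C. iso_arr C \<alpha>}"
  "Hom1 (two_one_core C) = Hom1 C"
  by (auto simp: two_one_core_def Hom1_def fun_eq_iff)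

lemma core_two_category:
  fixes X :: "('a, 'b, 'c) two_cat"
  assumes "two_category X" shows "two_category (two_one_core X)"
proof -
  interpret two_category X by fact
  show ?thesis
    by unfold_locales (auto simp: core_simps Hom_def Hom1_def composable1_def composable2_def H.merge)
qed

lemma core_iso:
  fixes X :: "('a, 'b, 'c) two_cat"
  assumes "two_category X"
  shows "iso_arr (two_one_core X) f \<longleftrightarrow> iso_arr X f"
proof -
  interpret two_category X by fact
  interpret K: two_category "two_one_core X" by (rule core_two_category) fact
  show ?thesis
  proof
    assume "iso_arr (two_one_core X) f"
    then show "iso_arr X f" using K.iso_simps(1) by (auto simp: core_simps)
  next
    assume f: "iso_arr X f"
    then have "inverse_arrs (two_one_core X) f (inv_arr X f)"
      unfolding K.inverse_arrs_iff by (simp add: core_simps)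
    then show "iso_arr (two_one_core X) f" by (auto simp: iso_arr_def)
  qed
qed

text \<open>
  A fully faithful functor reflects invertibility, so the unique 2-cell over an invertible one is
  itself invertible. The coherence cells and all isomorphisms in the conditions of essential
  surjectivity already lie in the cores.
\<close>

lemma core_equivalence:
  fixes X :: "('a, 'b, 'c) two_cat" and Y :: "('d, 'e, 'f) two_cat"
  assumes "equivalent_two_categories X Y"
  shows "equivalent_two_categories (two_one_core X) (two_one_core Y)"
proof -
  obtain F :: "('a, 'b, 'c, 'd, 'e, 'f) pfun" where "equivalence_pseudofunctor X Y F"
    using assms by (auto simp: equivalent_two_categories_def)
  then interpret equivalence_pseudofunctor X Y F .
  interpret KX: two_category "two_one_core X" by (rule core_two_category) unfold_locales
  interpret KY: two_category "two_one_core Y" by (rule core_two_category) unfold_locales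
  interpret P: functor_pair X Y "map1 F" "map2 F" by unfold_locales (rule locally_functor)
  have iX: "iso_arr (two_one_core X) f \<longleftrightarrow> iso_arr X f" for f by (rule core_iso) unfold_locales
  have iY: "iso_arr (two_one_core Y) f \<longleftrightarrow> iso_arr Y f" for f by (rule core_iso) unfold_locales
  note cs = core_simps
  have Iso: "Iso (two_one_core Y) a b = Iso Y a b" for a b
    by (auto simp: KY.Iso_iff D.Iso_iff iY)
  have c2: "composable2 (two_one_core X) \<beta> \<alpha> \<Longrightarrow> composable2 X \<beta> \<alpha>" for \<beta> \<alpha>
    by (simp add: composable2_def cs)
  have c1: "composable1 (two_one_core X) y x = composable1 X y x" for y x
    by (simp add: composable1_def cs)
  have refl: "iso_arr X \<alpha>" if \<alpha>: "\<alpha> \<in> Hom X x x'" and x: "x \<in> Hom1 X a b" "x' \<in> Hom1 X a b" and i: "iso_arr Y (map2 F \<alpha>)" for \<alpha> x x' a b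
  proof -
    have [simp]: "\<alpha> \<in> Arrs X" "src \<alpha> = x" "trg \<alpha> = x'" "x \<in> Obj X" "x' \<in> Obj X" using \<alpha> x by (auto simp: Hom_def Hom1_def)
    have "inv_arr Y (map2 F \<alpha>) \<in> Hom Y (map1 F x') (map1 F x)" using i by (simp add: Hom_def)
    then obtain \<beta> where \<beta>: "\<beta> \<in> Hom X x' x" "map2 F \<beta> = inv_arr Y (map2 F \<alpha>)"
      using fully_faithful2[OF x(2,1)] by blast
    have [simp]: "\<beta> \<in> Arrs X" "src \<beta> = x'" "trg \<beta> = x" using \<beta> by (auto simp: Hom_def)
    have "\<beta> \<cdot>\<^bsub>X\<^esub> \<alpha> = idt X x"
    proof -
      have "idt Y (map1 F x) \<in> Hom Y (map1 F x) (map1 F x)" by (simp add: Hom_def)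
      from fully_faithful2[OF x(1) x(1) this]
      have u: "\<And>\<delta> \<epsilon>. \<lbrakk>\<delta> \<in> Hom X x x; map2 F \<delta> = idt Y (map1 F x); \<epsilon> \<in> Hom X x x; map2 F \<epsilon> = idt Y (map1 F x)\<rbrakk> \<Longrightarrow> \<delta> = \<epsilon>"
        by blast
      show ?thesis using i by (intro u) (simp_all add: Hom_def \<beta>(2))
    qed
    moreover have "\<alpha> \<cdot>\<^bsub>X\<^esub> \<beta> = idt X x'"
    proof -
      have "idt Y (map1 F x') \<in> Hom Y (map1 F x') (map1 F x')" by (simp add: Hom_def)
      from fully_faithful2[OF x(2) x(2) this]
      have u: "\<And>\<delta> \<epsilon>. \<lbrakk>\<delta> \<in> Hom X x' x'; map2 F \<delta> = idt Y (map1 F x'); \<epsilon> \<in> Hom X x' x'; map2 F \<epsilon> = idt Y (map1 F x')\<rbrakk> \<Longrightarrow> \<delta> = \<epsilon>"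
        by blast
      show ?thesis using i by (intro u) (simp_all add: Hom_def \<beta>(2))
    qed
    ultimately have "inverse_arrs X \<alpha> \<beta>" unfolding C.inverse_arrs_iff by simp
    then show ?thesis by (auto simp: iso_arr_def)
  qed
  have "equivalence_pseudofunctor (two_one_core X) (two_one_core Y) F"
  proof unfold_locales
    show "is_functor (two_one_core X) (two_one_core Y) (map1 F) (map2 F)"
      by (auto simp: is_functor_def cs Hom_def)
  next
    fix d assume "d \<in> Obj0 (two_one_core Y)"
    then obtain c where "c \<in> Obj0 X" "equivalent0 Y (map0 F c) d" using ess_surj0 by (auto simp: cs)
    then show "\<exists>c \<in> Obj0 (two_one_core X). equivalent0 (two_one_core Y) (map0 F c) d"
      by (auto simp: cs equivalent0_def isomorphic1_def Iso)
  next
    fix a b y assume "a \<in> Obj0 (two_one_core X)" "b \<in> Obj0 (two_one_core X)" "y \<in> Hom1 (two_one_core Y) (map0 F a) (map0 F b)"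
    then show "\<exists>x \<in> Hom1 (two_one_core X) a b. isomorphic1 (two_one_core Y) (map1 F x) y"
      using ess_surj1[of a b y] by (simp add: cs isomorphic1_def Iso)
  next
    fix x x' a b \<gamma>
    assume "x \<in> Hom1 (two_one_core X) a b" "x' \<in> Hom1 (two_one_core X) a b" "\<gamma> \<in> Hom (two_one_core Y) (map1 F x) (map1 F x')"
    then have x: "x \<in> Hom1 X a b" "x' \<in> Hom1 X a b" and \<gamma>: "\<gamma> \<in> Hom Y (map1 F x) (map1 F x')" "iso_arr Y \<gamma>"
      by (auto simp: cs Hom_def)
    have "\<alpha> \<in> Hom (two_one_core X) x x' \<and> map2 F \<alpha> = \<gamma> \<longleftrightarrow> \<alpha> \<in> Hom X x x' \<and> map2 F \<alpha> = \<gamma>" for \<alpha>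
      using refl[OF _ x, of \<alpha>] \<gamma> by (auto simp: cs Hom_def)
    then show "\<exists>!\<alpha>. \<alpha> \<in> Hom (two_one_core X) x x' \<and> map2 F \<alpha> = \<gamma>"
      using fully_faithful2[OF x \<gamma>(1)] by simp
  next
    fix \<beta> \<alpha> assume "composable2 (two_one_core X) \<beta> \<alpha>"
    from mcomp_natural[OF c2[OF this]]
    show "mcomp F (trg \<beta>) (trg \<alpha>) \<cdot>\<^bsub>two_one_core Y\<^esub> (map2 F \<beta> \<star>\<^bsub>two_one_core Y\<^esub> map2 F \<alpha>)
              = map2 F (\<beta> \<star>\<^bsub>two_one_core X\<^esub> \<alpha>) \<cdot>\<^bsub>two_one_core Y\<^esub> mcomp F (src \<beta>) (src \<alpha>)" by (simp add: cs)
  qed (use map0_closed map1_closed munit_iso mcomp_iso mcomp_assoc munit_left munit_right in \<open>simp_all add: cs Iso c1\<close>)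
  then show ?thesis unfolding equivalent_two_categories_def by blast
qed

lemma (in weak_transformation) inverse_transformation:
  assumes iso: "\<And>x. x \<in> Obj C \<Longrightarrow> iso_arr D (\<eta> x)" and \<theta>: "\<And>x. x \<in> Obj C \<Longrightarrow> \<theta> x = inv_arr D (\<eta> x)"
  shows "weak_transformation C I s t e tO tA D J s' t' e' tO' tA' go ga k delta nu fo fa eps mu \<theta>"
proof -
  note [simp] = F.C.ends F.D.ends F.fun_ends G.fun_ends iso
  show ?thesis
  proof unfold_locales
    fix f assume f: "f \<in> Arrs C"
    show "\<theta> (trg f) \<cdot>\<^bsub>D\<^esub> ga f = fa f \<cdot>\<^bsub>D\<^esub> \<theta> (src f)"
    proof (rule F.D.iso_cancel_right[where f = "\<eta> (src f)"])
      show "\<theta> (trg f) \<cdot>\<^bsub>D\<^esub> ga f \<cdot>\<^bsub>D\<^esub> \<eta> (src f) = fa f \<cdot>\<^bsub>D\<^esub> \<theta> (src f) \<cdot>\<^bsub>D\<^esub> \<eta> (src f)"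
        using f by (simp add: \<theta> flip: nat)
    qed (use f in \<open>simp_all add: \<theta>\<close>)
  next
    fix i assume "i \<in> I"
    then show "\<theta> (e i) \<cdot>\<^bsub>D\<^esub> delta i = eps i" by (simp add: \<theta> flip: resp_eps)
  next
    fix x y assume *: "x \<in> Obj C" "y \<in> Obj C" "s y = t x"
    show "\<theta> (y \<odot> x) \<cdot>\<^bsub>D\<^esub> nu y x = mu y x \<cdot>\<^bsub>D\<^esub> (\<theta> y \<diamondop>' \<theta> x)"
    proof (rule F.D.iso_cancel_right[where f = "\<eta> y \<diamondop>' \<eta> x"])
      show "\<theta> (y \<odot> x) \<cdot>\<^bsub>D\<^esub> nu y x \<cdot>\<^bsub>D\<^esub> (\<eta> y \<diamondop>' \<eta> x) = mu y x \<cdot>\<^bsub>D\<^esub> (\<theta> y \<diamondop>' \<theta> x) \<cdot>\<^bsub>D\<^esub> (\<eta> y \<diamondop>' \<eta> x)"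
        using * by (simp add: \<theta> F.D.merge flip: resp_mu)
    qed (use * in \<open>simp_all add: \<theta>\<close>)
  qed (simp_all add: \<theta>)
qed

lemma pointed_transformation_inverse:
  assumes "pointed_transformation G C D A B \<eta>" "\<And>x. x \<in> Obj C \<Longrightarrow> iso_arr D (\<eta> x)"
  shows "pointed_transformation G C D B A (\<lambda>x \<in> Obj C. inv_arr D (\<eta> x))"
proof -
  interpret pointed_transformation G C D A B \<eta> by fact
  show ?thesis
    by (intro pointed_transformation.intro A.pointed_functor_axioms B.pointed_functor_axioms
        H.inverse_transformation T.inverse_transformation) (simp_all add: assms(2))
qed

text \<open>
  The componentwise inverse of a transformation is a transformation, so a 2-cell with invertible
  components is invertible; conversely the components of an inverse 2-cell are inverse to the
  components.
\<close>

lemma ThreeCat_st_core: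
  fixes G :: "('g, 'h) monoid_scheme"
  assumes G: "group G"
  shows "(ThreeCat_st G :: ('g, 'o, 'm) three_cat) = two_one_core (ThreeCat_st_lax G)"
proof -
  let ?X = "ThreeCat_st_lax G :: ('g, 'o, 'm) three_cat"
  interpret S: structured_categories "{C :: ('g, 'o, 'm) gray. strict_pointed G C}"
     functor3 transformation3 map1 map2 id_fun3 comp_fun3
    by (rule structured_ThreeCat[OF G])
  interpret X: two_category ?X
    unfolding ThreeCat_st_lax_eq by (rule S.two_category_TC)
  note sd = ThreeCat_st_lax_eq structured_two_cat_def
  have key: "iso_arr ?X (Arr (Arr C D A) (Arr C D B) \<eta>) \<longleftrightarrow> (\<forall>x \<in> Obj C. iso_arr D (\<eta> x))"
    if C: "strict_pointed G C" and D: "strict_pointed G D" and T: "transformation3 C D A B \<eta>"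
    for C D :: "('g, 'o, 'm) gray" and A B \<eta>
  proof -
    have PC: "pointed_gray G C" "pointed_gray G D" using C D strict_pointed_iff[OF G] by auto
    have PT: "pointed_transformation G C D A B \<eta>" and ext: "fun3_extensional C A" "fun3_extensional C B"
      using T by (auto simp: transformation3_iff[OF PC])
    interpret PT: pointed_transformation G C D A B \<eta> by (rule PT)
    let ?\<alpha> = "Arr (Arr C D A) (Arr C D B) \<eta>"
    show ?thesis
    proof
      assume i: "iso_arr ?X ?\<alpha>"
      let ?\<beta> = "inv_arr ?X ?\<alpha>"
      have \<beta>: "?\<beta> \<in> Arrs ?X" "src ?\<beta> = Arr C D B" "trg ?\<beta> = Arr C D A" using X.iso_simps[OF i] by simp_all
      then obtain \<zeta> where z: "?\<beta> = Arr (Arr C D B) (Arr C D A) \<zeta>" "transformation3 C D B A \<zeta>"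
        by (auto simp: sd)
      interpret Z: pointed_transformation G C D B A \<zeta> using z(2) by (simp add: transformation3_iff[OF PC])
      have 1: "?\<beta> \<cdot>\<^bsub>?X\<^esub> ?\<alpha> = idt ?X (Arr C D A)" "?\<alpha> \<cdot>\<^bsub>?X\<^esub> ?\<beta> = idt ?X (Arr C D B)"
        using X.iso_simps(5,6)[OF i] by simp_all
      show "\<forall>x \<in> Obj C. iso_arr D (\<eta> x)"
      proof
        fix x assume x: "x \<in> Obj C"
        have "\<zeta> x \<cdot>\<^bsub>D\<^esub> \<eta> x = idt D (map1 A x)" "\<eta> x \<cdot>\<^bsub>D\<^esub> \<zeta> x = idt D (map1 B x)"
          using 1[unfolded z(1)] x by (auto simp: sd fun_eq_iff restrict_def split: if_splits)
        then have "inverse_arrs D (\<eta> x) (\<zeta> x)" unfolding PT.A.D.inverse_arrs_iff using x by simp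
        then show "iso_arr D (\<eta> x)" by (auto simp: iso_arr_def)
      qed
    next
      assume i: "\<forall>x \<in> Obj C. iso_arr D (\<eta> x)"
      let ?\<zeta> = "\<lambda>x \<in> Obj C. inv_arr D (\<eta> x)"
      have Z: "transformation3 C D B A ?\<zeta>"
        using pointed_transformation_inverse[OF PT] i ext by (simp add: transformation3_iff[OF PC])
      have "inverse_arrs ?X ?\<alpha> (Arr (Arr C D B) (Arr C D A) ?\<zeta>)"
        unfolding X.inverse_arrs_iff
      proof (intro conjI)
        show "Arr (Arr C D B) (Arr C D A) ?\<zeta> \<in> Arrs ?X" using C D Z by (simp add: sd)
      qed (use C D T i in \<open>auto simp: sd fun_eq_iff restrict_def\<close>)
      then show "iso_arr ?X ?\<alpha>" by (auto simp: iso_arr_def)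
    qed
  qed
  have inv: "invertible_transformation3 C D A B \<eta> \<longleftrightarrow> transformation3 C D A B \<eta> \<and> (\<forall>x \<in> Obj C. iso_arr D (\<eta> x))"
    for C D :: "('g, 'o, 'm) gray" and A B \<eta>
    by (auto simp: invertible_transformation3_def invertible_transformation3_axioms_def)
  have A: "Arrs ?X = {Arr (Arr C D A) (Arr C D B) \<eta> | C D A B \<eta>.
                 strict_pointed G C \<and> strict_pointed G D \<and> transformation3 C D A B \<eta>}"
    by (simp add: ThreeCat_st_lax_def)
  have "{Arr (Arr C D A) (Arr C D B) \<eta> | C D A B \<eta>. strict_pointed G C \<and> strict_pointed G D
                  \<and> invertible_transformation3 C D A B \<eta>} = {\<alpha> \<in> Arrs ?X. iso_arr ?X \<alpha>}"
    unfolding A inv using key by auto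
  then show ?thesis unfolding ThreeCat_st_def two_one_core_def by simp
qed


section \<open>The equivalence\<close>

lemma trans_of_id:
  "trans_of G C (\<lambda>x \<in> Obj C. idt D (map1 A x)) = (\<lambda>a \<in> Obj (crossed_of G C). idt (crossed_of G D) (cobj (crsfun_of G C D A) a))"
  if "pointed_functor G C D A"
proof -
  interpret pointed_functor G C D A by fact
  show ?thesis by (auto simp: trans_of_def crossed_of_def crsfun_of_def fun_eq_iff)
qed

lemma trans_of_vcmp:
  assumes "pointed_transformation G C D A B \<eta>" "pointed_transformation G C D B K \<zeta>"
  shows "trans_of G C (\<lambda>x \<in> Obj C. \<zeta> x \<cdot>\<^bsub>D\<^esub> \<eta> x)
    = (\<lambda>a \<in> Obj (crossed_of G C). trans_of G C \<zeta> a \<cdot>\<^bsub>crossed_of G D\<^esub> trans_of G C \<eta> a)"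
proof -
  interpret E: pointed_transformation G C D A B \<eta> by fact
  interpret Z: pointed_transformation G C D B K \<zeta> by fact
  show ?thesis by (auto simp: trans_of_def crossed_of_def fun_eq_iff)
qed

lemma trans_of_hcmp:
  assumes "pointed_transformation G C D A B \<eta>" "pointed_transformation G D E A' B' \<zeta>"
  shows "trans_of G C (\<lambda>x \<in> Obj C. \<zeta> (map1 B x) \<cdot>\<^bsub>E\<^esub> map2 A' (\<eta> x))
    = (\<lambda>a \<in> Obj (crossed_of G C). trans_of G D \<zeta> (cobj (crsfun_of G C D B) a)
        \<cdot>\<^bsub>crossed_of G E\<^esub> carr (crsfun_of G D E A') (trans_of G C \<eta> a))"
proof -
  interpret E: pointed_transformation G C D A B \<eta> by fact
  interpret Z: pointed_transformation G D E A' B' \<zeta> by fact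
  show ?thesis by (auto simp: trans_of_def crossed_of_def crsfun_of_def fun_eq_iff)
qed

theorem ThreeCat_GCrsBrd_equivalent:
  fixes G :: "('g, 'h) monoid_scheme"
  assumes G: "group G"
  shows "equivalent_two_categories (ThreeCat_st_lax G :: ('g, 'o, 'm) three_cat) (GCrsBrd_st G :: ('g, 'o, 'm) crsbrd_two_cat)"
proof -
  let ?X = "ThreeCat_st_lax G :: ('g, 'o, 'm) three_cat" and ?Y = "GCrsBrd_st G :: ('g, 'o, 'm) crsbrd_two_cat"
  interpret SX: structured_categories "{C :: ('g, 'o, 'm) gray. strict_pointed G C}"
     functor3 transformation3 map1 map2 id_fun3 comp_fun3
    by (rule structured_ThreeCat[OF G])
  interpret SY: structured_categories "{C :: ('g, 'o, 'm) crsbrd. strict_crossed_braided G C}"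
     "crossed_functor G" "crossed_transformation G" cobj carr "id_crsfun G" "comp_crsfun G"
    by (rule structured_GCrsBrd)
  note X = SX.two_category_TC[folded ThreeCat_st_lax_eq]
  note Y = SY.two_category_TC[folded GCrsBrd_st_eq]
  note sp = strict_pointed_iff[OF G]
  define F1 where "F1 = (\<lambda>x :: (('g, 'o, 'm) gray, ('g, 'o, 'm) fun3) arr.
     Arr (crossed_of G (src x)) (crossed_of G (trg x)) (crsfun_of G (src x) (trg x) (lab x)))"
  define F2 where "F2 = (\<lambda>\<alpha> :: ((('g, 'o, 'm) gray, ('g, 'o, 'm) fun3) arr, ('g, 'o) arr \<Rightarrow> (('g, 'o) arr, 'm) arr) arr.
     Arr (F1 (src \<alpha>)) (F1 (trg \<alpha>)) (trans_of G (src (src \<alpha>)) (lab \<alpha>)))"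
  have F1 [simp]: "F1 (Arr C D A) = Arr (crossed_of G C) (crossed_of G D) (crsfun_of G C D A)" for C D A
    by (simp add: F1_def)
  have F2 [simp]: "F2 (Arr (Arr C D A) (Arr C' D' B) \<eta>)
     = Arr (F1 (Arr C D A)) (F1 (Arr C' D' B)) (trans_of G C \<eta>)" for C D A C' D' B \<eta>
    by (simp add: F2_def)
  have ob: "strict_crossed_braided G (crossed_of G C)" if "strict_pointed G C" for C :: "('g, 'o, 'm) gray"
    using that pointed_gray.crossed_of_braided by (auto simp: sp)
  have fn: "crossed_functor G (crossed_of G C) (crossed_of G D) (crsfun_of G C D A)"
    if "strict_pointed G C" "strict_pointed G D" "functor3 C D A" for C D :: "('g, 'o, 'm) gray" and A
    using that ob[OF that(1)] ob[OF that(2)] pointed_functor.crsfun_of_functor crsfun_extensional_of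
    by (auto simp: sp functor3_iff crossed_functor_iff)
  have tr: "crossed_transformation G (crossed_of G C) (crossed_of G D) (crsfun_of G C D A) (crsfun_of G C D B) (trans_of G C \<eta>)"
    if "strict_pointed G C" "strict_pointed G D" "transformation3 C D A B \<eta>" for C D :: "('g, 'o, 'm) gray" and A B \<eta>
    using that ob[OF that(1)] ob[OF that(2)] pointed_transformation.trans_of_transformation crsfun_extensional_of
    by (auto simp: sp transformation3_iff crossed_transformation_iff trans_of_def)
  have pf: "pointed_functor G C D A" if "strict_pointed G C" "strict_pointed G D" "functor3 C D A" for C D :: "('g, 'o, 'm) gray" and A
    using that by (simp add: sp functor3_iff)
  have pt: "pointed_transformation G C D A B \<eta>" "\<eta> \<in> extensional (Obj C)"
    if "strict_pointed G C" "strict_pointed G D" "transformation3 C D A B \<eta>" for C D :: "('g, 'o, 'm) gray" and A B \<eta>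
    using that by (simp_all add: sp transformation3_iff)
  note sX = ThreeCat_st_lax_eq structured_two_cat_def and sY = GCrsBrd_st_eq structured_two_cat_def
  show ?thesis
  proof (rule equivalence_if_strict[where ?F0.0 = "crossed_of G" and ?F1.0 = F1 and ?F2.0 = F2])
    show "two_category ?X" by (rule X)
    show "two_category ?Y" by (rule Y)
    have "is_functor ?X ?Y F1 F2"
      unfolding is_functor_def
    proof (intro conjI ballI impI)
      fix x assume "x \<in> Obj ?X"
      then obtain C D A where x: "x = Arr C D A" "strict_pointed G C" "strict_pointed G D" "functor3 C D A" by (auto simp: sX)
      show "F1 x \<in> Obj ?Y" using x ob fn by (auto simp: sY)
      show "F2 (idt ?X x) = idt ?Y (F1 x)" using x trans_of_id[OF pf[OF x(2-4)]] by (simp add: sX sY)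
    next
      fix f assume "f \<in> Arrs ?X"
      then show "F2 f \<in> Hom ?Y (F1 (src f)) (F1 (trg f))"
        using ob tr by (auto simp: sX sY Hom_def)
    next
      fix f g assume "f \<in> Arrs ?X" "g \<in> Arrs ?X" "src g = trg f"
      then obtain C D A B \<eta> K \<zeta> where f: "f = Arr (Arr C D A) (Arr C D B) \<eta>" "g = Arr (Arr C D B) (Arr C D K) \<zeta>"
        and C: "strict_pointed G C" "strict_pointed G D" and t: "transformation3 C D A B \<eta>" "transformation3 C D B K \<zeta>"
        by (auto simp: sX)
      show "F2 (g \<cdot>\<^bsub>?X\<^esub> f) = F2 g \<cdot>\<^bsub>?Y\<^esub> F2 f"
        using trans_of_vcmp[OF pt(1)[OF C t(1)] pt(1)[OF C t(2)]] by (simp add: f sX sY)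
    qed
    moreover have "F1 (y \<bullet>\<^bsub>?X\<^esub> x) = F1 y \<bullet>\<^bsub>?Y\<^esub> F1 x" if "composable1 ?X y x" for x y
      using that by (auto simp: sX sY composable1_def intro!: crsfun_of_comp pf)
    moreover have "F2 (\<beta> \<star>\<^bsub>?X\<^esub> \<alpha>) = F2 \<beta> \<star>\<^bsub>?Y\<^esub> F2 \<alpha>" if "composable2 ?X \<beta> \<alpha>" for \<alpha> \<beta>
    proof -
      from that obtain C D A B \<eta> E A' B' \<zeta> where f: "\<alpha> = Arr (Arr C D A) (Arr C D B) \<eta>" "\<beta> = Arr (Arr D E A') (Arr D E B') \<zeta>"
        and C: "strict_pointed G C" "strict_pointed G D" "strict_pointed G E" and t: "transformation3 C D A B \<eta>" "transformation3 D E A' B' \<zeta>"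
        by (auto simp: sX composable2_def)
      have n: "functor3 C D A" "functor3 C D B" "functor3 D E A'" "functor3 D E B'"
        using SX.Trf_Fun C t by auto
      show ?thesis
        using trans_of_hcmp[OF pt(1)[OF C(1,2) t(1)] pt(1)[OF C(2,3) t(2)]]
          crsfun_of_comp[OF pf[OF C(1,2) n(1)] pf[OF C(2,3) n(3)]] crsfun_of_comp[OF pf[OF C(1,2) n(2)] pf[OF C(2,3) n(4)]]
        by (simp add: f sX sY Let_def)
    qed
    ultimately show "strict_two_functor ?X ?Y (crossed_of G) F1 F2"
      using crsfun_of_id ob fn by (auto simp: strict_two_functor_def Hom1_def sX sY sp)
  next
    fix K assume "K \<in> Obj0 ?Y"
    then have K: "strict_crossed_braided G K" by (simp add: sY)
    then interpret K: strict_crossed G K by (simp add: strict_crossed_braided_iff)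
    have "strict_pointed G (gray_of G K)" using K.gray_pointed by (simp add: sp)
    then show "\<exists>C \<in> Obj0 ?X. equivalent0 ?Y (crossed_of G C) K"
      using crs_agree_equivalent[OF K.crossed_of_gray_agree ob K] by (auto simp: sX)
  next
    fix C D y assume "C \<in> Obj0 ?X" "D \<in> Obj0 ?X" "y \<in> Hom1 ?Y (crossed_of G C) (crossed_of G D)"
    then obtain A where C: "strict_pointed G C" "strict_pointed G D"
      and y: "y = Arr (crossed_of G C) (crossed_of G D) A" "crossed_functor G (crossed_of G C) (crossed_of G D) A"
      by (auto simp: sX sY Hom1_def)
    have A: "strict_crossed_functor G (crossed_of G C) (crossed_of G D) A" "crsfun_extensional G (crossed_of G C) A"
      using y(2) ob[OF C(1)] ob[OF C(2)] by (simp_all add: crossed_functor_iff)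
    interpret crossed_functor_of_grays G C D A
      using C A(1) by (simp add: crossed_functor_of_grays_def sp)
    have "functor3 C D (fun3_of G C D A)"
      using fun3_of_functor fun3_extensional_of C by (simp add: functor3_iff sp)
    then show "\<exists>x \<in> Hom1 ?X C D. F1 x = y"
      using crsfun_of_fun3_of[OF A(2)] C by (intro bexI[of _ "Arr C D (fun3_of G C D A)"]) (auto simp: sX Hom1_def y(1))
  next
    fix C D x x' \<gamma> assume "x \<in> Hom1 ?X C D" "x' \<in> Hom1 ?X C D" and \<gamma>: "\<gamma> \<in> Hom ?Y (F1 x) (F1 x')"
    then obtain A B where x: "x = Arr C D A" "x' = Arr C D B" and C: "strict_pointed G C" "strict_pointed G D"
      and n: "functor3 C D A" "functor3 C D B"
      by (auto simp: sX Hom1_def)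
    obtain \<theta> where g: "\<gamma> = Arr (F1 x) (F1 x') \<theta>"
      and t: "crossed_transformation G (crossed_of G C) (crossed_of G D) (crsfun_of G C D A) (crsfun_of G C D B) \<theta>"
      using \<gamma> by (auto simp: sY Hom_def x)
    have T: "strict_crossed_transformation G (crossed_of G C) (crossed_of G D) (crsfun_of G C D A) (crsfun_of G C D B) \<theta>"
      "\<theta> \<in> extensional (Obj (crossed_of G C))"
      using t ob[OF C(1)] ob[OF C(2)] by (simp_all add: crossed_transformation_iff)
    interpret crossed_trans_of_functors G C D A B \<theta>
      using T(1) pf[OF C n(1)] pf[OF C n(2)] by (simp add: crossed_trans_of_functors_def)
    let ?\<eta> = "trans_ext G C D A B \<theta>"
    have ext: "?\<eta> \<in> extensional (Obj C)" by (simp add: trans_ext_def)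
    have e: "transformation3 C D A B ?\<eta>"
      using eta_transformation ext C n by (simp add: transformation3_iff functor3_iff sp)
    show "\<exists>!\<alpha>. \<alpha> \<in> Hom ?X x x' \<and> F2 \<alpha> = \<gamma>"
    proof (rule ex1I[of _ "Arr x x' ?\<eta>"])
      show "Arr x x' ?\<eta> \<in> Hom ?X x x' \<and> F2 (Arr x x' ?\<eta>) = \<gamma>"
        using e C trans_of_eta[OF T(2)] by (auto simp: sX Hom_def x g)
    next
      fix \<alpha> assume a: "\<alpha> \<in> Hom ?X x x' \<and> F2 \<alpha> = \<gamma>"
      then obtain \<eta> where \<alpha>: "\<alpha> = Arr x x' \<eta>" "transformation3 C D A B \<eta>" by (auto simp: sX Hom_def x)
      have "trans_of G C \<eta> = trans_of G C ?\<eta>"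
        using a trans_of_eta[OF T(2)] by (simp add: \<alpha>(1) g x)
      then have "\<eta> = ?\<eta>"
        using trans_of_inj[OF pt(1)[OF C \<alpha>(2)] eta_transformation pt(2)[OF C \<alpha>(2)] ext] by blast
      then show "\<alpha> = Arr x x' ?\<eta>" by (simp add: \<alpha>(1))
    qed
  qed
qed

theorem theorem4p1:
  fixes G :: "('g, 'h) monoid_scheme"
  assumes "group G"
  shows "equivalent_two_categories
             (ThreeCat_st G :: ('g, 'o, 'm) three_cat)
             (two_one_core (GCrsBrd_st G :: ('g, 'o, 'm) crsbrd_two_cat))
       \<and> equivalent_two_categories
             (ThreeCat_st_lax G :: ('g, 'o, 'm) three_cat)
             (GCrsBrd_st G :: ('g, 'o, 'm) crsbrd_two_cat)"
  unfolding ThreeCat_st_core[OF assms]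
  using core_equivalence[OF ThreeCat_GCrsBrd_equivalent[OF assms]] ThreeCat_GCrsBrd_equivalent[OF assms]
  by (rule conjI)

end
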